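(* Let $\Omega\subset\mathbb{R}^N$, $N\ge3$, be a bounded smooth domain, $0<\delta<3$, $a>0$, $2^*=\frac{2N}{N-2}$, and let $\Lambda^a=\sup\{\lambda>0: (P_\lambda^a)\text{ has a weak solution}\}$. Then for every $\lambda\in(0,\Lambda^a)$, $(P_\lambda^a)$ admits a weak solution $u_\lambda$. Furthermore, there exist a weak solution $w_\lambda$ of $(S_\lambda^a)$ and a supersolution $\bar u$ of $(P_\lambda^a)$ with $w_\lambda\le\bar u$ such that $u_\lambda$ belongs to the convex set $\overline{\mathcal M}=\{u\in H^1_0(\Omega): w_\lambda\le u\le\bar u\}$ and is a global minimum of $E_\lambda^a$ on $\overline{\mathcal M}$.
   Context: $(P_\lambda^a)$: $-\Delta u=\lambda(u^{2^*-1}+\chi_{\{u<a\}}u^{-\delta})$, $u>0$ in $\Omega$, $u=0$ on $\partial\Omega$. $(S_\lambda^a)$: $-\Delta w=\lambda\chi_{\{w<a\}}w^{-\delta}$, $w>0$ in $\Omega$, $w=0$ on $\partial\Omega$. A weak solution of either problem is a function $u\in H^1_0(\Omega)$ with $\operatorname{ess\,inf}_K u>0$ for every compact $K\subset\Omega$ satisfying the equation tested against all $\varphi\in C_c^\infty(\Omega)$. The energy is $$E_\lambda^a(u)=\frac12\int_\Omega|\nabla u|^2-\lambda\int_\Omega G(u)-\frac{\lambda}{2^*}\int_\Omega|u|^{2^*},$$ where $G(u)=0$ for $u\le0$, $G(u)=(1-\delta)^{-1}u^{1-\delta}$ for $0<u<a/2$, and $G(u)=(1-\delta)^{-1}(a/2)^{1-\delta}+\int_{a/2}^u\chi_{\{t<a\}}t^{-\delta}\,dt$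 for $u\ge a/2$, when $\delta\ne1$; for $\delta=1$ the terms $(1-\delta)^{-1}x^{1-\delta}$ are replaced by $\log x$. *)

theory Defs
  imports "HOL-Analysis.Analysis"
begin

definition pd :: "'n::finite \<Rightarrow> (real^'n \<Rightarrow> real) \<Rightarrow> real^'n \<Rightarrow> real" where
  "pd i f x = deriv (\<lambda>t. f (x + t *\<^sub>R axis i 1)) 0"

fun iter_pd :: "'n::finite list \<Rightarrow> (real^'n \<Rightarrow> real) \<Rightarrow> real^'n \<Rightarrow> real" where
  "iter_pd [] f = f"
| "iter_pd (i # is) f = pd i (iter_pd is f)"

definition smooth_fun :: "(real^'n::finite \<Rightarrow> real) \<Rightarrow> bool" where
  "smooth_fun f \<longleftrightarrow>
     (\<forall>is. continuous_on UNIV (iter_pd is f) \<and>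
           (\<forall>i x. (\<lambda>t. iter_pd is f (x + t *\<^sub>R axis i 1)) differentiable (at 0)))"

definition grad :: "(real^'n::finite \<Rightarrow> real) \<Rightarrow> real^'n \<Rightarrow> real^'n" where
  "grad f x = (\<chi> i. pd i f x)"

definition bounded_smooth_domain :: "(real^'n::finite) set \<Rightarrow> bool" where
  "bounded_smooth_domain \<Omega> \<longleftrightarrow> bounded \<Omega> \<and> open \<Omega> \<and> connected \<Omega> \<and> \<Omega> \<noteq> {} \<and>
     (\<forall>p\<in>frontier \<Omega>. \<exists>r>0. \<exists>\<rho>. smooth_fun \<rho> \<and> grad \<rho> p \<noteq> 0 \<and>
         \<Omega> \<inter> ball p r = {x \<in> ball p r. \<rho> x < 0})"

definition test_fun :: "(real^'n::finite) set \<Rightarrow> (real^'n \<Rightarrow> real) \<Rightarrow> bool" where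
  "test_fun \<Omega> \<phi> \<longleftrightarrow> smooth_fun \<phi> \<and>
     (\<exists>K. compact K \<and> K \<subseteq> \<Omega> \<and> (\<forall>x. x \<notin> K \<longrightarrow> \<phi> x = 0))"

text \<open>u belongs to H^1_0(Omega) (closure of C_c^infinity(Omega) in H^1(Omega)) with weak gradient g.\<close>
definition H10_grad :: "(real^'n::finite) set \<Rightarrow> (real^'n \<Rightarrow> real) \<Rightarrow> (real^'n \<Rightarrow> real^'n) \<Rightarrow> bool" where
  "H10_grad \<Omega> u g \<longleftrightarrow>
     u \<in> borel_measurable lebesgue \<and> g \<in> borel_measurable lebesgue \<and>
     set_integrable lebesgue \<Omega> (\<lambda>x. (u x)\<^sup>2) \<and>
     set_integrable lebesgue \<Omega> (\<lambda>x. (norm (g x))\<^sup>2) \<and>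
     (\<exists>\<phi>s. (\<forall>k. test_fun \<Omega> (\<phi>s k)) \<and>
        (\<lambda>k. LINT x:\<Omega>|lebesgue. (\<phi>s k x - u x)\<^sup>2) \<longlonglongrightarrow> 0 \<and>
        (\<lambda>k. LINT x:\<Omega>|lebesgue. (norm (grad (\<phi>s k) x - g x))\<^sup>2) \<longlonglongrightarrow> 0)"

definition H10 :: "(real^'n::finite) set \<Rightarrow> (real^'n \<Rightarrow> real) \<Rightarrow> bool" where
  "H10 \<Omega> u \<longleftrightarrow> (\<exists>g. H10_grad \<Omega> u g)"

definition wgrad :: "(real^'n::finite) set \<Rightarrow> (real^'n \<Rightarrow> real) \<Rightarrow> real^'n \<Rightarrow> real^'n" where
  "wgrad \<Omega> u = (SOME g. H10_grad \<Omega> u g)"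

definition locally_pos :: "(real^'n::finite) set \<Rightarrow> (real^'n \<Rightarrow> real) \<Rightarrow> bool" where
  "locally_pos \<Omega> u \<longleftrightarrow>
     (\<forall>K. compact K \<and> K \<subseteq> \<Omega> \<longrightarrow> (\<exists>c>0. AE x in lebesgue. x \<in> K \<longrightarrow> c \<le> u x))"

definition crit_exp :: "'n::finite itself \<Rightarrow> real" where
  "crit_exp _ = 2 * real CARD('n) / (real CARD('n) - 2)"

definition rhs_P :: "'n::finite itself \<Rightarrow> real \<Rightarrow> real \<Rightarrow> real \<Rightarrow> real" where
  "rhs_P T a \<delta> s = s powr (crit_exp T - 1) + (if s < a then s powr (-\<delta>) else 0)"

definition rhs_S :: "real \<Rightarrow> real \<Rightarrow> real \<Rightarrow> real" where
  "rhs_S a \<delta> s = (if s < a then s powr (-\<delta>) else 0)"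

definition weak_sol :: "(real^'n::finite) set \<Rightarrow> (real \<Rightarrow> real) \<Rightarrow> real \<Rightarrow> (real^'n \<Rightarrow> real) \<Rightarrow> bool" where
  "weak_sol \<Omega> f lam u \<longleftrightarrow> H10 \<Omega> u \<and> locally_pos \<Omega> u \<and>
     (\<forall>\<phi>. test_fun \<Omega> \<phi> \<longrightarrow>
        set_integrable lebesgue \<Omega> (\<lambda>x. f (u x) * \<phi> x) \<and>
        (LINT x:\<Omega>|lebesgue. wgrad \<Omega> u x \<bullet> grad \<phi> x)
          = lam * (LINT x:\<Omega>|lebesgue. f (u x) * \<phi> x))"

definition weak_supersol :: "(real^'n::finite) set \<Rightarrow> (real \<Rightarrow> real) \<Rightarrow> real \<Rightarrow> (real^'n \<Rightarrow> real) \<Rightarrow> bool" where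
  "weak_supersol \<Omega> f lam u \<longleftrightarrow> H10 \<Omega> u \<and> locally_pos \<Omega> u \<and>
     (\<forall>\<phi>. test_fun \<Omega> \<phi> \<and> (\<forall>x. 0 \<le> \<phi> x) \<longrightarrow>
        set_integrable lebesgue \<Omega> (\<lambda>x. f (u x) * \<phi> x) \<and>
        lam * (LINT x:\<Omega>|lebesgue. f (u x) * \<phi> x)
          \<le> (LINT x:\<Omega>|lebesgue. wgrad \<Omega> u x \<bullet> grad \<phi> x))"

definition solP :: "(real^'n::finite) set \<Rightarrow> real \<Rightarrow> real \<Rightarrow> real \<Rightarrow> (real^'n \<Rightarrow> real) \<Rightarrow> bool" where
  "solP \<Omega> a \<delta> lam u = weak_sol \<Omega> (rhs_P TYPE('n) a \<delta>) lam u"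

definition supersolP :: "(real^'n::finite) set \<Rightarrow> real \<Rightarrow> real \<Rightarrow> real \<Rightarrow> (real^'n \<Rightarrow> real) \<Rightarrow> bool" where
  "supersolP \<Omega> a \<delta> lam u = weak_supersol \<Omega> (rhs_P TYPE('n) a \<delta>) lam u"

definition solS :: "(real^'n::finite) set \<Rightarrow> real \<Rightarrow> real \<Rightarrow> real \<Rightarrow> (real^'n \<Rightarrow> real) \<Rightarrow> bool" where
  "solS \<Omega> a \<delta> lam w = weak_sol \<Omega> (rhs_S a \<delta>) lam w"

text \<open>Lambda^a = sup of admissible lambda, in the extended reals (sup of empty set = -infinity).\<close>
definition Lambda_a :: "(real^'n::finite) set \<Rightarrow> real \<Rightarrow> real \<Rightarrow> ereal" where
  "Lambda_a \<Omega> a \<delta> = Sup (ereal ` {lam. 0 < lam \<and> (\<exists>u. solP \<Omega> a \<delta> lam u)})"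

definition Fp :: "real \<Rightarrow> real \<Rightarrow> real" where
  "Fp \<delta> x = (if \<delta> = 1 then ln x else x powr (1 - \<delta>) / (1 - \<delta>))"

definition Gfun :: "real \<Rightarrow> real \<Rightarrow> real \<Rightarrow> real" where
  "Gfun a \<delta> s =
     (if s \<le> 0 then 0
      else if s < a / 2 then Fp \<delta> s
      else Fp \<delta> (a / 2) + integral {a / 2 .. s} (\<lambda>t. if t < a then t powr (-\<delta>) else 0))"

definition energy :: "(real^'n::finite) set \<Rightarrow> real \<Rightarrow> real \<Rightarrow> real \<Rightarrow> (real^'n \<Rightarrow> real) \<Rightarrow> real" where
  "energy \<Omega> a \<delta> lam u =
     1 / 2 * (LINT x:\<Omega>|lebesgue. (norm (wgrad \<Omega> u x))\<^sup>2)
     - lam * (LINT x:\<Omega>|lebesgue. Gfun a \<delta> (u x))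
     - lam / crit_exp TYPE('n) * (LINT x:\<Omega>|lebesgue. \<bar>u x\<bar> powr crit_exp TYPE('n))"

end

(* A solution of the problem for a larger parameter is turned into a bounded supersolution
   for lambda by a concave, increasing change of variable that is the identity at height a
   and saturates at infinity.  Below it the singular problem is solved by minimisation, with a
   multiple of the squared distance to the boundary as a lower barrier.  The primitive G of the
   supersolution is integrable: for delta = 1 by the barrier, for delta > 1 because the
   supersolution may be tested with itself.  No compact embedding is used: the energy is
   submodular, E(max(u,v)) + E(min(u,v)) <= E(u) + E(v), and all competitors lie in a bounded
   order interval, so suprema of tails of a minimising sequence form an almost monotone
   minimising sequence.  The minimiser between the singular solution w and the supersolution
   is perturbed freely and clamped back into the interval at quadratic cost, which gives the
   Euler-Lagrange inequality with a defect carried by {u = a}; since Delta u vanishes on that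
   plateau, the defect is zero.

   Functions of H^1_0 are handled as functions on the whole space vanishing off Omega. *)

theory Submission
 imports Defs
begin

text \<open>Boundedness of the supersolution tames the critical exponent: on a bounded order
  interval the power is Lipschitz, so the one non-convex term of the energy is controlled by the L1
  distance of competitors. The change of variable S behind the bound solves S' = theta * (S /
  s)^(q-1) with theta = lam / lam', which is exactly what gives lam * S^(q-1) = lam' * s^(q-1) * S'.
  Its normalisation S(a) = a makes {S(u) < a} and {u < a} the same set, so the jump of the
  right-hand side is not displaced. That jump is the real obstacle. G is concave with a kink at a,
  hence at a function with a plateau at height a the energy has only one-sided derivatives.
  Concavity gives the other inequalities with the right sign; the plateau needs a regularity
  argument of its own, done with second differences since no second derivatives are at hand. The
  singular term is only locally bounded, so the singular equation is tested with compactly supported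
  functions. This suffices for clamping from below, because a perturbation by a test function leaves
  the minimiser unchanged near the boundary.\<close>

abbreviation leb_integral :: "('a::euclidean_space => 'b::{banach,second_countable_topology}) => 'b" (binder "LINT " 10) where
 "leb_integral f \<equiv> integral\<^sup>L lebesgue f"

subsection \<open>Smooth functions\<close>

text \<open>A relation instead of the function \<open>pd\<close>: \<open>deriv\<close> has a value
  even where no derivative exists, whereas \<open>pdiff\<close> carries differentiability with it
  and composes by rules.\<close>

definition pdiff :: "'n::finite => (real^'n => real) => (real^'n => real) => bool" where
 "pdiff i f g \<longleftrightarrow> (\<forall>x. ((\<lambda>t. f (x + t *\<^sub>R axis i 1)) has_real_derivative g x) (at 0))"

text \<open>Counting derivatives instead of listing their directions turns closure under sums,
  products and compositions into inductions on \<open>k\<close>.\<close>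

primrec Ck :: "nat => (real^'n::finite => real) => bool" where
 "Ck 0 f \<longleftrightarrow> continuous_on UNIV f"
| "Ck (Suc k) f \<longleftrightarrow> continuous_on UNIV f \<and> (\<forall>i. \<exists>g. pdiff i f g \<and> Ck k g)"

lemma pdiff_pd: "pdiff i f g ==> pd i f = g"
 by (auto simp: pdiff_def pd_def fun_eq_iff intro: DERIV_imp_deriv)

lemma Ck_continuous: "Ck k f ==> continuous_on UNIV f"
 by (cases k) auto

lemma Ck_SucD: "Ck (Suc k) f ==> Ck k f"
 by (induction k arbitrary: f) (auto, metis)

text \<open>The induction runs over all index lists at once, because a partial derivative of
  \<open>iter_pd is f\<close> is again of this form. Conversely, the derivatives that
  \<open>Ck\<close> provides are unique, hence equal to \<open>pd\<close>.\<close>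

lemma smooth_fun_iff_Ck: "smooth_fun f \<longleftrightarrow> (\<forall>k. Ck k f)"
proof
 assume f: "smooth_fun f"
 have "Ck k (iter_pd is f)" for k "is"
 proof (induction k arbitrary: "is")
  case 0
  then show ?case using f by (simp add: smooth_fun_def)
 next
  case (Suc k)
  have "\<exists>g. pdiff i (iter_pd is f) g \<and> Ck k g" for i
  proof (intro exI conjI)
   show "Ck k (iter_pd (i # is) f)" by (rule Suc)
   show "pdiff i (iter_pd is f) (iter_pd (i # is) f)"
    unfolding pdiff_def iter_pd.simps pd_def
   proof
    fix x
    have "(\<lambda>t. iter_pd is f (x + t *\<^sub>R axis i 1)) differentiable (at 0)"
     using f by (simp add: smooth_fun_def)
    then show "((\<lambda>t. iter_pd is f (x + t *\<^sub>R axis i 1)) has_real_derivative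
      deriv (\<lambda>t. iter_pd is f (x + t *\<^sub>R axis i 1)) 0) (at 0)"
     by (metis DERIV_deriv_iff_real_differentiable)
   qed
  qed
  then show ?case using f by (simp add: smooth_fun_def)
 qed
 from this[of _ "[]"] show "\<forall>k. Ck k f" by simp
next
 assume f: "\<forall>k. Ck k f"
 have pd: "\<forall>k. Ck k (pd i g)" if "\<forall>k. Ck k g" for i and g :: "real^'a => real"
  using that by (metis Ck.simps(2) pdiff_pd)
 have it: "\<forall>k. Ck k (iter_pd is f)" for "is"
  by (induction "is") (use f pd in auto)
 show "smooth_fun f"
  unfolding smooth_fun_def
 proof (intro allI conjI)
  fix "is"
  show "continuous_on UNIV (iter_pd is f)" using it[of "is"] Ck_continuous by blast
  fix i x
  have "Ck (Suc 0) (iter_pd is f)" using it by blast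
  then obtain g where "pdiff i (iter_pd is f) g" by auto
  then show "(\<lambda>t. iter_pd is f (x + t *\<^sub>R axis i 1)) differentiable (at 0)"
   by (auto simp: pdiff_def real_differentiable_def)
 qed
qed

lemma pdiff_const: "pdiff i (\<lambda>x. c) (\<lambda>x. 0)"
 by (simp add: pdiff_def)

lemma pdiff_add: "pdiff i f f' ==> pdiff i g g' ==> pdiff i (\<lambda>x. f x + g x) (\<lambda>x. f' x + g' x)"
 by (auto simp: pdiff_def intro!: DERIV_add)

lemma pdiff_mult: "pdiff i f f' ==> pdiff i g g' ==>
  pdiff i (\<lambda>x. f x * g x) (\<lambda>x. f' x * g x + g' x * f x)"
 unfolding pdiff_def
proof
 fix x
 assume "\<forall>x. ((\<lambda>t. f (x + t *\<^sub>R axis i 1)) has_real_derivative f' x) (at 0)"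
  "\<forall>x. ((\<lambda>t. g (x + t *\<^sub>R axis i 1)) has_real_derivative g' x) (at 0)"
 from DERIV_mult[OF this[THEN spec, of x]]
 show "((\<lambda>t. f (x + t *\<^sub>R axis i 1) * g (x + t *\<^sub>R axis i 1)) has_real_derivative f' x * g x + g' x * f x) (at 0)"
  by simp
qed

lemma pdiff_comp: 
 assumes "pdiff i f f'" "\<And>x. (s has_real_derivative s' x) (at (f x))"
 shows "pdiff i (\<lambda>x. s (f x)) (\<lambda>x. s' x * f' x)"
 unfolding pdiff_def
proof
 fix x
 show "((\<lambda>t. s (f (x + t *\<^sub>R axis i 1))) has_real_derivative s' x * f' x) (at 0)"
  using assms(1) assms(2)[of x] by (auto simp: pdiff_def intro!: DERIV_chain2[where g="\<lambda>t. f (x + t *\<^sub>R axis i 1)"])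
qed

lemma pdiff_nth: "pdiff i (\<lambda>x. x $ j) (\<lambda>x. axis i 1 $ j)"
 by (auto simp: pdiff_def intro!: derivative_eq_intros)

lemma Ck_const: "Ck k (\<lambda>x. c)"
 by (induction k arbitrary: c) (auto intro: pdiff_const)

lemma Ck_add: "Ck k f ==> Ck k g ==> Ck k (\<lambda>x. f x + g x)"
proof (induction k arbitrary: f g)
 case (Suc k)
 show ?case unfolding Ck.simps
 proof (intro conjI allI)
  show "continuous_on UNIV (\<lambda>x. f x + g x)" using Suc.prems by (auto intro: continuous_on_add)
  fix i
  obtain f' g' where "pdiff i f f'" "Ck k f'" "pdiff i g g'" "Ck k g'"
   using Suc.prems by (metis Ck.simps(2))
  then show "\<exists>h. pdiff i (\<lambda>x. f x + g x) h \<and> Ck k h" using Suc.IH pdiff_add by blast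
 qed
qed (auto intro: continuous_on_add)

lemma Ck_mult: "Ck k f ==> Ck k g ==> Ck k (\<lambda>x. f x * g x)"
proof (induction k arbitrary: f g)
 case (Suc k)
 show ?case unfolding Ck.simps
 proof (intro conjI allI)
  show "continuous_on UNIV (\<lambda>x. f x * g x)" using Suc.prems by (auto intro: continuous_on_mult)
  fix i
  obtain f' g' where *: "pdiff i f f'" "Ck k f'" "pdiff i g g'" "Ck k g'"
   using Suc.prems by (metis Ck.simps(2))
  have "Ck k (\<lambda>x. f' x * g x + g' x * f x)"
   using * Suc.IH Suc.prems Ck_SucD by (intro Ck_add) blast+
  then show "\<exists>h. pdiff i (\<lambda>x. f x * g x) h \<and> Ck k h" using * pdiff_mult by blast
 qed
qed (auto intro: continuous_on_mult)

lemma Ck_nth: "Ck k (\<lambda>x. x $ j)"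
proof (cases k)
 case (Suc k')
 have "\<exists>g. pdiff i (\<lambda>x. x $ j) g \<and> Ck k' g" for i using pdiff_nth[of i j] Ck_const by blast
 then show ?thesis using Suc by (auto intro: continuous_on_component)
qed (auto intro: continuous_on_component)

lemma Ck_inverse: "Ck k f ==> (\<And>x. f x \<noteq> 0) ==> Ck k (\<lambda>x. inverse (f x))"
proof (induction k)
 case (Suc k)
 have IH: "Ck k (\<lambda>x. inverse (f x))" using Suc Ck_SucD by blast
 show ?case unfolding Ck.simps
 proof (intro conjI allI)
  show "continuous_on UNIV (\<lambda>x. inverse (f x))" using Suc.prems by (auto intro: continuous_on_inverse)
  fix i
  obtain f' where *: "pdiff i f f'" "Ck k f'" using Suc.prems by (metis Ck.simps(2))
  have "pdiff i (\<lambda>x. inverse (f x)) (\<lambda>x. - (inverse (f x) * inverse (f x)) * f' x)"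
   using *(1) by (rule pdiff_comp) (use Suc.prems in \<open>auto intro!: derivative_eq_intros\<close>)
  moreover have "Ck k (\<lambda>x. (-1) * (inverse (f x) * inverse (f x)) * f' x)"
   by (intro Ck_mult Ck_const IH *(2))
  ultimately show "\<exists>h. pdiff i (\<lambda>x. inverse (f x)) h \<and> Ck k h" by auto
 qed
qed (auto intro: continuous_on_inverse)

lemma Ck_powr: "Ck k f ==> (\<And>x. f x > 0) ==> Ck k (\<lambda>x. f x powr r)"
proof (induction k arbitrary: r)
 case (Suc k)
 have pos: "f x \<noteq> 0" for x using Suc.prems(2)[of x] by simp
 show ?case unfolding Ck.simps
 proof (intro conjI allI)
  show "continuous_on UNIV (\<lambda>x. f x powr r)" using Suc.prems pos by (auto intro!: continuous_on_powr)
  fix i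
  obtain f' where *: "pdiff i f f'" "Ck k f'" using Suc.prems by (metis Ck.simps(2))
  have "pdiff i (\<lambda>x. f x powr r) (\<lambda>x. r * f x powr (r - 1) * f' x)"
   using *(1) by (rule pdiff_comp) (use Suc.prems in \<open>auto intro!: has_real_derivative_powr\<close>)
  moreover have "Ck k (\<lambda>x. r * f x powr (r - 1) * f' x)"
   using Suc Ck_SucD by (intro Ck_mult Ck_const *(2)) blast
  ultimately show "\<exists>h. pdiff i (\<lambda>x. f x powr r) h \<and> Ck k h" by auto
 qed
next
 case 0
 then show ?case by (auto intro!: continuous_on_powr) (metis less_irrefl)
qed

section \<open>Smooth functions of one variable and the flat exponential\<close>

primrec Cn :: "nat => (real => real) => bool" where
 "Cn 0 s \<longleftrightarrow> continuous_on UNIV s"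
| "Cn (Suc k) s \<longleftrightarrow> (\<exists>s'. (\<forall>x. (s has_real_derivative s' x) (at x)) \<and> Cn k s')"

lemma Cn_continuous: "Cn k s ==> continuous_on UNIV s"
 by (cases k) (auto intro: DERIV_isCont continuous_at_imp_continuous_on)

lemma Ck_comp: "Cn k s ==> Ck k f ==> Ck k (\<lambda>x. s (f x))"
proof (induction k arbitrary: s)
 case 0
 then show ?case by (auto intro: continuous_on_compose2)
next
 case (Suc k)
 obtain s' where s': "\<And>x. (s has_real_derivative s' x) (at x)" "Cn k s'"
  using Suc.prems(1) by auto
 show ?case unfolding Ck.simps
 proof (intro conjI allI)
  show "continuous_on UNIV (\<lambda>x. s (f x))"
   using Suc.prems Cn_continuous Ck_continuous by (blast intro: continuous_on_compose2)
  fix i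
  obtain f' where *: "pdiff i f f'" "Ck k f'" using Suc.prems by (metis Ck.simps(2))
  have "pdiff i (\<lambda>x. s (f x)) (\<lambda>x. s' (f x) * f' x)" using *(1) by (rule pdiff_comp) (rule s')
  moreover have "Ck k (\<lambda>x. s' (f x) * f' x)"
   by (rule Ck_mult[OF Suc.IH[OF s'(2) Ck_SucD[OF Suc.prems(2)]] *(2)])
  ultimately show "\<exists>h. pdiff i (\<lambda>x. s (f x)) h \<and> Ck k h" by auto
 qed
qed

text \<open>For \<open>k = 0\<close> the classical smooth function that is flat at 0. The powers of
  1/x close the family under differentiation, so one recursion in \<open>k\<close> yields all
  derivatives.\<close>

definition flat_exp :: "nat => real => real" where
 "flat_exp k x = (if x > 0 then (1 / x) ^ k * exp (- 1 / x) else 0)"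

lemma flat_exp_nonneg: "flat_exp k x \<ge> 0"
 by (simp add: flat_exp_def)

lemma flat_exp_tendsto_0: "(flat_exp k \<longlongrightarrow> 0) (at 0)"
proof -
 have lim: "((\<lambda>y::real. y ^ k / exp y) \<longlongrightarrow> 0) at_top" by (rule tendsto_power_div_exp_0)
 have "filterlim (\<lambda>x::real. inverse x) at_top (at_right 0)"
  by (rule filterlim_inverse_at_top_right)
 with lim have "((\<lambda>x::real. (inverse x) ^ k / exp (inverse x)) \<longlongrightarrow> 0) (at_right 0)"
  by (rule filterlim_compose)
 then have r: "(flat_exp k \<longlongrightarrow> 0) (at_right 0)"
 proof (rule Lim_transform_eventually)
  show "\<forall>\<^sub>F x in at_right 0. inverse x ^ k / exp (inverse x) = flat_exp k x"
   by (auto simp: eventually_at_filter flat_exp_def exp_minus divide_inverse intro!: always_eventually)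
 qed
 have l: "(flat_exp k \<longlongrightarrow> 0) (at_left 0)"
  by (rule Lim_transform_eventually[OF tendsto_const])
    (auto simp: eventually_at_filter flat_exp_def intro!: always_eventually)
 show ?thesis using l r by (simp add: filterlim_split_at)
qed

lemma flat_exp_deriv:
 "(flat_exp k has_real_derivative (- real k * flat_exp (k+1) x + flat_exp (k+2) x)) (at x)"
proof -
 consider "x > 0" | "x < 0" | "x = 0" by linarith
 then show ?thesis
 proof cases
  case 1
  have "((\<lambda>x. (1 / x) ^ k * exp (- 1 / x)) has_real_derivative
    (- real k * flat_exp (k+1) x + flat_exp (k+2) x)) (at x)"
  proof -
   have gen: "((\<lambda>x. y x ^ k * exp (- y x)) has_real_derivative
     - real k * (y x ^ (k+1) * exp (- y x)) + y x ^ (k+2) * exp (- y x)) (at x)"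
    if "(y has_real_derivative - ((y x)\<^sup>2)) (at x)" for y :: "real => real"
   proof -
    have "((\<lambda>x. y x ^ k) has_real_derivative real k * (- ((y x)\<^sup>2) * y x ^ (k - Suc 0))) (at x)"
     using DERIV_power[OF that, of k] by simp
    moreover have "((\<lambda>x. exp (- y x)) has_real_derivative exp (- y x) * (y x)\<^sup>2) (at x)"
     using that by (auto intro!: derivative_eq_intros)
    ultimately have "((\<lambda>x. y x ^ k * exp (- y x)) has_real_derivative
      real k * (- ((y x)\<^sup>2) * y x ^ (k - Suc 0)) * exp (- y x) + exp (- y x) * (y x)\<^sup>2 * y x ^ k) (at x)"
     by (rule DERIV_mult)
    moreover have "real k * (- ((y x)\<^sup>2) * y x ^ (k - Suc 0)) * exp (- y x) + exp (- y x) * (y x)\<^sup>2 * y x ^ k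
      = - real k * (y x ^ (k+1) * exp (- y x)) + y x ^ (k+2) * exp (- y x)"
     by (cases k) (simp_all add: power2_eq_square algebra_simps)
    ultimately show ?thesis by simp
   qed
   have "((\<lambda>x. 1 / x) has_real_derivative - ((1 / x)\<^sup>2)) (at x)"
    using 1 by (auto intro!: derivative_eq_intros simp: power2_eq_square)
   from gen[OF this] show ?thesis using 1 by (simp add: flat_exp_def)
  qed
  then show ?thesis
   by (rule has_field_derivative_transform_within_open[where S="{0<..}"])
     (use 1 in \<open>auto simp: flat_exp_def\<close>)
 next
  case 2
  have "((\<lambda>x. 0) has_real_derivative (- real k * flat_exp (k+1) x + flat_exp (k+2) x)) (at x)"
   using 2 by (simp add: flat_exp_def)
  then show ?thesis
   by (rule has_field_derivative_transform_within_open[where S="{..<0}"])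
     (use 2 in \<open>auto simp: flat_exp_def\<close>)
 next
  case 3
  \<comment> \<open>At 0 the difference quotient of one member of the family is the next member,
    whose limit at 0 is already known.\<close>
  have "(flat_exp k y - flat_exp k 0) / (y - 0) = flat_exp (k+1) y" for y
   by (auto simp: flat_exp_def)
  then have "((\<lambda>y. (flat_exp k y - flat_exp k 0) / (y - 0)) \<longlongrightarrow> 0) (at 0)"
   using flat_exp_tendsto_0[of "k+1"] by simp
  then show ?thesis using 3 by (simp add: has_field_derivative_iff flat_exp_def)
 qed
qed

lemma Cn_add: "Cn k f ==> Cn k g ==> Cn k (\<lambda>x. f x + g x)"
proof (induction k arbitrary: f g)
 case 0
 then show ?case by (auto intro: continuous_on_add)
next
 case (Suc k)
 obtain f' g' where *: "\<forall>x. (f has_real_derivative f' x) (at x)" "Cn k f'"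
  "\<forall>x. (g has_real_derivative g' x) (at x)" "Cn k g'"
  using Suc.prems by auto
 show ?case unfolding Cn.simps
  by (rule exI[of _ "\<lambda>x. f' x + g' x"]) (use * Suc.IH in \<open>auto intro: DERIV_add\<close>)
qed

lemma Cn_cmult: "Cn k f ==> Cn k (\<lambda>x. c * f x)"
proof (induction k arbitrary: f)
 case 0
 then show ?case by (auto intro: continuous_on_mult)
next
 case (Suc k)
 obtain f' where *: "\<forall>x. (f has_real_derivative f' x) (at x)" "Cn k f'"
  using Suc.prems by auto
 show ?case unfolding Cn.simps
  by (rule exI[of _ "\<lambda>x. c * f' x"]) (use * Suc.IH in \<open>auto intro: DERIV_cmult\<close>)
qed

lemma Cn_flat_exp: "Cn n (flat_exp k)"
proof (induction n arbitrary: k)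
 case 0
 show ?case using flat_exp_deriv[of k] by (auto intro!: DERIV_continuous_on)
next
 case (Suc n)
 show ?case unfolding Cn.simps
  by (rule exI, rule conjI, rule allI, rule flat_exp_deriv) (intro Cn_add Cn_cmult Suc)
qed

lemma smooth_const: "smooth_fun (\<lambda>x. c)"
 by (simp add: smooth_fun_iff_Ck Ck_const)
lemma smooth_add: "smooth_fun f ==> smooth_fun g ==> smooth_fun (\<lambda>x. f x + g x)"
 by (simp add: smooth_fun_iff_Ck Ck_add)
lemma smooth_mult: "smooth_fun f ==> smooth_fun g ==> smooth_fun (\<lambda>x. f x * g x)"
 by (simp add: smooth_fun_iff_Ck Ck_mult)
lemma smooth_diff: "smooth_fun f ==> smooth_fun g ==> smooth_fun (\<lambda>x. f x - g x)"
 using smooth_add[of f "\<lambda>x. (-1) * g x"] smooth_mult[OF smooth_const[of "-1"], of g] by simp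
lemma smooth_sum: "(\<And>j. j \<in> A ==> smooth_fun (f j)) ==> smooth_fun (\<lambda>x. \<Sum>j\<in>A. f j x)"
 by (induction A rule: infinite_finite_induct) (auto intro: smooth_const smooth_add)
lemma smooth_nth: "smooth_fun (\<lambda>x. x $ j)"
 by (simp add: smooth_fun_iff_Ck Ck_nth)
lemma smooth_inverse: "smooth_fun f ==> (\<And>x. f x \<noteq> 0) ==> smooth_fun (\<lambda>x. inverse (f x))"
 by (simp add: smooth_fun_iff_Ck Ck_inverse)
lemma smooth_powr: "smooth_fun f ==> (\<And>x. f x > 0) ==> smooth_fun (\<lambda>x. f x powr r)"
 by (simp add: smooth_fun_iff_Ck Ck_powr)
lemma smooth_flat_exp: "smooth_fun f ==> smooth_fun (\<lambda>x. flat_exp k (f x))"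
 by (simp add: smooth_fun_iff_Ck Ck_comp Cn_flat_exp)

lemma smooth_pdiff: "smooth_fun f ==> pdiff i f (pd i f)"
 unfolding smooth_fun_iff_Ck by (metis Ck.simps(2) pdiff_pd)
lemma smooth_pd: "smooth_fun f ==> smooth_fun (pd i f)"
 unfolding smooth_fun_iff_Ck by (metis Ck.simps(2) pdiff_pd)
lemma smooth_continuous: "smooth_fun f ==> continuous_on UNIV f"
 unfolding smooth_fun_iff_Ck using Ck_continuous by blast

lemma pdiff_at:
 assumes "pdiff i f g"
 shows "((\<lambda>t. f (x + t *\<^sub>R axis i 1)) has_real_derivative g (x + s *\<^sub>R axis i 1)) (at s)"
proof -
 have "((\<lambda>t. f (x + s *\<^sub>R axis i 1 + t *\<^sub>R axis i 1)) has_real_derivative g (x + s *\<^sub>R axis i 1)) (at 0)"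
  using assms by (simp add: pdiff_def)
 then have "((\<lambda>t. f (x + s *\<^sub>R axis i 1 + (t - s) *\<^sub>R axis i 1)) has_real_derivative g (x + s *\<^sub>R axis i 1)) (at s)"
  using DERIV_shift[of "\<lambda>t. f (x + s *\<^sub>R axis i 1 + (t - s) *\<^sub>R axis i 1)" "g (x + s *\<^sub>R axis i 1)" 0 s]
  by simp
 moreover have "x + s *\<^sub>R axis i 1 + (t - s) *\<^sub>R axis i 1 = x + t *\<^sub>R axis i (1::real)" for t
  by (simp add: algebra_simps)
 ultimately show ?thesis by simp
qed

lemma pdiff_affine:
 assumes "pdiff i f g" "c \<noteq> 0"
 shows "pdiff i (\<lambda>x. f (c *\<^sub>R (x - y))) (\<lambda>x. c * g (c *\<^sub>R (x - y)))"
 unfolding pdiff_def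
proof
 fix x
 have "((\<lambda>t. f (c *\<^sub>R (x - y) + t *\<^sub>R axis i 1)) has_real_derivative g (c *\<^sub>R (x - y))) (at (c * 0))"
  using assms(1) by (simp add: pdiff_def)
 then have "((\<lambda>t. f (c *\<^sub>R (x - y) + (c * t) *\<^sub>R axis i 1)) has_real_derivative g (c *\<^sub>R (x - y)) * c) (at 0)"
  by (rule DERIV_chain2[where g="\<lambda>t. c * t"]) (auto intro!: derivative_eq_intros)
 then show "((\<lambda>t. f (c *\<^sub>R (x + t *\<^sub>R axis i 1 - y))) has_real_derivative c * g (c *\<^sub>R (x - y))) (at 0)"
  by (simp add: algebra_simps)
qed

lemma Ck_affine: "c \<noteq> 0 ==> Ck k f ==> Ck k (\<lambda>x. f (c *\<^sub>R (x - y)))"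
proof (induction k arbitrary: f)
 case 0
 then show ?case by (auto intro!: continuous_on_compose2[of UNIV f] continuous_intros)
next
 case (Suc k)
 show ?case unfolding Ck.simps
 proof (intro conjI allI)
  show "continuous_on UNIV (\<lambda>x. f (c *\<^sub>R (x - y)))"
   using Suc.prems by (auto intro!: continuous_on_compose2[of UNIV f] continuous_intros)
  fix i
  obtain f' where *: "pdiff i f f'" "Ck k f'" using Suc.prems by (metis Ck.simps(2))
  show "\<exists>g. pdiff i (\<lambda>x. f (c *\<^sub>R (x - y))) g \<and> Ck k g"
   using pdiff_affine[OF *(1) Suc.prems(1)] Ck_mult[OF Ck_const Suc.IH[OF Suc.prems(1) *(2)]] by blast
 qed
qed

lemma smooth_affine: "smooth_fun f ==> c \<noteq> 0 ==> smooth_fun (\<lambda>x. f (c *\<^sub>R (x - y)))"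
 by (simp add: smooth_fun_iff_Ck Ck_affine)

subsection \<open>Test functions\<close>

lemma test_smooth: "test_fun \<Omega> \<phi> ==> smooth_fun \<phi>"
 by (simp add: test_fun_def)

lemma test_mono: "test_fun A \<phi> ==> A \<subseteq> B ==> test_fun B \<phi>"
 unfolding test_fun_def by blast

lemma test_off: "test_fun \<Omega> \<phi> ==> x \<notin> \<Omega> ==> \<phi> x = 0"
 unfolding test_fun_def by blast

lemma pd_off_compact:
 assumes "closed K" "\<And>x. x \<notin> K ==> \<phi> x = (0::real)" "x \<notin> K" "smooth_fun \<phi>"
 shows "pd i \<phi> x = 0"
proof -
 have "open (- K)" using assms by auto
 then obtain e where e: "e > 0" "ball x e \<subseteq> - K" using assms(3) by (meson ComplI open_contains_ball)
 have "((\<lambda>t. 0) has_real_derivative 0) (at (0::real))" by simp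
 then have "((\<lambda>t. \<phi> (x + t *\<^sub>R axis i 1)) has_real_derivative 0) (at 0)"
 proof (rule has_field_derivative_transform_within_open[where S="ball 0 e"])
  fix t :: real assume "t \<in> ball 0 e"
  then have "x + t *\<^sub>R axis i 1 \<in> ball x e" by (auto simp: dist_norm)
  then show "0 = \<phi> (x + t *\<^sub>R axis i 1)" using e assms(2) by (metis ComplD subsetD)
 qed (use e in auto)
 then show ?thesis by (simp add: pd_def DERIV_imp_deriv)
qed

lemma test_pd: "test_fun \<Omega> \<phi> ==> test_fun \<Omega> (pd i \<phi>)"
 unfolding test_fun_def by (metis pd_off_compact smooth_pd compact_imp_closed)

lemma test_mult: "test_fun \<Omega> \<phi> ==> smooth_fun \<psi> ==> test_fun \<Omega> (\<lambda>x. \<phi> x * \<psi> x)"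
 unfolding test_fun_def by (metis mult_zero_left smooth_mult)

lemma test_cmult: "test_fun \<Omega> \<phi> ==> test_fun \<Omega> (\<lambda>x. c * \<phi> x)"
 using test_mult[of \<Omega> \<phi> "\<lambda>x. c"] by (simp add: smooth_const mult.commute)

lemma test_zero: "test_fun \<Omega> (\<lambda>x. 0)"
 unfolding test_fun_def by (auto intro!: smooth_const exI[of _ "{}"])

lemma test_add:
 assumes "test_fun \<Omega> \<phi>" "test_fun \<Omega> \<psi>" shows "test_fun \<Omega> (\<lambda>x. \<phi> x + \<psi> x)"
proof -
 obtain K L where "compact K" "K \<subseteq> \<Omega>" "\<forall>x. x \<notin> K --> \<phi> x = 0" "compact L" "L \<subseteq> \<Omega>" "\<forall>x. x \<notin> L --> \<psi> x = 0"
  using assms unfolding test_fun_def by blast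
 then have "compact (K \<union> L)" "K \<union> L \<subseteq> \<Omega>" "\<forall>x. x \<notin> K \<union> L --> \<phi> x + \<psi> x = 0" by auto
 then show ?thesis using assms unfolding test_fun_def by (blast intro: smooth_add)
qed

lemma test_diff: "test_fun \<Omega> \<phi> ==> test_fun \<Omega> \<psi> ==> test_fun \<Omega> (\<lambda>x. \<phi> x - \<psi> x)"
 using test_add[of \<Omega> \<phi> "\<lambda>x. (-1) * \<psi> x"] test_cmult[of \<Omega> \<psi> "-1"] by simp

lemma test_sum: "(\<And>j. j \<in> A ==> test_fun \<Omega> (f j)) ==> test_fun \<Omega> (\<lambda>x. \<Sum>j\<in>A. f j x)"
 by (induction A rule: infinite_finite_induct) (auto intro: test_zero test_add)

lemma grad_pdiff: "(\<And>i. pdiff i f (g i)) ==> grad f x = (\<chi> i. g i x)"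
 unfolding grad_def vec_eq_iff by (metis pdiff_pd vec_lambda_beta)

lemma grad_nth: "grad f x $ i = pd i f x"
 by (simp add: grad_def)

lemma grad_add: "smooth_fun f ==> smooth_fun g ==> grad (\<lambda>x. f x + g x) x = grad f x + grad g x"
 by (subst grad_pdiff[OF pdiff_add[OF smooth_pdiff smooth_pdiff]]) (auto simp: vec_eq_iff grad_nth)

lemma grad_mult: "smooth_fun f ==> smooth_fun g ==>
  grad (\<lambda>x. f x * g x) x = f x *\<^sub>R grad g x + g x *\<^sub>R grad f x"
 by (subst grad_pdiff[OF pdiff_mult[OF smooth_pdiff smooth_pdiff]]) (auto simp: vec_eq_iff grad_nth)

lemma grad_cmult: "smooth_fun f ==> grad (\<lambda>x. c * f x) x = c *\<^sub>R grad f x"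
 using grad_mult[OF smooth_const[of c], of f x]
 by (simp add: grad_pdiff[OF pdiff_const] vec_eq_iff)

lemma grad_diff: "smooth_fun f ==> smooth_fun g ==> grad (\<lambda>x. f x - g x) x = grad f x - grad g x"
 using grad_add[of f "\<lambda>x. (-1) * g x" x] grad_cmult[of g "-1" x] smooth_mult[OF smooth_const[of "-1"], of g]
 by simp

lemma grad_comp:
 assumes "smooth_fun f" "\<And>x. (s has_real_derivative s' x) (at x)"
 shows "grad (\<lambda>x. s (f x)) x = s' (f x) *\<^sub>R grad f x"
 by (subst grad_pdiff[OF pdiff_comp[OF smooth_pdiff[OF assms(1)]]], rule assms(2))
   (auto simp: vec_eq_iff grad_nth)

lemma grad_continuous: "smooth_fun f ==> continuous_on UNIV (grad f)"
 unfolding grad_def[abs_def] by (intro continuous_on_vec_lambda smooth_continuous smooth_pd)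

lemma test_grad_off:
 assumes "test_fun \<Omega> \<phi>" "x \<notin> \<Omega>" shows "grad \<phi> x = 0"
 using test_off[OF test_pd[OF assms(1)] assms(2)] by (simp add: grad_def vec_eq_iff)

section \<open>Bumps and cutoff functions\<close>

definition bump :: "real^'n::finite => real => real^'n => real" where
 "bump y r x = flat_exp 0 (r\<^sup>2 - (dist x y)\<^sup>2)"

lemma smooth_bump:
 fixes y :: "real^'n::finite"
 shows "smooth_fun (bump y r)"
proof -
 have "(dist x y)\<^sup>2 = (\<Sum>i\<in>UNIV. (x $ i - y $ i) * (x $ i - y $ i))" for x :: "real^'n"
  by (simp add: dist_norm power2_norm_eq_inner inner_vec_def)
 then show ?thesis unfolding bump_def[abs_def]
  by (intro smooth_flat_exp smooth_diff smooth_const)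
    (simp, intro smooth_sum smooth_mult smooth_diff smooth_nth smooth_const)
qed

lemma bump_pos: "dist x y < r ==> bump y r x > 0"
proof -
 assume a: "dist x y < r"
 have "(dist x y)\<^sup>2 < r\<^sup>2" using a zero_le_dist[of x y] by (intro power_strict_mono) auto
 then show ?thesis by (simp add: bump_def flat_exp_def)
qed

lemma bump_nonneg: "bump y r x \<ge> 0"
 by (simp add: bump_def flat_exp_nonneg)

lemma bump_zero: "0 \<le> r ==> r \<le> dist x y ==> bump y r x = 0"
 by (simp add: bump_def flat_exp_def not_less power_mono)

lemma test_bump: "0 \<le> r ==> cball y r \<subseteq> \<Omega> ==> test_fun \<Omega> (bump y r)"
 unfolding test_fun_def
 by (auto intro!: exI[of _ "cball y r"] smooth_bump bump_zero simp: dist_commute)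

text \<open>By compactness a finite sum of bumps is at least some \<open>m > 0\<close> on
  \<open>K\<close>. A smooth step that reaches 1 already at \<open>m / 2\<close> makes the
  composition equal to 1 on a whole neighbourhood of \<open>K\<close>, not merely on
  \<open>K\<close>.\<close>

lemma cutoff:
 fixes K :: "(real^'n::finite) set"
 assumes "compact K" "open U" "K \<subseteq> U"
 obtains \<eta> V where "test_fun U \<eta>" "\<forall>x. 0 \<le> \<eta> x \<and> \<eta> x \<le> 1" "open V" "K \<subseteq> V" "\<forall>x\<in>V. \<eta> x = 1"
proof -
 have "\<exists>r>0. cball x r \<subseteq> U" if "x \<in> K" for x
  using that assms by (meson open_contains_cball subsetD)
 then obtain r where r: "\<And>x. x \<in> K ==> r x > 0 \<and> cball x (r x) \<subseteq> U" by metis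
 have "K \<subseteq> \<Union> ((\<lambda>x. ball x (r x)) ` K)" using r by force
 then obtain F where F: "F \<subseteq> K" "finite F" "K \<subseteq> (\<Union>x\<in>F. ball x (r x))"
  using compactE_image[OF assms(1), of K "\<lambda>x. ball x (r x)"] by auto
 define \<beta> where "\<beta> x = (\<Sum>y\<in>F. bump y (r y) x)" for x
 have tb: "test_fun U \<beta>" unfolding \<beta>_def[abs_def]
  using r F(1) by (intro test_sum test_bump) (auto intro: less_imp_le)
 have cont: "continuous_on UNIV \<beta>" using tb by (simp add: test_smooth smooth_continuous)
 have pos: "\<beta> x > 0" if xK: "x \<in> K" for x
 proof -
  obtain y where "y \<in> F" "dist y x < r y" using F(3) xK by (auto simp: subset_iff)
  then show ?thesis unfolding \<beta>_def using F
   by (intro sum_pos2[where i=y]) (auto simp: bump_nonneg intro!: bump_pos simp: dist_commute)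
 qed
 obtain m where m: "m > 0" "\<And>x. x \<in> K ==> \<beta> x \<ge> m"
 proof (cases "K = {}")
  case True
  then show ?thesis using that[of 1] by simp
 next
  case False
  obtain z where "z \<in> K" "\<forall>x\<in>K. \<beta> z \<le> \<beta> x"
   using continuous_attains_inf[OF assms(1) False continuous_on_subset[OF cont]] by auto
  then show ?thesis using that[of "\<beta> z"] pos by auto
 qed
 \<comment> \<open>The step: 0 for t <= 0 and 1 for t >= m / 2. Its denominator is positive because
   the two arguments are never both nonpositive.\<close>
 define S where "S t = flat_exp 0 t * inverse (flat_exp 0 t + flat_exp 0 (m/2 - t))" for t
 have den: "flat_exp 0 t + flat_exp 0 (m/2 - t) > 0" for t
 proof (cases "t > 0")
  case True then show ?thesis using flat_exp_nonneg[of 0 "m/2 - t"] by (simp add: flat_exp_def add_pos_nonneg)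
 next
  case False then show ?thesis using m by (simp add: flat_exp_def)
 qed
 define \<eta> where "\<eta> x = S (\<beta> x)" for x
 show ?thesis
 proof
  have "smooth_fun \<eta>" unfolding \<eta>_def[abs_def] S_def using tb den
   by (intro smooth_mult smooth_inverse smooth_add smooth_flat_exp smooth_diff smooth_const test_smooth[OF tb])
     (metis less_irrefl)
  then show "test_fun U \<eta>" using tb unfolding test_fun_def \<eta>_def S_def
   by (auto simp: flat_exp_def) 
  show "\<forall>x. 0 \<le> \<eta> x \<and> \<eta> x \<le> 1"
  proof
   fix x
   show "0 \<le> \<eta> x \<and> \<eta> x \<le> 1" unfolding \<eta>_def S_def
    using den[of "\<beta> x"] flat_exp_nonneg[of 0] by (auto simp: field_simps intro: less_imp_le)
  qed
 next
  show "open {x. m / 2 < \<beta> x}" using cont by (intro open_Collect_less continuous_on_const) 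
  show "K \<subseteq> {x. m / 2 < \<beta> x}" using m by force
  show "\<forall>x\<in>{x. m / 2 < \<beta> x}. \<eta> x = 1"
  proof
   fix x assume x: "x \<in> {x. m / 2 < \<beta> x}"
   then have "flat_exp 0 (\<beta> x) \<noteq> 0" "flat_exp 0 (m/2 - \<beta> x) = 0" using m by (auto simp: flat_exp_def)
   then show "\<eta> x = 1" by (simp add: \<eta>_def S_def)
  qed
 qed
qed

subsection \<open>Square integrable functions\<close>

text \<open>Square integrability of honest functions rather than of classes, since compositions,
  order relations and translations are needed pointwise.\<close>

definition sq :: "'a measure => ('a => 'b::euclidean_space) => bool" where
 "sq M f \<longleftrightarrow> f \<in> borel_measurable M \<and> integrable M (\<lambda>x. (norm (f x))\<^sup>2)"

definition nrm :: "'a measure => ('a => 'b::euclidean_space) => real" where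
 "nrm M f = sqrt (\<integral>x. (norm (f x))\<^sup>2 \<partial>M)"

lemma sq_measurable [measurable_dest]: "sq M f ==> f \<in> borel_measurable M"
 by (simp add: sq_def)

lemma sq_integrable: "sq M f ==> integrable M (\<lambda>x. (norm (f x))\<^sup>2)"
 by (simp add: sq_def)

lemma nrm_nonneg [simp]: "0 \<le> nrm M f"
 by (simp add: nrm_def)

lemma nrm_power2: "(nrm M f)\<^sup>2 = (\<integral>x. (norm (f x))\<^sup>2 \<partial>M)"
 by (simp add: nrm_def)

lemma sq_bound:
 assumes "sq M g" "f \<in> borel_measurable M" "AE x in M. norm (f x) \<le> norm (g x)"
 shows "sq M f"
 unfolding sq_def
proof
 show "integrable M (\<lambda>x. (norm (f x))\<^sup>2)"
  by (rule Bochner_Integration.integrable_bound[OF sq_integrable[OF assms(1)]])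
    (use assms in \<open>auto elim!: AE_mp intro!: AE_I2 power_mono\<close>)
qed fact

lemma nrm_mono:
 assumes "sq M g" "f \<in> borel_measurable M" "AE x in M. norm (f x) \<le> norm (g x)"
 shows "nrm M f \<le> nrm M g"
 unfolding nrm_def
 by (intro real_sqrt_le_mono integral_mono_AE sq_integrable sq_bound[OF assms] assms(1))
   (use assms in \<open>auto elim!: AE_mp intro!: AE_I2 power_mono\<close>)

lemma nrm_cong_AE:
 assumes "f \<in> borel_measurable M" "g \<in> borel_measurable M" "AE x in M. f x = g x"
 shows "nrm M f = nrm M g"
 unfolding nrm_def by (intro arg_cong[where f=sqrt] integral_cong_AE) (use assms in auto)

lemma sq_cong_AE:
 assumes "sq M f" "g \<in> borel_measurable M" "AE x in M. f x = g x"
 shows "sq M g"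
 by (rule sq_bound[OF assms(1,2)]) (use assms(3) in auto)

lemma sq_scale: "sq M f ==> sq M (\<lambda>x. c *\<^sub>R f x)"
 by (auto simp: sq_def power_mult_distrib)

lemma sq_cmult: "sq M f ==> sq M (\<lambda>x. c * f x :: real)"
 using sq_scale[of M f c] by simp

lemma nrm_scale: "nrm M (\<lambda>x. c *\<^sub>R f x) = \<bar>c\<bar> * nrm M f"
 by (simp add: nrm_def power_mult_distrib real_sqrt_mult)

lemma nrm_cmult: "nrm M (\<lambda>x. c * f x :: real) = \<bar>c\<bar> * nrm M f"
 using nrm_scale[of M c f] by simp

lemma sq_zero [simp]: "sq M (\<lambda>x. 0)"
 by (simp add: sq_def)

lemma nrm_zero [simp]: "nrm M (\<lambda>x. 0) = 0"
 by (simp add: nrm_def)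

lemma norm_add_sq: "(norm (a + b))\<^sup>2 \<le> 2 * (norm a)\<^sup>2 + 2 * (norm (b::'b::real_inner))\<^sup>2"
proof -
 have "(norm (a + b))\<^sup>2 + (norm (a - b))\<^sup>2 = 2 * (norm a)\<^sup>2 + 2 * (norm b)\<^sup>2"
  by (simp add: power2_norm_eq_inner algebra_simps)
 then show ?thesis using zero_le_power2[of "norm (a - b)"] by linarith
qed

lemma sq_add:
 assumes "sq M f" "sq M g" shows "sq M (\<lambda>x. f x + g x)"
 unfolding sq_def
proof
 show "integrable M (\<lambda>x. (norm (f x + g x))\<^sup>2)"
 proof (rule Bochner_Integration.integrable_bound)
  show "integrable M (\<lambda>x. 2 * (norm (f x))\<^sup>2 + 2 * (norm (g x))\<^sup>2)" using assms by (simp add: sq_def)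
  show "AE x in M. norm ((norm (f x + g x))\<^sup>2) \<le> norm (2 * (norm (f x))\<^sup>2 + 2 * (norm (g x))\<^sup>2)"
   using norm_add_sq by (auto intro!: AE_I2)
 qed (use assms in \<open>auto simp: sq_def\<close>)
qed (use assms in \<open>auto simp: sq_def\<close>)

lemma sq_diff:
 assumes "sq M f" "sq M g" shows "sq M (\<lambda>x. f x - g x)"
 using sq_add[OF assms(1) sq_scale[OF assms(2), of "-1"]] by simp

lemma nrm_minus_commute: "nrm M (\<lambda>x. f x - g x) = nrm M (\<lambda>x. g x - f x)"
 by (simp add: nrm_def norm_minus_commute)

lemma sq_norm: "sq M f ==> sq M (\<lambda>x. norm (f x))"
 by (auto simp: sq_def)

lemma nrm_norm: "nrm M (\<lambda>x. norm (f x)) = nrm M f"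
 by (simp add: nrm_def)

lemma sq_inner:
 assumes "sq M f" "sq M g" shows "integrable M (\<lambda>x. f x \<bullet> g x)"
proof (rule Bochner_Integration.integrable_bound)
 show "integrable M (\<lambda>x. (norm (f x))\<^sup>2 + (norm (g x))\<^sup>2)" using assms by (simp add: sq_def)
 have "\<bar>a \<bullet> b\<bar> \<le> (norm a)\<^sup>2 + (norm b)\<^sup>2" for a b :: 'b
 proof -
  have "\<bar>a \<bullet> b\<bar> \<le> norm a * norm b" by (rule Cauchy_Schwarz_ineq2)
  also have "\<dots> \<le> (norm a)\<^sup>2 + (norm b)\<^sup>2"
   using sum_squares_bound[of "norm a" "norm b"] zero_le_power2[of "norm a"] zero_le_power2[of "norm b"]
    mult_nonneg_nonneg[OF norm_ge_zero[of a] norm_ge_zero[of b]] by linarith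
  finally show ?thesis .
 qed
 then show "AE x in M. norm (f x \<bullet> g x) \<le> norm ((norm (f x))\<^sup>2 + (norm (g x))\<^sup>2)"
  by (auto intro!: AE_I2)
qed (use assms in \<open>auto simp: sq_def\<close>)

lemma sq_mult: "sq M f ==> sq M g ==> integrable M (\<lambda>x. f x * g x :: real)"
 using sq_inner[of M f g] by simp

lemma CS:
 assumes "sq M f" "sq M g"
 shows "\<bar>\<integral>x. f x \<bullet> g x \<partial>M\<bar> \<le> nrm M f * nrm M g"
proof -
 define A B C where "A = (nrm M f)\<^sup>2" "B = (nrm M g)\<^sup>2" "C = (\<integral>x. f x \<bullet> g x \<partial>M)"
 have *: "0 \<le> A + 2 * t * C + t\<^sup>2 * B" for t
 proof -
  have "0 \<le> (\<integral>x. (norm (f x + t *\<^sub>R g x))\<^sup>2 \<partial>M)" by simp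
  also have "\<dots> = (\<integral>x. (norm (f x))\<^sup>2 + 2 * t * (f x \<bullet> g x) + t\<^sup>2 * (norm (g x))\<^sup>2 \<partial>M)"
   by (intro Bochner_Integration.integral_cong refl)
     (simp only: power2_norm_eq_inner inner_add_left inner_add_right inner_scaleR_left inner_scaleR_right, simp add: algebra_simps inner_commute power2_eq_square)
  also have "\<dots> = A + 2 * t * C + t\<^sup>2 * B"
   using assms sq_inner[OF assms] by (simp add: A_B_C_def nrm_power2 sq_integrable)
  finally show ?thesis .
 qed
 have "C\<^sup>2 \<le> A * B"
 proof (cases "B = 0")
  case True
  have "C = 0"
  proof (rule ccontr)
   assume "C \<noteq> 0"
   \<comment> \<open>For \<open>B = 0\<close> the quadratic is affine in t, and this t gives it the
     value -1.\<close>
   then show False using *[of "- (A + 1) / (2 * C)"] True by (simp add: field_simps)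
  qed
  then show ?thesis using True by simp
 next
  case False
  then have "B > 0" by (simp add: A_B_C_def)
  \<comment> \<open>The minimum point of the quadratic.\<close>
  then show ?thesis using *[of "- C / B"] by (simp add: field_simps power2_eq_square)
 qed
 also have "A * B = (nrm M f * nrm M g)\<^sup>2" by (simp add: A_B_C_def power_mult_distrib)
 finally show ?thesis unfolding A_B_C_def(3) using power2_le_imp_le[of "\<bar>\<integral>x. f x \<bullet> g x \<partial>M\<bar>"]
  by (simp add: A_B_C_def)
qed

lemma CS_norm:
 assumes "sq M f" "sq M g"
 shows "(\<integral>x. norm (f x) * norm (g x) \<partial>M) \<le> nrm M f * nrm M g"
 using CS[OF sq_norm[OF assms(1)] sq_norm[OF assms(2)]] by (simp add: nrm_norm)

lemma nrm_triangle:
 assumes "sq M f" "sq M g"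
 shows "nrm M (\<lambda>x. f x + g x) \<le> nrm M f + nrm M g"
proof (rule power2_le_imp_le)
 have "(nrm M (\<lambda>x. f x + g x))\<^sup>2 = (\<integral>x. (norm (f x))\<^sup>2 + 2 * (f x \<bullet> g x) + (norm (g x))\<^sup>2 \<partial>M)"
  unfolding nrm_power2 by (intro Bochner_Integration.integral_cong refl)
     (simp add: power2_norm_eq_inner algebra_simps inner_commute)
 also have "\<dots> = (nrm M f)\<^sup>2 + 2 * (\<integral>x. f x \<bullet> g x \<partial>M) + (nrm M g)\<^sup>2"
  using assms sq_inner[OF assms] by (simp add: nrm_power2 sq_integrable)
 also have "\<dots> \<le> (nrm M f + nrm M g)\<^sup>2" using CS[OF assms] by (simp add: power2_sum)
 finally show "(nrm M (\<lambda>x. f x + g x))\<^sup>2 \<le> (nrm M f + nrm M g)\<^sup>2" .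
qed simp

lemma nrm_triangle_diff:
 assumes "sq M f" "sq M g" "sq M h"
 shows "nrm M (\<lambda>x. f x - h x) \<le> nrm M (\<lambda>x. f x - g x) + nrm M (\<lambda>x. g x - h x)"
 using nrm_triangle[OF sq_diff[OF assms(1,2)] sq_diff[OF assms(2,3)]] by simp

lemma nrm_diff_abs:
 assumes "sq M f" "sq M g"
 shows "\<bar>nrm M f - nrm M g\<bar> \<le> nrm M (\<lambda>x. f x - g x)"
 using nrm_triangle[OF sq_diff[OF assms] assms(2)] nrm_triangle[OF sq_diff[OF assms(2,1)] assms(1)]
 by (simp add: nrm_minus_commute[of M g f])

lemma nrm_eq_0:
 assumes "sq M f" "nrm M f = 0" shows "AE x in M. f x = 0"
proof -
 have "(\<integral>x. (norm (f x))\<^sup>2 \<partial>M) = 0" using assms(2) nrm_power2[of M f] by simp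
 then have "AE x in M. (norm (f x))\<^sup>2 = 0"
  using integral_nonneg_eq_0_iff_AE[OF sq_integrable[OF assms(1)]] by simp
 then show ?thesis by simp
qed

definition L2lim :: "'a measure => (nat => 'a => 'b::euclidean_space) => ('a => 'b) => bool" where
 "L2lim M fs f \<longleftrightarrow> (\<forall>n. sq M (fs n)) \<and> sq M f \<and> (\<lambda>n. nrm M (\<lambda>x. fs n x - f x)) \<longlonglongrightarrow> 0"

lemma L2lim_sq: "L2lim M fs f ==> sq M (fs n)" "L2lim M fs f ==> sq M f"
 by (simp_all add: L2lim_def)

lemma L2lim_const: "sq M f ==> L2lim M (\<lambda>n. f) f"
 by (simp add: L2lim_def)

lemma L2lim_add:
 assumes "L2lim M fs f" "L2lim M gs g" shows "L2lim M (\<lambda>n x. fs n x + gs n x) (\<lambda>x. f x + g x)"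
 unfolding L2lim_def
proof (intro conjI allI)
 show "sq M (\<lambda>x. fs n x + gs n x)" for n using assms by (simp add: L2lim_def sq_add)
 show "sq M (\<lambda>x. f x + g x)" using assms by (simp add: L2lim_def sq_add)
 have "(\<lambda>n. nrm M (\<lambda>x. fs n x - f x) + nrm M (\<lambda>x. gs n x - g x)) \<longlonglongrightarrow> 0 + 0"
  using assms by (intro tendsto_add) (auto simp: L2lim_def)
 then have lim: "(\<lambda>n. nrm M (\<lambda>x. fs n x - f x) + nrm M (\<lambda>x. gs n x - g x)) \<longlonglongrightarrow> 0" by simp
 show "(\<lambda>n. nrm M (\<lambda>x. fs n x + gs n x - (f x + g x))) \<longlonglongrightarrow> 0"
 proof (rule Lim_null_comparison[OF _ lim])
  show "\<forall>\<^sub>F n in sequentially. norm (nrm M (\<lambda>x. fs n x + gs n x - (f x + g x)))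
    \<le> nrm M (\<lambda>x. fs n x - f x) + nrm M (\<lambda>x. gs n x - g x)"
  proof (intro always_eventually allI)
   fix n
   have "fs n x + gs n x - (f x + g x) = (fs n x - f x) + (gs n x - g x)" for x by simp
   then show "norm (nrm M (\<lambda>x. fs n x + gs n x - (f x + g x))) \<le> nrm M (\<lambda>x. fs n x - f x) + nrm M (\<lambda>x. gs n x - g x)"
    using nrm_triangle[of M "\<lambda>x. fs n x - f x" "\<lambda>x. gs n x - g x"] assms
    by (simp only: real_norm_def abs_of_nonneg nrm_nonneg) (simp add: L2lim_def sq_diff)
  qed
 qed
qed

lemma L2lim_scale:
 assumes "L2lim M fs f" shows "L2lim M (\<lambda>n x. c *\<^sub>R fs n x) (\<lambda>x. c *\<^sub>R f x)"
proof -
 have "nrm M (\<lambda>x. c *\<^sub>R fs n x - c *\<^sub>R f x) = \<bar>c\<bar> * nrm M (\<lambda>x. fs n x - f x)" for n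
  using nrm_scale[of M c "\<lambda>x. fs n x - f x"] by (simp add: scaleR_diff_right)
 then show ?thesis using assms by (auto simp: L2lim_def sq_scale intro!: tendsto_mult_right_zero)
qed

lemma L2lim_nrm:
 assumes "L2lim M fs f" shows "(\<lambda>n. nrm M (fs n)) \<longlonglongrightarrow> nrm M f"
proof -
 have "(\<lambda>n. nrm M (\<lambda>x. fs n x - f x)) \<longlonglongrightarrow> 0" using assms by (simp add: L2lim_def)
 then have "(\<lambda>n. nrm M (fs n) - nrm M f) \<longlonglongrightarrow> 0"
  by (rule Lim_null_comparison[rotated])
    (use assms nrm_diff_abs in \<open>auto simp: L2lim_def intro!: always_eventually\<close>)
 then show ?thesis by (simp add: LIM_zero_iff)
qed

lemma L2lim_inner:
 assumes "L2lim M fs f" "L2lim M gs g"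
 shows "(\<lambda>n. \<integral>x. fs n x \<bullet> gs n x \<partial>M) \<longlonglongrightarrow> (\<integral>x. f x \<bullet> g x \<partial>M)"
proof -
 note sq = L2lim_sq[OF assms(1)] L2lim_sq[OF assms(2)]
 have eq: "(\<integral>x. fs n x \<bullet> gs n x \<partial>M) - (\<integral>x. f x \<bullet> g x \<partial>M)
   = (\<integral>x. (fs n x - f x) \<bullet> gs n x \<partial>M) + (\<integral>x. f x \<bullet> (gs n x - g x) \<partial>M)" for n
  using sq by (simp add: inner_diff_left inner_diff_right sq_inner)
 have "(\<lambda>n. nrm M (\<lambda>x. fs n x - f x) * nrm M (gs n) + nrm M f * nrm M (\<lambda>x. gs n x - g x)) \<longlonglongrightarrow> 0 * nrm M g + nrm M f * 0"
  using assms by (intro tendsto_intros L2lim_nrm) (auto simp: L2lim_def)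
 then have lim0: "(\<lambda>n. nrm M (\<lambda>x. fs n x - f x) * nrm M (gs n) + nrm M f * nrm M (\<lambda>x. gs n x - g x)) \<longlonglongrightarrow> 0"
  by simp
 have "(\<lambda>n. (\<integral>x. fs n x \<bullet> gs n x \<partial>M) - (\<integral>x. f x \<bullet> g x \<partial>M)) \<longlonglongrightarrow> 0"
 proof (rule Lim_null_comparison[OF _ lim0], intro always_eventually allI)
  fix n
  show "norm ((\<integral>x. fs n x \<bullet> gs n x \<partial>M) - (\<integral>x. f x \<bullet> g x \<partial>M))
   \<le> nrm M (\<lambda>x. fs n x - f x) * nrm M (gs n) + nrm M f * nrm M (\<lambda>x. gs n x - g x)"
   unfolding eq real_norm_def
   using CS[OF sq_diff[OF sq(1) sq(2)] sq(3), of n n] CS[OF sq(2) sq_diff[OF sq(3) sq(4)], of n]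
   by linarith
 qed
 then show ?thesis by (simp add: LIM_zero_iff)
qed

lemma L2lim_subseq: "L2lim M fs f ==> strict_mono r ==> L2lim M (\<lambda>n. fs (r n)) f"
 using LIMSEQ_subseq_LIMSEQ[of "\<lambda>n. nrm M (\<lambda>x. fs n x - f x)" 0 r] by (auto simp: L2lim_def o_def)

lemma L2lim_AE_subseq:
 assumes "L2lim M fs f"
 obtains r where "strict_mono r" "AE x in M. (\<lambda>n. fs (r n) x) \<longlonglongrightarrow> f x"
proof -
 have "(\<lambda>n. (nrm M (\<lambda>x. fs n x - f x))\<^sup>2) \<longlonglongrightarrow> 0\<^sup>2"
  using assms by (intro tendsto_power) (simp add: L2lim_def)
 then have "(\<lambda>n. (\<integral>x. norm ((norm (fs n x - f x))\<^sup>2) \<partial>M)) \<longlonglongrightarrow> 0" by (simp add: nrm_power2)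
 moreover have "integrable M (\<lambda>x. (norm (fs n x - f x))\<^sup>2)" for n
  using assms by (auto simp: L2lim_def intro!: sq_integrable sq_diff)
 ultimately obtain r where r: "strict_mono r" "AE x in M. (\<lambda>n. (norm (fs (r n) x - f x))\<^sup>2) \<longlonglongrightarrow> 0"
  using tendsto_L1_AE_subseq[of M "\<lambda>n x. (norm (fs n x - f x))\<^sup>2"] by blast
 have "AE x in M. (\<lambda>n. fs (r n) x) \<longlonglongrightarrow> f x"
  using r(2)
 proof (rule AE_mp, intro AE_I2 impI)
  fix x assume "(\<lambda>n. (norm (fs (r n) x - f x))\<^sup>2) \<longlonglongrightarrow> 0"
  then have "(\<lambda>n. sqrt ((norm (fs (r n) x - f x))\<^sup>2)) \<longlonglongrightarrow> sqrt 0" by (rule tendsto_real_sqrt)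
  then have "(\<lambda>n. fs (r n) x - f x) \<longlonglongrightarrow> 0" by (simp add: tendsto_norm_zero_iff)
  then show "(\<lambda>n. fs (r n) x) \<longlonglongrightarrow> f x" by (simp add: LIM_zero_iff)
 qed
 with r(1) show ?thesis using that by blast
qed

lemma L2lim_dominated:
 fixes fs :: "nat => 'a => 'b::euclidean_space"
 assumes "sq M (w :: 'a => real)" "\<And>n. fs n \<in> borel_measurable M" "f \<in> borel_measurable M"
  "AE x in M. (\<lambda>n. fs n x) \<longlonglongrightarrow> f x" "\<And>n. AE x in M. norm (fs n x) \<le> w x"
 shows "L2lim M fs f"
proof -
 have w: "AE x in M. norm (f x) \<le> w x"
 proof -
  have "AE x in M. \<forall>n. norm (fs n x) \<le> w x" using assms(5) by (simp add: AE_all_countable)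
  with assms(4) show ?thesis
   by eventually_elim (auto intro: tendsto_upperbound[OF tendsto_norm])
 qed
 have sqn: "sq M (fs n)" for n
  using assms(5)[of n] by (intro sq_bound[OF assms(1)] assms) auto
 have sqf: "sq M f" using w by (intro sq_bound[OF assms(1)] assms) auto
 have "(\<lambda>n. \<integral>x. (norm (fs n x - f x))\<^sup>2 \<partial>M) \<longlonglongrightarrow> (\<integral>x. 0 \<partial>M)"
 proof (rule integral_dominated_convergence[where w="\<lambda>x. (2 * w x)\<^sup>2"])
  show "integrable M (\<lambda>x. (2 * w x)\<^sup>2)" using sq_integrable[OF assms(1)] by (simp add: power_mult_distrib)
  show "AE x in M. (\<lambda>n. (norm (fs n x - f x))\<^sup>2) \<longlonglongrightarrow> 0"
   using assms(4)
  proof eventually_elim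
   case (elim x)
   then have "(\<lambda>n. (norm (fs n x - f x))\<^sup>2) \<longlonglongrightarrow> (norm (f x - f x))\<^sup>2" by (intro tendsto_intros)
   then show ?case by simp
  qed
  show "AE x in M. norm ((norm (fs n x - f x))\<^sup>2) \<le> (2 * w x)\<^sup>2" for n
   using w assms(5)[of n]
  proof eventually_elim
   case (elim x)
   have "norm (fs n x - f x) \<le> 2 * w x" using norm_triangle_ineq4[of "fs n x" "f x"] elim by linarith
   from power_mono[OF this norm_ge_zero, of 2] show ?case by simp
  qed
 qed (use assms in auto)
 then have "(\<lambda>n. (nrm M (\<lambda>x. fs n x - f x))\<^sup>2) \<longlonglongrightarrow> 0" by (simp add: nrm_power2)
 then have "(\<lambda>n. sqrt ((nrm M (\<lambda>x. fs n x - f x))\<^sup>2)) \<longlonglongrightarrow> sqrt 0" by (rule tendsto_real_sqrt)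
 then show ?thesis using sqn sqf by (simp add: L2lim_def)
qed

lemma sq_bounded_scale:
 assumes "sq M f" "c \<in> borel_measurable M" "AE x in M. \<bar>c x\<bar> \<le> (C::real)"
 shows "sq M (\<lambda>x. c x *\<^sub>R f x)" "nrm M (\<lambda>x. c x *\<^sub>R f x) \<le> \<bar>C\<bar> * nrm M f"
proof -
 have *: "AE x in M. norm (c x *\<^sub>R f x) \<le> norm (C *\<^sub>R f x)"
  using assms(3) by eventually_elim (auto intro!: mult_right_mono)
 show "sq M (\<lambda>x. c x *\<^sub>R f x)"
  by (rule sq_bound[OF sq_scale[OF assms(1)] _ *]) (use assms in \<open>auto simp: sq_def\<close>)
 have "nrm M (\<lambda>x. c x *\<^sub>R f x) \<le> nrm M (\<lambda>x. C *\<^sub>R f x)"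
  by (rule nrm_mono[OF sq_scale[OF assms(1)] _ *]) (use assms in \<open>auto simp: sq_def\<close>)
 then show "nrm M (\<lambda>x. c x *\<^sub>R f x) \<le> \<bar>C\<bar> * nrm M f" by (simp add: nrm_scale)
qed

text \<open>The coefficients converge only pointwise, so the product is split as \<open>c n\<close>
  times \<open>f\<close> plus \<open>c n\<close> times the difference: the first part converges by
  dominated convergence, the second is small because the coefficients are bounded.\<close>

lemma L2lim_bounded_scale:
 assumes "L2lim M fs f" "\<And>n. c n \<in> borel_measurable M" "d \<in> borel_measurable M"
  "\<And>n. AE x in M. \<bar>c n x\<bar> \<le> (C::real)" "AE x in M. (\<lambda>n. c n x) \<longlonglongrightarrow> d x"
 shows "L2lim M (\<lambda>n x. c n x *\<^sub>R fs n x) (\<lambda>x. d x *\<^sub>R f x)"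
proof -
 note sq = L2lim_sq[OF assms(1)]
 have "L2lim M (\<lambda>n x. c n x *\<^sub>R f x) (\<lambda>x. d x *\<^sub>R f x)"
 proof (rule L2lim_dominated[where w="\<lambda>x. \<bar>C\<bar> * norm (f x)"])
  show "sq M (\<lambda>x. \<bar>C\<bar> * norm (f x))" by (intro sq_cmult sq_norm sq)
  show "AE x in M. (\<lambda>n. c n x *\<^sub>R f x) \<longlonglongrightarrow> d x *\<^sub>R f x"
   using assms(5) by eventually_elim (auto intro!: tendsto_intros)
  show "AE x in M. norm (c n x *\<^sub>R f x) \<le> \<bar>C\<bar> * norm (f x)" for n
   using assms(4)[of n] by eventually_elim (auto intro!: mult_right_mono)
 qed (use assms sq in \<open>auto simp: sq_def\<close>)
 moreover have "L2lim M (\<lambda>n x. c n x *\<^sub>R (fs n x - f x)) (\<lambda>x. 0)"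
  unfolding L2lim_def
 proof (intro conjI allI)
  have b: "sq M (\<lambda>x. c n x *\<^sub>R (fs n x - f x))" 
   "nrm M (\<lambda>x. c n x *\<^sub>R (fs n x - f x)) \<le> \<bar>C\<bar> * nrm M (\<lambda>x. fs n x - f x)" for n
   using sq_bounded_scale[OF sq_diff[OF sq(1) sq(2)] assms(2,4)] by auto
  show "sq M (\<lambda>x. c n x *\<^sub>R (fs n x - f x))" for n by (rule b)
  have "(\<lambda>n. \<bar>C\<bar> * nrm M (\<lambda>x. fs n x - f x)) \<longlonglongrightarrow> 0"
   using assms(1) by (auto simp: L2lim_def intro!: tendsto_mult_right_zero)
  then show "(\<lambda>n. nrm M (\<lambda>x. c n x *\<^sub>R (fs n x - f x) - 0)) \<longlonglongrightarrow> 0"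
   by (rule Lim_null_comparison[rotated]) (use b in \<open>auto intro!: always_eventually\<close>)
 qed simp
 ultimately have "L2lim M (\<lambda>n x. c n x *\<^sub>R f x + c n x *\<^sub>R (fs n x - f x)) (\<lambda>x. d x *\<^sub>R f x + 0)"
  by (rule L2lim_add)
 then show ?thesis by (simp add: algebra_simps)
qed

text \<open>Fatou's lemma in a form where the integrability of the limit is a conclusion and the
  bounds may vary with n. It supplies lower semicontinuity for terms whose integrability is not
  known beforehand.\<close>

lemma fatou_real:
 assumes "\<And>n. integrable M (f n)" "\<And>n. AE x in M. 0 \<le> f n x" "h \<in> borel_measurable M"
  "AE x in M. (\<lambda>n. f n x) \<longlonglongrightarrow> h x" "\<And>n. (\<integral>x. f n x \<partial>M) \<le> c n" "c \<longlonglongrightarrow> (C::real)"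
 shows "integrable M h" "(\<integral>x. h x \<partial>M) \<le> C"
proof -
 have pos: "AE x in M. 0 \<le> h x"
 proof -
  have "AE x in M. \<forall>n. 0 \<le> f n x" using assms(2) by (simp add: AE_all_countable)
  with assms(4) show ?thesis by eventually_elim (auto intro: tendsto_lowerbound)
 qed
 have m [measurable]: "f n \<in> borel_measurable M" for n using assms(1) by auto
 have "(\<integral>\<^sup>+x. ennreal (h x) \<partial>M) = (\<integral>\<^sup>+x. liminf (\<lambda>n. ennreal (f n x)) \<partial>M)"
 proof (rule nn_integral_cong_AE)
  show "AE x in M. ennreal (h x) = liminf (\<lambda>n. ennreal (f n x))"
   using assms(4)
  proof eventually_elim
   case (elim x)
   then have "(\<lambda>n. ennreal (f n x)) \<longlonglongrightarrow> ennreal (h x)" by (rule tendsto_ennrealI)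
   then show ?case by (simp add: lim_imp_Liminf)
  qed
 qed
 also have "\<dots> \<le> liminf (\<lambda>n. \<integral>\<^sup>+x. ennreal (f n x) \<partial>M)"
  by (rule nn_integral_liminf) simp
 also have "\<dots> \<le> liminf (\<lambda>n. ennreal (c n))"
 proof (rule Liminf_mono, intro always_eventually allI)
  fix n
  have "(\<integral>\<^sup>+x. ennreal (f n x) \<partial>M) = ennreal (\<integral>x. f n x \<partial>M)"
   by (rule nn_integral_eq_integral[OF assms(1,2)])
  then show "(\<integral>\<^sup>+x. ennreal (f n x) \<partial>M) \<le> ennreal (c n)" using assms(5)[of n] by (simp add: ennreal_leI)
 qed
 also have "\<dots> = ennreal C"
  by (rule lim_imp_Liminf) (auto intro: tendsto_ennrealI assms)
 finally have le: "(\<integral>\<^sup>+x. ennreal (h x) \<partial>M) \<le> ennreal C" .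
 show i: "integrable M h"
 proof (rule integrableI_nonneg[OF assms(3) pos])
  show "(\<integral>\<^sup>+x. ennreal (h x) \<partial>M) < \<infinity>" using le by (simp add: le_less_trans)
 qed
 have "C \<ge> 0"
 proof (rule tendsto_lowerbound[OF assms(6)])
  show "\<forall>\<^sub>F n in sequentially. 0 \<le> c n"
   using order_trans[OF integral_nonneg_AE[OF assms(2)] assms(5)] by (simp add: always_eventually)
 qed simp
 then show "(\<integral>x. h x \<partial>M) \<le> C"
  using le by (simp add: nn_integral_eq_integral[OF i pos])
qed

text \<open>Along a subsequence with increments at most 4^-k the sum of 2^k times the squared
  increments has a finite integral. So almost everywhere its terms are bounded, the increments decay
  geometrically and the subsequence converges.\<close>

lemma L2_complete:
 fixes f :: "nat => 'a => 'b::euclidean_space"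
 assumes sq: "\<And>n. sq M (f n)"
  and cauchy: "\<And>e. e > 0 ==> \<exists>N. \<forall>m\<ge>N. \<forall>n\<ge>N. nrm M (\<lambda>x. f m x - f n x) < e"
 obtains h where "L2lim M f h"
proof -
 have m [measurable]: "f n \<in> borel_measurable M" for n using sq by (simp add: sq_def)
 have "\<forall>k. \<exists>N. \<forall>m\<ge>N. \<forall>n\<ge>N. nrm M (\<lambda>x. f m x - f n x) < (1/4) ^ k"
  using cauchy by simp
 then obtain N where N: "\<And>k m n. m \<ge> N k ==> n \<ge> N k ==> nrm M (\<lambda>x. f m x - f n x) < (1/4) ^ k"
  by metis
 define r where "r = rec_nat (N 0) (\<lambda>k p. max (Suc p) (N (Suc k)))"
 have r_Suc: "r (Suc k) = max (Suc (r k)) (N (Suc k))" for k by (simp add: r_def)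
 have "strict_mono r" by (intro strict_monoI_Suc) (simp add: r_Suc)
 have rN: "r k \<ge> N k" for k by (cases k) (auto simp: r_def)
 define d where "d k x = (norm (f (r (Suc k)) x - f (r k) x))\<^sup>2" for k x
 have dm [measurable]: "d k \<in> borel_measurable M" for k by (simp add: d_def[abs_def])
 have di: "(\<integral>\<^sup>+x. ennreal (2 ^ k * d k x) \<partial>M) \<le> ennreal ((1/8) ^ k)" for k
 proof -
  have i: "integrable M (d k)" unfolding d_def[abs_def] by (intro sq_integrable sq_diff sq)
  have "(\<integral>x. d k x \<partial>M) = (nrm M (\<lambda>x. f (r (Suc k)) x - f (r k) x))\<^sup>2" by (simp add: nrm_power2 d_def)
  also have "\<dots> \<le> ((1/4) ^ k)\<^sup>2"
  proof (intro power_mono)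
   have "nrm M (\<lambda>x. f (r (Suc k)) x - f (r k) x) < (1/4) ^ k"
    using rN[of k] strict_mono_less[OF \<open>strict_mono r\<close>, of k "Suc k"] by (intro N) auto
   then show "nrm M (\<lambda>x. f (r (Suc k)) x - f (r k) x) \<le> (1/4) ^ k" by simp
  qed simp
  also have "\<dots> = (1/16) ^ k" by (simp add: power2_eq_square flip: power_mult_distrib)
  finally have "2 ^ k * (\<integral>x. d k x \<partial>M) \<le> 2 ^ k * (1/16) ^ k" by simp
  also have "\<dots> = (1/8::real) ^ k" by (simp flip: power_mult_distrib)
  finally have "2 ^ k * (\<integral>x. d k x \<partial>M) \<le> (1/8) ^ k" .
  moreover have "(\<integral>\<^sup>+x. ennreal (2 ^ k * d k x) \<partial>M) = ennreal (\<integral>x. 2 ^ k * d k x \<partial>M)"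
   by (intro nn_integral_eq_integral integrable_mult_right i) (simp add: d_def)
  ultimately show ?thesis by (simp add: ennreal_leI)
 qed
 have "(\<integral>\<^sup>+x. (\<Sum>k. ennreal (2 ^ k * d k x)) \<partial>M) = (\<Sum>k. \<integral>\<^sup>+x. ennreal (2 ^ k * d k x) \<partial>M)"
  by (rule nn_integral_suminf) measurable
 also have "\<dots> \<le> (\<Sum>k. ennreal ((1/8) ^ k))" by (intro suminf_le di) auto
 also have "\<dots> = ennreal (\<Sum>k. (1/8) ^ k)"
  by (intro suminf_ennreal2) (auto intro: summable_geometric)
 also have "\<dots> < \<infinity>" by simp
 finally have "AE x in M. (\<Sum>k. ennreal (2 ^ k * d k x)) \<noteq> \<infinity>"
  by (intro nn_integral_PInf_AE) auto
 then have conv: "AE x in M. convergent (\<lambda>k. f (r k) x)"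
 proof eventually_elim
  case (elim x)
  then have "summable (\<lambda>k. 2 ^ k * d k x)" 
   by (intro summable_suminf_not_top) (auto simp: d_def)
  then have "(\<lambda>k. 2 ^ k * d k x) \<longlonglongrightarrow> 0" by (rule summable_LIMSEQ_zero)
  then have "Bseq (\<lambda>k. 2 ^ k * d k x)" by (intro convergent_imp_Bseq convergentI)
  then obtain K where K: "\<And>k. norm (2 ^ k * d k x) \<le> K" unfolding Bseq_def by blast
  have le: "norm (f (r (Suc k)) x - f (r k) x) \<le> sqrt K * (sqrt (1/2)) ^ k" for k
  proof (rule power2_le_imp_le)
   have K0: "K \<ge> 0" using K[of 0] norm_ge_zero order_trans by blast
   have "2 ^ k * d k x \<le> K" using K[of k] by simp
   then have "d k x \<le> K * (1/2) ^ k" by (simp add: field_simps)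
   also have "\<dots> = (sqrt K)\<^sup>2 * ((sqrt (1/2))\<^sup>2) ^ k" using K0 by simp
   also have "\<dots> = (sqrt K * (sqrt (1/2)) ^ k)\<^sup>2"
    unfolding power_mult_distrib power_mult[symmetric] mult.commute[of k 2] ..
   finally show "(norm (f (r (Suc k)) x - f (r k) x))\<^sup>2 \<le> (sqrt K * (sqrt (1/2)) ^ k)\<^sup>2" unfolding d_def .
   show "0 \<le> sqrt K * sqrt (1 / 2) ^ k" using K0 by simp
  qed
  have "sqrt (1/2::real) < 1" by (simp add: real_sqrt_lt_1_iff)
  then have "summable (\<lambda>k. sqrt K * (sqrt (1/2)) ^ k)" by (intro summable_mult summable_geometric) simp
  then have "summable (\<lambda>k. f (r (Suc k)) x - f (r k) x)"
   by (rule summable_comparison_test'[of _ 0]) (use le in auto)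
  then have "convergent (\<lambda>n. \<Sum>k<n. f (r (Suc k)) x - f (r k) x)" by (simp add: summable_iff_convergent)
  then have "convergent (\<lambda>n. f (r n) x - f (r 0) x)" using sum_lessThan_telescope[of "\<lambda>n. f (r n) x"] by simp
  then have "convergent (\<lambda>n. (f (r n) x - f (r 0) x) + f (r 0) x)" by (intro convergent_add convergent_const)
  then show ?case by simp
 qed
 define h where "h x = lim (\<lambda>k. f (r k) x)" for x
 have [measurable]: "h \<in> borel_measurable M" unfolding h_def[abs_def] by (rule borel_measurable_lim_metric) simp
 have lim: "AE x in M. (\<lambda>k. f (r k) x) \<longlonglongrightarrow> h x"
  using conv by eventually_elim (simp add: h_def convergent_LIMSEQ_iff)
 \<comment> \<open>Fatou along the subsequence bounds the distance of \<open>h\<close> to every late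
   \<open>f n\<close>. This gives convergence of the whole sequence and, as a by-product, square
   integrability of \<open>h\<close>.\<close>
 have key: "integrable M (\<lambda>x. (norm (h x - f n x))\<^sup>2) \<and> (\<integral>x. (norm (h x - f n x))\<^sup>2 \<partial>M) \<le> ((1/4)^k)\<^sup>2"
  if "n \<ge> N k" for n k
 proof -
  let ?F = "\<lambda>j x. (norm (f (r (j + k)) x - f n x))\<^sup>2"
  have a: "integrable M (?F j)" for j by (intro sq_integrable sq_diff sq)
  have b: "AE x in M. (\<lambda>j. ?F j x) \<longlonglongrightarrow> (norm (h x - f n x))\<^sup>2"
   using lim by eventually_elim (auto intro!: tendsto_intros LIMSEQ_ignore_initial_segment[of "\<lambda>i. f (r i) x" for x])
  have c: "(\<integral>x. ?F j x \<partial>M) \<le> ((1/4)^k)\<^sup>2" for j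
  proof -
   have "r (j + k) \<ge> N k" using rN[of k] strict_mono_less_eq[OF \<open>strict_mono r\<close>, of k "j+k"] by simp
   then have "nrm M (\<lambda>x. f (r (j + k)) x - f n x) < (1/4)^k" using that by (rule N)
   then have "(nrm M (\<lambda>x. f (r (j + k)) x - f n x))\<^sup>2 \<le> ((1/4)^k)\<^sup>2"
    by (intro power_mono) auto
   then show ?thesis by (simp add: nrm_power2)
  qed
  show ?thesis
   using fatou_real[of M ?F "\<lambda>x. (norm (h x - f n x))\<^sup>2" "\<lambda>_. ((1/4)^k)\<^sup>2" "((1/4)^k)\<^sup>2"] a b c by auto
 qed
 have hd: "sq M (\<lambda>x. h x - f n x)" if "n \<ge> N 0" for n
  using key[OF that] by (simp add: sq_def)
 have sqh: "sq M h" using sq_add[OF hd[OF order_refl] sq[of "N 0"]] by simp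
 have "L2lim M f h"
  unfolding L2lim_def
 proof (intro conjI allI sq sqh)
  show "(\<lambda>n. nrm M (\<lambda>x. f n x - h x)) \<longlonglongrightarrow> 0"
  proof (rule LIMSEQ_I)
   fix e :: real assume "e > 0"
   then obtain k where k: "(1/4) ^ k < e" using real_arch_pow_inv[of e "1/4"] by auto
   have "nrm M (\<lambda>x. f n x - h x) < e" if "n \<ge> N k" for n
   proof -
    have "(nrm M (\<lambda>x. h x - f n x))\<^sup>2 \<le> ((1/4)^k)\<^sup>2" using key[OF that] by (simp add: nrm_power2)
    then have "nrm M (\<lambda>x. h x - f n x) \<le> (1/4)^k" by (rule power2_le_imp_le) simp
    then show ?thesis using k by (simp add: nrm_minus_commute)
   qed
   then show "\<exists>no. \<forall>n\<ge>no. norm (nrm M (\<lambda>x. f n x - h x) - 0) < e" by auto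
  qed
 qed
 then show ?thesis by (rule that)
qed

section \<open>Translation invariance of Lebesgue measure\<close>

lemma leb_shift:
 fixes a :: "'a::euclidean_space"
 shows leb_shift_measurable: "(\<lambda>x. x + a) \<in> lebesgue \<rightarrow>\<^sub>M lebesgue"
  and leb_shift_distr: "distr lebesgue lebesgue (\<lambda>x. x + a) = lebesgue"
proof -
 have eq: "(\<lambda>x. a + (\<Sum>j\<in>Basis. (1 * (x \<bullet> j)) *\<^sub>R j)) = (\<lambda>x. x + a)"
  by (simp add: euclidean_representation add.commute)
 show "(\<lambda>x. x + a) \<in> lebesgue \<rightarrow>\<^sub>M lebesgue"
  using lebesgue_affine_measurable[of "\<lambda>_. 1" a] unfolding eq by simp
 show "distr lebesgue lebesgue (\<lambda>x. x + a) = lebesgue"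
  using lebesgue_affine_euclidean[of "\<lambda>_. 1" a] unfolding eq by (simp add: density_1)
qed

lemma leb_shift_borel:
 fixes f :: "'a::euclidean_space => 'b::euclidean_space"
 shows "f \<in> borel_measurable lebesgue ==> (\<lambda>x. f (x + a)) \<in> borel_measurable lebesgue"
 using measurable_compose[OF leb_shift_measurable] .

lemma integral_shift:
 fixes f :: "'a::euclidean_space => real"
 assumes "f \<in> borel_measurable lebesgue"
 shows "(LINT x. f (x + a)) = (LINT x. f x)"
 using integral_distr[OF leb_shift_measurable assms] by (simp add: leb_shift_distr)

lemma integrable_shift:
 fixes f :: "'a::euclidean_space => real"
 assumes "integrable lebesgue f"
 shows "integrable lebesgue (\<lambda>x. f (x + a))"
 using integrable_distr_eq[OF leb_shift_measurable, of f a] assms by (simp add: leb_shift_distr)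

lemma AE_shift:
 assumes "AE x in lebesgue. P x"
 shows "AE x in lebesgue. P (x + (a::'a::euclidean_space))"
proof -
 obtain N where "\<And>x. x \<in> space lebesgue - N ==> P x" and N2: "N \<in> null_sets lebesgue"
  using AE_E3[OF assms] by blast
 then have N: "{x. \<not> P x} \<subseteq> N" "N \<in> null_sets lebesgue" by auto
 have "emeasure (distr lebesgue lebesgue (\<lambda>x. x + a)) N = emeasure lebesgue ((\<lambda>x. x + a) -` N \<inter> space lebesgue)"
  using N by (intro emeasure_distr leb_shift_measurable) auto
 then have "(\<lambda>x. x + a) -` N \<in> null_sets lebesgue"
  using N measurable_sets[OF leb_shift_measurable[of a], of N] by (simp add: leb_shift_distr null_sets_def)
 then show ?thesis by (rule AE_I') (use N in auto)
qed

lemma sq_shift: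
 fixes f :: "'a::euclidean_space => 'b::euclidean_space"
 assumes "sq lebesgue f" shows "sq lebesgue (\<lambda>x. f (x + a))"
 using assms integrable_shift[of "\<lambda>x. (norm (f x))\<^sup>2" a] by (simp add: sq_def leb_shift_borel)

lemma nrm_shift:
 fixes f :: "'a::euclidean_space => 'b::euclidean_space"
 assumes "f \<in> borel_measurable lebesgue" shows "nrm lebesgue (\<lambda>x. f (x + a)) = nrm lebesgue f"
 using integral_shift[of "\<lambda>x. (norm (f x))\<^sup>2" a] assms by (simp add: nrm_def)

lemma cont_leb: 
 fixes f :: "'a::euclidean_space => 'b::euclidean_space"
 shows "continuous_on UNIV f ==> f \<in> borel_measurable lebesgue"
 by (intro measurable_completion) (simp add: borel_measurable_continuous_onI)

lemma comp_leb:
 fixes s :: "real => real"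
 assumes "s \<in> borel_measurable borel" "u \<in> borel_measurable lebesgue"
 shows "(\<lambda>x. s (u x)) \<in> borel_measurable lebesgue"
 using measurable_compose[OF assms(2,1)] .

lemma indicator_integrable:

 \<comment> \<open>Integrability of bounded functions and of test functions\<close>
 "S \<in> sets lebesgue ==> bounded S ==> integrable lebesgue (indicator S :: 'a::euclidean_space => real)"
 by (intro integrable_real_indicator) (use bounded_set_imp_lmeasurable fmeasurableD2 in \<open>auto simp: less_top simp del: emeasure_completion\<close>)

lemma bounded_integrable:
 fixes f :: "'a::euclidean_space => real"
 assumes "f \<in> borel_measurable lebesgue" "bounded S" "S \<in> sets lebesgue" "AE x in lebesgue. \<bar>f x\<bar> \<le> B * indicator S x"
 shows "integrable lebesgue f"
proof (rule Bochner_Integration.integrable_bound)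
 show "integrable lebesgue (\<lambda>x. B * indicator S x)" using assms by (intro integrable_mult_right indicator_integrable) auto
 show "AE x in lebesgue. norm (f x) \<le> norm (B * indicator S x)" using assms(4) by eventually_elim auto
qed fact

lemma sq_indicator:
 "S \<in> sets lebesgue ==> bounded S ==> sq lebesgue (\<lambda>x. B * indicator S x :: real)"
proof (intro sq_cmult)
 assume S: "S \<in> sets lebesgue" "bounded S"
 have "(norm (indicator S x :: real))\<^sup>2 = indicator S x" for x by (simp add: indicator_def)
 then show "sq lebesgue (indicator S :: _ => real)" using indicator_integrable[OF S] S by (simp add: sq_def)
qed

lemma bounded_sq:
 fixes f :: "'a::euclidean_space => 'b::euclidean_space"
 assumes "f \<in> borel_measurable lebesgue" "bounded S" "S \<in> sets lebesgue" "AE x in lebesgue. norm (f x) \<le> B * indicator S x"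
 shows "sq lebesgue f"
 by (rule sq_bound[OF sq_indicator[OF assms(3,2), of B] assms(1)]) (use assms(4) in auto)

lemma test_bound:
 assumes "test_fun \<Omega> \<phi>"
 obtains B R where "B \<ge> 0" "R > 0" "\<And>x. \<bar>\<phi> x\<bar> \<le> B * indicator (cball 0 R) x"
proof -
 obtain K where K: "compact K" "K \<subseteq> \<Omega>" "\<And>x. x \<notin> K ==> \<phi> x = 0"
  using assms unfolding test_fun_def by blast
 have "continuous_on K \<phi>" using continuous_on_subset[OF smooth_continuous[OF test_smooth[OF assms]]] by auto
 then have "bounded (\<phi> ` K)" using K(1) compact_continuous_image compact_imp_bounded by blast
 then obtain B where B: "\<And>x. x \<in> K ==> \<bar>\<phi> x\<bar> \<le> B" by (auto simp: bounded_iff)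
 obtain R where R: "K \<subseteq> cball 0 R" "R > 0"
  using bounded_subset_ballD[OF compact_imp_bounded[OF K(1)], of 0] ball_subset_cball by (metis order_trans)
 have "\<bar>\<phi> x\<bar> \<le> \<bar>B\<bar> * indicator (cball 0 R) x" for x
 proof (cases "x \<in> K")
  case True
  then have "x \<in> cball 0 R" using R by blast
  then show ?thesis using B[OF True] by (simp add: indicator_def)
 next
  case False
  then show ?thesis using K by simp
 qed
 then show ?thesis using that[of "\<bar>B\<bar>" R] R by auto
qed

lemma test_leb: "test_fun \<Omega> \<phi> ==> \<phi> \<in> borel_measurable lebesgue"
 by (intro cont_leb smooth_continuous test_smooth)

lemma test_grad_leb: "test_fun \<Omega> \<phi> ==> grad \<phi> \<in> borel_measurable lebesgue"
 by (intro cont_leb grad_continuous test_smooth)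

lemma test_sq: 
 assumes "test_fun \<Omega> \<phi>" shows "sq lebesgue \<phi>"
proof -
 obtain B R where "\<And>x. \<bar>\<phi> x\<bar> \<le> B * indicator (cball 0 R) x" using test_bound[OF assms] by metis
 then show ?thesis by (intro bounded_sq[of _ "cball 0 R" B] test_leb[OF assms]) auto
qed

lemma test_integrable:
 assumes "test_fun \<Omega> \<phi>" shows "integrable lebesgue \<phi>"
proof -
 obtain B R where "\<And>x. \<bar>\<phi> x\<bar> \<le> B * indicator (cball 0 R) x" using test_bound[OF assms] by metis
 then show ?thesis by (intro bounded_integrable[of _ "cball 0 R" B] test_leb[OF assms]) auto
qed

lemma grad_bound:
 assumes "test_fun \<Omega> \<phi>"
 obtains B R where "B \<ge> 0" "R > 0" "\<And>x. norm (grad \<phi> x) \<le> B * indicator (cball 0 R) x"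
proof -
 have "\<forall>i. \<exists>B R. B \<ge> 0 \<and> R > 0 \<and> (\<forall>x. \<bar>pd i \<phi> x\<bar> \<le> B * indicator (cball 0 R) x)"
  using test_bound[OF test_pd[OF assms]] by metis
 then obtain B R where BR: "\<And>i. B i \<ge> 0" "\<And>i. R i > 0" "\<And>i x. \<bar>pd i \<phi> x\<bar> \<le> B i * indicator (cball 0 (R i)) x"
  by metis
 define R' where "R' = Max (range R)"
 have R': "R i \<le> R'" for i by (simp add: R'_def)
 have "norm (grad \<phi> x) \<le> (\<Sum>i\<in>UNIV. B i) * indicator (cball 0 R') x" for x
 proof -
  have "norm (grad \<phi> x) \<le> (\<Sum>i\<in>UNIV. \<bar>grad \<phi> x $ i\<bar>)" by (rule norm_le_l1_cart)
  also have "\<dots> \<le> (\<Sum>i\<in>UNIV. B i * indicator (cball 0 R') x)"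
  proof (rule sum_mono)
   fix i
   have "B i * indicator (cball 0 (R i)) x \<le> B i * indicator (cball 0 R') x"
    using BR(1)[of i] R'[of i] by (intro mult_left_mono) (auto simp: indicator_def)
   then show "\<bar>grad \<phi> x $ i\<bar> \<le> B i * indicator (cball 0 R') x"
    using BR(3)[of i x] by (simp add: grad_nth)
  qed
  finally show ?thesis by (simp add: sum_distrib_right)
 qed
 moreover have "R' > 0" using BR(2) R' by (meson less_le_trans)
 ultimately show ?thesis using that[of "\<Sum>i\<in>UNIV. B i" R'] BR(1) by (auto simp: sum_nonneg)
qed

lemma test_grad_sq: 
 assumes "test_fun \<Omega> \<phi>" shows "sq lebesgue (grad \<phi>)"
proof -
 obtain B R where "\<And>x. norm (grad \<phi> x) \<le> B * indicator (cball 0 R) x" using grad_bound[OF assms] by metis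
 then show ?thesis by (intro bounded_sq[of _ "cball 0 R" B] test_grad_leb[OF assms]) auto
qed

section \<open>Difference quotients of test functions\<close>

definition dq :: "real => 'n::finite => (real^'n => 'b::real_vector) => real^'n => 'b" where
 "dq h i f x = (1 / h) *\<^sub>R (f (x + h *\<^sub>R axis i 1) - f x)"

text \<open>One dominating function serves all steps up to 1: the mean value theorem bounds the
  quotient, and enlarging the radius of the support by 1 covers the translate.\<close>

lemma dq_test_bound:
 assumes "test_fun \<Omega> \<phi>"
 obtains B R where "B \<ge> 0" "\<And>h x. 0 < \<bar>h\<bar> ==> \<bar>h\<bar> \<le> 1 ==> \<bar>dq h i \<phi> x\<bar> \<le> B * indicator (cball 0 R) x"
proof -
 obtain B R where B: "B \<ge> 0" "\<And>x. \<bar>pd i \<phi> x\<bar> \<le> B * indicator (cball 0 R) x"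
  using test_bound[OF test_pd[OF assms]] by metis
 obtain B2 R2 where B2: "\<And>x. \<bar>\<phi> x\<bar> \<le> B2 * indicator (cball 0 R2) x"
  using test_bound[OF assms] by metis
 have Bb: "\<bar>pd i \<phi> x\<bar> \<le> B" for x using B(1) B(2)[of x] by (cases "x \<in> cball 0 R") auto
 have *: "\<bar>dq h i \<phi> x\<bar> \<le> B * indicator (cball 0 (R2 + 1)) x" if h: "0 < \<bar>h\<bar>" "\<bar>h\<bar> \<le> 1" for h x
 proof (cases "x \<in> cball 0 (R2 + 1)")
  case True
  have d: "((\<lambda>t. \<phi> (x + t *\<^sub>R axis i 1)) has_real_derivative pd i \<phi> (x + s *\<^sub>R axis i 1)) (at s within UNIV)" for s
   using pdiff_at[OF smooth_pdiff[OF test_smooth[OF assms]]] by simp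
  have "\<bar>\<phi> (x + h *\<^sub>R axis i 1) - \<phi> (x + 0 *\<^sub>R axis i 1)\<bar> \<le> B * \<bar>h - 0\<bar>"
   using field_differentiable_bound[of UNIV "\<lambda>t. \<phi> (x + t *\<^sub>R axis i 1)" "\<lambda>s. pd i \<phi> (x + s *\<^sub>R axis i 1)" B h 0] d Bb
   by simp
  then show ?thesis using h True by (simp add: dq_def field_simps abs_mult)
 next
  case False
  have n: "norm (h *\<^sub>R axis i (1::real)) \<le> 1" using h by simp
  have "x \<notin> cball 0 R2" "x + h *\<^sub>R axis i 1 \<notin> cball 0 R2"
   using False n norm_triangle_ineq4[of "x + h *\<^sub>R axis i 1" "h *\<^sub>R axis i 1"] by auto
  then have "\<phi> x = 0" "\<phi> (x + h *\<^sub>R axis i 1) = 0"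
   using B2[of x] B2[of "x + h *\<^sub>R axis i 1"] by auto
  then show ?thesis using B(1) by (simp add: dq_def)
 qed
 show ?thesis using that[OF B(1) *] by blast
qed

lemma dq_test_tendsto:
 assumes "smooth_fun \<phi>" "h \<longlonglongrightarrow> 0" "\<And>n. h n \<noteq> 0"
 shows "(\<lambda>n. dq (h n) i \<phi> x) \<longlonglongrightarrow> pd i \<phi> x"
proof -
 have "((\<lambda>t. \<phi> (x + t *\<^sub>R axis i 1)) has_real_derivative pd i \<phi> x) (at 0)"
  using smooth_pdiff[OF assms(1), of i] by (simp add: pdiff_def)
 then have "((\<lambda>t. (\<phi> (x + t *\<^sub>R axis i 1) - \<phi> x) / t) \<longlongrightarrow> pd i \<phi> x) (at 0)"
  by (simp add: has_field_derivative_iff)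
 moreover have "filterlim h (at 0) sequentially"
  using assms by (simp add: filterlim_at)
 ultimately have "(\<lambda>n. (\<phi> (x + h n *\<^sub>R axis i 1) - \<phi> x) / h n) \<longlonglongrightarrow> pd i \<phi> x"
  by (rule filterlim_compose)
 then show ?thesis by (simp add: dq_def divide_inverse mult.commute)
qed

lemma dq_leb:
 fixes f :: "real^'n::finite => 'b::euclidean_space"
 shows "f \<in> borel_measurable lebesgue ==> dq h i f \<in> borel_measurable lebesgue"
 unfolding dq_def[abs_def]
proof (intro borel_measurable_scaleR borel_measurable_const borel_measurable_diff)
 assume "f \<in> borel_measurable lebesgue"
 then show "(\<lambda>x. f (x + h *\<^sub>R axis i 1)) \<in> borel_measurable lebesgue" by (rule leb_shift_borel)
qed

lemma dq_sq:
 fixes f :: "real^'n::finite => 'b::euclidean_space"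
 shows "sq lebesgue f ==> sq lebesgue (dq h i f)"
 unfolding dq_def[abs_def]
proof (intro sq_scale sq_diff)
 assume "sq lebesgue f"
 then show "sq lebesgue (\<lambda>x. f (x + h *\<^sub>R axis i 1))" by (rule sq_shift)
qed

lemma dq_test_L2:
 assumes "test_fun \<Omega> \<phi>" "h \<longlonglongrightarrow> 0" "\<And>n. h n \<noteq> 0" "\<And>n. \<bar>h n\<bar> \<le> 1"
 shows "L2lim lebesgue (\<lambda>n. dq (h n) i \<phi>) (pd i \<phi>)"
proof -
 obtain B R where "B \<ge> 0" "\<And>h x. 0 < \<bar>h\<bar> ==> \<bar>h\<bar> \<le> 1 ==> \<bar>dq h i \<phi> x\<bar> \<le> B * indicator (cball 0 R) x"
  using dq_test_bound[OF assms(1)] by metis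
 then show ?thesis using assms
  by (intro L2lim_dominated[where w="\<lambda>x. B * indicator (cball 0 R) x"] sq_indicator)
    (auto intro!: dq_leb dq_test_tendsto test_smooth[OF assms(1)] test_leb[OF assms(1)] test_leb[OF test_pd[OF assms(1)]])
qed

text \<open>Difference quotients have integral zero by translation invariance, and dominated
  convergence passes to the derivative; no iterated integrals are involved.\<close>

lemma integral_pd_0:
 assumes "test_fun \<Omega> \<phi>"
 shows "(LINT x. pd i \<phi> x) = 0"
proof -
 obtain B R where B: "B \<ge> 0" "\<And>h x. 0 < \<bar>h\<bar> ==> \<bar>h\<bar> \<le> 1 ==> \<bar>dq h i \<phi> x\<bar> \<le> B * indicator (cball 0 R) x"
  using dq_test_bound[OF assms(1)] by metis
 define h :: "nat => real" where "h n = 1 / real (Suc n)" for n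
 have h: "h \<longlonglongrightarrow> 0" "h n \<noteq> 0" "\<bar>h n\<bar> \<le> 1" for n
  unfolding h_def using LIMSEQ_inverse_real_of_nat by (auto simp: inverse_eq_divide divide_simps)
 have "(\<lambda>n. LINT x. dq (h n) i \<phi> x) \<longlonglongrightarrow> (LINT x. pd i \<phi> x)"
 proof (rule integral_dominated_convergence[where w="\<lambda>x. B * indicator (cball 0 R) x"])
  show "integrable lebesgue (\<lambda>x. B * indicator (cball 0 R) x)" by (intro integrable_mult_right indicator_integrable) auto
 qed (use B h assms in \<open>auto intro!: dq_leb dq_test_tendsto test_smooth[OF assms(1)] test_leb[OF assms(1)] test_leb[OF test_pd[OF assms(1)]] AE_I2\<close>)
 moreover have "(LINT x. dq (h n) i \<phi> x) = 0" for n
  using integral_shift[OF test_leb[OF assms], of "h n *\<^sub>R axis i 1"] integrable_shift[OF test_integrable[OF assms]]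
   test_integrable[OF assms] by (simp add: dq_def)
 ultimately show ?thesis by (simp add: LIMSEQ_const_iff)
qed

text \<open>Inner and outer regularity of the measure give a compact \<open>K\<close> and an open
  \<open>U\<close> around \<open>E\<close>. A cutoff between them differs from the indicator by at
  most 1, and only on the two small sets \<open>E - K\<close> and \<open>U - E\<close>.\<close>

lemma indicator_approx:
 fixes E :: "(real^'n::finite) set"
 assumes "E \<in> sets lebesgue" "bounded E" "e > 0"
 obtains \<rho> where "test_fun UNIV \<rho>" "\<forall>x. 0 \<le> \<rho> x \<and> \<rho> x \<le> 1" "nrm lebesgue (\<lambda>x. \<rho> x - indicator E x) < e"
proof -
 \<comment> \<open>Two error sets of measure below \<open>d\<close> use up only two thirds of the
   squared tolerance.\<close>
 define d where "d = e\<^sup>2 / 3"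
 have d: "d > 0" using assms by (simp add: d_def)
 obtain K where K: "closed K" "K \<subseteq> E" "E - K \<in> lmeasurable" "emeasure lebesgue (E - K) < ennreal d"
  using sets_lebesgue_inner_closed[OF assms(1) d] by metis
 obtain U where U: "open U" "E \<subseteq> U" "U - E \<in> lmeasurable" "emeasure lebesgue (U - E) < ennreal d"
  using sets_lebesgue_outer_open[OF assms(1) d] by metis
 have cK: "compact K" using K assms(2) bounded_subset by (auto simp: compact_eq_bounded_closed)
 have KU: "K \<subseteq> U" using U K by auto
 obtain \<rho> V where r0: "test_fun U \<rho>" "\<forall>x. 0 \<le> \<rho> x \<and> \<rho> x \<le> 1" "open V" "K \<subseteq> V" "\<forall>x\<in>V. \<rho> x = 1"
  by (rule cutoff[OF cK U(1) KU])
 have r: "test_fun U \<rho>" "\<And>x. 0 \<le> \<rho> x" "\<And>x. \<rho> x \<le> 1" "K \<subseteq> V" "\<And>x. x \<in> V ==> \<rho> x = 1"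
  using r0 by auto
 define S where "S = (E - K) \<union> (U - E)"
 have S: "S \<in> lmeasurable" unfolding S_def using K U by (intro fmeasurable.Un) auto
 have mS: "measure lebesgue S < e\<^sup>2"
 proof -
  have "measure lebesgue (E - K) < d" "measure lebesgue (U - E) < d"
   using K U d by (auto simp: emeasure_eq_measure2 ennreal_less_iff)
  then have "measure lebesgue S \<le> 2 * d"
   using measure_Un_le[of "E - K" lebesgue "U - E"] K U unfolding S_def by auto
  also have "\<dots> < e\<^sup>2" using assms by (simp add: d_def)
  finally show ?thesis .
 qed
 have i: "integrable lebesgue (indicator S :: _ => real)" using S by (auto simp: fmeasurable_def)
 have le: "(norm (\<rho> x - indicator E x))\<^sup>2 \<le> indicator S x" for x
 proof (cases "x \<in> S")
  case True
  have "\<bar>\<rho> x - indicator E x\<bar> \<le> 1" using r(2,3)[of x] by (auto simp: indicator_def)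
  then have "\<bar>\<rho> x - indicator E x\<bar>\<^sup>2 \<le> 1\<^sup>2" by (intro power_mono) auto
  then show ?thesis using True by simp
 next
  case False
  then have "\<rho> x = indicator E x" using r(4,5) test_off[OF r(1), of x] U(2) by (auto simp: S_def indicator_def)
  then show ?thesis by simp
 qed
 have "(nrm lebesgue (\<lambda>x. \<rho> x - indicator E x))\<^sup>2 \<le> (LINT x. indicator S x)"
  unfolding nrm_power2
 proof (rule integral_mono[OF _ i le])
  show "integrable lebesgue (\<lambda>x. (norm (\<rho> x - indicator E x))\<^sup>2)"
   by (rule Bochner_Integration.integrable_bound[OF i])
     (use test_leb[OF r(1)] assms le in \<open>auto intro!: AE_I2 borel_measurable_indicator\<close>)
 qed
 also have "\<dots> < e\<^sup>2" using mS S by (simp add: fmeasurableD)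
 finally have "nrm lebesgue (\<lambda>x. \<rho> x - indicator E x) < e" using assms(3) by (simp add: power_less_imp_less_base)
 then show ?thesis using that[OF test_mono[OF r(1)] r0(2)] by blast
qed

subsection \<open>Weak gradients\<close>

text \<open>The H1 closure of a class \<open>T\<close> of test functions, with the weak gradient as
  an explicit argument. The class is a parameter so that all test functions and the nonnegative ones
  are covered by the same lemmas.\<close>

definition gcl :: "(real^'n::finite => real) set => (real^'n => real) => (real^'n => real^'n) => bool" where
 "gcl T u g \<longleftrightarrow> sq lebesgue u \<and> sq lebesgue g \<and>
   (\<forall>e>0. \<exists>\<phi>\<in>T. nrm lebesgue (\<lambda>x. \<phi> x - u x) < e \<and> nrm lebesgue (\<lambda>x. grad \<phi> x - g x) < e)"

abbreviation tests :: "(real^'n::finite) set => (real^'n => real) set" where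
 "tests \<Omega> \<equiv> Collect (test_fun \<Omega>)"

abbreviation ptests :: "(real^'n::finite) set => (real^'n => real) set" where
 "ptests \<Omega> \<equiv> {\<phi>. test_fun \<Omega> \<phi> \<and> (\<forall>x. 0 \<le> \<phi> x)}"

abbreviation H01 :: "(real^'n::finite) set => (real^'n => real) => (real^'n => real^'n) => bool" where
 "H01 \<Omega> \<equiv> gcl (tests \<Omega>)"

lemma gcl_sq: "gcl T u g ==> sq lebesgue u" "gcl T u g ==> sq lebesgue g"
 by (auto simp: gcl_def)

lemma gcl_leb: "gcl T u g ==> u \<in> borel_measurable lebesgue" "gcl T u g ==> g \<in> borel_measurable lebesgue"
 by (auto simp: gcl_def sq_def)

lemma gcl_seq:
 assumes "gcl T u g" "T \<subseteq> tests \<Omega>"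
 obtains \<phi> where "\<And>n. \<phi> n \<in> T" "\<And>n. test_fun \<Omega> (\<phi> n)" "L2lim lebesgue \<phi> u" "L2lim lebesgue (\<lambda>n. grad (\<phi> n)) g"
proof -
 have "\<forall>n. \<exists>\<phi>. \<phi> \<in> T \<and> nrm lebesgue (\<lambda>x. \<phi> x - u x) < 1 / real (Suc n) \<and> nrm lebesgue (\<lambda>x. grad \<phi> x - g x) < 1 / real (Suc n)"
 proof
  fix n
  show "\<exists>\<phi>. \<phi> \<in> T \<and> nrm lebesgue (\<lambda>x. \<phi> x - u x) < 1 / real (Suc n) \<and> nrm lebesgue (\<lambda>x. grad \<phi> x - g x) < 1 / real (Suc n)"
   using assms(1)[unfolded gcl_def, THEN conjunct2, THEN conjunct2, rule_format, of "1 / real (Suc n)"]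
   unfolding Bex_def by simp
 qed
 from choice[OF this] obtain \<phi> where "\<forall>n. \<phi> n \<in> T \<and> nrm lebesgue (\<lambda>x. \<phi> n x - u x) < 1 / real (Suc n) \<and>
   nrm lebesgue (\<lambda>x. grad (\<phi> n) x - g x) < 1 / real (Suc n)" by (elim exE) (rule that)
 then have \<phi>: "\<And>n. \<phi> n \<in> T" "\<And>n. nrm lebesgue (\<lambda>x. \<phi> n x - u x) < 1 / real (Suc n)"
  "\<And>n. nrm lebesgue (\<lambda>x. grad (\<phi> n) x - g x) < 1 / real (Suc n)" by auto
 have t: "test_fun \<Omega> (\<phi> n)" for n using \<phi>(1)[of n] assms(2) by auto
 have lim: "(\<lambda>n. 1 / real (Suc n)) \<longlonglongrightarrow> 0" using LIMSEQ_inverse_real_of_nat by (simp add: inverse_eq_divide)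
 have "L2lim lebesgue \<phi> u"
  unfolding L2lim_def using gcl_sq[OF assms(1)] test_sq[OF t]
  by (auto simp del: of_nat_Suc intro!: Lim_null_comparison[OF _ lim] always_eventually less_imp_le[OF \<phi>(2)])
 moreover have "L2lim lebesgue (\<lambda>n. grad (\<phi> n)) g"
  unfolding L2lim_def using gcl_sq[OF assms(1)] test_grad_sq[OF t]
  by (auto simp del: of_nat_Suc intro!: Lim_null_comparison[OF _ lim] always_eventually less_imp_le[OF \<phi>(3)])
 ultimately show ?thesis using that[of \<phi>, OF \<phi>(1) t] by blast
qed

lemma gcl_closed:
 assumes "\<And>n. gcl T (us n) (gs n)" "L2lim lebesgue us u" "L2lim lebesgue gs g" "T \<subseteq> tests UNIV"
 shows "gcl T u g"
 unfolding gcl_def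
proof (intro conjI allI impI)
 show "sq lebesgue u" "sq lebesgue g" using assms by (auto simp: L2lim_def)
 fix e :: real assume e: "e > 0"
 have "\<forall>\<^sub>F n in sequentially. nrm lebesgue (\<lambda>x. us n x - u x) < e / 2"
  using assms(2) e by (intro order_tendstoD(2)[of _ 0]) (auto simp: L2lim_def)
 moreover have "\<forall>\<^sub>F n in sequentially. nrm lebesgue (\<lambda>x. gs n x - g x) < e / 2"
  using assms(3) e by (intro order_tendstoD(2)[of _ 0]) (auto simp: L2lim_def)
 ultimately have "\<forall>\<^sub>F n in sequentially. nrm lebesgue (\<lambda>x. us n x - u x) < e / 2 \<and> nrm lebesgue (\<lambda>x. gs n x - g x) < e / 2"
  by eventually_elim simp
 then obtain n where n: "nrm lebesgue (\<lambda>x. us n x - u x) < e / 2" "nrm lebesgue (\<lambda>x. gs n x - g x) < e / 2"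
  using eventually_happens' by force
 obtain \<phi> where \<phi>: "\<phi> \<in> T" "nrm lebesgue (\<lambda>x. \<phi> x - us n x) < e / 2" "nrm lebesgue (\<lambda>x. grad \<phi> x - gs n x) < e / 2"
  using assms(1)[of n] e unfolding gcl_def by (meson half_gt_zero)
 have t: "test_fun UNIV \<phi>" using \<phi> assms(4) by auto
 have "nrm lebesgue (\<lambda>x. \<phi> x - u x) < e"
  using nrm_triangle_diff[OF test_sq[OF t] gcl_sq(1)[OF assms(1)[of n]], of u] \<phi>(2) n(1) assms(2) by (auto simp: L2lim_def)
 moreover have "nrm lebesgue (\<lambda>x. grad \<phi> x - g x) < e"
  using nrm_triangle_diff[OF test_grad_sq[OF t] gcl_sq(2)[OF assms(1)[of n]], of g] \<phi>(3) n(2) assms(3) by (auto simp: L2lim_def)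
 ultimately show "\<exists>\<phi>\<in>T. nrm lebesgue (\<lambda>x. \<phi> x - u x) < e \<and> nrm lebesgue (\<lambda>x. grad \<phi> x - g x) < e"
  using \<phi>(1) by blast
qed

lemma gcl_in: "\<phi> \<in> T ==> T \<subseteq> tests UNIV ==> gcl T \<phi> (grad \<phi>)"
 unfolding gcl_def by (auto intro!: test_sq test_grad_sq bexI[of _ \<phi>])

lemma gcl_I:
 assumes "\<And>n. \<phi> n \<in> T" "L2lim lebesgue \<phi> u" "L2lim lebesgue (\<lambda>n. grad (\<phi> n)) g" "T \<subseteq> tests UNIV"
 shows "gcl T u g"
 by (rule gcl_closed[OF gcl_in assms(2,3,4)]) (use assms in auto)

lemma tests_UNIV: "tests \<Omega> \<subseteq> tests UNIV" "ptests \<Omega> \<subseteq> tests UNIV"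
 by (auto intro: test_mono)

lemma gcl_mono: "gcl T u g ==> T \<subseteq> T' ==> gcl T' u g"
 unfolding gcl_def by blast

lemma H01_UNIV: "H01 \<Omega> u g ==> H01 UNIV u g"
 by (rule gcl_mono[OF _ tests_UNIV(1)])

lemma H01_test: "test_fun \<Omega> \<phi> ==> H01 \<Omega> \<phi> (grad \<phi>)"
 by (rule gcl_in) (auto intro: test_mono)

lemma gcl_cong_AE:
 assumes "gcl T u g" "u' \<in> borel_measurable lebesgue" "g' \<in> borel_measurable lebesgue"
  "AE x in lebesgue. u x = u' x" "AE x in lebesgue. g x = g' x" "T \<subseteq> tests UNIV"
 shows "gcl T u' g'"
proof -
 obtain \<phi> where \<phi>: "\<And>n. \<phi> n \<in> T" "\<And>n. test_fun UNIV (\<phi> n)" "L2lim lebesgue \<phi> u" "L2lim lebesgue (\<lambda>n. grad (\<phi> n)) g"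
  using gcl_seq[OF assms(1,6)] by metis
 have "nrm lebesgue (\<lambda>x. \<phi> n x - u' x) = nrm lebesgue (\<lambda>x. \<phi> n x - u x)" for n
  using assms gcl_leb[OF assms(1)] test_leb[OF \<phi>(2)] by (intro nrm_cong_AE) auto
 moreover have "nrm lebesgue (\<lambda>x. grad (\<phi> n) x - g' x) = nrm lebesgue (\<lambda>x. grad (\<phi> n) x - g x)" for n
  using assms gcl_leb[OF assms(1)] test_grad_leb[OF \<phi>(2)] by (intro nrm_cong_AE) auto
 moreover have "sq lebesgue u'" "sq lebesgue g'"
  using sq_cong_AE[OF gcl_sq(1)[OF assms(1)] assms(2,4)] sq_cong_AE[OF gcl_sq(2)[OF assms(1)] assms(3,5)] by auto
 ultimately have "L2lim lebesgue \<phi> u'" "L2lim lebesgue (\<lambda>n. grad (\<phi> n)) g'"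
  using \<phi>(3,4) by (auto simp: L2lim_def)
 then show ?thesis using \<phi>(1) assms(6) by (intro gcl_I)
qed

lemma H01_add:
 assumes "H01 \<Omega> u g" "H01 \<Omega> v h" shows "H01 \<Omega> (\<lambda>x. u x + v x) (\<lambda>x. g x + h x)"
proof -
 obtain \<phi> where \<phi>: "\<And>n. test_fun \<Omega> (\<phi> n)" "L2lim lebesgue \<phi> u" "L2lim lebesgue (\<lambda>n. grad (\<phi> n)) g"
  using gcl_seq[OF assms(1)] by (metis order_refl)
 obtain \<psi> where \<psi>: "\<And>n. test_fun \<Omega> (\<psi> n)" "L2lim lebesgue \<psi> v" "L2lim lebesgue (\<lambda>n. grad (\<psi> n)) h"
  using gcl_seq[OF assms(2)] by (metis order_refl)
 have "(\<lambda>n. grad (\<lambda>x. \<phi> n x + \<psi> n x)) = (\<lambda>n x. grad (\<phi> n) x + grad (\<psi> n) x)"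
  by (auto simp: fun_eq_iff grad_add[OF test_smooth[OF \<phi>(1)] test_smooth[OF \<psi>(1)]])
 then show ?thesis using L2lim_add[OF \<phi>(2) \<psi>(2)] L2lim_add[OF \<phi>(3) \<psi>(3)] \<phi>(1) \<psi>(1)
  by (intro gcl_I[where \<phi>="\<lambda>n x. \<phi> n x + \<psi> n x"] tests_UNIV) (auto intro: test_add)
qed

lemma H01_cmult:
 assumes "H01 \<Omega> u g" shows "H01 \<Omega> (\<lambda>x. c * u x) (\<lambda>x. c *\<^sub>R g x)"
proof -
 obtain \<phi> where \<phi>: "\<And>n. test_fun \<Omega> (\<phi> n)" "L2lim lebesgue \<phi> u" "L2lim lebesgue (\<lambda>n. grad (\<phi> n)) g"
  using gcl_seq[OF assms(1)] by (metis order_refl)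
 have "(\<lambda>n. grad (\<lambda>x. c * \<phi> n x)) = (\<lambda>n x. c *\<^sub>R grad (\<phi> n) x)"
  by (auto simp: fun_eq_iff grad_cmult[OF test_smooth[OF \<phi>(1)]])
 then show ?thesis using L2lim_scale[OF \<phi>(2), of c] L2lim_scale[OF \<phi>(3), of c] \<phi>(1)
  by (intro gcl_I[where \<phi>="\<lambda>n x. c * \<phi> n x"] tests_UNIV) (auto intro: test_cmult)
qed

lemma H01_diff:
 assumes "H01 \<Omega> u g" "H01 \<Omega> v h" shows "H01 \<Omega> (\<lambda>x. u x - v x) (\<lambda>x. g x - h x)"
 using H01_add[OF assms(1) H01_cmult[OF assms(2), of "-1"]] by simp

lemma H01_off:
 assumes "H01 \<Omega> u g" shows "AE x in lebesgue. x \<notin> \<Omega> --> u x = 0 \<and> g x = 0"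
proof -
 obtain \<phi> where \<phi>: "\<And>n. test_fun \<Omega> (\<phi> n)" "L2lim lebesgue \<phi> u" "L2lim lebesgue (\<lambda>n. grad (\<phi> n)) g"
  using gcl_seq[OF assms(1)] by (metis order_refl)
 obtain r where "strict_mono r" and r: "AE x in lebesgue. (\<lambda>n. \<phi> (r n) x) \<longlonglongrightarrow> u x"
  by (rule L2lim_AE_subseq[OF \<phi>(2)])
 obtain r' where "strict_mono r'" and r': "AE x in lebesgue. (\<lambda>n. grad (\<phi> (r' n)) x) \<longlonglongrightarrow> g x"
  by (rule L2lim_AE_subseq[OF \<phi>(3)])
 from r r' show ?thesis
 proof eventually_elim
  case (elim x)
  show ?case using elim test_off[OF \<phi>(1)] test_grad_off[OF \<phi>(1)] by (auto simp: LIMSEQ_const_iff)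
 qed
qed

lemma H01_ibp:
 assumes "H01 UNIV u g" "test_fun UNIV \<psi>"
 shows "(LINT x. (g x $ i) * \<psi> x) = - (LINT x. u x * pd i \<psi> x)"
proof -
 obtain \<phi> where \<phi>: "\<And>n. test_fun UNIV (\<phi> n)" "L2lim lebesgue \<phi> u" "L2lim lebesgue (\<lambda>n. grad (\<phi> n)) g"
  using gcl_seq[OF assms(1)] by (metis order_refl)
 have sqax: "sq lebesgue (\<lambda>x. \<psi> x *\<^sub>R axis i (1::real))"
  by (rule sq_bound[OF test_sq[OF assms(2)]]) (use test_leb[OF assms(2)] in auto)
 have eq: "(LINT x. grad (\<phi> n) x \<bullet> (\<psi> x *\<^sub>R axis i 1)) = - (LINT x. \<phi> n x \<bullet> pd i \<psi> x)" for n
 proof -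
  have t: "test_fun UNIV (\<lambda>x. \<phi> n x * \<psi> x)" by (intro test_mult \<phi> test_smooth[OF assms(2)])
  have p: "pd i (\<lambda>x. \<phi> n x * \<psi> x) = (\<lambda>x. pd i (\<phi> n) x * \<psi> x + pd i \<psi> x * \<phi> n x)"
   by (intro pdiff_pd pdiff_mult smooth_pdiff test_smooth[OF \<phi>(1)] test_smooth[OF assms(2)])
  have i1: "integrable lebesgue (\<lambda>x. pd i (\<phi> n) x * \<psi> x)"
   by (intro test_integrable[of UNIV] test_mult test_pd \<phi> test_smooth[OF assms(2)])
  have i2: "integrable lebesgue (\<lambda>x. pd i \<psi> x * \<phi> n x)"
   by (intro test_integrable[of UNIV] test_mult test_pd assms(2) test_smooth[OF \<phi>(1)])
  have "(LINT x. pd i (\<phi> n) x * \<psi> x) + (LINT x. pd i \<psi> x * \<phi> n x) = 0"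
   using integral_pd_0[OF t, of i] i1 i2 unfolding p by simp
  then show ?thesis by (simp add: inner_axis grad_nth mult.commute)
 qed
 have "(\<lambda>n. LINT x. grad (\<phi> n) x \<bullet> (\<psi> x *\<^sub>R axis i 1)) \<longlonglongrightarrow> (LINT x. g x \<bullet> (\<psi> x *\<^sub>R axis i 1))"
  by (intro L2lim_inner \<phi> L2lim_const sqax)
 moreover have "(\<lambda>n. - (LINT x. \<phi> n x \<bullet> pd i \<psi> x)) \<longlonglongrightarrow> - (LINT x. u x \<bullet> pd i \<psi> x)"
  by (intro tendsto_minus L2lim_inner \<phi> L2lim_const test_sq[of UNIV] test_pd assms)
 ultimately have "(LINT x. g x \<bullet> (\<psi> x *\<^sub>R axis i 1)) = - (LINT x. u x \<bullet> pd i \<psi> x)"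
  unfolding eq by (rule LIMSEQ_unique)
 then show ?thesis by (simp add: inner_axis mult.commute)
qed

text \<open>Indicators of bounded sets are L2 limits of test functions, so \<open>d\<close> has
  integral zero over every bounded part of the sets where it is positive or negative.\<close>

lemma ae_zero_if_orthogonal:
 fixes d :: "real^'n::finite => real"
 assumes d: "sq lebesgue d" and 0: "\<And>\<psi>. test_fun UNIV \<psi> ==> (LINT x. d x * \<psi> x) = 0"
 shows "AE x in lebesgue. d x = 0"
proof -
 have E0: "(LINT x. d x * indicator E x) = 0" if E: "E \<in> sets lebesgue" "bounded E" for E
 proof -
  have sqE: "sq lebesgue (indicator E :: _ => real)" using sq_indicator[OF E, of 1] by simp
  have "\<bar>LINT x. d x * indicator E x\<bar> \<le> e" if "e > 0" for e
  proof -
   define e' where "e' = e / (nrm lebesgue d + 1)"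
   have e': "e' > 0" "nrm lebesgue d * e' \<le> e" using \<open>e > 0\<close> nrm_nonneg[of lebesgue d]
    by (auto simp: e'_def field_simps add_pos_nonneg add_nonneg_pos)
   obtain \<rho> where r: "test_fun UNIV \<rho>" "\<forall>x. 0 \<le> \<rho> x \<and> \<rho> x \<le> 1" "nrm lebesgue (\<lambda>x. \<rho> x - indicator E x) < e'"
    by (rule indicator_approx[OF E e'(1)])
   have "\<bar>LINT x. d x * (\<rho> x - indicator E x)\<bar> \<le> nrm lebesgue d * nrm lebesgue (\<lambda>x. \<rho> x - indicator E x)"
    using CS[OF d sq_diff[OF test_sq[OF r(1)] sqE]] by simp
   also have "\<dots> \<le> nrm lebesgue d * e'" using r by (intro mult_left_mono) auto
   finally have "\<bar>LINT x. d x * (\<rho> x - indicator E x)\<bar> \<le> e" using e'(2) by linarith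
   moreover have "(LINT x. d x * (\<rho> x - indicator E x)) = 0 - (LINT x. d x * indicator E x)"
    unfolding right_diff_distrib
    using Bochner_Integration.integral_diff[OF sq_mult[OF d test_sq[OF r(1)]] sq_mult[OF d sqE]] 0[OF r(1)] by simp
   ultimately show ?thesis by simp
  qed
  from dense_ge[of 0, OF this] have "\<bar>LINT x. d x * indicator E x\<bar> \<le> 0" .
  then show ?thesis unfolding abs_le_zero_iff .
 qed
 have [measurable]: "d \<in> borel_measurable lebesgue" using d by (simp add: sq_def)
 have *: "AE x in lebesgue. \<not> (s * d x > 0 \<and> x \<in> cball 0 (real k))" if "s = 1 \<or> s = -1" for k s
 proof -
  define E where "E = {x. s * d x > 0} \<inter> cball 0 (real k)"
  have "{x \<in> space lebesgue. s * d x > 0} \<in> sets lebesgue" by measurable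
  then have mE: "E \<in> sets lebesgue" unfolding E_def by (intro sets.Int) auto
  have bE: "bounded E" unfolding E_def by (simp add: bounded_Int)
  have sqE: "sq lebesgue (indicator E :: _ => real)" using sq_indicator[OF mE bE, of 1] by simp
  have i: "integrable lebesgue (\<lambda>x. s * (d x * indicator E x))" using sq_mult[OF d sqE] by simp
  have "(LINT x. s * (d x * indicator E x)) = 0" using E0[OF mE bE] by simp
  moreover have "AE x in lebesgue. 0 \<le> s * (d x * indicator E x)" by (auto simp: E_def indicator_def)
  ultimately have "AE x in lebesgue. s * (d x * indicator E x) = 0"
   using integral_nonneg_eq_0_iff_AE[OF i] by simp
  then show ?thesis by eventually_elim (auto simp: E_def indicator_def)
 qed
 have "AE x in lebesgue. \<forall>k::nat. \<not> (1 * d x > 0 \<and> x \<in> cball 0 (real k)) \<and> \<not> (-1 * d x > 0 \<and> x \<in> cball 0 (real k))"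
  unfolding AE_all_countable using *[of 1] *[of "-1"] by (auto intro: AE_conjI)
 then show ?thesis
 proof eventually_elim
  case (elim x)
  obtain k :: nat where "norm x \<le> real k" using real_arch_simple by blast
  then show ?case using elim[rule_format, of k] by auto
 qed
qed

lemma sq_nth:
 fixes g :: "'a => real^'n::finite"
 shows "sq M g ==> sq M (\<lambda>x. g x $ i)" and "sq M g ==> nrm M (\<lambda>x. g x $ i) \<le> nrm M g"
proof -
 assume g: "sq M g"
 have m: "(\<lambda>x. g x $ i) \<in> borel_measurable M" using g by (auto simp: sq_def cart_eq_inner_axis intro!: borel_measurable_inner)
 have a: "AE x in M. norm (g x $ i) \<le> norm (g x)" using component_le_norm_cart by auto
 show "sq M (\<lambda>x. g x $ i)" "nrm M (\<lambda>x. g x $ i) \<le> nrm M g"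
  using sq_bound[OF g m a] nrm_mono[OF g m a] by auto
qed

text \<open>Both gradients satisfy the same integration by parts, so their difference is orthogonal
  to all test functions. Later this identifies gradients that come from different
  constructions.\<close>

lemma H01_grad_unique:
 assumes "H01 UNIV u g" "H01 UNIV u g'" shows "AE x in lebesgue. g x = g' x"
proof -
 have "AE x in lebesgue. g x $ i - g' x $ i = 0" for i
 proof (rule ae_zero_if_orthogonal)
  note c = sq_nth(1)
  show "sq lebesgue (\<lambda>x. g x $ i - g' x $ i)" using assms by (intro sq_diff c) (auto dest: gcl_sq)
  fix \<psi> :: "real^'a => real" assume t: "test_fun UNIV \<psi>"
  have "integrable lebesgue (\<lambda>x. g x $ i * \<psi> x)" "integrable lebesgue (\<lambda>x. g' x $ i * \<psi> x)"
   using assms t by (auto intro!: sq_mult c test_sq[of UNIV \<psi>] dest: gcl_sq)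
  then show "(LINT x. (g x $ i - g' x $ i) * \<psi> x) = 0"
   using H01_ibp[OF assms(1) t, of i] H01_ibp[OF assms(2) t, of i] by (simp add: left_diff_distrib)
 qed
 then have "AE x in lebesgue. \<forall>i. g x $ i - g' x $ i = 0" by (simp add: AE_all_countable)
 then show ?thesis by eventually_elim (simp add: vec_eq_iff)
qed

section \<open>Chain rule, absolute value and positive part\<close>

lemma L2lim_lipschitz:
 assumes "L2lim lebesgue fs (u :: 'a::euclidean_space => real)" "\<And>s t. \<bar>S s - S t\<bar> \<le> L * \<bar>s - t\<bar>" "S 0 = 0" "continuous_on UNIV S"
 shows "L2lim lebesgue (\<lambda>n x. S (fs n x)) (\<lambda>x. S (u x))"
proof -
 note sq = L2lim_sq[OF assms(1)]
 have L: "L \<ge> 0" using assms(2)[of 1 0] by simp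
 have m: "(\<lambda>x. S (v x)) \<in> borel_measurable lebesgue" if "v \<in> borel_measurable lebesgue" for v :: "'a => real"
  by (rule comp_leb[OF borel_measurable_continuous_onI[OF assms(4)] that])
 have s: "sq lebesgue (\<lambda>x. S (v x))" if "sq lebesgue v" for v :: "'a => real"
  by (rule sq_bound[OF sq_cmult[OF that, of L]])
    (use that m L assms(2)[of _ 0] assms(3) in \<open>auto simp: sq_def abs_mult\<close>)
 have lim: "(\<lambda>n. L * nrm lebesgue (\<lambda>x. fs n x - u x)) \<longlonglongrightarrow> 0"
  using assms(1) by (auto simp: L2lim_def intro!: tendsto_mult_right_zero)
 have "nrm lebesgue (\<lambda>x. S (fs n x) - S (u x)) \<le> L * nrm lebesgue (\<lambda>x. fs n x - u x)" for n
 proof -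
  have "nrm lebesgue (\<lambda>x. S (fs n x) - S (u x)) \<le> nrm lebesgue (\<lambda>x. L * (fs n x - u x))"
  proof (rule nrm_mono[OF sq_cmult[OF sq_diff[OF sq(1) sq(2)]]])
   show "(\<lambda>x. S (fs n x) - S (u x)) \<in> borel_measurable lebesgue"
    using sq by (intro borel_measurable_diff m) (auto simp: sq_def)
  qed (use L assms(2) in \<open>auto simp: abs_mult\<close>)
  then show ?thesis using L by (simp add: nrm_cmult)
 qed
 then show ?thesis unfolding L2lim_def
  by (auto intro!: s sq Lim_null_comparison[OF _ lim] always_eventually)
qed

text \<open>\<open>S'\<close> is merely continuous and bounded, so its composition converges only
  pointwise along a subsequence, which bounded scaling tolerates. \<open>T\<close> and
  \<open>T'\<close> may differ because the outer function can improve the class, for instance make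
  test functions nonnegative.\<close>

lemma gcl_chain:
 assumes "gcl T u g" "T \<subseteq> tests UNIV" "T' \<subseteq> tests UNIV"
  "\<And>\<phi>. \<phi> \<in> T ==> (\<lambda>x. S (\<phi> x)) \<in> T'" "S 0 = 0"
  "\<And>t. (S has_real_derivative S' t) (at t)" "continuous_on UNIV S'" "\<And>t. \<bar>S' t\<bar> \<le> L"
 shows "gcl T' (\<lambda>x. S (u x)) (\<lambda>x. S' (u x) *\<^sub>R g x)"
proof -
 obtain \<phi>0 where \<phi>0: "\<And>n. \<phi>0 n \<in> T" "L2lim lebesgue \<phi>0 u" "L2lim lebesgue (\<lambda>n. grad (\<phi>0 n)) g"
  using gcl_seq[OF assms(1,2)] by metis
 obtain r where r: "strict_mono r" "AE x in lebesgue. (\<lambda>n. \<phi>0 (r n) x) \<longlonglongrightarrow> u x"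
  by (rule L2lim_AE_subseq[OF \<phi>0(2)])
 define \<phi> where "\<phi> n = \<phi>0 (r n)" for n
 have \<phi>: "\<phi> n \<in> T" "test_fun UNIV (\<phi> n)" "L2lim lebesgue \<phi> u" "L2lim lebesgue (\<lambda>n. grad (\<phi> n)) g"
  "AE x in lebesgue. (\<lambda>n. \<phi> n x) \<longlonglongrightarrow> u x" for n
  using \<phi>0 r L2lim_subseq[OF \<phi>0(2) r(1)] L2lim_subseq[OF \<phi>0(3) r(1)] assms(2) unfolding \<phi>_def[abs_def] by auto
 have mS': "S' \<in> borel_measurable borel" using assms(7) by (rule borel_measurable_continuous_onI)
 have lip: "\<bar>S s - S t\<bar> \<le> L * \<bar>s - t\<bar>" for s t
  using field_differentiable_bound[of UNIV S S' L s t] assms(6,8) by simp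
 have contS: "continuous_on UNIV S" using assms(6) by (auto intro: DERIV_isCont continuous_at_imp_continuous_on)
 have 1: "L2lim lebesgue (\<lambda>n x. S (\<phi> n x)) (\<lambda>x. S (u x))"
  by (rule L2lim_lipschitz[OF \<phi>(3) lip assms(5) contS])
 have 2: "L2lim lebesgue (\<lambda>n x. S' (\<phi> n x) *\<^sub>R grad (\<phi> n) x) (\<lambda>x. S' (u x) *\<^sub>R g x)"
 proof (rule L2lim_bounded_scale[OF \<phi>(4)])
  show "AE x in lebesgue. (\<lambda>n. S' (\<phi> n x)) \<longlonglongrightarrow> S' (u x)"
   using \<phi>(5) by eventually_elim (auto intro: continuous_on_tendsto_compose[OF assms(7)])
  show "AE x in lebesgue. \<bar>S' (\<phi> n x)\<bar> \<le> L" for n using assms(8) by simp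
 qed (auto intro!: comp_leb[OF mS'] test_leb[OF \<phi>(2)] gcl_leb[OF assms(1)])
 have 3: "grad (\<lambda>x. S (\<phi> n x)) = (\<lambda>x. S' (\<phi> n x) *\<^sub>R grad (\<phi> n) x)" for n
  using grad_comp[OF test_smooth[OF \<phi>(2)] assms(6)] by (simp add: fun_eq_iff)
 show ?thesis by (rule gcl_I[where \<phi>="\<lambda>n x. S (\<phi> n x)"]) (use 1 2 3 assms \<phi> in auto)
qed

text \<open>For outer functions with corners: \<open>R'\<close> is only the pointwise limit of the
  derivatives, such as \<open>sgn\<close> for the absolute value, and need not be a derivative of
  \<open>R\<close> everywhere.\<close>

lemma gcl_chain_lim:
 fixes S :: "nat => real => real"
 assumes "\<And>n. gcl T (\<lambda>x. S n (u x)) (\<lambda>x. S' n (u x) *\<^sub>R g x)" "sq lebesgue u" "sq lebesgue g" "T \<subseteq> tests UNIV"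
  "\<And>n t. \<bar>S n t\<bar> \<le> L * \<bar>t\<bar>" "\<And>n t. \<bar>S' n t\<bar> \<le> L"
  "\<And>t. (\<lambda>n. S n t) \<longlonglongrightarrow> R t" "\<And>t. (\<lambda>n. S' n t) \<longlonglongrightarrow> R' t"
  "\<And>n. S n \<in> borel_measurable borel" "\<And>n. S' n \<in> borel_measurable borel"
 shows "gcl T (\<lambda>x. R (u x)) (\<lambda>x. R' (u x) *\<^sub>R g x)"
proof -
 have m: "R \<in> borel_measurable borel" "R' \<in> borel_measurable borel"
  using assms by (auto intro: borel_measurable_LIMSEQ_real[where u=S] borel_measurable_LIMSEQ_real[where u=S'])
 have u: "u \<in> borel_measurable lebesgue" using assms(2) by (simp add: sq_def)
 have L: "L \<ge> 0" using assms(6)[of 0 0] by linarith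
 show ?thesis
 proof (rule gcl_closed[OF assms(1) _ _ assms(4)])
  show "L2lim lebesgue (\<lambda>n x. S n (u x)) (\<lambda>x. R (u x))"
   by (rule L2lim_dominated[where w="\<lambda>x. L * norm (u x)"])
     (use assms u m in \<open>auto intro!: sq_cmult sq_norm[where f=u, simplified] comp_leb\<close>)
  show "L2lim lebesgue (\<lambda>n x. S' n (u x) *\<^sub>R g x) (\<lambda>x. R' (u x) *\<^sub>R g x)"
   by (rule L2lim_bounded_scale[OF L2lim_const[OF assms(3)], where C=L])
     (use assms u m in \<open>auto intro!: comp_leb\<close>)
 qed
qed

lemma test_comp:
 assumes "test_fun \<Omega> \<phi>" "smooth_fun (\<lambda>x. S (\<phi> x))" "S 0 = (0::real)" shows "test_fun \<Omega> (\<lambda>x. S (\<phi> x))"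
 using assms unfolding test_fun_def by metis

text \<open>A smooth approximation of the absolute value; subtracting \<open>e\<close> makes it
  vanish at 0, so that compositions keep compact support.\<close>

definition sabs :: "real => real => real" where "sabs e t = (t\<^sup>2 + e\<^sup>2) powr (1/2) - e"

lemma smooth_sabs: "smooth_fun \<phi> ==> e > 0 ==> smooth_fun (\<lambda>x. sabs e (\<phi> x))"
 unfolding sabs_def power2_eq_square
 by (intro smooth_diff smooth_powr smooth_add smooth_mult smooth_const) (auto intro: add_nonneg_pos)

lemma powr_minus_half: "x > 0 ==> x powr (-1/2) = 1 / sqrt (x::real)"
 by (simp add: powr_minus_divide powr_half_sqrt flip: minus_divide_left)

lemma sabs_deriv: "e > 0 ==> (sabs e has_real_derivative t * (t\<^sup>2 + e\<^sup>2) powr (-1/2)) (at t)"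
 unfolding sabs_def[abs_def]
proof -
 assume e: "e > 0"
 have p: "t\<^sup>2 + e\<^sup>2 > 0" using zero_le_power2[of t] zero_less_power[OF e, of 2] by linarith
 have "((\<lambda>t. t\<^sup>2 + e\<^sup>2) has_real_derivative 2 * t) (at t)" by (auto intro!: derivative_eq_intros)
 from DERIV_powr[OF this p DERIV_const, of "1/2"] 
 show "((\<lambda>t. (t\<^sup>2 + e\<^sup>2) powr (1/2) - e) has_real_derivative t * (t\<^sup>2 + e\<^sup>2) powr (-1/2)) (at t)"
  using p by (auto intro!: derivative_eq_intros simp: powr_diff powr_minus powr_half_sqrt field_simps real_sqrt_divide)
qed

lemma sabs_deriv_bound:
 fixes e t :: real
 shows "e > 0 ==> \<bar>t * (t\<^sup>2 + e\<^sup>2) powr (-1/2)\<bar> \<le> 1"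
proof -
 assume e: "e > 0"
 have p: "t\<^sup>2 + e\<^sup>2 > 0" using zero_le_power2[of t] zero_less_power[OF e, of 2] by linarith
 have "\<bar>t\<bar> \<le> sqrt (t\<^sup>2 + e\<^sup>2)" by (rule real_le_rsqrt) simp
 then show ?thesis using p
  unfolding powr_minus_half[OF p] by (simp add: abs_mult abs_divide)
qed

lemma sabs_nonneg: "e > 0 ==> 0 \<le> sabs e t"
proof -
 assume "e > 0"
 have "e \<le> sqrt (t\<^sup>2 + e\<^sup>2)" by (rule real_le_rsqrt) simp
 then show ?thesis using \<open>e > 0\<close> by (simp add: sabs_def powr_half_sqrt add_nonneg_nonneg)
qed

text \<open>Since \<open>sabs\<close> is nonnegative, the approximating test functions are too. This
  is what allows inequalities to be tested with arbitrary nonnegative functions.\<close>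

lemma gcl_abs:
 assumes "H01 \<Omega> u g"
 shows "gcl (ptests \<Omega>) (\<lambda>x. \<bar>u x\<bar>) (\<lambda>x. sgn (u x) *\<^sub>R g x)"
proof -
 define e :: "nat => real" where "e n = 1 / real (Suc n)" for n
 have e: "e n > 0" for n by (simp add: e_def)
 have elim: "e \<longlonglongrightarrow> 0" unfolding e_def using LIMSEQ_inverse_real_of_nat by (simp add: inverse_eq_divide)
 have p: "t\<^sup>2 + (e n)\<^sup>2 > 0" for t n by (intro add_nonneg_pos zero_le_power2 zero_less_power e)
 have c': "continuous_on UNIV (\<lambda>t. t * (t\<^sup>2 + (e n)\<^sup>2) powr (-1/2))" for n
  by (intro continuous_intros) (metis p less_irrefl)
 have chain: "gcl (ptests \<Omega>) (\<lambda>x. sabs (e n) (u x)) (\<lambda>x. (u x * ((u x)\<^sup>2 + (e n)\<^sup>2) powr (-1/2)) *\<^sub>R g x)" for n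
 proof -
  have z: "sabs (e n) 0 = 0" using e[of n] by (simp add: sabs_def powr_half_sqrt)
  have mem: "(\<lambda>x. sabs (e n) (\<phi> x)) \<in> ptests \<Omega>" if "\<phi> \<in> tests \<Omega>" for \<phi>
  proof -
   have t: "test_fun \<Omega> \<phi>" using that by simp
   have "test_fun \<Omega> (\<lambda>x. sabs (e n) (\<phi> x))" by (rule test_comp[OF t smooth_sabs[OF test_smooth[OF t] e] z])
   then show ?thesis using sabs_nonneg[OF e] by simp
  qed
  show ?thesis
   by (rule gcl_chain[OF assms tests_UNIV mem z sabs_deriv[OF e] c' sabs_deriv_bound[OF e]])
 qed
 have lip: "\<bar>sabs (e n) t\<bar> \<le> 1 * \<bar>t\<bar>" for n t
  using field_differentiable_bound[of UNIV "sabs (e n)" "\<lambda>t. t * (t\<^sup>2 + (e n)\<^sup>2) powr (-1/2)" 1 t 0]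
   sabs_deriv[OF e] sabs_deriv_bound[OF e] e[of n] by (simp add: sabs_def powr_half_sqrt)
 show ?thesis
 proof (rule gcl_chain_lim[OF chain gcl_sq[OF assms] tests_UNIV(2) lip, where R="\<lambda>t. \<bar>t\<bar>" and R'="sgn"])
  show "\<bar>t * (t\<^sup>2 + (e n)\<^sup>2) powr (-1/2)\<bar> \<le> 1" for n t using sabs_deriv_bound[OF e] .
  show "(\<lambda>n. sabs (e n) t) \<longlonglongrightarrow> \<bar>t\<bar>" for t
  proof -
   have "(\<lambda>n. sqrt (t\<^sup>2 + (e n)\<^sup>2) - e n) \<longlonglongrightarrow> sqrt (t\<^sup>2 + 0\<^sup>2) - 0" by (intro tendsto_intros elim)
   then show ?thesis by (simp add: sabs_def powr_half_sqrt add_nonneg_nonneg)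
  qed
  show "(\<lambda>n. t * (t\<^sup>2 + (e n)\<^sup>2) powr (-1/2)) \<longlonglongrightarrow> sgn t" for t
  proof (cases "t = 0")
   case False
   have "(\<lambda>n. t / sqrt (t\<^sup>2 + (e n)\<^sup>2)) \<longlonglongrightarrow> t / sqrt (t\<^sup>2 + 0\<^sup>2)" using False by (intro tendsto_intros elim) auto
   then show ?thesis using False
    by (simp only: powr_minus_half[OF p]) (cases "t > 0"; simp add: sgn_if)
  qed simp
  show "sabs (e n) \<in> borel_measurable borel" for n unfolding sabs_def[abs_def] by measurable
  show "(\<lambda>t. t * (t\<^sup>2 + (e n)\<^sup>2) powr (-1/2)) \<in> borel_measurable borel" for n by measurable
 qed
qed

lemma H01_abs: "H01 \<Omega> u g ==> H01 \<Omega> (\<lambda>x. \<bar>u x\<bar>) (\<lambda>x. sgn (u x) *\<^sub>R g x)"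
 by (rule gcl_mono[OF gcl_abs]) auto

text \<open>A nonnegative \<open>u\<close> equals its absolute value, to which
  \<open>gcl_abs\<close> applies. Uniqueness of the gradient turns
  \<open>sgn (u x) *\<^sub>R g x\<close> into \<open>g x\<close>, which contains the fact that the
  gradient vanishes almost everywhere on {u = 0}.\<close>

lemma H01_nonneg:
 assumes "H01 \<Omega> u g" "AE x in lebesgue. 0 \<le> u x"
 shows "gcl (ptests \<Omega>) u g"
proof -
 have "AE x in lebesgue. sgn (u x) *\<^sub>R g x = g x"
 proof -
  have "H01 UNIV u (\<lambda>x. sgn (u x) *\<^sub>R g x)"
   by (rule gcl_cong_AE[OF H01_UNIV[OF H01_abs[OF assms(1)]]])
     (use assms gcl_leb[OF H01_abs[OF assms(1)]] gcl_leb[OF assms(1)] in auto)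
  then show ?thesis using H01_grad_unique[OF _ H01_UNIV[OF assms(1)]] by blast
 qed
 then show ?thesis
  by (intro gcl_cong_AE[OF gcl_abs[OF assms(1)]] tests_UNIV gcl_leb[OF assms(1)]) (use assms(2) in auto)
qed

text \<open>The Heaviside function with value 1/2 at 0, which is what averaging the absolute value
  and the identity produces. Subsequent estimates need only that its values lie in [0, 1].\<close>

definition hs :: "real => real" where "hs t = (sgn t + 1) / 2"

lemma hs_range: "0 \<le> hs t" "hs t \<le> 1"
 by (auto simp: hs_def sgn_if)

lemma H01_pos:
 assumes "H01 \<Omega> u g" shows "H01 \<Omega> (\<lambda>x. max 0 (u x)) (\<lambda>x. hs (u x) *\<^sub>R g x)"
proof -
 have "H01 \<Omega> (\<lambda>x. (1/2) * (\<bar>u x\<bar> + u x)) (\<lambda>x. (1/2) *\<^sub>R (sgn (u x) *\<^sub>R g x + g x))"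
  by (intro H01_cmult H01_add H01_abs assms)
 moreover have "(\<lambda>x. (1/2) * (\<bar>u x\<bar> + u x)) = (\<lambda>x. max 0 (u x))" by (auto simp: fun_eq_iff)
 moreover have "(\<lambda>x. (1/2) *\<^sub>R (sgn (u x) *\<^sub>R g x + g x)) = (\<lambda>x. hs (u x) *\<^sub>R g x)"
  by (auto simp: fun_eq_iff hs_def algebra_simps simp flip: scaleR_add_left)
 ultimately show ?thesis by simp
qed

lemma L2lim_scaleR_vec:
 fixes b :: "'a::euclidean_space => 'b::euclidean_space"
 assumes "L2lim lebesgue fs (f :: 'a => real)" "b \<in> borel_measurable lebesgue" "\<And>x. norm (b x) \<le> B"
 shows "L2lim lebesgue (\<lambda>n x. fs n x *\<^sub>R b x) (\<lambda>x. f x *\<^sub>R b x)"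
proof -
 note sq = L2lim_sq[OF assms(1)]
 have B: "B \<ge> 0" using assms(3)[of undefined] norm_ge_zero order_trans by blast
 have m: "v \<in> borel_measurable lebesgue ==> (\<lambda>x. v x *\<^sub>R b x) \<in> borel_measurable lebesgue" for v :: "'a => real"
  using assms(2) by simp
 have s: "sq lebesgue (\<lambda>x. v x *\<^sub>R b x)" "nrm lebesgue (\<lambda>x. v x *\<^sub>R b x) \<le> B * nrm lebesgue v" 
  if "sq lebesgue v" for v :: "'a => real"
 proof -
  have a: "AE x in lebesgue. norm (v x *\<^sub>R b x) \<le> norm (B * v x)"
  proof (rule AE_I2)
   fix x
   have "\<bar>v x\<bar> * norm (b x) \<le> \<bar>v x\<bar> * B" using assms(3) by (intro mult_left_mono) auto
   then show "norm (v x *\<^sub>R b x) \<le> norm (B * v x)" using B by (simp add: abs_mult mult.commute)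
  qed
  show "sq lebesgue (\<lambda>x. v x *\<^sub>R b x)" by (rule sq_bound[OF sq_cmult[OF that] m a]) (use that in \<open>simp add: sq_def\<close>)
  show "nrm lebesgue (\<lambda>x. v x *\<^sub>R b x) \<le> B * nrm lebesgue v"
   using nrm_mono[OF sq_cmult[OF that] m a] that B by (simp add: sq_def nrm_cmult)
 qed
 have lim: "(\<lambda>n. B * nrm lebesgue (\<lambda>x. fs n x - f x)) \<longlonglongrightarrow> 0"
  using assms(1) by (auto simp: L2lim_def intro!: tendsto_mult_right_zero)
 have "nrm lebesgue (\<lambda>x. fs n x *\<^sub>R b x - f x *\<^sub>R b x) \<le> B * nrm lebesgue (\<lambda>x. fs n x - f x)" for n
  using s(2)[OF sq_diff[OF sq(1)[of n] sq(2)]] by (simp add: scaleR_diff_left)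
 then show ?thesis unfolding L2lim_def using s(1) sq
  by (auto intro!: Lim_null_comparison[OF _ lim] always_eventually)
qed

lemma test_bound1:
 assumes "test_fun \<Omega> \<phi>" obtains B where "B \<ge> 0" "\<And>x. \<bar>\<phi> x\<bar> \<le> B" "\<And>x. norm (grad \<phi> x) \<le> B"
proof -
 obtain B R where 1: "B \<ge> 0" "\<And>x. \<bar>\<phi> x\<bar> \<le> B * indicator (cball 0 R) x" using test_bound[OF assms] by metis
 obtain B' R' where 2: "B' \<ge> 0" "\<And>x. norm (grad \<phi> x) \<le> B' * indicator (cball 0 R') x" using grad_bound[OF assms] by metis
 have "\<bar>\<phi> x\<bar> \<le> B + B'" "norm (grad \<phi> x) \<le> B + B'" for x
  using 1(1) 1(2)[of x] 2(1) 2(2)[of x] by (cases "x \<in> cball 0 R"; cases "x \<in> cball 0 R'"; simp)+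
 then show ?thesis using that[of "B + B'"] 1(1) 2(1) by simp
qed

text \<open>Localisation: \<open>u\<close> belongs to the whole space, yet the product lies in the
  closure of the test functions on \<Omega>, because the cutoff is supported there.\<close>

lemma H01_mult_test:
 assumes "H01 UNIV u g" "test_fun \<Omega> \<eta>"
 shows "H01 \<Omega> (\<lambda>x. \<eta> x * u x) (\<lambda>x. \<eta> x *\<^sub>R g x + u x *\<^sub>R grad \<eta> x)"
proof -
 obtain \<phi> where \<phi>: "\<And>n. test_fun UNIV (\<phi> n)" "L2lim lebesgue \<phi> u" "L2lim lebesgue (\<lambda>n. grad (\<phi> n)) g"
  using gcl_seq[OF assms(1)] by (metis order_refl)
 obtain B where B: "\<And>x. \<bar>\<eta> x\<bar> \<le> B" "\<And>x. norm (grad \<eta> x) \<le> B" using test_bound1[OF assms(2)] by metis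
 have 1: "L2lim lebesgue (\<lambda>n x. \<eta> x * \<phi> n x) (\<lambda>x. \<eta> x * u x)"
  using L2lim_bounded_scale[OF \<phi>(2), of "\<lambda>_. \<eta>" \<eta> B] test_leb[OF assms(2)] B by simp
 have 2: "L2lim lebesgue (\<lambda>n x. \<eta> x *\<^sub>R grad (\<phi> n) x + \<phi> n x *\<^sub>R grad \<eta> x) (\<lambda>x. \<eta> x *\<^sub>R g x + u x *\<^sub>R grad \<eta> x)"
  by (intro L2lim_add L2lim_bounded_scale[OF \<phi>(3), of "\<lambda>_. \<eta>" \<eta> B] L2lim_scaleR_vec[OF \<phi>(2) test_grad_leb[OF assms(2)] B(2)])
    (use test_leb[OF assms(2)] B in auto)
 have 3: "grad (\<lambda>x. \<eta> x * \<phi> n x) = (\<lambda>x. \<eta> x *\<^sub>R grad (\<phi> n) x + \<phi> n x *\<^sub>R grad \<eta> x)" for n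
  by (auto simp: fun_eq_iff grad_mult test_smooth[OF \<phi>(1)] test_smooth[OF assms(2)])
 show ?thesis
  by (rule gcl_I[where \<phi>="\<lambda>n x. \<eta> x * \<phi> n x"])
    (use 1 2 3 test_mult[OF assms(2) test_smooth[OF \<phi>(1)]] tests_UNIV in auto)
qed

section \<open>Translates and difference quotients of weakly differentiable functions\<close>

lemma test_shift:
 assumes "test_fun UNIV \<phi>"
 shows "test_fun UNIV (\<lambda>x. \<phi> (x + a))" "grad (\<lambda>x. \<phi> (x + a)) = (\<lambda>x. grad \<phi> (x + a))"
proof -
 have s: "smooth_fun (\<lambda>x. \<phi> (x + a))" using smooth_affine[OF test_smooth[OF assms], of 1 "-a"] by simp
 obtain K where K: "compact K" "\<forall>x. x \<notin> K --> \<phi> x = 0" using assms unfolding test_fun_def by blast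
 have "compact ((\<lambda>x. x - a) ` K)" using K by (intro compact_continuous_image continuous_intros)
 moreover have "\<phi> (x + a) = 0" if "x \<notin> (\<lambda>x. x - a) ` K" for x
  using K(2) that by (metis add_diff_cancel imageI)
 ultimately show "test_fun UNIV (\<lambda>x. \<phi> (x + a))" using s unfolding test_fun_def by blast
 have "pdiff i (\<lambda>x. \<phi> (x + a)) (\<lambda>x. pd i \<phi> (x + a))" for i
  using pdiff_affine[OF smooth_pdiff[OF test_smooth[OF assms], of i], of 1 "-a"] by simp
 then have "pd i (\<lambda>x. \<phi> (x + a)) = (\<lambda>x. pd i \<phi> (x + a))" for i by (rule pdiff_pd)
 then show "grad (\<lambda>x. \<phi> (x + a)) = (\<lambda>x. grad \<phi> (x + a))" by (simp add: grad_def[abs_def])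
qed

lemma L2lim_shift:
 fixes f :: "'a::euclidean_space => 'b::euclidean_space"
 assumes "L2lim lebesgue fs f" shows "L2lim lebesgue (\<lambda>n x. fs n (x + a)) (\<lambda>x. f (x + a))"
proof -
 have "nrm lebesgue (\<lambda>x. fs n (x + a) - f (x + a)) = nrm lebesgue (\<lambda>x. fs n x - f x)" for n
  using nrm_shift[of "\<lambda>x. fs n x - f x" a] L2lim_sq[OF assms] by (simp add: sq_def)
 then show ?thesis using assms by (auto simp: L2lim_def intro!: sq_shift[of "fs n" for n] sq_shift[of f])
qed

lemma H01_shift:
 assumes "H01 UNIV u g" shows "H01 UNIV (\<lambda>x. u (x + a)) (\<lambda>x. g (x + a))"
proof -
 obtain \<phi> where \<phi>: "\<And>n. test_fun UNIV (\<phi> n)" "L2lim lebesgue \<phi> u" "L2lim lebesgue (\<lambda>n. grad (\<phi> n)) g"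
  using gcl_seq[OF assms(1)] by (metis order_refl)
 show ?thesis
  by (rule gcl_I[where \<phi>="\<lambda>n x. \<phi> n (x + a)"])
    (use L2lim_shift[OF \<phi>(2)] L2lim_shift[OF \<phi>(3)] test_shift[OF \<phi>(1)] in auto)
qed

lemma H01_dq: "H01 UNIV u g ==> H01 UNIV (dq h i u) (dq h i g)"
 unfolding dq_def[abs_def] real_scaleR_def by (intro H01_cmult H01_diff) (rule H01_shift)

lemma nrm_shift_le_multiple:
 fixes f :: "real^'n::finite => real"
 assumes "sq lebesgue f"
 shows "nrm lebesgue (\<lambda>x. f (x + real n *\<^sub>R a) - f x) \<le> real n * nrm lebesgue (\<lambda>x. f (x + a) - f x)"
proof (induction n)
 case (Suc n)
 have "nrm lebesgue (\<lambda>x. f (x + real (Suc n) *\<^sub>R a) - f x)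
   \<le> nrm lebesgue (\<lambda>x. f (x + real (Suc n) *\<^sub>R a) - f (x + real n *\<^sub>R a)) + nrm lebesgue (\<lambda>x. f (x + real n *\<^sub>R a) - f x)"
  by (rule nrm_triangle_diff[OF sq_shift[OF assms] sq_shift[OF assms] assms])
 also have "nrm lebesgue (\<lambda>x. f (x + real (Suc n) *\<^sub>R a) - f (x + real n *\<^sub>R a)) = nrm lebesgue (\<lambda>x. f (x + a) - f x)"
  using nrm_shift[of "\<lambda>x. f (x + a) - f x" "real n *\<^sub>R a"] sq_shift[OF assms, of a] assms
  by (simp add: sq_def algebra_simps)
 finally show ?case using Suc by (simp add: algebra_simps)
qed simp

lemma L2lim_nth:
 fixes g :: "'a => real^'n::finite"
 assumes "L2lim M gs g" shows "L2lim M (\<lambda>n x. gs n x $ i) (\<lambda>x. g x $ i)"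
proof -
 have lim: "(\<lambda>n. nrm M (\<lambda>x. gs n x - g x)) \<longlonglongrightarrow> 0" using assms by (simp add: L2lim_def)
 have "nrm M (\<lambda>x. gs n x $ i - g x $ i) \<le> nrm M (\<lambda>x. gs n x - g x)" for n
  using sq_nth(2)[OF sq_diff[OF L2lim_sq(1)[OF assms, of n] L2lim_sq(2)[OF assms]], of i] by simp
 then show ?thesis unfolding L2lim_def using L2lim_sq[OF assms]
  by (auto intro!: sq_nth Lim_null_comparison[OF _ lim] always_eventually)
qed

text \<open>A translation by h is a chain of m translations by h / m, so the quotient at step h is
  bounded by the one at step h / m. Letting m grow replaces the latter by the derivative.\<close>

lemma nrm_dq_test:
 assumes "test_fun UNIV \<phi>" "h \<noteq> 0"
 shows "nrm lebesgue (dq h i \<phi>) \<le> nrm lebesgue (pd i \<phi>)"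
proof -
 \<comment> \<open>The offset makes every step at most 1 in absolute value, as the L2 convergence of
   the quotients requires.\<close>
 define k where "k n = h / real (n + nat \<lceil>\<bar>h\<bar>\<rceil> + 1)" for n
 have hn: "\<bar>h\<bar> \<le> real (n + nat \<lceil>\<bar>h\<bar>\<rceil> + 1)" for n using real_nat_ceiling_ge[of "\<bar>h\<bar>"] by linarith
 have k0: "k n \<noteq> 0" "\<bar>k n\<bar> \<le> 1" for n
 proof -
  show "k n \<noteq> 0" unfolding k_def divide_eq_0_iff of_nat_eq_0_iff using assms(2) by simp
  have "\<bar>k n\<bar> = \<bar>h\<bar> / real (n + nat \<lceil>\<bar>h\<bar>\<rceil> + 1)" by (simp only: k_def abs_divide abs_of_nat)
  also have "\<dots> \<le> 1" using hn[of n] by (subst divide_le_eq_1_pos) (simp_all only: of_nat_0_less_iff add_gr_0 zero_less_one simp_thms)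
  finally show "\<bar>k n\<bar> \<le> 1" .
 qed
 have "(\<lambda>n. h / real n) \<longlonglongrightarrow> 0" by (rule lim_const_over_n)
 from LIMSEQ_ignore_initial_segment[OF this, of "nat \<lceil>\<bar>h\<bar>\<rceil> + 1"]
 have klim: "k \<longlonglongrightarrow> 0" by (simp add: k_def[abs_def] add.assoc)
 have "nrm lebesgue (dq h i \<phi>) \<le> nrm lebesgue (dq (k n) i \<phi>)" for n
 proof -
  define m where "m = n + nat \<lceil>\<bar>h\<bar>\<rceil> + 1"
  have "m > 0" by (simp add: m_def)
  moreover have "k n = h / real m" by (simp only: k_def m_def)
  ultimately have hk: "h = real m * k n" "m > 0" by simp_all
  have "nrm lebesgue (\<lambda>x. \<phi> (x + h *\<^sub>R axis i 1) - \<phi> x) \<le> real m * nrm lebesgue (\<lambda>x. \<phi> (x + k n *\<^sub>R axis i 1) - \<phi> x)"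
   using nrm_shift_le_multiple[OF test_sq[OF assms(1)], of m "k n *\<^sub>R axis i 1"] hk(1) by simp
  then have "\<bar>1 / h\<bar> * nrm lebesgue (\<lambda>x. \<phi> (x + h *\<^sub>R axis i 1) - \<phi> x)
    \<le> \<bar>1 / h\<bar> * (real m * nrm lebesgue (\<lambda>x. \<phi> (x + k n *\<^sub>R axis i 1) - \<phi> x))"
   by (intro mult_left_mono) auto
  also have "\<dots> = \<bar>1 / k n\<bar> * nrm lebesgue (\<lambda>x. \<phi> (x + k n *\<^sub>R axis i 1) - \<phi> x)"
   using hk by (simp add: abs_mult abs_divide)
  finally show ?thesis unfolding dq_def[abs_def] nrm_scale .
 qed
 moreover have "(\<lambda>n. nrm lebesgue (dq (k n) i \<phi>)) \<longlonglongrightarrow> nrm lebesgue (pd i \<phi>)"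
  by (rule L2lim_nrm[OF dq_test_L2[OF assms(1) klim k0]])
 ultimately show ?thesis by (intro tendsto_lowerbound[of _ _ sequentially]) auto
qed

lemma L2lim_dq:
 fixes f :: "real^'n::finite => 'b::euclidean_space"
 assumes "L2lim lebesgue fs f" shows "L2lim lebesgue (\<lambda>n. dq h i (fs n)) (dq h i f)"
proof -
 have "L2lim lebesgue (\<lambda>n x. (1/h) *\<^sub>R (fs n (x + h *\<^sub>R axis i 1) + (-1) *\<^sub>R fs n x))
   (\<lambda>x. (1/h) *\<^sub>R (f (x + h *\<^sub>R axis i 1) + (-1) *\<^sub>R f x))"
  by (rule L2lim_scale[OF L2lim_add[OF L2lim_shift[OF assms] L2lim_scale[OF assms]]])
 then show ?thesis by (simp add: dq_def[abs_def])
qed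

lemma H01_nrm_dq:
 assumes "H01 UNIV u g" "h \<noteq> 0"
 shows "nrm lebesgue (dq h i u) \<le> nrm lebesgue (\<lambda>x. g x $ i)"
proof -
 obtain \<phi> where \<phi>: "\<And>n. test_fun UNIV (\<phi> n)" "L2lim lebesgue \<phi> u" "L2lim lebesgue (\<lambda>n. grad (\<phi> n)) g"
  using gcl_seq[OF assms(1)] by (metis order_refl)
 have "(\<lambda>n. nrm lebesgue (dq h i (\<phi> n))) \<longlonglongrightarrow> nrm lebesgue (dq h i u)"
  by (rule L2lim_nrm[OF L2lim_dq[OF \<phi>(2)]])
 moreover have "(\<lambda>n. nrm lebesgue (\<lambda>x. grad (\<phi> n) x $ i)) \<longlonglongrightarrow> nrm lebesgue (\<lambda>x. g x $ i)"
  by (rule L2lim_nrm[OF L2lim_nth[OF \<phi>(3)]])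
 ultimately show ?thesis
  by (rule LIMSEQ_le) (use nrm_dq_test[OF \<phi>(1) assms(2), where i=i] in \<open>auto simp: grad_nth\<close>)
qed

text \<open>A substitute for the Poincare inequality: with a step longer than the diameter,
  \<open>x\<close> and its translate are never both in \<Omega>. The difference quotient vanishes
  together with the gradient, hence so does \<open>u\<close>.\<close>

lemma H01_zero_grad:
 fixes u :: "real^'n::finite => real"
 assumes "H01 \<Omega> u g" "bounded \<Omega>" "AE x in lebesgue. g x = 0"
 shows "AE x in lebesgue. u x = 0"
proof -
 fix i :: 'n
 obtain R where R: "R > 0" "\<And>x. x \<in> \<Omega> ==> norm x \<le> R" using assms(2) by (auto simp: bounded_pos)
 define h where "h = 2 * R + 1"
 have h: "h > 0" using R by (simp add: h_def)
 have "nrm lebesgue (\<lambda>x. g x $ i) = nrm lebesgue (\<lambda>x::real^'n. 0::real)"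
 proof (rule nrm_cong_AE)
  show "(\<lambda>x. g x $ i) \<in> borel_measurable lebesgue" using sq_nth(1)[OF gcl_sq(2)[OF assms(1)]] by (simp add: sq_def)
  show "AE x in lebesgue. g x $ i = 0" using assms(3) by eventually_elim simp
 qed simp
 then have "nrm lebesgue (dq h i u) = 0"
  using H01_nrm_dq[OF H01_UNIV[OF assms(1)], of h i] h nrm_nonneg[of lebesgue "dq h i u"] by simp
 then have 1: "AE x in lebesgue. dq h i u x = 0" by (rule nrm_eq_0[OF dq_sq[OF gcl_sq(1)[OF assms(1)]]])
 have 2: "AE x in lebesgue. x \<notin> \<Omega> --> u x = 0" using H01_off[OF assms(1)] by eventually_elim auto
 have 3: "AE x in lebesgue. x + h *\<^sub>R axis i 1 \<notin> \<Omega> --> u (x + h *\<^sub>R axis i 1) = 0"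
  using AE_shift[OF 2] .
 show ?thesis using 1 2 3
 proof eventually_elim
  case (elim x)
  show ?case
  proof (cases "x \<in> \<Omega>")
   case True
   have "x + h *\<^sub>R axis i 1 \<notin> \<Omega>"
   proof
    assume "x + h *\<^sub>R axis i 1 \<in> \<Omega>"
    then have "norm (x + h *\<^sub>R axis i 1) \<le> R" "norm x \<le> R" using R True by auto
    then have "norm (h *\<^sub>R axis i (1::real)) \<le> 2 * R"
     using norm_triangle_ineq4[of "x + h *\<^sub>R axis i 1" x] by simp
    then show False using h by (simp add: h_def)
   qed
   then show ?thesis using elim h by (simp add: dq_def)
  qed (use elim in simp)
 qed
qed

subsection \<open>Plateaus of weak solutions\<close>

lemma inv_Suc_lim: "(\<lambda>n. 1 / real (Suc n)) \<longlonglongrightarrow> 0"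
 using LIMSEQ_inverse_real_of_nat by (simp add: inverse_eq_divide)

lemma grad_const_on_open:
 assumes "open V" "\<And>x. x \<in> V ==> f x = c" "smooth_fun f" "x \<in> V"
 shows "grad f x = 0"
proof -
 have s: "smooth_fun (\<lambda>x. f x - c)" by (intro smooth_diff smooth_const assms(3))
 have "pd i (\<lambda>x. f x - c) x = 0" for i
  by (rule pd_off_compact[of "- V"]) (use assms s in auto)
 then have "grad (\<lambda>x. f x - c) x = 0" by (simp add: grad_def vec_eq_iff)
 moreover have "grad (\<lambda>x. c) x = 0" by (simp add: grad_pdiff[OF pdiff_const] vec_eq_iff)
 ultimately show ?thesis using grad_diff[OF assms(3) smooth_const[of c], of x] by simp
qed

lemma dq_parts:
 fixes a b :: "real^'n::finite => 'b::euclidean_space"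
 assumes "sq lebesgue a" "sq lebesgue b" "h \<noteq> 0"
 shows "(LINT x. a x \<bullet> dq (-h) i b x) = - (LINT x. dq h i a x \<bullet> b x)"
proof -
 define e where "e = h *\<^sub>R axis i (1::real)"
 have i1: "integrable lebesgue (\<lambda>x. a x \<bullet> b (x + (-e)))" by (intro sq_inner assms sq_shift)
 have i2: "integrable lebesgue (\<lambda>x. a x \<bullet> b x)" by (intro sq_inner assms)
 have i3: "integrable lebesgue (\<lambda>x. a (x + e) \<bullet> b x)" by (intro sq_inner assms sq_shift)
 have s: "(LINT x. a (x + e) \<bullet> b x) = (LINT x. a x \<bullet> b (x + (-e)))"
  using integral_shift[of "\<lambda>x. a x \<bullet> b (x + (-e))" e] i1 by simp
 have "(LINT x. a x \<bullet> dq (-h) i b x) = (LINT x. (-1/h) * (a x \<bullet> b (x + (-e)) - a x \<bullet> b x))"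
  by (intro Bochner_Integration.integral_cong refl) (simp add: dq_def e_def inner_diff_right)
 also have "\<dots> = (-1/h) * ((LINT x. a x \<bullet> b (x + (-e))) - (LINT x. a x \<bullet> b x))"
  using Bochner_Integration.integral_diff[OF i1 i2] by simp
 also have "\<dots> = (-1/h) * ((LINT x. a (x + e) \<bullet> b x) - (LINT x. a x \<bullet> b x))" using s by simp
 also have "\<dots> = (LINT x. (-1/h) * (a (x + e) \<bullet> b x - a x \<bullet> b x))"
  using Bochner_Integration.integral_diff[OF i3 i2] by simp
 also have "\<dots> = (LINT x. - (dq h i a x \<bullet> b x))"
  by (intro Bochner_Integration.integral_cong refl) (simp add: dq_def e_def inner_diff_left right_diff_distrib)
 finally show ?thesis by simp
qed

text \<open>Continuity of translation in L2. For a test function near the indicator the displacement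
  is at most the step times the norm of a derivative, and translation does not change the norm of
  the approximation error.\<close>

lemma indicator_shift_tendsto:
 fixes E :: "(real^'n::finite) set"
 assumes "E \<in> sets lebesgue" "bounded E" "h \<longlonglongrightarrow> 0"
 shows "(\<lambda>n. nrm lebesgue (\<lambda>x. indicator E (x + h n *\<^sub>R axis i 1) - indicator E x :: real)) \<longlonglongrightarrow> 0"
proof (rule LIMSEQ_I)
 fix e :: real assume e: "e > 0"
 let ?I = "indicator E :: real^'n => real"
 have sqE: "sq lebesgue ?I" using sq_indicator[OF assms(1,2), of 1] by simp
 have e3: "e / 3 > 0" using e by simp
 obtain \<rho> where r: "test_fun UNIV \<rho>" "\<forall>x. 0 \<le> \<rho> x \<and> \<rho> x \<le> 1" "nrm lebesgue (\<lambda>x. \<rho> x - ?I x) < e / 3"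
  by (rule indicator_approx[OF assms(1,2) e3])
 have "(\<lambda>n. \<bar>h n\<bar> * nrm lebesgue (pd i \<rho>)) \<longlonglongrightarrow> 0"
  using assms(3) by (intro tendsto_mult_left_zero tendsto_rabs_zero)
 from LIMSEQ_D[OF this e3] obtain N where N: "\<And>n. n \<ge> N ==> \<bar>h n\<bar> * nrm lebesgue (pd i \<rho>) < e / 3"
  by auto
 show "\<exists>N. \<forall>n\<ge>N. norm (nrm lebesgue (\<lambda>x. ?I (x + h n *\<^sub>R axis i 1) - ?I x) - 0) < e"
 proof (intro exI allI impI)
  fix n assume n: "n \<ge> N"
  let ?e = "h n *\<^sub>R axis i (1::real)"
  note sr = test_sq[OF r(1)]
  have a: "nrm lebesgue (\<lambda>x. ?I (x + ?e) - \<rho> (x + ?e)) < e / 3"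
   using nrm_shift[of "\<lambda>x. ?I x - \<rho> x" ?e] sq_diff[OF sqE sr] r(3) nrm_minus_commute[of lebesgue ?I \<rho>]
   by (simp add: sq_def)
  have b: "nrm lebesgue (\<lambda>x. \<rho> (x + ?e) - \<rho> x) < e / 3"
  proof (cases "h n = 0")
   case True then show ?thesis using e by simp
  next
   case False
   have "nrm lebesgue (\<lambda>x. \<rho> (x + ?e) - \<rho> x) = \<bar>h n\<bar> * nrm lebesgue (dq (h n) i \<rho>)"
    using False nrm_scale[of lebesgue "1 / h n" "\<lambda>x. \<rho> (x + ?e) - \<rho> x"] unfolding dq_def[abs_def] by simp
   also have "\<dots> \<le> \<bar>h n\<bar> * nrm lebesgue (pd i \<rho>)" by (intro mult_left_mono nrm_dq_test[OF r(1) False]) simp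
   finally show ?thesis using N[OF n] by simp
  qed
  have "nrm lebesgue (\<lambda>x. ?I (x + ?e) - ?I x) \<le> nrm lebesgue (\<lambda>x. ?I (x + ?e) - \<rho> (x + ?e)) + nrm lebesgue (\<lambda>x. \<rho> (x + ?e) - ?I x)"
   by (rule nrm_triangle_diff[OF sq_shift[OF sqE] sq_shift[OF sr] sqE])
  also have "nrm lebesgue (\<lambda>x. \<rho> (x + ?e) - ?I x) \<le> nrm lebesgue (\<lambda>x. \<rho> (x + ?e) - \<rho> x) + nrm lebesgue (\<lambda>x. \<rho> x - ?I x)"
   by (rule nrm_triangle_diff[OF sq_shift[OF sr] sr sqE])
  finally show "norm (nrm lebesgue (\<lambda>x. ?I (x + ?e) - ?I x) - 0) < e" using a b r(3) by simp
 qed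
qed

text \<open>The regularity estimate behind the plateau argument: if \<open>\<phi> \<mapsto> \<integral>\<nabla>v\<bullet>\<nabla>\<phi>\<close> is bounded in
 the \<open>L\<^sup>2\<close> norm of \<open>\<phi>\<close>, testing with \<open>D\<^sub>-\<^sub>h D\<^sub>h v\<close> bounds the second differences of \<open>v\<close>.\<close>

lemma second_difference_bound:
 fixes v :: "real^'n::finite => real"
 assumes v: "H01 UNIV v G" and C: "\<And>\<psi>. test_fun UNIV \<psi> ==> \<bar>LINT x. G x \<bullet> grad \<psi> x\<bar> \<le> C * nrm lebesgue \<psi>"
  and h: "h \<noteq> 0" and C0: "0 \<le> C"
 shows "nrm lebesgue (dq (-h) i (dq h i v)) \<le> C"
proof -
 \<comment> \<open>By density the bound extends to weakly differentiable test functions, in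
   particular to second differences of \<open>v\<close>.\<close>
 have ext: "\<bar>LINT x. G x \<bullet> g x\<bar> \<le> C * nrm lebesgue z" if zg: "H01 UNIV z g" for z g
 proof -
  obtain \<phi> where \<phi>: "\<And>n. test_fun UNIV (\<phi> n)" "L2lim lebesgue \<phi> z" "L2lim lebesgue (\<lambda>n. grad (\<phi> n)) g"
   using gcl_seq[OF zg] by (metis order_refl)
  have "(\<lambda>n. \<bar>LINT x. G x \<bullet> grad (\<phi> n) x\<bar>) \<longlonglongrightarrow> \<bar>LINT x. G x \<bullet> g x\<bar>"
   by (intro tendsto_rabs L2lim_inner L2lim_const gcl_sq(2)[OF v] \<phi>)
  moreover have "(\<lambda>n. C * nrm lebesgue (\<phi> n)) \<longlonglongrightarrow> C * nrm lebesgue z"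
   by (intro tendsto_mult_left L2lim_nrm \<phi>)
  ultimately show ?thesis by (rule LIMSEQ_le) (use C[OF \<phi>(1)] in auto)
 qed
 note sG = gcl_sq(2)[OF v]
 have sdG: "sq lebesgue (dq h i G)" by (rule dq_sq[OF sG])
 have "(nrm lebesgue (dq h i G))\<^sup>2 = (LINT x. dq h i G x \<bullet> dq h i G x)"
  by (simp add: nrm_power2 power2_norm_eq_inner)
 also have "\<dots> = - (LINT x. G x \<bullet> dq (-h) i (dq h i G) x)"
  using dq_parts[OF sG sdG h] by simp
 also have "\<dots> \<le> \<bar>LINT x. G x \<bullet> dq (-h) i (dq h i G) x\<bar>" by simp
 also have "\<dots> \<le> C * nrm lebesgue (dq (-h) i (dq h i v))" by (rule ext[OF H01_dq[OF H01_dq[OF v]]])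
 finally have 1: "(nrm lebesgue (dq h i G))\<^sup>2 \<le> C * nrm lebesgue (dq (-h) i (dq h i v))" .
 have 2: "nrm lebesgue (dq (-h) i (dq h i v)) \<le> nrm lebesgue (dq h i G)"
  using H01_nrm_dq[OF H01_dq[OF v], of "-h" i h i] h sq_nth(2)[OF sdG, of i] by simp
 show ?thesis
 proof (cases "nrm lebesgue (dq (-h) i (dq h i v)) = 0")
  case True
  then show ?thesis using C0 by simp
 next
  case False
  then have pos: "nrm lebesgue (dq (-h) i (dq h i v)) > 0" using nrm_nonneg by (metis less_eq_real_def)
  \<comment> \<open>Facts \<open>1\<close> and \<open>2\<close> give X^2 <= C * X for the norm X to
    be bounded, and X is positive in this case.\<close>
  have "(nrm lebesgue (dq (-h) i (dq h i v)))\<^sup>2 \<le> (nrm lebesgue (dq h i G))\<^sup>2" using 2 by (intro power_mono) auto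
  then have "nrm lebesgue (dq (-h) i (dq h i v)) * nrm lebesgue (dq (-h) i (dq h i v)) \<le> C * nrm lebesgue (dq (-h) i (dq h i v))"
   using 1 by (simp add: power2_eq_square)
  then show ?thesis using pos by simp
 qed
qed

text \<open>\<open>v\<close> has only one weak derivative, so one difference is moved to the test
  function. Its quotient converges in L2 while that of \<open>v\<close> stays bounded; in the
  remaining product with \<open>pd i \<psi>\<close> the second difference is moved over as
  well.\<close>

lemma second_difference_tendsto:
 fixes v :: "real^'n::finite => real"
 assumes v: "H01 UNIV v G" and \<psi>: "test_fun UNIV \<psi>"
  and h: "h \<longlonglongrightarrow> 0" "\<And>n. h n \<noteq> 0" "\<And>n. \<bar>h n\<bar> \<le> 1"
 shows "(\<lambda>n. LINT x. dq (- h n) i (dq (h n) i v) x * \<psi> x) \<longlonglongrightarrow> - (LINT x. G x $ i * pd i \<psi> x)"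
proof -
 note sv = gcl_sq(1)[OF v] and s\<psi> = test_sq[OF \<psi>] and s\<theta> = test_sq[OF test_pd[OF \<psi>, of i]]
 let ?\<theta> = "pd i \<psi>"
 have sd: "sq lebesgue (dq (h n) i v)" for n by (rule dq_sq[OF sv])
 have sd\<psi>: "sq lebesgue (dq (h n) i \<psi>)" for n by (rule dq_sq[OF s\<psi>])
 have eq: "(LINT x. dq (- h n) i (dq (h n) i v) x * \<psi> x)
   = - (LINT x. dq (h n) i v x * (dq (h n) i \<psi> x - ?\<theta> x)) + (LINT x. v x * dq (- h n) i ?\<theta> x)" for n
 proof -
  have "(LINT x. dq (- h n) i (dq (h n) i v) x * \<psi> x) = - (LINT x. dq (h n) i \<psi> x * dq (h n) i v x)"
   using dq_parts[OF s\<psi> sd[of n] h(2)[of n], where i=i] by (simp add: mult.commute)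
  also have "\<dots> = - ((LINT x. dq (h n) i v x * (dq (h n) i \<psi> x - ?\<theta> x)) + (LINT x. dq (h n) i v x * ?\<theta> x))"
   by (subst Bochner_Integration.integral_add[symmetric])
     (auto intro!: sq_mult sd sq_diff sd\<psi> s\<theta> Bochner_Integration.integral_cong simp: algebra_simps)
  also have "(LINT x. dq (h n) i v x * ?\<theta> x) = - (LINT x. v x * dq (- h n) i ?\<theta> x)"
   using dq_parts[OF sv s\<theta> h(2)[of n], where i=i] by simp
  finally show ?thesis by simp
 qed
 have "(\<lambda>n. LINT x. dq (h n) i v x * (dq (h n) i \<psi> x - ?\<theta> x)) \<longlonglongrightarrow> 0"
 proof (rule Lim_null_comparison)
  show "\<forall>\<^sub>F n in sequentially. norm (LINT x. dq (h n) i v x * (dq (h n) i \<psi> x - ?\<theta> x))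
    \<le> nrm lebesgue G * nrm lebesgue (\<lambda>x. dq (h n) i \<psi> x - ?\<theta> x)"
  proof (intro always_eventually allI)
   fix n
   have "\<bar>LINT x. dq (h n) i v x * (dq (h n) i \<psi> x - ?\<theta> x)\<bar>
     \<le> nrm lebesgue (dq (h n) i v) * nrm lebesgue (\<lambda>x. dq (h n) i \<psi> x - ?\<theta> x)"
    using CS[OF sd sq_diff[OF sd\<psi> s\<theta>]] by simp
   also have "\<dots> \<le> nrm lebesgue G * nrm lebesgue (\<lambda>x. dq (h n) i \<psi> x - ?\<theta> x)"
    using H01_nrm_dq[OF v h(2)[of n], where i=i] sq_nth(2)[OF gcl_sq(2)[OF v], of i] by (intro mult_right_mono) auto
   finally show "norm (LINT x. dq (h n) i v x * (dq (h n) i \<psi> x - ?\<theta> x))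
    \<le> nrm lebesgue G * nrm lebesgue (\<lambda>x. dq (h n) i \<psi> x - ?\<theta> x)" by simp
  qed
  show "(\<lambda>n. nrm lebesgue G * nrm lebesgue (\<lambda>x. dq (h n) i \<psi> x - ?\<theta> x)) \<longlonglongrightarrow> 0"
   using dq_test_L2[OF \<psi> h, of i] by (intro tendsto_mult_right_zero) (simp add: L2lim_def)
 qed
 moreover have "(\<lambda>n. LINT x. v x * dq (- h n) i ?\<theta> x) \<longlonglongrightarrow> (LINT x. v x * pd i ?\<theta> x)"
 proof -
  have "L2lim lebesgue (\<lambda>n. dq (- h n) i ?\<theta>) (pd i ?\<theta>)"
   using h tendsto_minus[OF h(1)] by (intro dq_test_L2[OF test_pd[OF \<psi>]]) auto
  from L2lim_inner[OF L2lim_const[OF sv] this] show ?thesis by simp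
 qed
 moreover have "(LINT x. v x * pd i ?\<theta> x) = - (LINT x. G x $ i * ?\<theta> x)"
  using H01_ibp[OF v test_pd[OF \<psi>], of i] by simp
 ultimately show ?thesis unfolding eq using tendsto_add[OF tendsto_minus] by fastforce
qed

text \<open>The second differences \<open>Q n\<close> of \<open>v\<close> are bounded in L2 and
  vanish where all neighbours lie in \<open>E\<close>. Hence \<open>\<rho>\<close> may be replaced
  by its difference to the indicator of those points, and these fill up \<open>E\<close> by
  continuity of translation.\<close>

lemma plateau_localized:
 fixes v :: "real^'n::finite => real"
 assumes v: "H01 UNIV v G" and C: "\<And>\<psi>. test_fun UNIV \<psi> ==> \<bar>LINT x. G x \<bullet> grad \<psi> x\<bar> \<le> C * nrm lebesgue \<psi>"
  and C0: "0 \<le> C" and E: "E \<in> sets lebesgue" "bounded E"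
  and K: "compact K" "open V" "K \<subseteq> V" "\<And>x. x \<in> E \<inter> V ==> v x = a"
  and \<phi>: "test_fun UNIV \<phi>" "\<And>x. x \<notin> K ==> \<phi> x = 0" "\<And>x. \<bar>\<phi> x\<bar> \<le> B"
  and \<rho>: "test_fun UNIV \<rho>"
 shows "\<bar>LINT x. G x \<bullet> grad (\<lambda>x. \<rho> x * \<phi> x) x\<bar> \<le> real CARD('n) * C * B * nrm lebesgue (\<lambda>x. \<rho> x - indicator E x)"
proof -
 obtain d where d: "d > 0" "\<And>x. x \<in> K ==> ball x d \<subseteq> V"
  using compact_subset_open_imp_ball_epsilon_subset[OF K(1,2,3)] by (metis UN_subset_iff)
 \<comment> \<open>Steps below \<open>d\<close> keep the translates of points of \<open>K\<close>
   inside \<open>V\<close>; steps at most 1 are what the convergence of quotients requires.\<close>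
 define h where "h n = min 1 (d/2) * (1 / real (Suc n))" for n
 have hl: "h \<longlonglongrightarrow> 0" unfolding h_def[abs_def] by (intro tendsto_mult_right_zero inv_Suc_lim)
 have h0: "h n > 0" for n using d(1) by (simp add: h_def)
 have hle: "h n \<le> min 1 (d/2)" for n using d(1) unfolding h_def by (intro mult_left_le) auto
 have h: "h n \<noteq> 0" "\<bar>h n\<bar> \<le> 1" "h n < d" for n using h0[of n] hle[of n] d(1) by auto
 define ax where "ax i = axis i (1::real)" for i :: 'n
 \<comment> \<open>The points of \<open>E\<close> whose neighbours in all coordinate directions lie
   in \<open>E\<close> too. At such points of \<open>K\<close> the second differences of
   \<open>v\<close> are zero.\<close>
 define En where "En n = {x \<in> E. \<forall>i. x + h n *\<^sub>R ax i \<in> E \<and> x + (- h n) *\<^sub>R ax i \<in> E}" for n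
 define I where "I = (indicator E :: real^'n => real)"
 define J where "J n = (indicator (En n) :: real^'n => real)" for n
 define Q where "Q n x = (\<Sum>i\<in>UNIV. dq (- h n) i (dq (h n) i v) x)" for n x
 have sqE: "sq lebesgue I" unfolding I_def using sq_indicator[OF E, of 1] by simp
 have shE: "{x. x + y \<in> E} \<in> sets lebesgue" for y
  using measurable_sets[OF leb_shift_measurable E(1), of y] by (simp add: vimage_def)
 have "En n = E \<inter> (\<Inter>i\<in>UNIV. {x. x + h n *\<^sub>R ax i \<in> E} \<inter> {x. x + (- h n) *\<^sub>R ax i \<in> E})" for n
  by (auto simp: En_def)
 then have mEn: "En n \<in> sets lebesgue" for n using E(1) by (simp only:) (intro sets.Int sets.finite_INT shE; simp)
 have bEn: "bounded (En n)" for n using E(2) by (rule bounded_subset) (auto simp: En_def)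
 have sqJ: "sq lebesgue (J n)" for n unfolding J_def using sq_indicator[OF mEn bEn, of 1] by simp
 have Bp: "B \<ge> 0" using \<phi>(3)[of undefined] by simp
 have sv2: "sq lebesgue (dq (- h n) i (dq (h n) i v))" for n i by (intro dq_sq gcl_sq(1)[OF v])
 have sQ: "sq lebesgue (Q n)" "nrm lebesgue (Q n) \<le> real CARD('n) * C" for n
 proof -
  have "sq lebesgue (\<lambda>x. \<Sum>i\<in>S. dq (- h n) i (dq (h n) i v) x) \<and>
    nrm lebesgue (\<lambda>x. \<Sum>i\<in>S. dq (- h n) i (dq (h n) i v) x) \<le> real (card S) * C" if "finite S" for S
   using that
  proof (induction S)
   case (insert i S)
   have "nrm lebesgue (\<lambda>x. dq (- h n) i (dq (h n) i v) x + (\<Sum>i\<in>S. dq (- h n) i (dq (h n) i v) x)) \<le> C + real (card S) * C"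
    using nrm_triangle[OF sv2[of n i], of "\<lambda>x. \<Sum>i\<in>S. dq (- h n) i (dq (h n) i v) x"] insert.IH
     second_difference_bound[OF v C h(1)[of n] C0, where i=i] by simp
   then show ?case using insert sq_add[OF sv2[of n i]] by (simp add: distrib_right)
  qed simp
  from this[of UNIV] show "sq lebesgue (Q n)" "nrm lebesgue (Q n) \<le> real CARD('n) * C" by (simp_all add: Q_def[abs_def])
 qed
 have Q0: "Q n x * (J n x * \<phi> x) = 0" for n x
 proof (cases "x \<in> En n \<and> x \<in> K")
  case True
  have "dq (- h n) i (dq (h n) i v) x = 0" for i
  proof -
   have m: "x \<in> E" "x + h n *\<^sub>R ax i \<in> E" "x + (- h n) *\<^sub>R ax i \<in> E" using True by (auto simp: En_def)
   have "x \<in> V" "x + h n *\<^sub>R ax i \<in> V" "x + (- h n) *\<^sub>R ax i \<in> V"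
    using d(2)[of x] True h(3)[of n] h0[of n] d(1) by (auto simp: dist_norm ax_def subset_iff)
   then have "v x = a" "v (x + h n *\<^sub>R ax i) = a" "v (x + (- h n) *\<^sub>R ax i) = a" using K(4) m by auto
   then show ?thesis by (simp add: dq_def ax_def)
  qed
  then show ?thesis by (simp add: Q_def)
 next
  case False
  then show ?thesis using \<phi>(2) by (auto simp: J_def indicator_def)
 qed
 have JI: "(\<lambda>n. nrm lebesgue (\<lambda>x. I x - J n x)) \<longlonglongrightarrow> 0"
 proof -
  let ?D = "\<lambda>s n i x. I (x + (s * h n) *\<^sub>R ax i) - I x"
  \<comment> \<open>A point of \<open>E\<close> outside \<open>En n\<close> has a translate outside
    \<open>E\<close>, which contributes 1 to the sum.\<close>
  have le: "\<bar>I x - J n x\<bar> \<le> (\<Sum>i\<in>UNIV. \<bar>?D 1 n i x\<bar> + \<bar>?D (-1) n i x\<bar>)" for n x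
  proof (cases "x \<in> E \<and> x \<notin> En n")
   case True
   then obtain i where "x + h n *\<^sub>R ax i \<notin> E \<or> x + (- h n) *\<^sub>R ax i \<notin> E" by (auto simp: En_def)
   then have "1 \<le> \<bar>?D 1 n i x\<bar> + \<bar>?D (-1) n i x\<bar>" using True by (auto simp: I_def indicator_def)
   also have "\<dots> \<le> (\<Sum>i\<in>UNIV. \<bar>?D 1 n i x\<bar> + \<bar>?D (-1) n i x\<bar>)"
    by (rule member_le_sum[where f="\<lambda>i. \<bar>?D 1 n i x\<bar> + \<bar>?D (-1) n i x\<bar>"]) auto
   finally show ?thesis using True by (simp add: I_def J_def)
  next
   case False
   then have "I x = J n x" by (auto simp: I_def J_def En_def indicator_def)
   then show ?thesis by (simp add: sum_nonneg)
  qed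
  have sD: "sq lebesgue (\<lambda>x. \<bar>?D s n i x\<bar>)" for s n i
   using sq_norm[OF sq_diff[OF sq_shift[OF sqE] sqE]] by simp
  have sum: "sq lebesgue (\<lambda>x. \<Sum>i\<in>S. \<bar>?D 1 n i x\<bar> + \<bar>?D (-1) n i x\<bar>) \<and>
    nrm lebesgue (\<lambda>x. \<Sum>i\<in>S. \<bar>?D 1 n i x\<bar> + \<bar>?D (-1) n i x\<bar>)
    \<le> (\<Sum>i\<in>S. nrm lebesgue (?D 1 n i) + nrm lebesgue (?D (-1) n i))" if "finite S" for S n
   using that
  proof (induction S)
   case (insert i S)
   let ?f = "\<lambda>x. \<bar>?D 1 n i x\<bar> + \<bar>?D (-1) n i x\<bar>"
   have f: "sq lebesgue ?f" by (intro sq_add sD)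
   have nf: "nrm lebesgue ?f \<le> nrm lebesgue (?D 1 n i) + nrm lebesgue (?D (-1) n i)"
    using nrm_triangle[OF sD[of 1 n i] sD[of "-1" n i]] nrm_norm[of lebesgue "?D 1 n i"] nrm_norm[of lebesgue "?D (-1) n i"]
    by simp
   show ?case using insert sq_add[OF f] nrm_triangle[OF f, of "\<lambda>x. \<Sum>i\<in>S. \<bar>?D 1 n i x\<bar> + \<bar>?D (-1) n i x\<bar>"] nf by simp
  qed simp
  have lim: "(\<lambda>n. \<Sum>i\<in>UNIV. nrm lebesgue (?D 1 n i) + nrm lebesgue (?D (-1) n i)) \<longlonglongrightarrow> (\<Sum>i\<in>(UNIV::'n set). 0 + 0)"
   using hl tendsto_minus[OF hl] unfolding I_def ax_def
   by (intro tendsto_sum tendsto_add indicator_shift_tendsto[OF E]) auto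
  have "nrm lebesgue (\<lambda>x. I x - J n x) \<le> (\<Sum>i\<in>UNIV. nrm lebesgue (?D 1 n i) + nrm lebesgue (?D (-1) n i))" for n
  proof -
   have "nrm lebesgue (\<lambda>x. I x - J n x) \<le> nrm lebesgue (\<lambda>x. \<Sum>i\<in>UNIV. \<bar>?D 1 n i x\<bar> + \<bar>?D (-1) n i x\<bar>)"
    by (rule nrm_mono[OF conjunct1[OF sum]])
      (use le sq_diff[OF sqE sqJ] in \<open>auto simp: sq_def sum_nonneg intro!: AE_I2\<close>)
   then show ?thesis using conjunct2[OF sum, of UNIV n] by simp
  qed
  then have ev: "\<forall>\<^sub>F n in sequentially. norm (nrm lebesgue (\<lambda>x. I x - J n x)) \<le> (\<Sum>i\<in>UNIV. nrm lebesgue (?D 1 n i) + nrm lebesgue (?D (-1) n i))"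
   by (intro always_eventually allI) (simp only: real_norm_def abs_of_nonneg nrm_nonneg)
  have "(\<Sum>i\<in>(UNIV::'n set). 0 + 0 :: real) = 0" by simp
  with lim show ?thesis by (intro Lim_null_comparison[OF ev]) (simp only:)
 qed
 define \<psi> where "\<psi> x = \<rho> x * \<phi> x" for x
 have t: "test_fun UNIV \<psi>" unfolding \<psi>_def[abs_def] by (intro test_mult \<rho> test_smooth[OF \<phi>(1)])
 have lim1: "(\<lambda>n. LINT x. Q n x * \<psi> x) \<longlonglongrightarrow> - (LINT x. G x \<bullet> grad \<psi> x)"
 proof -
  have "(\<lambda>n. \<Sum>i\<in>UNIV. LINT x. dq (- h n) i (dq (h n) i v) x * \<psi> x) \<longlonglongrightarrow> (\<Sum>i\<in>UNIV. - (LINT x. G x $ i * pd i \<psi> x))"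
   by (intro tendsto_sum second_difference_tendsto[OF v t hl h(1,2)])
  moreover have "(\<Sum>i\<in>UNIV. LINT x. dq (- h n) i (dq (h n) i v) x * \<psi> x) = (LINT x. Q n x * \<psi> x)" for n
   unfolding Q_def sum_distrib_right
   by (rule Bochner_Integration.integral_sum[symmetric]) (intro sq_mult sv2 test_sq[OF t])
  moreover have "(\<Sum>i\<in>UNIV. - (LINT x. G x $ i * pd i \<psi> x)) = - (LINT x. G x \<bullet> grad \<psi> x)"
  proof -
   have "(LINT x. G x \<bullet> grad \<psi> x) = (LINT x. (\<Sum>i\<in>UNIV. G x $ i * pd i \<psi> x))"
    by (simp add: inner_vec_def grad_nth)
   also have "\<dots> = (\<Sum>i\<in>UNIV. LINT x. G x $ i * pd i \<psi> x)"
    by (rule Bochner_Integration.integral_sum)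
      (intro sq_mult sq_nth(1) gcl_sq(2)[OF v] test_sq[OF test_pd[OF t]])
   finally show ?thesis by (simp add: sum_negf)
  qed
  ultimately show ?thesis by simp
 qed
 have bound: "\<bar>LINT x. Q n x * \<psi> x\<bar> \<le> real CARD('n) * C * (B * (nrm lebesgue (\<lambda>x. \<rho> x - I x) + nrm lebesgue (\<lambda>x. I x - J n x)))" for n
 proof -
  note s\<phi> = test_sq[OF \<phi>(1)] and sr = test_sq[OF \<rho>]
  have d1: "sq lebesgue (\<lambda>x. \<rho> x - J n x)" by (intro sq_diff sr sqJ)
  have d2: "sq lebesgue (\<lambda>x. \<phi> x * (\<rho> x - J n x))" "nrm lebesgue (\<lambda>x. \<phi> x * (\<rho> x - J n x)) \<le> B * nrm lebesgue (\<lambda>x. \<rho> x - J n x)"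
   using sq_bounded_scale[OF d1 test_leb[OF \<phi>(1)], of B] \<phi>(3) Bp by auto
  \<comment> \<open>By \<open>Q0\<close> a vanishing term may be subtracted, so that only the
    distance of \<open>\<rho>\<close> to \<open>J n\<close> enters the estimate.\<close>
  have "Q n x * \<psi> x = Q n x * (\<phi> x * (\<rho> x - J n x))" for x
   using Q0[of n x] by (simp add: \<psi>_def algebra_simps)
  then have "\<bar>LINT x. Q n x * \<psi> x\<bar> = \<bar>LINT x. Q n x * (\<phi> x * (\<rho> x - J n x))\<bar>" by (simp only:)
  also have "\<dots> \<le> nrm lebesgue (Q n) * nrm lebesgue (\<lambda>x. \<phi> x * (\<rho> x - J n x))"
   using CS[OF sQ(1) d2(1)] by simp
  also have "\<dots> \<le> (real CARD('n) * C) * (B * nrm lebesgue (\<lambda>x. \<rho> x - J n x))"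
   using sQ(2)[of n] d2(2) order_trans[OF nrm_nonneg sQ(2)[of n]] by (intro mult_mono) auto
  also have "\<dots> \<le> (real CARD('n) * C) * (B * (nrm lebesgue (\<lambda>x. \<rho> x - I x) + nrm lebesgue (\<lambda>x. I x - J n x)))"
   using nrm_triangle_diff[OF sr sqE sqJ] order_trans[OF nrm_nonneg sQ(2)[of n]] Bp by (intro mult_left_mono) auto
  finally show ?thesis .
 qed
 have "(\<lambda>n. real CARD('n) * C * (B * (nrm lebesgue (\<lambda>x. \<rho> x - I x) + nrm lebesgue (\<lambda>x. I x - J n x))))
   \<longlonglongrightarrow> real CARD('n) * C * (B * (nrm lebesgue (\<lambda>x. \<rho> x - I x) + 0))"
  by (intro tendsto_intros JI)
 then have "\<bar>- (LINT x. G x \<bullet> grad \<psi> x)\<bar> \<le> real CARD('n) * C * (B * (nrm lebesgue (\<lambda>x. \<rho> x - I x) + 0))"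
  by (rule LIMSEQ_le[OF tendsto_rabs[OF lim1]]) (use bound in auto)
 then show ?thesis by (simp add: \<psi>_def[abs_def] I_def mult.assoc)
qed


text \<open>Where \<open>u\<close> is constant, its second differences vanish, hence so does \<open>- \<Delta>u\<close>: a
 distribution equal to \<open>f\<close> up to an error carried by \<open>{u = a}\<close> is \<open>f\<close> off \<open>{u = a}\<close>.\<close>

lemma plateau:
 fixes u :: "real^'n::finite => real"
 assumes \<Omega>: "open \<Omega>" "bounded \<Omega>" and u: "H01 \<Omega> u g" and f: "f \<in> borel_measurable lebesgue"
  and loc: "\<And>K. compact K ==> K \<subseteq> \<Omega> ==> \<exists>C. AE x in lebesgue. x \<in> K --> \<bar>f x\<bar> \<le> C"
  and E_def: "E = {x \<in> \<Omega>. u x = a}" and D: "0 \<le> D"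
  and key: "\<And>\<phi>. test_fun \<Omega> \<phi> ==> \<bar>(LINT x. g x \<bullet> grad \<phi> x) - (LINT x. f x * \<phi> x)\<bar>
    \<le> D * (LINT x. indicator E x * \<bar>\<phi> x\<bar>)"
  and \<phi>: "test_fun \<Omega> \<phi>"
 shows "(LINT x. g x \<bullet> grad \<phi> x) = (LINT x. f x * \<phi> x) - (LINT x. indicator E x * (f x * \<phi> x))"
proof -
 have [measurable]: "u \<in> borel_measurable lebesgue" by (rule gcl_leb[OF u])
 have "{x \<in> space lebesgue. u x = a} \<in> sets lebesgue" by measurable
 then have mE: "E \<in> sets lebesgue"
  using \<Omega>(1) sets.Int[of "\<Omega>" lebesgue "{x. u x = a}"] unfolding E_def by (simp add: Int_def)
 have bE: "bounded E" using \<Omega>(2) by (rule bounded_subset) (auto simp: E_def)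
 have sqE: "sq lebesgue (indicator E :: _ => real)" using sq_indicator[OF mE bE, of 1] by simp
 obtain K where K: "compact K" "K \<subseteq> \<Omega>" "\<And>x. x \<notin> K ==> \<phi> x = 0" using \<phi> unfolding test_fun_def by blast
 obtain \<eta> V where \<eta>: "test_fun \<Omega> \<eta>" "\<forall>x. 0 \<le> \<eta> x \<and> \<eta> x \<le> 1" "open V" "K \<subseteq> V" "\<forall>x\<in>V. \<eta> x = 1"
  by (rule cutoff[OF K(1) \<Omega>(1) K(2)])
 obtain L where L: "compact L" "L \<subseteq> \<Omega>" "\<And>x. x \<notin> L ==> \<eta> x = 0" using \<eta>(1) unfolding test_fun_def by blast
 have VL: "V \<subseteq> L" using \<eta>(5) L(3) by force
 obtain C where C: "AE x in lebesgue. x \<in> L --> \<bar>f x\<bar> \<le> C" using loc[OF L(1,2)] by blast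
 have sf: "sq lebesgue (\<lambda>x. \<psi> x * f x)" if p: "test_fun UNIV \<psi>" "\<And>x. x \<notin> L ==> \<psi> x = 0" for \<psi>
 proof (rule sq_bound[OF sq_cmult[OF test_sq[OF p(1)], of C]])
  show "(\<lambda>x. \<psi> x * f x) \<in> borel_measurable lebesgue" using f test_leb[OF p(1)] by simp
  show "AE x in lebesgue. norm (\<psi> x * f x) \<le> norm (C * \<psi> x)"
   using C
  proof eventually_elim
   case (elim x)
   show ?case
   proof (cases "x \<in> L")
    case True
    then have "\<bar>f x\<bar> * \<bar>\<psi> x\<bar> \<le> \<bar>C\<bar> * \<bar>\<psi> x\<bar>" using elim by (intro mult_right_mono) auto
    then show ?thesis by (simp add: abs_mult mult.commute)
   next
    case False then show ?thesis using p(2) by simp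
   qed
  qed
 qed
 note uU = H01_UNIV[OF u]
 note s\<eta> = test_smooth[OF \<eta>(1)]
 have t\<eta>: "test_fun UNIV \<eta>" using test_mono[OF \<eta>(1)] by simp
 \<comment> \<open>Difference quotients need a function on the whole space; the cutoff is 1 near the
   support of \<open>\<phi>\<close>, where nothing changes.\<close>
 define v where "v x = \<eta> x * u x" for x
 define G where "G x = \<eta> x *\<^sub>R g x + u x *\<^sub>R grad \<eta> x" for x
 have v: "H01 UNIV v G" unfolding v_def[abs_def] G_def[abs_def] by (rule H01_mult_test[OF uU t\<eta>])
 obtain B0 where B0: "\<And>x. norm (grad \<eta> x) \<le> B0" using test_bound1[OF \<eta>(1)] by metis
 define A1 where "A1 = nrm lebesgue (\<lambda>x. \<eta> x * f x) + D * nrm lebesgue \<eta>"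
 define W where "W x = g x \<bullet> grad \<eta> x" for x
 have sW: "sq lebesgue W" 
 proof (rule sq_bound[OF sq_cmult[OF sq_norm[OF gcl_sq(2)[OF u]], of B0]])
  show "W \<in> borel_measurable lebesgue" unfolding W_def[abs_def]
   by (intro borel_measurable_inner gcl_leb(2)[OF u] test_grad_leb[OF \<eta>(1)])
  show "AE x in lebesgue. norm (W x) \<le> norm (B0 * norm (g x))"
  proof (rule AE_I2)
   fix x
   have "\<bar>W x\<bar> \<le> norm (g x) * norm (grad \<eta> x)" unfolding W_def by (rule Cauchy_Schwarz_ineq2)
   also have "\<dots> \<le> norm (g x) * B0" by (intro mult_left_mono B0) simp
   finally show "norm (W x) \<le> norm (B0 * norm (g x))" by (simp add: mult.commute)
  qed
 qed
 \<comment> \<open>The term of \<open>u\<close> with the product of \<open>grad \<eta>\<close> and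
   \<open>grad \<psi>\<close> still contains a derivative of \<open>\<psi>\<close>. These gradients
   allow it to be integrated by parts, leaving only the L2 norm of \<open>\<psi>\<close>.\<close>
 define gi where "gi i x = pd i \<eta> x *\<^sub>R g x + u x *\<^sub>R grad (pd i \<eta>) x" for i x
 have gi: "H01 UNIV (\<lambda>x. pd i \<eta> x * u x) (gi i)" for i
  unfolding gi_def[abs_def] by (rule H01_mult_test[OF uU test_pd[OF t\<eta>]])
 define A where "A = A1 + nrm lebesgue W + (\<Sum>i\<in>UNIV. nrm lebesgue (\<lambda>x. gi i x $ i))"
 have A0: "0 \<le> A" using D by (simp add: A_def A1_def sum_nonneg)
 have bound: "\<bar>LINT x. G x \<bullet> grad \<psi> x\<bar> \<le> A * nrm lebesgue \<psi>" if \<psi>: "test_fun UNIV \<psi>" for \<psi>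
 proof -
  note s\<psi> = test_sq[OF \<psi>] and sm = test_smooth[OF \<psi>]
  have t: "test_fun \<Omega> (\<lambda>x. \<eta> x * \<psi> x)" by (rule test_mult[OF \<eta>(1) sm])
  have G1: "G x \<bullet> grad \<psi> x = g x \<bullet> grad (\<lambda>x. \<eta> x * \<psi> x) x - W x * \<psi> x + (\<Sum>i\<in>UNIV. pd i \<eta> x * u x * pd i \<psi> x)" for x
  proof -
   have "(\<Sum>i\<in>UNIV. pd i \<eta> x * u x * pd i \<psi> x) = u x * (grad \<eta> x \<bullet> grad \<psi> x)"
    by (simp add: inner_vec_def grad_nth sum_distrib_left mult_ac)
   then show ?thesis unfolding G_def W_def grad_mult[OF s\<eta> sm] by (simp add: algebra_simps)
  qed
  have i1: "integrable lebesgue (\<lambda>x. g x \<bullet> grad (\<lambda>x. \<eta> x * \<psi> x) x)" by (intro sq_inner gcl_sq(2)[OF u] test_grad_sq[OF t])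
  have i2: "integrable lebesgue (\<lambda>x. W x * \<psi> x)" by (intro sq_mult sW s\<psi>)
  have i3: "integrable lebesgue (\<lambda>x. pd i \<eta> x * u x * pd i \<psi> x)" for i
   by (intro sq_mult gcl_sq(1)[OF gi] test_sq[OF test_pd[OF \<psi>]])
  have split: "(LINT x. G x \<bullet> grad \<psi> x) = (LINT x. g x \<bullet> grad (\<lambda>x. \<eta> x * \<psi> x) x)
    - (LINT x. W x * \<psi> x) + (\<Sum>i\<in>UNIV. LINT x. pd i \<eta> x * u x * pd i \<psi> x)"
   unfolding G1 using i1 i2 i3 by simp
  have b1: "\<bar>LINT x. g x \<bullet> grad (\<lambda>x. \<eta> x * \<psi> x) x\<bar> \<le> A1 * nrm lebesgue \<psi>"
  proof -
   have "\<bar>LINT x. f x * (\<eta> x * \<psi> x)\<bar> \<le> nrm lebesgue (\<lambda>x. \<eta> x * f x) * nrm lebesgue \<psi>"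
    using CS[OF sf[OF t\<eta> L(3)] s\<psi>] by (simp add: mult_ac)
   moreover have "(LINT x. indicator E x * \<bar>\<eta> x * \<psi> x\<bar>) \<le> nrm lebesgue \<eta> * nrm lebesgue \<psi>"
   proof -
    have "(LINT x. indicator E x * \<bar>\<eta> x * \<psi> x\<bar>) \<le> (LINT x. norm (\<eta> x) * norm (\<psi> x))"
    proof (rule integral_mono_AE)
     show i: "integrable lebesgue (\<lambda>x. norm (\<eta> x) * norm (\<psi> x))"
      by (intro sq_mult sq_norm test_sq[OF t\<eta>] s\<psi>)
     show "integrable lebesgue (\<lambda>x. indicator E x * \<bar>\<eta> x * \<psi> x\<bar>)"
      by (rule Bochner_Integration.integrable_bound[OF i])
        (use mE test_leb[OF t\<eta>] test_leb[OF \<psi>] in \<open>auto simp: indicator_def abs_mult intro!: AE_I2 borel_measurable_times borel_measurable_indicator\<close>)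
    qed (auto simp: indicator_def abs_mult)
    also have "\<dots> \<le> nrm lebesgue \<eta> * nrm lebesgue \<psi>" by (rule CS_norm[OF test_sq[OF t\<eta>] s\<psi>])
    finally show ?thesis .
   qed
   then have "D * (LINT x. indicator E x * \<bar>\<eta> x * \<psi> x\<bar>) \<le> D * (nrm lebesgue \<eta> * nrm lebesgue \<psi>)"
    using D by (rule mult_left_mono)
   ultimately show ?thesis using key[OF t] by (simp add: A1_def algebra_simps abs_le_iff)
  qed
  have b2: "\<bar>LINT x. W x * \<psi> x\<bar> \<le> nrm lebesgue W * nrm lebesgue \<psi>"
   using CS[OF sW s\<psi>] by simp
  have b3: "\<bar>LINT x. pd i \<eta> x * u x * pd i \<psi> x\<bar> \<le> nrm lebesgue (\<lambda>x. gi i x $ i) * nrm lebesgue \<psi>" for i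
   using CS[OF sq_nth(1)[OF gcl_sq(2)[OF gi[of i]], of i] s\<psi>] H01_ibp[OF gi[of i] \<psi>, of i] by simp
  have "\<bar>\<Sum>i\<in>UNIV. LINT x. pd i \<eta> x * u x * pd i \<psi> x\<bar> \<le> (\<Sum>i\<in>UNIV. nrm lebesgue (\<lambda>x. gi i x $ i) * nrm lebesgue \<psi>)"
   by (rule order_trans[OF sum_abs sum_mono[OF b3]])
  then show ?thesis unfolding split A_def using b1 b2
   by (simp add: distrib_right sum_distrib_right abs_le_iff)
 qed
 have \<phi>U: "test_fun UNIV \<phi>" using test_mono[OF \<phi>] by simp
 obtain B where B: "\<And>x. \<bar>\<phi> x\<bar> \<le> B" using test_bound1[OF \<phi>] by metis
 have vE: "v x = a" if "x \<in> E \<inter> V" for x using that \<eta>(5) by (simp add: v_def E_def)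
 have "\<exists>\<rho>. test_fun UNIV \<rho> \<and> (\<forall>x. 0 \<le> \<rho> x \<and> \<rho> x \<le> 1) \<and> nrm lebesgue (\<lambda>x. \<rho> x - indicator E x) < 1 / real (Suc n)" for n
 proof -
  have pos: "0 < 1 / real (Suc n)" by simp
  obtain \<rho> where "test_fun UNIV \<rho>" "\<forall>x. 0 \<le> \<rho> x \<and> \<rho> x \<le> 1" "nrm lebesgue (\<lambda>x. \<rho> x - indicator E x) < 1 / real (Suc n)"
   by (rule indicator_approx[OF mE bE pos])
  then show ?thesis by blast
 qed
 then have "\<forall>n. \<exists>\<rho>. test_fun UNIV \<rho> \<and> (\<forall>x. 0 \<le> \<rho> x \<and> \<rho> x \<le> 1) \<and> nrm lebesgue (\<lambda>x. \<rho> x - indicator E x) < 1 / real (Suc n)" by blast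
 from choice[OF this] obtain \<rho> where "\<forall>n. test_fun UNIV (\<rho> n) \<and> (\<forall>x. 0 \<le> \<rho> n x \<and> \<rho> n x \<le> 1) \<and>
   nrm lebesgue (\<lambda>x. \<rho> n x - indicator E x) < 1 / real (Suc n)" by (elim exE) (rule that)
 then have \<rho>: "\<And>n. test_fun UNIV (\<rho> n)" "\<And>n x. 0 \<le> \<rho> n x \<and> \<rho> n x \<le> 1"
  "\<And>n. nrm lebesgue (\<lambda>x. \<rho> n x - indicator E x) < 1 / real (Suc n)" by auto
 have \<rho>lim: "(\<lambda>n. nrm lebesgue (\<lambda>x. \<rho> n x - indicator E x)) \<longlonglongrightarrow> 0"
  by (rule Lim_null_comparison[OF _ inv_Suc_lim]) (use less_imp_le[OF \<rho>(3)] in \<open>auto intro!: always_eventually simp del: of_nat_Suc\<close>)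
 define \<psi> where "\<psi> n x = \<rho> n x * \<phi> x" for n x
 have t\<psi>: "test_fun \<Omega> (\<psi> n)" for n
  unfolding \<psi>_def[abs_def] using test_mult[OF \<phi> test_smooth[OF \<rho>(1)]] by (simp add: mult.commute)
 \<comment> \<open>On \<open>V\<close> the cutoff is 1 with zero gradient, and off \<open>V\<close>
   the gradient of the test function vanishes, so \<open>v\<close> may be exchanged for
   \<open>u\<close>.\<close>
 have GV: "G x \<bullet> grad (\<psi> n) x = g x \<bullet> grad (\<psi> n) x" for n x
 proof (cases "x \<in> V")
  case True
  have "grad \<eta> x = 0" using grad_const_on_open[OF \<eta>(3), of \<eta> 1 x] \<eta>(5) s\<eta> True by blast
  then show ?thesis using \<eta>(5) True by (simp add: G_def)
 next
  case False
  then have "x \<notin> K" using \<eta>(4) by blast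
  moreover have "test_fun K (\<psi> n)" using K(1,3) test_smooth[OF t\<psi>[of n]] unfolding test_fun_def \<psi>_def by auto
  ultimately have "grad (\<psi> n) x = 0" using test_grad_off by blast
  then show ?thesis by simp
 qed
 have lim1: "(\<lambda>n. LINT x. g x \<bullet> grad (\<psi> n) x) \<longlonglongrightarrow> 0"
 proof (rule Lim_null_comparison)
  show "(\<lambda>n. real CARD('n) * A * B * nrm lebesgue (\<lambda>x. \<rho> n x - indicator E x)) \<longlonglongrightarrow> 0"
   by (rule tendsto_mult_right_zero[OF \<rho>lim])
  show "\<forall>\<^sub>F n in sequentially. norm (LINT x. g x \<bullet> grad (\<psi> n) x) \<le> real CARD('n) * A * B * nrm lebesgue (\<lambda>x. \<rho> n x - indicator E x)"
  proof (intro always_eventually allI)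
   fix n
   show "norm (LINT x. g x \<bullet> grad (\<psi> n) x) \<le> real CARD('n) * A * B * nrm lebesgue (\<lambda>x. \<rho> n x - indicator E x)"
    using plateau_localized[OF v bound A0 mE bE K(1) \<eta>(3,4) vE \<phi>U K(3) B \<rho>(1)[of n]]
    unfolding \<psi>_def[symmetric, abs_def] by (simp add: GV)
  qed
 qed
 have s\<phi>f: "sq lebesgue (\<lambda>x. \<phi> x * f x)" by (rule sf[OF \<phi>U]) (use K(3) VL \<eta>(4) in auto)
 have f\<psi>: "(LINT x. f x * \<psi> n x) = (LINT x. (\<phi> x * f x) * \<rho> n x)" for n
  by (simp add: \<psi>_def mult_ac)
 have L\<rho>: "L2lim lebesgue \<rho> (indicator E :: _ => real)"
  unfolding L2lim_def using \<rho>lim test_sq[OF \<rho>(1)] sqE by auto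
 have lim2: "(\<lambda>n. LINT x. f x * \<psi> n x) \<longlonglongrightarrow> (LINT x. indicator E x * (f x * \<phi> x))"
  using L2lim_inner[OF L2lim_const[OF s\<phi>f] L\<rho>] unfolding f\<psi> by (simp add: mult_ac)
 \<comment> \<open>The bound \<open>key\<close> sees a test function only on \<open>E\<close>; there
   \<open>\<phi> x - \<psi> n x\<close> is \<open>\<phi> x\<close> times
   \<open>1 - \<rho> n x\<close>, which tends to 0 in L2.\<close>
 have diff: "\<bar>((LINT x. g x \<bullet> grad \<phi> x) - (LINT x. f x * \<phi> x)) - ((LINT x. g x \<bullet> grad (\<psi> n) x) - (LINT x. f x * \<psi> n x))\<bar>
   \<le> D * (nrm lebesgue \<phi> * nrm lebesgue (\<lambda>x. \<rho> n x - indicator E x))" for n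
 proof -
  define \<zeta> where "\<zeta> x = \<phi> x - \<psi> n x" for x
  have t: "test_fun \<Omega> \<zeta>" unfolding \<zeta>_def[abs_def] by (intro test_diff \<phi> t\<psi>)
  have "grad \<zeta> x = grad \<phi> x - grad (\<psi> n) x" for x
   unfolding \<zeta>_def[abs_def] by (rule grad_diff[OF test_smooth[OF \<phi>] test_smooth[OF t\<psi>]])
  then have a: "(LINT x. g x \<bullet> grad \<zeta> x) = (LINT x. g x \<bullet> grad \<phi> x) - (LINT x. g x \<bullet> grad (\<psi> n) x)"
   by (simp add: inner_diff_right sq_inner gcl_sq(2)[OF u] test_grad_sq[OF \<phi>] test_grad_sq[OF t\<psi>])
  have i1: "integrable lebesgue (\<lambda>x. f x * \<phi> x)" 
   using sq_mult[OF sf[OF t\<eta> L(3)] test_sq[OF \<phi>]] K(3) \<eta>(4,5)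
   by (rule_tac Bochner_Integration.integrable_cong[THEN iffD1, rotated 2, of lebesgue "\<lambda>x. \<eta> x * f x * \<phi> x"]) force+
  have i2: "integrable lebesgue (\<lambda>x. f x * \<psi> n x)" 
   using sq_mult[OF s\<phi>f test_sq[OF \<rho>(1)[of n]]] by (simp add: \<psi>_def mult_ac)
  have b: "(LINT x. f x * \<zeta> x) = (LINT x. f x * \<phi> x) - (LINT x. f x * \<psi> n x)"
   using i1 i2 by (simp add: \<zeta>_def right_diff_distrib)
  have "indicator E x * \<bar>\<zeta> x\<bar> \<le> norm (\<phi> x) * norm (\<rho> n x - indicator E x)" for x
  proof (cases "x \<in> E")
   case True
   have "\<zeta> x = - (\<phi> x * (\<rho> n x - 1))" by (simp add: \<zeta>_def \<psi>_def algebra_simps)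
   then show ?thesis using True by (simp add: abs_mult)
  qed simp
  then have "(LINT x. indicator E x * \<bar>\<zeta> x\<bar>) \<le> (LINT x. norm (\<phi> x) * norm (\<rho> n x - indicator E x))"
   using sq_mult[OF sqE sq_norm[OF test_sq[OF t]]]
   by (intro integral_mono sq_mult[OF sq_norm[OF test_sq[OF \<phi>]] sq_norm[OF sq_diff[OF test_sq[OF \<rho>(1)] sqE]]]) auto
  also have "\<dots> \<le> nrm lebesgue \<phi> * nrm lebesgue (\<lambda>x. \<rho> n x - indicator E x)"
   by (intro CS_norm test_sq[OF \<phi>] sq_diff test_sq[OF \<rho>(1)] sqE)
  finally have "D * (LINT x. indicator E x * \<bar>\<zeta> x\<bar>) \<le> D * (nrm lebesgue \<phi> * nrm lebesgue (\<lambda>x. \<rho> n x - indicator E x))"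
   using D by (rule mult_left_mono)
  then show ?thesis using key[OF t] unfolding a b by (simp add: algebra_simps)
 qed
 have "(\<lambda>n. ((LINT x. g x \<bullet> grad \<phi> x) - (LINT x. f x * \<phi> x)) - ((LINT x. g x \<bullet> grad (\<psi> n) x) - (LINT x. f x * \<psi> n x))) \<longlonglongrightarrow> 0"
 proof (rule Lim_null_comparison)
  show "(\<lambda>n. D * (nrm lebesgue \<phi> * nrm lebesgue (\<lambda>x. \<rho> n x - indicator E x))) \<longlonglongrightarrow> 0"
   by (intro tendsto_mult_right_zero \<rho>lim)
 qed (use diff in \<open>auto intro!: always_eventually\<close>)
 moreover have "(\<lambda>n. ((LINT x. g x \<bullet> grad \<phi> x) - (LINT x. f x * \<phi> x)) - ((LINT x. g x \<bullet> grad (\<psi> n) x) - (LINT x. f x * \<psi> n x)))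
   \<longlonglongrightarrow> ((LINT x. g x \<bullet> grad \<phi> x) - (LINT x. f x * \<phi> x)) - (0 - (LINT x. indicator E x * (f x * \<phi> x)))"
  by (intro tendsto_diff tendsto_const lim1 lim2)
 ultimately have "0 = ((LINT x. g x \<bullet> grad \<phi> x) - (LINT x. f x * \<phi> x)) - (0 - (LINT x. indicator E x * (f x * \<phi> x)))"
  by (rule LIMSEQ_unique)
 then show ?thesis by simp
qed

subsection \<open>Supersolutions and the distance barrier\<close>

lemma gcl_seq_ex:
 assumes "gcl T u g" "T \<subseteq> tests \<Omega>"
 shows "\<exists>\<phi>. (\<forall>n. \<phi> n \<in> T) \<and> L2lim lebesgue \<phi> u \<and> L2lim lebesgue (\<lambda>n. grad (\<phi> n)) g"
 using gcl_seq[OF assms] by metis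

text \<open>\<open>\<zeta>\<close> is approximated by nonnegative test functions. Fatou's lemma on
  the left-hand side yields integrability and inequality together, although \<open>F\<close> may
  blow up at the boundary.\<close>

lemma super_test:
 assumes u: "H01 \<Omega> u g" and F: "F \<in> borel_measurable lebesgue" "AE x in lebesgue. 0 \<le> F x"
  and sup: "\<And>\<phi>. test_fun \<Omega> \<phi> ==> \<forall>x. 0 \<le> \<phi> x ==>
    integrable lebesgue (\<lambda>x. F x * \<phi> x) \<and> (LINT x. F x * \<phi> x) \<le> (LINT x. g x \<bullet> grad \<phi> x)"
  and \<zeta>: "H01 \<Omega> \<zeta> k" "AE x in lebesgue. 0 \<le> \<zeta> x"
 shows "integrable lebesgue (\<lambda>x. F x * \<zeta> x)"
  "(LINT x. F x * \<zeta> x) \<le> (LINT x. g x \<bullet> k x)"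
proof -
 have sub: "ptests \<Omega> \<subseteq> tests \<Omega>" by auto
 from gcl_seq_ex[OF H01_nonneg[OF \<zeta>] sub]
 obtain \<phi>0 where \<phi>0: "\<forall>n. \<phi>0 n \<in> ptests \<Omega>" "L2lim lebesgue \<phi>0 \<zeta>" "L2lim lebesgue (\<lambda>n. grad (\<phi>0 n)) k"
  by (elim exE conjE) (rule that)
 obtain r where r: "strict_mono r" "AE x in lebesgue. (\<lambda>n. \<phi>0 (r n) x) \<longlonglongrightarrow> \<zeta> x"
  by (rule L2lim_AE_subseq[OF \<phi>0(2)])
 have p: "test_fun \<Omega> (\<phi>0 (r n))" "\<forall>x. 0 \<le> \<phi>0 (r n) x" for n using \<phi>0(1) by auto
 have lim: "(\<lambda>n. LINT x. g x \<bullet> grad (\<phi>0 (r n)) x) \<longlonglongrightarrow> (LINT x. g x \<bullet> k x)"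
  by (intro L2lim_inner L2lim_const gcl_sq(2)[OF u] L2lim_subseq[OF \<phi>0(3) r(1)])
 have m: "(\<lambda>x. F x * \<zeta> x) \<in> borel_measurable lebesgue" using F gcl_leb(1)[OF \<zeta>(1)] by simp
 have nn: "AE x in lebesgue. 0 \<le> F x * \<phi>0 (r n) x" for n
  using F(2) by eventually_elim (use p(2) in simp)
 have pt: "AE x in lebesgue. (\<lambda>n. F x * \<phi>0 (r n) x) \<longlonglongrightarrow> F x * \<zeta> x"
  using r(2) by eventually_elim (intro tendsto_mult_left)
 show "integrable lebesgue (\<lambda>x. F x * \<zeta> x)" "(LINT x. F x * \<zeta> x) \<le> (LINT x. g x \<bullet> k x)"
  using fatou_real[OF conjunct1[OF sup[OF p]] nn m pt conjunct2[OF sup[OF p]] lim] by auto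
qed

section \<open>The primitive of the singular term and its concavity\<close>

lemma Fp_deriv: "x > 0 ==> (Fp \<delta> has_real_derivative x powr (-\<delta>)) (at x)"
proof (cases "\<delta> = 1")
 case True
 assume "x > 0"
 then show ?thesis using True unfolding Fp_def[abs_def]
  by (auto intro!: derivative_eq_intros simp: powr_minus inverse_eq_divide)
next
 case False
 assume x: "x > 0"
 have "((\<lambda>x. x powr (1 - \<delta>) / (1 - \<delta>)) has_real_derivative x powr (-\<delta>)) (at x)"
  using x False by (auto intro!: derivative_eq_intros)
 then show ?thesis using False unfolding Fp_def[abs_def] by simp
qed

lemma Fp_mono: "0 < x ==> x \<le> y ==> Fp \<delta> x \<le> Fp \<delta> y"
 by (rule DERIV_nonneg_imp_nondecreasing[of x y])
   (auto intro!: exI[of _ "t powr (-\<delta>)" for t] Fp_deriv)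

lemma Fp_concave:
 assumes "0 < x" "0 < y" "0 < \<delta>" shows "Fp \<delta> y - Fp \<delta> x \<le> x powr (-\<delta>) * (y - x)"
proof (cases x y rule: linorder_cases)
 case less
 obtain z where z: "x < z" "z < y" "Fp \<delta> y - Fp \<delta> x = (y - x) * z powr (-\<delta>)"
  using MVT2[OF less, of "Fp \<delta>" "\<lambda>z. z powr (-\<delta>)"] Fp_deriv assms by auto
 have "z powr (-\<delta>) \<le> x powr (-\<delta>)" using z assms by (intro powr_mono2') auto
 then show ?thesis using z less by (simp add: mult.commute)
next
 case greater
 obtain z where z: "y < z" "z < x" "Fp \<delta> x - Fp \<delta> y = (x - y) * z powr (-\<delta>)"
  using MVT2[OF greater, of "Fp \<delta>" "\<lambda>z. z powr (-\<delta>)"] Fp_deriv assms by auto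
 have "x powr (-\<delta>) \<le> z powr (-\<delta>)" using z assms by (intro powr_mono2') auto
 then have "(x - y) * x powr (-\<delta>) \<le> (x - y) * z powr (-\<delta>)" using greater by (intro mult_left_mono) auto
 then show ?thesis using z(3) by (simp add: algebra_simps)
qed simp

text \<open>On positive arguments G is the untruncated primitive frozen at height \<open>a\<close>,
  since the integrand is zero from \<open>a\<close> on. All further properties of G are read off
  from this form.\<close>

lemma Gfun_eq:
 assumes "0 < a" "0 < s" shows "Gfun a \<delta> s = Fp \<delta> (min s a)"
proof (cases "s < a / 2")
 case True
 then show ?thesis using assms by (simp add: Gfun_def min_def)
next
 case False
 let ?f = "\<lambda>t. if t < a then t powr (-\<delta>) else 0"
 define m where "m = min s a"
 have m: "a / 2 \<le> m" "m \<le> s" using False assms by (auto simp: m_def)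
 have 1: "(?f has_integral (Fp \<delta> m - Fp \<delta> (a/2))) {a/2..m}"
 proof (rule has_integral_spike_finite[of "{m}"])
  show "((\<lambda>t. t powr (-\<delta>)) has_integral (Fp \<delta> m - Fp \<delta> (a/2))) {a/2..m}"
   by (rule fundamental_theorem_of_calculus[OF m(1)])
     (use assms in \<open>auto intro!: has_real_derivative_iff_has_vector_derivative[THEN iffD1] has_field_derivative_at_within Fp_deriv\<close>)
 qed (auto simp: m_def)
 have 2: "(?f has_integral 0) {m..s}"
 proof (cases "s \<le> a")
  case True
  then have "m = s" by (simp add: m_def)
  then show ?thesis by (simp add: has_integral_refl)
 next
  case False
  then have "m = a" by (simp add: m_def)
  then show ?thesis by (intro has_integral_is_0) auto
 qed
 have "(?f has_integral (Fp \<delta> m - Fp \<delta> (a/2) + 0)) {a/2..s}"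
  by (rule has_integral_combine[OF m 1 2])
 then have "integral {a/2..s} ?f = Fp \<delta> m - Fp \<delta> (a/2)" by (simp add: integral_unique)
 then show ?thesis using False assms by (simp add: Gfun_def m_def)
qed

lemma Gfun_nonpos: "s \<le> 0 ==> Gfun a \<delta> s = 0"
 by (simp add: Gfun_def)

lemma Gfun_le: "0 < a ==> 0 < s ==> Gfun a \<delta> s \<le> Fp \<delta> a"
 by (simp add: Gfun_eq Fp_mono)

lemma Gfun_mono: "0 < a ==> 0 < s ==> s \<le> t ==> Gfun a \<delta> s \<le> Gfun a \<delta> t"
 by (simp add: Gfun_eq Fp_mono)

lemma Fp_continuous: "continuous_on {0<..} (Fp \<delta>)"
 by (intro continuous_at_imp_continuous_on ballI DERIV_isCont[OF Fp_deriv]) auto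

lemma Gfun_continuous: "0 < a ==> continuous_on {0<..} (Gfun a \<delta>)"
proof -
 assume a: "0 < a"
 have "continuous_on {0<..} (\<lambda>s. Fp \<delta> (min s a))"
  using a by (intro continuous_on_compose2[OF Fp_continuous] continuous_intros) auto
 then show ?thesis using a by (subst continuous_on_cong[OF refl, of _ _ "\<lambda>s. Fp \<delta> (min s a)"]) (auto simp: Gfun_eq)
qed

lemma Gfun_tendsto: "0 < a ==> 0 < l ==> (\<lambda>n. s n) \<longlonglongrightarrow> l ==> (\<lambda>n. Gfun a \<delta> (s n)) \<longlonglongrightarrow> Gfun a \<delta> l"
 using Gfun_continuous[of a \<delta>] by (intro isCont_tendsto_compose[of _ "Gfun a \<delta>"]) (auto simp: continuous_on_eq_continuous_at)

lemma Gfun_borel: "0 < a ==> Gfun a \<delta> \<in> borel_measurable borel"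
proof -
 assume a: "0 < a"
 have "(\<lambda>s. if s \<le> 0 then 0 else if \<delta> = 1 then ln (min s a) else (min s a) powr (1 - \<delta>) / (1 - \<delta>)) \<in> borel_measurable borel"
  by measurable
 moreover have "Gfun a \<delta> = (\<lambda>s. if s \<le> 0 then 0 else if \<delta> = 1 then ln (min s a) else (min s a) powr (1 - \<delta>) / (1 - \<delta>))"
  using a by (auto simp: fun_eq_iff Gfun_nonpos Gfun_eq Fp_def)
 ultimately show ?thesis by simp
qed

text \<open>Freezing an increasing concave function keeps it concave. At the kink
  \<open>s = a\<close> the supergradient chosen by \<open>rhs_S\<close> is the right derivative
  0.\<close>

lemma Gfun_concave:
 assumes "0 < a" "0 < \<delta>" "0 < s" "0 < t" shows "Gfun a \<delta> t - Gfun a \<delta> s \<le> rhs_S a \<delta> s * (t - s)"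
proof (cases "s < a")
 case True
 have "Fp \<delta> (min t a) - Fp \<delta> s \<le> s powr (-\<delta>) * (min t a - s)" using assms by (intro Fp_concave) auto
 also have "\<dots> \<le> s powr (-\<delta>) * (t - s)" by (intro mult_left_mono) auto
 finally show ?thesis using True assms by (simp add: Gfun_eq rhs_S_def)
next
 case False
 then have "Gfun a \<delta> s = Fp \<delta> a" using assms by (simp add: Gfun_eq)
 then show ?thesis using False Gfun_le[OF assms(1,4), of \<delta>] by (simp add: rhs_S_def)
qed

lemma Gfun_mid:
 assumes "0 < a" "0 < \<delta>" "0 < s" "0 < t"
 shows "Gfun a \<delta> s / 2 + Gfun a \<delta> t / 2 \<le> Gfun a \<delta> ((s + t) / 2)"
proof -
 define m where "m = (s + t) / 2"
 have m: "0 < m" using assms by (simp add: m_def)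
 have "Gfun a \<delta> s - Gfun a \<delta> m + (Gfun a \<delta> t - Gfun a \<delta> m) \<le> rhs_S a \<delta> m * (s - m) + rhs_S a \<delta> m * (t - m)"
  using assms m by (intro add_mono Gfun_concave) auto
 also have "\<dots> = rhs_S a \<delta> m * (s + t - 2 * m)" by (simp add: algebra_simps)
 also have "\<dots> = 0" by (simp add: m_def)
 finally show ?thesis by (simp add: m_def)
qed

lemma rhs_S_nonneg: "0 \<le> rhs_S a \<delta> s"
 by (simp add: rhs_S_def)

lemma rhs_S_borel: "rhs_S a \<delta> \<in> borel_measurable borel"
 unfolding rhs_S_def[abs_def] by measurable

lemma rhs_P_eq: "rhs_P T a \<delta> s = s powr (crit_exp T - 1) + rhs_S a \<delta> s"
 by (simp add: rhs_P_def rhs_S_def)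

text \<open>The gradient is explicit and \<open>F\<close> includes the parameter. Positivity is
  demanded only almost everywhere; for the singular problem the distance barrier makes it locally
  uniform.\<close>

definition supersol :: "(real^'n::finite) set => (real => real) => (real^'n => real) => (real^'n => real^'n) => bool" where
 "supersol \<Omega> F u g \<longleftrightarrow> H01 \<Omega> u g \<and> (AE x in lebesgue. x \<in> \<Omega> --> 0 < u x) \<and>
   (\<forall>\<phi>. test_fun \<Omega> \<phi> --> (\<forall>x. 0 \<le> \<phi> x) --> integrable lebesgue (\<lambda>x. F (u x) * \<phi> x) \<and>
    (LINT x. F (u x) * \<phi> x) \<le> (LINT x. g x \<bullet> grad \<phi> x))"

lemma supersol_nonneg:
 assumes "supersol \<Omega> F u g" shows "AE x in lebesgue. 0 \<le> u x"
proof -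
 have "AE x in lebesgue. x \<notin> \<Omega> --> u x = 0 \<and> g x = 0" "AE x in lebesgue. x \<in> \<Omega> --> 0 < u x"
  using assms H01_off unfolding supersol_def by blast+
 then show ?thesis by eventually_elim force
qed

lemma supersol_test:
 assumes "supersol \<Omega> F u g" "F \<in> borel_measurable borel" "\<And>s. 0 \<le> F s" "H01 \<Omega> \<zeta> k" "AE x in lebesgue. 0 \<le> \<zeta> x"
 shows "integrable lebesgue (\<lambda>x. F (u x) * \<zeta> x)" "(LINT x. F (u x) * \<zeta> x) \<le> (LINT x. g x \<bullet> k x)"
proof -
 have "H01 \<Omega> u g" using assms by (simp add: supersol_def)
 note * = super_test[OF this comp_leb[OF assms(2) gcl_leb(1)[OF this]] _ _ assms(4,5)]
 show "integrable lebesgue (\<lambda>x. F (u x) * \<zeta> x)" by (rule *(1)) (use assms in \<open>auto simp: supersol_def\<close>)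
 show "(LINT x. F (u x) * \<zeta> x) \<le> (LINT x. g x \<bullet> k x)" by (rule *(2)) (use assms in \<open>auto simp: supersol_def\<close>)
qed

text \<open>The distance barrier: every supersolution of the singular problem lies above a rescaled
 bump \<open>\<epsilon> r\<^sup>2 \<beta> ((x - y) / r)\<close> with \<open>r\<close> the distance of \<open>y\<close> to the complement, whose Laplacian is
 bounded independently of \<open>y\<close>.\<close>

lemma supersol_ge_test:
 fixes \<Omega> :: "(real^'n::finite) set"
 assumes \<Omega>: "bounded \<Omega>" and a: "0 < a" "0 < \<delta>" and u: "supersol \<Omega> (\<lambda>s. lam * rhs_S a \<delta> s) u g" and lam: "0 < lam"
  and z: "test_fun \<Omega> z" "\<And>x. z x < a" "\<And>x. - (\<Sum>i\<in>UNIV. pd i (pd i z) x) \<le> lam * a powr (-\<delta>)"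
 shows "AE x in lebesgue. x \<in> \<Omega> --> z x \<le> u x"
proof -
 have uH: "H01 \<Omega> u g" using u by (simp add: supersol_def)
 note zH = H01_test[OF z(1)]
 define \<zeta> where "\<zeta> x = max 0 (z x - u x)" for x
 define k where "k x = hs (z x - u x) *\<^sub>R (grad z x - g x)" for x
 have dH: "H01 \<Omega> (\<lambda>x. z x - u x) (\<lambda>x. grad z x - g x)" by (rule H01_diff[OF zH uH])
 have \<zeta>H: "H01 \<Omega> \<zeta> k" unfolding \<zeta>_def[abs_def] k_def[abs_def] by (rule H01_pos[OF dH])
 have unn: "AE x in lebesgue. 0 \<le> u x" by (rule supersol_nonneg[OF u])
 have F: "(\<lambda>s. lam * rhs_S a \<delta> s) \<in> borel_measurable borel" "\<And>s. 0 \<le> lam * rhs_S a \<delta> s"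
  using lam rhs_S_borel[of a \<delta>] by (auto simp: rhs_S_nonneg)
 have \<zeta>nn: "AE x in lebesgue. 0 \<le> \<zeta> x" by (simp add: \<zeta>_def)
 note st = supersol_test[OF u F \<zeta>H \<zeta>nn]
 define Lz where "Lz x = - (\<Sum>i\<in>UNIV. pd i (pd i z) x)" for x
 have zU: "test_fun UNIV z" using test_mono[OF z(1)] by simp
 have sL: "sq lebesgue Lz"
 proof -
  have "test_fun UNIV (\<lambda>x. (-1) * (\<Sum>i\<in>UNIV. pd i (pd i z) x))" by (intro test_cmult test_sum test_pd zU)
  from test_sq[OF this] show ?thesis by (simp add: Lz_def[abs_def])
 qed
 have s1: "(LINT x. grad z x \<bullet> k x) = (LINT x. Lz x * \<zeta> x)"
 proof -
  have "(LINT x. grad z x \<bullet> k x) = (LINT x. (\<Sum>i\<in>UNIV. k x $ i * pd i z x))"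
   by (simp add: inner_vec_def grad_nth mult.commute)
  also have "\<dots> = (\<Sum>i\<in>UNIV. LINT x. k x $ i * pd i z x)"
   by (rule Bochner_Integration.integral_sum) (intro sq_mult sq_nth(1) gcl_sq(2)[OF \<zeta>H] test_sq[OF test_pd[OF zU]])
  also have "\<dots> = (\<Sum>i\<in>UNIV. - (LINT x. \<zeta> x * pd i (pd i z) x))"
   by (intro sum.cong refl H01_ibp[OF H01_UNIV[OF \<zeta>H] test_pd[OF zU]])
  also have "\<dots> = - (LINT x. (\<Sum>i\<in>UNIV. \<zeta> x * pd i (pd i z) x))"
   by (subst Bochner_Integration.integral_sum)
     (auto simp: sum_negf intro!: sq_mult gcl_sq(1)[OF \<zeta>H] test_sq[OF test_pd[OF test_pd[OF zU]]])
  also have "\<dots> = (LINT x. Lz x * \<zeta> x)"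
   by (simp add: Lz_def sum_distrib_left[symmetric] mult.commute)
  finally show ?thesis .
 qed
 have "(nrm lebesgue k)\<^sup>2 \<le> (LINT x. grad z x \<bullet> k x) - (LINT x. g x \<bullet> k x)"
 proof -
  note i1 = sq_inner[OF gcl_sq(2)[OF zH] gcl_sq(2)[OF \<zeta>H]] and i2 = sq_inner[OF gcl_sq(2)[OF uH] gcl_sq(2)[OF \<zeta>H]]
  have "(norm (k x))\<^sup>2 \<le> grad z x \<bullet> k x - g x \<bullet> k x" for x
  proof -
   define t d where "t = hs (z x - u x)" and "d = grad z x - g x"
   have t: "0 \<le> t" "t \<le> 1" by (auto simp: t_def hs_range)
   have "(norm (k x))\<^sup>2 = t * t * (d \<bullet> d)" unfolding k_def t_def d_def power2_norm_eq_inner by simp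
   \<comment> \<open>\<open>hs\<close> also takes the value 1/2, hence an inequality in place of the
     identity t * t = t.\<close>
   also have "\<dots> \<le> t * (d \<bullet> d)" using t by (intro mult_right_mono mult_left_le) auto
   also have "\<dots> = grad z x \<bullet> k x - g x \<bullet> k x" by (simp add: k_def t_def d_def inner_diff_left right_diff_distrib)
   finally show ?thesis .
  qed
  then have "(LINT x. (norm (k x))\<^sup>2) \<le> (LINT x. grad z x \<bullet> k x - g x \<bullet> k x)"
   by (intro integral_mono sq_integrable gcl_sq(2)[OF \<zeta>H] Bochner_Integration.integrable_diff i1 i2)
  then show ?thesis using i1 i2 by (simp add: nrm_power2)
 qed
 also have "\<dots> \<le> (LINT x. Lz x * \<zeta> x) - (LINT x. lam * rhs_S a \<delta> (u x) * \<zeta> x)"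
  using s1 st(2) by simp
 also have "\<dots> \<le> 0"
 proof -
  have "(LINT x. Lz x * \<zeta> x) \<le> (LINT x. lam * rhs_S a \<delta> (u x) * \<zeta> x)"
  proof (rule integral_mono_AE)
   show "integrable lebesgue (\<lambda>x. Lz x * \<zeta> x)" by (intro sq_mult sL gcl_sq(1)[OF \<zeta>H])
   show "integrable lebesgue (\<lambda>x. lam * rhs_S a \<delta> (u x) * \<zeta> x)" by (rule st(1))
   have off: "AE x in lebesgue. x \<notin> \<Omega> --> u x = 0 \<and> g x = 0" by (rule H01_off[OF uH])
   have up: "AE x in lebesgue. x \<in> \<Omega> --> 0 < u x" using u by (simp add: supersol_def)
   show "AE x in lebesgue. Lz x * \<zeta> x \<le> lam * rhs_S a \<delta> (u x) * \<zeta> x"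
    using off up
   proof eventually_elim
    case (elim x)
    show ?case
    proof (cases "\<zeta> x = 0")
     case False
     then have lt: "u x < z x" by (simp add: \<zeta>_def max_def split: if_splits)
     have x: "x \<in> \<Omega>"
     proof (rule ccontr)
      assume "x \<notin> \<Omega>"
      then show False using lt elim test_off[OF z(1)] by simp
     qed
     then have pos: "0 < u x" "u x < a" using elim lt z(2)[of x] by auto
     \<comment> \<open>Where the barrier exceeds \<open>u\<close>, the value of \<open>u\<close> is
       below \<open>a\<close>, in the range where the singular term is active and
       decreasing.\<close>
     then have "a powr (-\<delta>) \<le> (u x) powr (-\<delta>)" using a by (intro powr_mono2') auto
     then have "Lz x \<le> lam * rhs_S a \<delta> (u x)" using z(3)[of x] lam pos(2) unfolding Lz_def rhs_S_def
      by (auto intro: order_trans mult_left_mono)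
     then show ?thesis by (intro mult_right_mono) (auto simp: \<zeta>_def)
    qed simp
   qed
  qed
  then show ?thesis by simp
 qed
 finally have "nrm lebesgue k = 0" by simp
 then have "AE x in lebesgue. k x = 0" by (rule nrm_eq_0[OF gcl_sq(2)[OF \<zeta>H]])
 then have "AE x in lebesgue. \<zeta> x = 0" by (rule H01_zero_grad[OF \<zeta>H \<Omega>])
 then show ?thesis by eventually_elim (auto simp: \<zeta>_def max_def split: if_splits)
qed

text \<open>With radius 1/2 and distance at most 1/4 the exponent is at most 1 / (1/4 - 1/16) =
  16/3.\<close>

lemma bump_lower: "dist x y \<le> 1/4 ==> exp (-16/3) \<le> bump y (1/2) x"
proof -
 assume "dist x y \<le> 1/4"
 then have "(dist x y)\<^sup>2 \<le> (1/4)\<^sup>2" by (intro power_mono) auto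
 then have d: "3/16 \<le> (1/2)\<^sup>2 - (dist x y)\<^sup>2" by (simp add: power2_eq_square)
 then have "1 / ((1/2)\<^sup>2 - (dist x y)\<^sup>2) \<le> 1 / (3/16)" by (intro divide_left_mono) auto
 then show ?thesis using d by (simp add: bump_def flat_exp_def)
qed

lemma bump_le_1: "bump y r x \<le> 1"
 by (simp add: bump_def flat_exp_def)

text \<open>Each centre \<open>y\<close> gives a bound outside a null set, so only countably many
  centres are used. A point at distance d from the complement has a centre within d/8, where the
  scaled bump is bounded below by a fixed constant.\<close>

lemma distance_barrier:
 fixes \<Omega> :: "(real^'n::finite) set"
 assumes \<Omega>: "open \<Omega>" "bounded \<Omega>" and a: "0 < a" "0 < \<delta>" and lam: "0 < lam"
 obtains c where "c > 0" "\<And>u g. supersol \<Omega> (\<lambda>s. lam * rhs_S a \<delta> s) u g ==>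
   AE x in lebesgue. x \<in> \<Omega> --> c * (infdist x (- \<Omega>))\<^sup>2 \<le> u x"
proof -
 have ne: "- \<Omega> \<noteq> {}" using \<Omega>(2) not_bounded_UNIV by (metis Compl_empty_eq double_complement)
 obtain R where R: "R > 0" "\<And>x. x \<in> \<Omega> ==> infdist x (- \<Omega>) \<le> R"
 proof -
  obtain y where y: "y \<notin> \<Omega>" using ne by auto
  obtain R0 where R0: "\<And>x. x \<in> \<Omega> ==> norm x \<le> R0" using \<Omega>(2) by (auto simp: bounded_iff)
  have "infdist x (- \<Omega>) \<le> \<bar>R0\<bar> + norm y + 1" if "x \<in> \<Omega>" for x
  proof -
   have "infdist x (- \<Omega>) \<le> dist x y" using y by (intro infdist_le) auto
   also have "\<dots> \<le> norm x + norm y" by (simp add: dist_norm norm_triangle_ineq4)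
   finally show ?thesis using R0[OF that] by linarith
  qed
  moreover have "\<bar>R0\<bar> + norm y + 1 > 0" by (intro add_nonneg_pos) auto
  ultimately show ?thesis using that by blast
 qed
 \<comment> \<open>Radius 1/2 keeps the bump scaled by \<open>r\<close> within half the distance to
   the complement.\<close>
 define \<beta> where "\<beta> = bump (0::real^'n) (1/2)"
 have \<beta>: "smooth_fun \<beta>" "test_fun UNIV \<beta>" unfolding \<beta>_def by (auto intro: smooth_bump test_bump)
 have tL: "test_fun UNIV (\<lambda>x. \<Sum>i\<in>UNIV. pd i (pd i \<beta>) x)" by (intro test_sum test_pd \<beta>(2))
 obtain CD where CD: "\<And>x. \<bar>\<Sum>i\<in>UNIV. pd i (pd i \<beta>) x\<bar> \<le> CD" using test_bound1[OF tL] by metis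
 \<comment> \<open>The first entry keeps the scaled bump below \<open>a\<close>, the second its
   Laplacian below the singular term. The prefactor \<open>r\<^sup>2\<close> cancels the two factors
   1/r from differentiation, so one \<open>e\<close> serves all centres.\<close>
 define e where "e = min (a / (2 * R\<^sup>2)) (lam * a powr (-\<delta>) / (\<bar>CD\<bar> + 1))"
 have e: "e > 0" "e * R\<^sup>2 < a" "e * \<bar>CD\<bar> \<le> lam * a powr (-\<delta>)"
 proof -
  show "e > 0" using a R lam by (auto simp: e_def intro!: divide_pos_pos)
  have "e * R\<^sup>2 \<le> a / (2 * R\<^sup>2) * R\<^sup>2" unfolding e_def by (intro mult_right_mono) auto
  then show "e * R\<^sup>2 < a" using R a by simp
  have "e * \<bar>CD\<bar> \<le> (lam * a powr (-\<delta>) / (\<bar>CD\<bar> + 1)) * (\<bar>CD\<bar> + 1)" unfolding e_def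
   using a R lam by (intro mult_mono) (auto intro!: divide_nonneg_pos)
  then show "e * \<bar>CD\<bar> \<le> lam * a powr (-\<delta>)" by simp
 qed
 define c where "c = e * exp (-16/3) / 2"
 obtain D :: "(real^'n) set" where D: "countable D" "\<And>X. open X ==> X \<noteq> {} ==> \<exists>d\<in>D. d \<in> X"
  using countable_dense_exists by (metis (no_types, lifting))
 show ?thesis
 proof
  show "c > 0" using e by (simp add: c_def)
  fix u g assume u: "supersol \<Omega> (\<lambda>s. lam * rhs_S a \<delta> s) u g"
  define z where "z y x = e * (infdist y (- \<Omega>))\<^sup>2 * \<beta> ((1 / infdist y (- \<Omega>)) *\<^sub>R (x - y))" for y x
  have main: "AE x in lebesgue. x \<in> \<Omega> --> z y x \<le> u x" if y: "y \<in> \<Omega>" for y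
  proof (rule supersol_ge_test[OF \<Omega>(2) a u lam])
   define r where "r = infdist y (- \<Omega>)"
   have clo: "closed (- \<Omega>)" using \<Omega>(1) by auto
   have r: "r > 0" unfolding r_def using in_closed_iff_infdist_zero[OF clo ne, of y] infdist_nonneg[of y "- \<Omega>"] y by force
   have rR: "r \<le> R" using R(2)[OF y] by (simp add: r_def)
   have zy: "z y = (\<lambda>x. e * r\<^sup>2 * \<beta> ((1/r) *\<^sub>R (x - y)))" by (simp add: z_def r_def fun_eq_iff)
   have sm: "smooth_fun (z y)" unfolding zy using r \<beta> by (intro smooth_mult smooth_const smooth_affine) auto
   have ball: "cball y (r/2) \<subseteq> \<Omega>"
   proof
    fix x assume x: "x \<in> cball y (r/2)"
    show "x \<in> \<Omega>"
    proof (rule ccontr)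
     assume "x \<notin> \<Omega>"
     then have "r \<le> dist y x" unfolding r_def by (intro infdist_le) auto
     then show False using x r by simp
    qed
   qed
   show "test_fun \<Omega> (z y)"
    unfolding test_fun_def
   proof (intro conjI exI[of _ "cball y (r/2)"] allI impI sm ball)
    fix x assume "x \<notin> cball y (r/2)"
    then have "r / 2 < norm (x - y)" by (simp add: dist_norm norm_minus_commute)
    moreover have "dist ((1/r) *\<^sub>R (x - y)) 0 = norm (x - y) / r" using r by (simp add: dist_norm)
    ultimately have "1/2 \<le> dist ((1/r) *\<^sub>R (x - y)) 0" using r by (simp add: pos_le_divide_eq)
    then show "z y x = 0" unfolding zy \<beta>_def by (simp add: bump_zero)
   qed simp
   show "z y x < a" for x
   proof -
    have "z y x \<le> e * r\<^sup>2 * 1" unfolding zy \<beta>_def using e by (intro mult_left_mono bump_le_1) auto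
    also have "\<dots> \<le> e * R\<^sup>2" using r rR e by (simp add: power_mono)
    finally show ?thesis using e(2) by linarith
   qed
   have p1: "pd i (z y) = (\<lambda>x. e * r * pd i \<beta> ((1/r) *\<^sub>R (x - y)))" for i
   proof (rule pdiff_pd)
    have "pdiff i (\<lambda>x. e * r\<^sup>2 * \<beta> ((1/r) *\<^sub>R (x - y))) (\<lambda>x. 0 * \<beta> ((1/r) *\<^sub>R (x - y)) + (1/r) * pd i \<beta> ((1/r) *\<^sub>R (x - y)) * (e * r\<^sup>2))"
     using r by (intro pdiff_mult pdiff_const pdiff_affine smooth_pdiff \<beta>) auto
    then show "pdiff i (z y) (\<lambda>x. e * r * pd i \<beta> ((1/r) *\<^sub>R (x - y)))"
     using r by (simp add: zy power2_eq_square mult_ac)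
   qed
   have p2: "pd i (pd i (z y)) = (\<lambda>x. e * pd i (pd i \<beta>) ((1/r) *\<^sub>R (x - y)))" for i
   proof (rule pdiff_pd)
    have "pdiff i (\<lambda>x. e * r * pd i \<beta> ((1/r) *\<^sub>R (x - y))) (\<lambda>x. 0 * pd i \<beta> ((1/r) *\<^sub>R (x - y)) + (1/r) * pd i (pd i \<beta>) ((1/r) *\<^sub>R (x - y)) * (e * r))"
     using r by (intro pdiff_mult pdiff_const pdiff_affine smooth_pdiff smooth_pd \<beta>) auto
    then show "pdiff i (pd i (z y)) (\<lambda>x. e * pd i (pd i \<beta>) ((1/r) *\<^sub>R (x - y)))"
     using r by (simp add: p1 mult_ac)
   qed
   show "- (\<Sum>i\<in>UNIV. pd i (pd i (z y)) x) \<le> lam * a powr (-\<delta>)" for x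
   proof -
    have "- (\<Sum>i\<in>UNIV. pd i (pd i (z y)) x) = e * (- (\<Sum>i\<in>UNIV. pd i (pd i \<beta>) ((1/r) *\<^sub>R (x - y))))"
     by (simp add: p2 sum_distrib_left)
    also have "\<dots> \<le> e * \<bar>CD\<bar>" using CD[of "(1/r) *\<^sub>R (x - y)"] e by (intro mult_left_mono) auto
    finally show ?thesis using e(3) by linarith
   qed
  qed
  have "AE x in lebesgue. \<forall>y\<in>D \<inter> \<Omega>. x \<in> \<Omega> --> z y x \<le> u x"
   using main D(1) by (subst AE_ball_countable) auto
  then show "AE x in lebesgue. x \<in> \<Omega> --> c * (infdist x (- \<Omega>))\<^sup>2 \<le> u x"
  proof eventually_elim
   case (elim x)
   show ?case
   proof
    assume x: "x \<in> \<Omega>"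
    define d where "d = infdist x (- \<Omega>)"
    have clo: "closed (- \<Omega>)" using \<Omega>(1) by auto
    have d: "d > 0" unfolding d_def using in_closed_iff_infdist_zero[OF clo ne, of x] infdist_nonneg[of x "- \<Omega>"] x by force
    obtain y where y: "y \<in> D" "y \<in> ball x (d/8)" using D(2)[of "ball x (d/8)"] d by auto
    have dy: "dist x y < d / 8" using y by simp
    define r where "r = infdist y (- \<Omega>)"
    have r1: "d \<le> r + dist x y" unfolding d_def r_def by (rule infdist_triangle)
    then have r: "7/8 * d \<le> r" "r > 0" using dy d by auto
    have yO: "y \<in> \<Omega>"
    proof (rule ccontr)
     assume "y \<notin> \<Omega>" then have "r = 0" unfolding r_def by (simp add: infdist_zero)
     then show False using r by simp
    qed
    have "dist ((1/r) *\<^sub>R (x - y)) 0 = norm (x - y) / r" using r by (simp add: dist_norm)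
    then have "dist ((1/r) *\<^sub>R (x - y)) 0 \<le> 1/4" using r dy d by (simp add: pos_divide_le_eq dist_norm)
    then have b: "exp (-16/3) \<le> \<beta> ((1/r) *\<^sub>R (x - y))" unfolding \<beta>_def by (rule bump_lower)
    \<comment> \<open>Moving the centre by d/8 costs the factor 49/64, which is covered by the
      factor 1/2 in \<open>c\<close>.\<close>
    have "(7/8 * d)\<^sup>2 \<le> r\<^sup>2" using r d by (intro power_mono) auto
    moreover have "(7/8 * d)\<^sup>2 = 49/64 * d\<^sup>2" by (simp add: power2_eq_square)
    moreover have "0 \<le> d\<^sup>2" by simp
    ultimately have "d\<^sup>2 / 2 \<le> r\<^sup>2" by linarith
    then have "e * (d\<^sup>2 / 2) * exp (-16/3) \<le> e * r\<^sup>2 * \<beta> ((1/r) *\<^sub>R (x - y))"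
     using b e by (intro mult_mono) auto
    also have "\<dots> = z y x" by (simp add: z_def r_def)
    also have "\<dots> \<le> u x" using elim y(1) yO x by blast
    finally show "c * d\<^sup>2 \<le> u x" by (simp add: c_def mult_ac)
   qed
  qed
 qed
qed

subsection \<open>Integrability of the logarithm of the distance\<close>

lemma axis_increment:
 assumes f: "smooth_fun f" and t: "0 \<le> t" and b: "\<And>s. 0 \<le> s ==> s \<le> t ==> m \<le> pd i f (x + s *\<^sub>R axis i 1)"
 shows "m * t \<le> f (x + t *\<^sub>R axis i 1) - f x"
proof (cases "t = 0")
 case False
 then have t': "0 < t" using t by simp
 obtain s where s: "0 < s" "s < t" "f (x + t *\<^sub>R axis i 1) - f (x + 0 *\<^sub>R axis i 1) = (t - 0) * pd i f (x + s *\<^sub>R axis i 1)"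
  using MVT2[OF t', of "\<lambda>t. f (x + t *\<^sub>R axis i 1)" "\<lambda>s. pd i f (x + s *\<^sub>R axis i 1)"] pdiff_at[OF smooth_pdiff[OF f]] by blast
 then show ?thesis using mult_left_mono[OF b[of s], of t] t' by (simp add: mult.commute)
qed simp

lemma axis_abs_increment:
 assumes f: "smooth_fun f" and b: "\<And>s. \<bar>s\<bar> \<le> \<bar>t\<bar> ==> 0 \<le> s * t ==> \<bar>pd i f (x + s *\<^sub>R axis i 1)\<bar> \<le> M"
 shows "\<bar>f (x + t *\<^sub>R axis i 1) - f x\<bar> \<le> M * \<bar>t\<bar>"
proof -
 have *: "\<bar>f (y + t *\<^sub>R axis i 1) - f y\<bar> \<le> M * t" 
  if "0 \<le> t" "\<And>s. 0 \<le> s ==> s \<le> t ==> \<bar>pd i f (y + s *\<^sub>R axis i 1)\<bar> \<le> M" for y t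
 proof (cases "t = 0")
  case False
  then have t': "0 < t" using that by simp
  obtain s where s: "0 < s" "s < t" "f (y + t *\<^sub>R axis i 1) - f (y + 0 *\<^sub>R axis i 1) = (t - 0) * pd i f (y + s *\<^sub>R axis i 1)"
   using MVT2[OF t', of "\<lambda>t. f (y + t *\<^sub>R axis i 1)" "\<lambda>s. pd i f (y + s *\<^sub>R axis i 1)"] pdiff_at[OF smooth_pdiff[OF f]] by blast
  then show ?thesis using mult_right_mono[OF that(2)[of s], of t] t' by (simp add: abs_mult mult.commute)
 qed simp
 show ?thesis
 proof (cases "0 \<le> t")
  case True
  then show ?thesis using *[of t x] b by simp
 next
  case False
  have "\<bar>f (x + t *\<^sub>R axis i 1 + (-t) *\<^sub>R axis i 1) - f (x + t *\<^sub>R axis i 1)\<bar> \<le> M * (-t)"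
  proof (rule *)
   fix s assume s: "0 \<le> s" "s \<le> - t"
   have "\<bar>pd i f (x + (t + s) *\<^sub>R axis i 1)\<bar> \<le> M" using s False by (intro b) (auto simp: mult_nonpos_nonpos)
   then show "\<bar>pd i f (x + t *\<^sub>R axis i 1 + s *\<^sub>R axis i 1)\<bar> \<le> M" by (simp add: algebra_simps)
  qed (use False in simp)
  then show ?thesis using False by (simp add: abs_minus_commute)
 qed
qed

text \<open>Only partial derivatives are available, so one coordinate is changed at a time. All
  intermediate points stay in the cube, which would fail for a ball.\<close>

lemma smooth_lipschitz_cube:
 fixes f :: "real^'n::finite => real"
 assumes f: "smooth_fun f" and M: "\<And>z i. (\<forall>j. \<bar>z $ j - p $ j\<bar> \<le> r) ==> \<bar>pd i f z\<bar> \<le> M"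
  and x: "\<forall>j. \<bar>x $ j - p $ j\<bar> \<le> r" and y: "\<forall>j. \<bar>y $ j - p $ j\<bar> \<le> r"
 shows "\<bar>f x - f y\<bar> \<le> real CARD('n) * M * norm (x - y)"
proof -
 have M0: "0 \<le> M" using M[OF x] by (meson abs_ge_zero order_trans)
 define mix where "mix S = (\<chi> j. if j \<in> S then x $ j else y $ j)" for S
 have "\<bar>f (mix S) - f y\<bar> \<le> real (card S) * (M * norm (x - y))" if "finite S" for S
  using that
 proof (induction S)
  case empty
  have "mix {} = y" by (simp add: mix_def vec_eq_iff)
  then show ?case by simp
 next
  case (insert i S)
  define t where "t = x $ i - y $ i"
  have mi: "mix (insert i S) = mix S + t *\<^sub>R axis i 1"
   using insert by (auto simp: mix_def vec_eq_iff t_def axis_def)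
  have "\<bar>f (mix S + t *\<^sub>R axis i 1) - f (mix S)\<bar> \<le> M * \<bar>t\<bar>"
  proof (rule axis_abs_increment[OF f], rule M, rule allI)
   fix s j assume s: "\<bar>s\<bar> \<le> \<bar>t\<bar>" "0 \<le> s * t"
   show "\<bar>(mix S + s *\<^sub>R axis i 1) $ j - p $ j\<bar> \<le> r"
   proof (cases "j = i")
    case True
    have "(0 \<le> s \<and> s \<le> t) \<or> (t \<le> s \<and> s \<le> 0)"
     using s by (cases "0 < t"; cases "t = 0") (auto simp: zero_le_mult_iff abs_if split: if_splits)
    then have "\<bar>y $ i + s - p $ i\<bar> \<le> max \<bar>y $ i - p $ i\<bar> \<bar>x $ i - p $ i\<bar>"
     unfolding t_def by (auto simp: abs_if max_def)
    then have "\<bar>y $ i + s - p $ i\<bar> \<le> r" using x y by (metis max_def order_trans)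
    then show ?thesis using True insert by (simp add: mix_def)
   next
    case False
    then show ?thesis using x y by (simp add: mix_def axis_def)
   qed
  qed
  also have "M * \<bar>t\<bar> \<le> M * norm (x - y)" using component_le_norm_cart[of "x - y" i] M0 by (intro mult_left_mono) (auto simp: t_def)
  finally have "\<bar>f (mix (insert i S)) - f y\<bar> \<le> M * norm (x - y) + real (card S) * (M * norm (x - y))"
   using insert.IH unfolding mi by linarith
  then show ?case using insert by (simp add: algebra_simps)
 qed
 from this[of UNIV] have "\<bar>f (mix UNIV) - f y\<bar> \<le> real CARD('n) * (M * norm (x - y))" by simp
 moreover have "mix UNIV = x" by (simp add: mix_def vec_eq_iff)
 ultimately show ?thesis by (simp add: mult.assoc)
qed

text \<open>Near a boundary point the layer \<open>{d < t}\<close> has measure \<open>O(t)\<close>: its translates by multiples of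
 a step proportional to \<open>t\<close>, in a direction along which the defining function increases, are disjoint.\<close>

lemma boundary_layer_local:
 fixes \<Omega> :: "(real^'n::finite) set"
 assumes \<Omega>: "open \<Omega>" "- \<Omega> \<noteq> {}" and \<rho>: "smooth_fun \<rho>" "grad \<rho> p \<noteq> 0" and R: "0 < R" "\<Omega> \<inter> ball p R = {x \<in> ball p R. \<rho> x < 0}"
 obtains r C where "r > 0" "\<And>t. t > 0 ==> measure lebesgue ({x \<in> \<Omega>. infdist x (- \<Omega>) < t} \<inter> ball p r) \<le> C * t"
proof -
 obtain i where i: "pd i \<rho> p \<noteq> 0" using \<rho>(2) by (auto simp: grad_def vec_eq_iff)
 define s where "s = sgn (pd i \<rho> p)"
 define m where "m = \<bar>pd i \<rho> p\<bar> / 2"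
 have m: "m > 0" using i by (simp add: m_def)
 have s: "s * s = 1" "s * pd i \<rho> p = 2 * m" "s = 1 \<or> s = -1" using i by (auto simp: s_def m_def sgn_if)
 define P where "P z = s * pd i \<rho> z" for z
 have "continuous_on UNIV P" unfolding P_def[abs_def] by (intro continuous_intros smooth_continuous smooth_pd \<rho>(1))
 then have "isCont P p" by (simp add: continuous_on_eq_continuous_at)
 then obtain d where d: "d > 0" "\<And>z. dist z p < d ==> dist (P z) (P p) < m"
  using m unfolding continuous_at_eps_delta by blast
 \<comment> \<open>The Euclidean norm is at most the sum of the coordinates, so a cube of this half
   side lies in the ball of radius \<open>min R d\<close>.\<close>
 define q where "q = min R d / (2 * (real CARD('n) + 1))"
 have cn: "real CARD('n) > 0" by simp
 have q: "q > 0" using R d cn by (auto simp: q_def intro!: divide_pos_pos add_pos_pos)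
 have cube: "dist z p < min R d" if "\<forall>j. \<bar>z $ j - p $ j\<bar> \<le> q" for z
 proof -
  have "dist z p \<le> (\<Sum>j\<in>UNIV. \<bar>(z - p) $ j\<bar>)" unfolding dist_norm by (rule norm_le_l1_cart)
  also have "\<dots> \<le> (\<Sum>j\<in>(UNIV::'n set). q)" using that by (intro sum_mono) auto
  also have "\<dots> = real CARD('n) * q" by simp
  also have "\<dots> < (2 * (real CARD('n) + 1)) * q" using q cn by (intro mult_strict_right_mono) auto
  also have "\<dots> = min R d" using cn by (simp add: q_def)
  finally show ?thesis .
 qed
 have incr: "m \<le> P z" if "\<forall>j. \<bar>z $ j - p $ j\<bar> \<le> q" for z
  using d(2)[of z] cube[OF that] s(2) by (auto simp: P_def dist_real_def)
 have ball_cube: "\<forall>j. \<bar>z $ j - p $ j\<bar> \<le> e" if "z \<in> ball p e" for z e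
  using that component_le_norm_cart[of "z - p"] by (auto simp: dist_norm norm_minus_commute intro: order_trans less_imp_le)
 define M where "M = (SUP z\<in>cball p R. \<Sum>j\<in>UNIV. \<bar>pd j \<rho> z\<bar>)"
 have M: "\<bar>pd j \<rho> z\<bar> \<le> M" if "z \<in> cball p R" for j z
 proof -
  have c: "continuous_on (cball p R) (\<lambda>z. \<Sum>j\<in>UNIV. \<bar>pd j \<rho> z\<bar>)"
   by (intro continuous_intros continuous_on_subset[OF smooth_continuous[OF smooth_pd[OF \<rho>(1)]]]) auto
  have "compact ((\<lambda>z. \<Sum>j\<in>UNIV. \<bar>pd j \<rho> z\<bar>) ` cball p R)" by (intro compact_continuous_image c) simp
  then have "bdd_above ((\<lambda>z. \<Sum>j\<in>UNIV. \<bar>pd j \<rho> z\<bar>) ` cball p R)" by (intro bounded_imp_bdd_above compact_imp_bounded)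
  then have "(\<Sum>j\<in>UNIV. \<bar>pd j \<rho> z\<bar>) \<le> M" unfolding M_def using that by (intro cSUP_upper)
  moreover have "\<bar>pd j \<rho> z\<bar> \<le> (\<Sum>j\<in>UNIV. \<bar>pd j \<rho> z\<bar>)" by (rule member_le_sum) auto
  ultimately show ?thesis by linarith
 qed
 define L where "L = real CARD('n) * M + 1"
 have M0: "0 \<le> M" using M[of p] R by (metis abs_ge_zero centre_in_cball less_imp_le order_trans)
 have L: "L > 0" using M0 by (simp add: L_def add_nonneg_pos)
 define r where "r = q / 2"
 have r: "r > 0" using q by (simp add: r_def)
 define A where "A t = {x \<in> \<Omega>. infdist x (- \<Omega>) < t} \<inter> ball p r" for t
 define V where "V = measure lebesgue (ball p (r + 1))"
 have oA: "open (A t)" for t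
 proof -
  have "open {x. infdist x (- \<Omega>) < t}" by (intro open_Collect_less continuous_intros)
  then have "open (\<Omega> \<inter> {x. infdist x (- \<Omega>) < t} \<inter> ball p r)" using \<Omega>(1) by (intro open_Int) auto
  moreover have "A t = \<Omega> \<inter> {x. infdist x (- \<Omega>) < t} \<inter> ball p r" by (auto simp: A_def)
  ultimately show ?thesis by simp
 qed
 have bA: "bounded (A t)" for t by (rule bounded_subset[of "ball p r"]) (auto simp: A_def)
 have mA: "A t \<in> lmeasurable" for t by (intro bounded_set_imp_lmeasurable bA) (use oA in auto)
 \<comment> \<open>Within distance \<open>t\<close> of a point of the layer there is a point outside
   \<Omega>, where \<open>\<rho>\<close> is nonnegative. The Lipschitz bound then confines
   \<open>\<rho>\<close> on the layer to an interval of length \<open>L * t\<close>.\<close>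
 have low: "- (L * t) < \<rho> x \<and> \<rho> x < 0" if x: "x \<in> A t" and t: "t \<le> r" for x t
 proof -
  have xb: "x \<in> \<Omega>" "x \<in> ball p r" "infdist x (- \<Omega>) < t" using x by (auto simp: A_def)
  have "\<exists>y\<in>- \<Omega>. dist x y < t"
  proof (rule ccontr)
   assume "\<not> ?thesis"
   then have "t \<le> infdist x (- \<Omega>)" using \<Omega>(2) by (auto simp: infdist_def not_less intro!: cINF_greatest)
   then show False using xb(3) by simp
  qed
  then obtain y where y: "y \<notin> \<Omega>" "dist x y < t" by auto
  have yb: "y \<in> ball p q" using dist_triangle[of p y x] xb(2) y(2) t by (simp add: r_def)
  have xq: "x \<in> ball p q" using xb(2) q by (simp add: r_def)
  have bR: "z \<in> ball p R" if "z \<in> ball p q" for z using cube[OF ball_cube[OF that]] by (simp add: dist_commute)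
  have "\<rho> x < 0" using R(2) xb(1) bR[OF xq] by blast
  moreover have "0 \<le> \<rho> y" using R(2) y(1) bR[OF yb] by (metis (mono_tags, lifting) IntD1 mem_Collect_eq not_le)
  moreover have "\<bar>\<rho> x - \<rho> y\<bar> \<le> real CARD('n) * M * norm (x - y)"
  proof (rule smooth_lipschitz_cube[OF \<rho>(1) _ ball_cube[OF xq] ball_cube[OF yb]])
   fix z j assume "\<forall>j. \<bar>z $ j - p $ j\<bar> \<le> q"
   then show "\<bar>pd j \<rho> z\<bar> \<le> M" using cube[of z] by (intro M) (simp add: dist_commute)
  qed
  moreover have "real CARD('n) * M * norm (x - y) \<le> real CARD('n) * M * t"
   using y(2) M0 by (intro mult_left_mono) (auto simp: dist_norm)
  moreover have "t > 0" using y(2) zero_le_dist[of x y] by linarith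
  ultimately show ?thesis unfolding L_def distrib_right mult_1 by linarith
 qed
 define v where "v = s *\<^sub>R axis i (1::real)"
 have nv: "norm v = 1" using s(3) by (auto simp: v_def)
 have inc: "\<rho> y + m * T \<le> \<rho> (y + T *\<^sub>R v)" if y: "y \<in> ball p r" "y + T *\<^sub>R v \<in> ball p r" and T: "0 \<le> T" for y T
 proof -
  have seg: "\<forall>j. \<bar>(y + S *\<^sub>R v) $ j - p $ j\<bar> \<le> q" if "0 \<le> S" "S \<le> T" for S
  proof -
   have "y + S *\<^sub>R v \<in> ball p r"
   proof (cases "T = 0")
    case True then show ?thesis using that y by simp
   next
    case False
    have "y + S *\<^sub>R v = (1 - S/T) *\<^sub>R y + (S/T) *\<^sub>R (y + T *\<^sub>R v)" using False by (simp add: algebra_simps)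
    also have "\<dots> \<in> ball p r" using that T False y by (intro convexD[OF convex_ball]) auto
    finally show ?thesis .
   qed
   then have "y + S *\<^sub>R v \<in> ball p q" using q by (simp add: r_def)
   then show ?thesis by (rule ball_cube)
  qed
  from s(3) show ?thesis
  proof
   assume s1: "s = 1"
   have "m * T \<le> \<rho> (y + T *\<^sub>R axis i 1) - \<rho> y"
    by (rule axis_increment[OF \<rho>(1) T]) (use incr seg s1 in \<open>auto simp: P_def v_def\<close>)
   then show ?thesis by (simp add: v_def s1)
  next
   assume s1: "s = -1"
   have sm: "smooth_fun (\<lambda>x. (-1) * \<rho> x)" by (intro smooth_mult smooth_const \<rho>)
   have "m * T \<le> - \<rho> ((y + T *\<^sub>R v) + T *\<^sub>R axis i 1) - (- \<rho> (y + T *\<^sub>R v))"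
   proof -
    have pm: "pd i (\<lambda>x. (-1) * \<rho> x) z = - pd i \<rho> z" for z
     using grad_cmult[OF \<rho>(1), of "-1" z] by (simp add: vec_eq_iff grad_nth)
    have eq: "y + T *\<^sub>R v + S *\<^sub>R axis i 1 = y + (T - S) *\<^sub>R v" for S by (simp add: v_def s1 algebra_simps)
    have "m * T \<le> (\<lambda>x. (-1) * \<rho> x) ((y + T *\<^sub>R v) + T *\<^sub>R axis i 1) - (\<lambda>x. (-1) * \<rho> x) (y + T *\<^sub>R v)"
    proof (rule axis_increment[OF sm T])
     fix S assume "0 \<le> S" "S \<le> T"
     then have "m \<le> P (y + (T - S) *\<^sub>R v)" by (intro incr seg) auto
     then show "m \<le> pd i (\<lambda>x. (-1) * \<rho> x) (y + T *\<^sub>R v + S *\<^sub>R axis i 1)" unfolding pm eq by (simp add: P_def s1)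
    qed
    then show ?thesis by simp
   qed
   then show ?thesis by (simp add: v_def s1)
  qed
 qed
 have V0: "0 \<le> V" by (simp add: V_def)
 have key: "measure lebesgue (A t) \<le> (4 * L * V / m) * t" if t: "0 < t" "t \<le> r" for t
 proof -
  \<comment> \<open>A shift by \<open>\<tau>\<close> raises \<open>\<rho>\<close> by at least
    \<open>m * \<tau> = 2 * L * t\<close>, more than its range on the layer; hence translates by
    different multiples are disjoint.\<close>
  define \<tau> where "\<tau> = 2 * L * t / m"
  have \<tau>: "\<tau> > 0" using L t m by (simp add: \<tau>_def)
  have AV: "measure lebesgue (A t) \<le> V" unfolding V_def
   by (rule measure_mono_fmeasurable) (use mA in \<open>auto simp: A_def fmeasurableD\<close>)
  show ?thesis
  proof (cases "\<tau> \<le> 1/2")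
   case False
   \<comment> \<open>Here \<open>t\<close> is bounded from below, and the volume of the ball alone
     gives the estimate.\<close>
   then have "V \<le> 2 * \<tau> * V" using V0 by (intro mult_right_mono[of 1 "2 * \<tau>" V, simplified]) auto
   then show ?thesis using AV by (simp add: \<tau>_def mult_ac)
  next
   case True
   \<comment> \<open>As many translates as keep the total shift at most 1, hence inside the ball of
     radius \<open>r + 1\<close>. For \<open>\<tau> \<le> 1/2\<close> rounding down loses at most a
     factor 2.\<close>
   define n where "n = nat \<lfloor>1 / \<tau>\<rfloor>"
   have n: "real n * \<tau> \<le> 1" "1 / (2 * \<tau>) \<le> real n"
   proof -
    have "real n \<le> 1 / \<tau>" using \<tau> by (simp add: n_def)
    then show "real n * \<tau> \<le> 1" using \<tau> by (simp add: field_simps)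
    have "1 / \<tau> - 1 \<le> real n" unfolding n_def using \<tau> by linarith
    moreover have "1 / (2 * \<tau>) \<le> 1 / \<tau> - 1" using True \<tau> by (simp add: field_simps)
    ultimately show "1 / (2 * \<tau>) \<le> real n" by linarith
   qed
   define T where "T k = (+) ((real k * \<tau>) *\<^sub>R v) ` A t" for k
   have mT: "T k \<in> lmeasurable" for k unfolding T_def by (rule measurable_translation[OF mA])
   have eT: "measure lebesgue (T k) = measure lebesgue (A t)" for k unfolding T_def by (rule measure_translation)
   have disj: "T k \<inter> T l = {}" if "k < l" for k l
   proof (rule ccontr)
    assume "T k \<inter> T l \<noteq> {}"
    then obtain x x' where x: "x \<in> A t" "x' \<in> A t" "(real k * \<tau>) *\<^sub>R v + x = (real l * \<tau>) *\<^sub>R v + x'"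
     unfolding T_def by auto
    then have xx: "x = x' + ((real l - real k) * \<tau>) *\<^sub>R v" by (simp add: algebra_simps)
    have kl: "1 \<le> real l - real k" using that by linarith
    have "\<rho> x' + m * ((real l - real k) * \<tau>) \<le> \<rho> x"
     using inc[of x' "(real l - real k) * \<tau>"] x xx \<tau> kl by (simp add: A_def)
    moreover have "m * \<tau> \<le> m * ((real l - real k) * \<tau>)" using kl \<tau> m by (intro mult_left_mono) auto
    moreover have "m * \<tau> = 2 * L * t" using m by (simp add: \<tau>_def)
    moreover have "L * t > 0" using L t by simp
    ultimately show False using low[OF x(1) t(2)] low[OF x(2) t(2)] by linarith
   qed
   then have "disjoint_family_on T {..<n}" unfolding disjoint_family_on_def
    by (metis inf_commute linorder_neqE_nat)
   then have "measure lebesgue (\<Union>k<n. T k) = (\<Sum>k<n. measure lebesgue (T k))"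
    using mT fmeasurableD2 by (intro measure_finite_Union) (auto simp: fmeasurableD simp del: emeasure_completion)
   then have "real n * measure lebesgue (A t) = measure lebesgue (\<Union>k<n. T k)" by (simp add: eT)
   also have "\<dots> \<le> V" unfolding V_def
   proof (rule measure_mono_fmeasurable)
    show "(\<Union>k<n. T k) \<subseteq> ball p (r + 1)"
    proof
     fix z assume "z \<in> (\<Union>k<n. T k)"
     then obtain k x where k: "k < n" "x \<in> A t" "z = (real k * \<tau>) *\<^sub>R v + x" unfolding T_def by auto
     have "real k * \<tau> \<le> real n * \<tau>" using k \<tau> by (intro mult_right_mono) auto
     then have "real k * \<tau> \<le> 1" using n(1) by linarith
     then have "norm ((real k * \<tau>) *\<^sub>R v) \<le> 1" using \<tau> nv by simp
     moreover have "dist p x < r" using k by (simp add: A_def)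
     ultimately show "z \<in> ball p (r + 1)" using norm_triangle_ineq4[of "p - x" "(real k * \<tau>) *\<^sub>R v"] k(3)
      by (simp add: dist_norm algebra_simps)
    qed
   qed (use mT in \<open>auto intro!: fmeasurableD sets.finite_UN\<close>)
   finally have "real n * measure lebesgue (A t) \<le> V" .
   moreover have "1 / (2 * \<tau>) * measure lebesgue (A t) \<le> real n * measure lebesgue (A t)" using n(2) by (intro mult_right_mono) auto
   ultimately have "1 / (2 * \<tau>) * measure lebesgue (A t) \<le> V" by linarith
   then have "measure lebesgue (A t) \<le> 2 * \<tau> * V" using \<tau> by (simp add: field_simps)
   then show ?thesis by (simp add: \<tau>_def mult_ac)
  qed
 qed
 show ?thesis
 proof (rule that[OF r])
  fix t :: real assume t: "t > 0"
  \<comment> \<open>The second summand covers \<open>t > r\<close>, where the volume of the ball is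
    compared with \<open>t / r\<close>.\<close>
  define C where "C = 4 * L * V / m + V / r"
  have C: "0 \<le> 4 * L * V / m" "0 \<le> V / r" using L V0 m r by auto
  have "measure lebesgue (A t) \<le> C * t"
  proof (cases "t \<le> r")
   case True
   then show ?thesis using key[OF t] C t mult_nonneg_nonneg[OF C(2), of t] unfolding C_def distrib_right by linarith
  next
   case False
   have "measure lebesgue (A t) \<le> V" unfolding V_def
    by (rule measure_mono_fmeasurable) (use mA in \<open>auto simp: A_def fmeasurableD\<close>)
   also have "V = V / r * r" using r by simp
   also have "\<dots> \<le> V / r * t" using False C by (intro mult_left_mono) auto
   finally show ?thesis using mult_nonneg_nonneg[OF C(1), of t] t unfolding C_def distrib_right by linarith
  qed
  then show "measure lebesgue ({x \<in> \<Omega>. infdist x (- \<Omega>) < t} \<inter> ball p r) \<le> (4 * L * V / m + V / r) * t"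
   by (simp add: A_def C_def)
 qed
qed

text \<open>Finitely many local layers cover the compact boundary. The rest of the closure is
  compact inside \<Omega> and so keeps a positive distance from the complement; a thin layer
  therefore lies in the local ones, and a thick one is bounded by the volume.\<close>

lemma boundary_layer:
 fixes \<Omega> :: "(real^'n::finite) set"
 assumes "bounded_smooth_domain \<Omega>"
 obtains C where "\<forall>t>0. measure lebesgue {x \<in> \<Omega>. infdist x (- \<Omega>) < t} \<le> C * t"
proof -
 have \<Omega>: "open \<Omega>" "bounded \<Omega>" using assms by (auto simp: bounded_smooth_domain_def)
 have ne: "- \<Omega> \<noteq> {}" using \<Omega>(2) not_bounded_UNIV by (metis Compl_empty_eq double_complement)
 have "\<exists>r C. r > 0 \<and> (\<forall>t>0. measure lebesgue ({x \<in> \<Omega>. infdist x (- \<Omega>) < t} \<inter> ball p r) \<le> C * t)" if p: "p \<in> frontier \<Omega>" for p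
 proof -
  obtain R \<rho> where R: "R > 0" "smooth_fun \<rho>" "grad \<rho> p \<noteq> 0" "\<Omega> \<inter> ball p R = {x \<in> ball p R. \<rho> x < 0}"
   using assms p unfolding bounded_smooth_domain_def by blast
  show ?thesis
  proof (rule boundary_layer_local[OF \<Omega>(1) ne R(2,3,1,4)])
   fix r C assume "0 < r" "\<And>t. 0 < t ==> measure lebesgue ({x \<in> \<Omega>. infdist x (- \<Omega>) < t} \<inter> ball p r) \<le> C * t"
   then show ?thesis by blast
  qed
 qed
 then have "\<forall>p\<in>frontier \<Omega>. \<exists>rc. fst rc > 0 \<and> (\<forall>t>0. measure lebesgue ({x \<in> \<Omega>. infdist x (- \<Omega>) < t} \<inter> ball p (fst rc)) \<le> snd rc * t)"
  by fastforce
 from bchoice[OF this] obtain rc where rc: "\<forall>p\<in>frontier \<Omega>. fst (rc p) > 0 \<and> (\<forall>t>0. measure lebesgue ({x \<in> \<Omega>. infdist x (- \<Omega>) < t} \<inter> ball p (fst (rc p))) \<le> snd (rc p) * t)"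
  by (elim exE) (rule that)
 define r C where "r p = fst (rc p)" and "C p = snd (rc p)" for p
 have rC: "\<And>p. p \<in> frontier \<Omega> ==> r p > 0"
  "\<And>p t. p \<in> frontier \<Omega> ==> t > 0 ==> measure lebesgue ({x \<in> \<Omega>. infdist x (- \<Omega>) < t} \<inter> ball p (r p)) \<le> C p * t"
  using rc by (auto simp: r_def C_def)
 have cf: "compact (frontier \<Omega>)" using \<Omega>(2) by (rule compact_frontier_bounded)
 have "frontier \<Omega> \<subseteq> (\<Union>p\<in>frontier \<Omega>. ball p (r p))" using rC(1) by force
 then obtain F where F: "F \<subseteq> frontier \<Omega>" "finite F" "frontier \<Omega> \<subseteq> (\<Union>p\<in>F. ball p (r p))"
  using compactE_image[OF cf, of "frontier \<Omega>" "\<lambda>p. ball p (r p)"] by auto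
 define K where "K = closure \<Omega> - (\<Union>p\<in>F. ball p (r p))"
 have cK: "compact K" unfolding K_def using \<Omega>(2) by (intro compact_diff) (auto intro: open_UN)
 have KO: "K \<subseteq> \<Omega>" using F(3) \<Omega>(1) by (auto simp: K_def frontier_def interior_open)
 have clo: "closed (- \<Omega>)" using \<Omega>(1) by auto
 obtain d where d: "d > 0" "\<And>x. x \<in> K ==> d \<le> infdist x (- \<Omega>)"
 proof (cases "K = {}")
  case True then show ?thesis using that[of 1] by simp
 next
  case False
  have "continuous_on K (\<lambda>x. infdist x (- \<Omega>))" by (intro continuous_intros)
  then obtain z where z: "z \<in> K" "\<forall>x\<in>K. infdist z (- \<Omega>) \<le> infdist x (- \<Omega>)"
   using continuous_attains_inf[OF cK False] by blast
  have "infdist z (- \<Omega>) > 0" using in_closed_iff_infdist_zero[OF clo ne, of z] infdist_nonneg[of z "- \<Omega>"] z(1) KO by force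
  then show ?thesis using that z(2) by blast
 qed
 define A where "A t = {x \<in> \<Omega>. infdist x (- \<Omega>) < t}" for t
 have oA: "open (A t)" for t
 proof -
  have "open {x. infdist x (- \<Omega>) < t}" by (intro open_Collect_less continuous_intros)
  then have "open (\<Omega> \<inter> {x. infdist x (- \<Omega>) < t})" using \<Omega>(1) by (intro open_Int)
  moreover have "A t = \<Omega> \<inter> {x. infdist x (- \<Omega>) < t}" by (auto simp: A_def)
  ultimately show ?thesis by simp
 qed
 have bA: "bounded (A t)" for t by (rule bounded_subset[OF \<Omega>(2)]) (auto simp: A_def)
 have mA: "A t \<in> lmeasurable" for t by (intro bounded_set_imp_lmeasurable bA) (use oA in auto)
 have mO: "\<Omega> \<in> lmeasurable" by (intro bounded_set_imp_lmeasurable \<Omega>(2)) (use \<Omega>(1) in auto)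
 define D where "D = (\<Sum>p\<in>F. \<bar>C p\<bar>)"
 have small: "measure lebesgue (A t) \<le> D * t" if t: "0 < t" "t \<le> d" for t
 proof -
  have sub: "A t \<subseteq> (\<Union>p\<in>F. A t \<inter> ball p (r p))"
  proof
   fix x assume x: "x \<in> A t"
   then have "x \<notin> K" using d(2)[of x] t by (auto simp: A_def)
   moreover have "x \<in> closure \<Omega>" using x closure_subset by (auto simp: A_def)
   ultimately show "x \<in> (\<Union>p\<in>F. A t \<inter> ball p (r p))" using x by (auto simp: K_def)
  qed
  have mi: "A t \<inter> ball p (r p) \<in> lmeasurable" for p by (intro fmeasurable.Int mA) auto
  have "measure lebesgue (A t) \<le> measure lebesgue (\<Union>p\<in>F. A t \<inter> ball p (r p))"
   using mA mi F(2) by (intro measure_mono_fmeasurable[OF sub] fmeasurable.finite_UN) (auto simp: fmeasurableD)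
  also have "\<dots> \<le> (\<Sum>p\<in>F. measure lebesgue (A t \<inter> ball p (r p)))"
   using mi by (intro measure_UNION_le F(2)) (auto simp: fmeasurableD)
  also have "\<dots> \<le> (\<Sum>p\<in>F. \<bar>C p\<bar> * t)"
  proof (rule sum_mono)
   fix p assume "p \<in> F"
   then have "measure lebesgue (A t \<inter> ball p (r p)) \<le> C p * t" using rC(2)[of p t] F(1) t by (auto simp: A_def)
   also have "\<dots> \<le> \<bar>C p\<bar> * t" using t by (intro mult_right_mono) auto
   finally show "measure lebesgue (A t \<inter> ball p (r p)) \<le> \<bar>C p\<bar> * t" .
  qed
  finally show ?thesis by (simp add: D_def sum_distrib_right)
 qed
 have D0: "0 \<le> D" by (simp add: D_def sum_nonneg)
 show ?thesis
 proof (rule that, intro allI impI)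
  fix t :: real assume t: "t > 0"
  have V: "0 \<le> measure lebesgue \<Omega> / d" using d by simp
  have "measure lebesgue (A t) \<le> (D + measure lebesgue \<Omega> / d) * t"
  proof (cases "t \<le> d")
   case True
   then show ?thesis using small[OF t] V t mult_nonneg_nonneg[OF V, of t] unfolding distrib_right by linarith
  next
   case False
   have "measure lebesgue (A t) \<le> measure lebesgue \<Omega>"
    by (rule measure_mono_fmeasurable) (use mA mO in \<open>auto simp: A_def fmeasurableD\<close>)
   also have "\<dots> = measure lebesgue \<Omega> / d * d" using d by simp
   also have "\<dots> \<le> measure lebesgue \<Omega> / d * t" using False V by (intro mult_left_mono) auto
   finally show ?thesis using mult_nonneg_nonneg[OF D0, of t] t unfolding distrib_right by linarith
  qed
  then show "measure lebesgue {x \<in> \<Omega>. infdist x (- \<Omega>) < t} \<le> (D + measure lebesgue \<Omega> / d) * t" by (simp add: A_def)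
 qed
qed

text \<open>Up to the factor ln 2, minus the logarithm of the distance is at most the number of
  dyadic layers {d < 2^-k} that contain the point. Their measures are of order 2^-k, so the sum is
  geometric.\<close>

lemma ln_dist_integrable:
 fixes \<Omega> :: "(real^'n::finite) set"
 assumes "bounded_smooth_domain \<Omega>"
 shows "integrable lebesgue (\<lambda>x. indicator \<Omega> x * max 0 (- ln (infdist x (- \<Omega>))))"
proof -
 have \<Omega>: "open \<Omega>" "bounded \<Omega>" using assms by (auto simp: bounded_smooth_domain_def)
 have ne: "- \<Omega> \<noteq> {}" using \<Omega>(2) not_bounded_UNIV by (metis Compl_empty_eq double_complement)
 have clo: "closed (- \<Omega>)" using \<Omega>(1) by auto
 obtain C where C: "\<forall>t>0. measure lebesgue {x \<in> \<Omega>. infdist x (- \<Omega>) < t} \<le> C * t"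
  by (rule boundary_layer[OF assms])
 define A where "A k = {x \<in> \<Omega>. infdist x (- \<Omega>) < (1/2)^k}" for k :: nat
 have mA: "A k \<in> lmeasurable" for k
 proof (rule bounded_set_imp_lmeasurable)
  have "open {x. infdist x (- \<Omega>) < (1/2)^k}" by (intro open_Collect_less continuous_intros)
  then have "open (\<Omega> \<inter> {x. infdist x (- \<Omega>) < (1/2)^k})" using \<Omega>(1) by (intro open_Int)
  moreover have "A k = \<Omega> \<inter> {x. infdist x (- \<Omega>) < (1/2)^k}" by (auto simp: A_def)
  ultimately show "A k \<in> sets lebesgue" by simp
 qed (rule bounded_subset[OF \<Omega>(2)], auto simp: A_def)
 let ?f = "\<lambda>x. indicator \<Omega> x * max 0 (- ln (infdist x (- \<Omega>)))"
 have meas: "?f \<in> borel_measurable lebesgue"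
 proof -
  have "(\<lambda>x. infdist x (- \<Omega>)) \<in> borel_measurable lebesgue" by (intro cont_leb continuous_intros)
  then show ?thesis using \<Omega>(1) by (intro borel_measurable_times borel_measurable_indicator borel_measurable_max borel_measurable_uminus) (auto intro: borel_measurable_ln)
 qed
 have pt: "ennreal (?f x) \<le> (\<Sum>k. ennreal (ln 2 * indicator (A k) x))" for x
 proof (cases "x \<in> \<Omega> \<and> infdist x (- \<Omega>) < 1")
  case True
  define d where "d = infdist x (- \<Omega>)"
  have d: "0 < d" "d < 1" unfolding d_def using in_closed_iff_infdist_zero[OF clo ne, of x] infdist_nonneg[of x "- \<Omega>"] True by force+
  have "\<exists>n. (1/2::real)^n \<le> d" using real_arch_pow_inv[OF d(1), of "1/2"] less_imp_le by auto
  define n where "n = (LEAST n. (1/2::real)^n \<le> d)"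
  have n: "(1/2::real)^n \<le> d" unfolding n_def using \<open>\<exists>n. _\<close> by (rule LeastI_ex)
  have less: "d < (1/2)^k" if "k < n" for k using not_less_Least[of k "\<lambda>n. (1/2::real)^n \<le> d"] that unfolding n_def by (simp add: not_le)
  have "- ln d \<le> - ln ((1/2)^n)" using n d by simp
  also have "\<dots> = real n * ln 2" by (simp add: ln_realpow ln_div)
  finally have le: "- ln d \<le> real n * ln 2" .
  have "ennreal (?f x) = ennreal (- ln d)" using True d by (simp add: d_def)
  also have "\<dots> \<le> ennreal (\<Sum>k<n. ln 2 * indicator (A k) x)"
  proof (rule ennreal_leI)
   have "(\<Sum>k<n. ln 2 * indicator (A k) x) = (\<Sum>k<n. ln (2::real))" using less True by (intro sum.cong) (auto simp: A_def d_def)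
   then show "- ln d \<le> (\<Sum>k<n. ln 2 * indicator (A k) x)" using le by simp
  qed
  also have "\<dots> = (\<Sum>k<n. ennreal (ln 2 * indicator (A k) x))" by (rule sum_ennreal[symmetric]) (simp add: zero_le_mult_iff)
  also have "\<dots> \<le> (\<Sum>k. ennreal (ln 2 * indicator (A k) x))" by (rule sum_le_suminf) auto
  finally show ?thesis .
 next
  case False
  then have "?f x = 0" by (auto simp: indicator_def)
  then show ?thesis by (simp only: ennreal_0 zero_le)
 qed
 have int: "(\<integral>\<^sup>+x. ennreal (ln 2 * indicator (A k) x) \<partial>lebesgue) \<le> ennreal (ln 2 * \<bar>C\<bar> * (1/2)^k)" for k
 proof -
  have i: "integrable lebesgue (\<lambda>x. ln 2 * indicator (A k) x :: real)"
   using indicator_integrable[of "A k"] mA[of k] \<Omega>(2) by (intro integrable_mult_right) (auto simp: A_def fmeasurableD intro: bounded_subset)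
  have "(\<integral>\<^sup>+x. ennreal (ln 2 * indicator (A k) x) \<partial>lebesgue) = ennreal (LINT x. ln 2 * indicator (A k) x)"
   by (rule nn_integral_eq_integral[OF i]) (simp add: zero_le_mult_iff)
  also have "(LINT x. ln 2 * indicator (A k) x) = ln 2 * measure lebesgue (A k)" using mA by (simp add: fmeasurableD)
  also have "\<dots> \<le> ln 2 * \<bar>C\<bar> * (1/2)^k"
  proof -
   have "measure lebesgue (A k) \<le> C * (1/2)^k" using C by (simp add: A_def)
   also have "\<dots> \<le> \<bar>C\<bar> * (1/2)^k" by (intro mult_right_mono) auto
   finally show ?thesis using mult_left_mono[of "measure lebesgue (A k)" "\<bar>C\<bar> * (1/2)^k" "ln 2"] by (simp add: mult.assoc)
  qed
  finally show ?thesis by (simp add: ennreal_leI)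
 qed
 have "(\<integral>\<^sup>+x. ennreal (?f x) \<partial>lebesgue) \<le> (\<integral>\<^sup>+x. (\<Sum>k. ennreal (ln 2 * indicator (A k) x)) \<partial>lebesgue)"
  by (intro nn_integral_mono pt)
 also have "\<dots> = (\<Sum>k. \<integral>\<^sup>+x. ennreal (ln 2 * indicator (A k) x) \<partial>lebesgue)"
  by (rule nn_integral_suminf) (use mA in \<open>auto intro!: measurable_compose[OF _ measurable_ennreal] borel_measurable_times borel_measurable_indicator simp: fmeasurableD\<close>)
 also have "\<dots> \<le> (\<Sum>k. ennreal (ln 2 * \<bar>C\<bar> * (1/2)^k))" by (intro suminf_le int) auto
 also have "\<dots> = ennreal (\<Sum>k. ln 2 * \<bar>C\<bar> * (1/2)^k)"
  by (intro suminf_ennreal2 summable_mult summable_geometric) auto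
 also have "\<dots> < \<infinity>" by simp
 finally show ?thesis by (intro integrableI_nonneg meas) (auto simp: zero_le_mult_iff)
qed

subsection \<open>Minimisers of the energy\<close>

lemma powr_lipschitz:
 fixes q s t B :: real
 assumes "1 \<le> q" "0 \<le> s" "s \<le> B" "0 \<le> t" "t \<le> B"
 shows "\<bar>s powr q - t powr q\<bar> \<le> q * B powr (q - 1) * \<bar>s - t\<bar>"
proof -
 have *: "t powr q - s powr q \<le> q * B powr (q - 1) * (t - s)" if "0 \<le> s" "s \<le> t" "t \<le> B" for s t :: real
 proof (cases "s = t")
  case False
  then have st: "s < t" using that by linarith
  have c: "continuous_on {s..t} (\<lambda>x. x powr q)"
   using assms that by (intro continuous_intros continuous_on_powr') auto
  obtain z where z: "s < z" "z < t" "t powr q - s powr q = (t - s) * (q * z powr (q - 1))"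
  proof -
   have "\<exists>z>s. z < t \<and> (\<lambda>x. x powr q) t - (\<lambda>x. x powr q) s = (\<lambda>y. y * (q * z powr (q - 1))) (t - s)"
    if der: "\<And>x. s < x ==> x < t ==> ((\<lambda>x. x powr q) has_derivative (\<lambda>y. y * (q * x powr (q - 1)))) (at x)"
   proof -
    obtain \<xi> where "s < \<xi>" "\<xi> < t" "(\<lambda>x. x powr q) t - (\<lambda>x. x powr q) s = (\<lambda>x y. y * (q * x powr (q - 1))) \<xi> (t - s)"
     by (rule mvt[OF st c, of "\<lambda>x y. y * (q * x powr (q - 1))"]) (use der in auto)
    then show ?thesis by blast
   qed
   moreover have "((\<lambda>x. x powr q) has_derivative (\<lambda>y. y * (q * x powr (q - 1)))) (at x)" if "s < x" for x
    using has_real_derivative_powr[of x q] that \<open>0 \<le> s\<close>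
    by (simp add: has_field_derivative_def mult.commute[of _ "q * x powr (q - 1)"])
   ultimately show ?thesis using that by blast
  qed
  have "z powr (q - 1) \<le> B powr (q - 1)" using z that assms by (intro powr_mono2) auto
  then have "(t - s) * (q * z powr (q - 1)) \<le> (t - s) * (q * B powr (q - 1))"
   using st assms by (intro mult_left_mono) auto
  then show ?thesis using z(3) by (simp add: mult_ac)
 qed simp
 show ?thesis
 proof (cases "s \<le> t")
  case True
  then have "s powr q \<le> t powr q" using assms by (intro powr_mono2) auto
  then show ?thesis using *[of s t] assms True by simp
 next
  case False
  then have "t powr q \<le> s powr q" using assms by (intro powr_mono2) auto
  then show ?thesis using *[of t s] assms False by simp
 qed
qed

text \<open>Both problems are treated at once: \<open>\<kappa> = 0\<close> gives the singular one, \<open>\<kappa> = 1\<close> the critical one.\<close>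

locale energy_pb =
 fixes \<Omega> :: "(real^'n::finite) set" and a \<delta> lam \<kappa> q :: real
 assumes \<Omega>: "open \<Omega>" "bounded \<Omega>" and a: "0 < a" and \<delta>: "0 < \<delta>" and lam: "0 < lam" and \<kappa>: "0 \<le> \<kappa>" and q: "2 < q"
begin

text \<open>The gradient is an argument, which keeps the choice hidden in \<open>wgrad\<close> out
  of the variational arguments.\<close>

definition J :: "(real^'n => real) => (real^'n => real^'n) => real" where
 "J v g = 1/2 * (LINT x. (norm (g x))\<^sup>2) - lam * (LINT x. Gfun a \<delta> (v x))
   - lam * \<kappa> / q * (LINT x. \<bar>v x\<bar> powr q)"

text \<open>The functions on which every term of \<open>J\<close> is a genuine integral: the upper
  bound takes care of the power, but G can tend to minus infinity at the boundary, so its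
  integrability is demanded.\<close>

definition fin :: "real => (real^'n => real) => (real^'n => real^'n) => bool" where
 "fin B v g \<longleftrightarrow> H01 \<Omega> v g \<and> (AE x in lebesgue. x \<in> \<Omega> --> 0 < v x \<and> v x \<le> B) \<and>
   integrable lebesgue (\<lambda>x. Gfun a \<delta> (v x))"

definition adm :: "(real^'n => real) => (real^'n => real) => (real^'n => real) => (real^'n => real^'n) => bool" where
 "adm l b v g \<longleftrightarrow> H01 \<Omega> v g \<and> (AE x in lebesgue. x \<in> \<Omega> --> l x \<le> v x \<and> v x \<le> b x) \<and>
   integrable lebesgue (\<lambda>x. Gfun a \<delta> (v x))"

lemma \<Omega>_meas: "\<Omega> \<in> sets lebesgue" "\<Omega> \<in> lmeasurable"
 using \<Omega> by (auto intro: bounded_set_imp_lmeasurable)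

lemma adm_fin:
 assumes "adm l b v g" "AE x in lebesgue. x \<in> \<Omega> --> 0 < l x" "AE x in lebesgue. x \<in> \<Omega> --> b x \<le> B"
 shows "fin B v g"
proof -
 have "AE x in lebesgue. x \<in> \<Omega> --> l x \<le> v x \<and> v x \<le> b x" using assms(1) by (simp add: adm_def)
 then have "AE x in lebesgue. x \<in> \<Omega> --> 0 < v x \<and> v x \<le> B"
  using assms(2,3) by eventually_elim auto
 then show ?thesis using assms(1) by (simp add: adm_def fin_def)
qed

lemma fin_AE:
 assumes "fin B v g"
 shows "AE x in lebesgue. (x \<in> \<Omega> --> 0 < v x \<and> v x \<le> B) \<and> (x \<notin> \<Omega> --> v x = 0 \<and> g x = 0)"
proof -
 have "AE x in lebesgue. x \<in> \<Omega> --> 0 < v x \<and> v x \<le> B" "AE x in lebesgue. x \<notin> \<Omega> --> v x = 0 \<and> g x = 0"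
  using assms H01_off[of \<Omega> v g] by (auto simp: fin_def)
 then show ?thesis by eventually_elim blast
qed

lemma fin_leb:
 assumes "fin B v g"
 shows "v \<in> borel_measurable lebesgue" "g \<in> borel_measurable lebesgue" "(\<lambda>x. Gfun a \<delta> (v x)) \<in> borel_measurable lebesgue"
  "(\<lambda>x. \<bar>v x\<bar> powr q) \<in> borel_measurable lebesgue"
proof -
 show v: "v \<in> borel_measurable lebesgue" and "g \<in> borel_measurable lebesgue"
  using assms gcl_leb unfolding fin_def by blast+
 show "(\<lambda>x. Gfun a \<delta> (v x)) \<in> borel_measurable lebesgue" by (rule comp_leb[OF Gfun_borel[OF a] v])
 have "(\<lambda>s::real. \<bar>s\<bar> powr q) \<in> borel_measurable borel" by measurable
 from comp_leb[OF this v] show "(\<lambda>x. \<bar>v x\<bar> powr q) \<in> borel_measurable lebesgue" .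
qed

lemma fin_powr:
 assumes "fin B v g"
 shows "AE x in lebesgue. \<bar>v x\<bar> powr q \<le> (\<bar>B\<bar> powr q) * indicator \<Omega> x" "integrable lebesgue (\<lambda>x. \<bar>v x\<bar> powr q)"
proof -
 show *: "AE x in lebesgue. \<bar>v x\<bar> powr q \<le> (\<bar>B\<bar> powr q) * indicator \<Omega> x"
  using fin_AE[OF assms]
 proof eventually_elim
  case (elim x)
  show ?case
  proof (cases "x \<in> \<Omega>")
   case True
   then show ?thesis using elim q by (auto intro!: powr_mono2)
  qed (use elim in simp)
 qed
 show "integrable lebesgue (\<lambda>x. \<bar>v x\<bar> powr q)"
  by (rule bounded_integrable[OF fin_leb(4)[OF assms] \<Omega>(2) \<Omega>_meas(1), of "\<bar>B\<bar> powr q"])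
    (use * in \<open>auto elim!: AE_mp intro!: AE_I2\<close>)
qed

lemma fin_abs_integrable:
 assumes "fin B v g" shows "integrable lebesgue v" "AE x in lebesgue. \<bar>v x\<bar> \<le> \<bar>B\<bar> * indicator \<Omega> x"
proof -
 show *: "AE x in lebesgue. \<bar>v x\<bar> \<le> \<bar>B\<bar> * indicator \<Omega> x"
  using fin_AE[OF assms]
 proof eventually_elim
  case (elim x)
  then show ?case by (cases "x \<in> \<Omega>") auto
 qed
 show "integrable lebesgue v" by (rule bounded_integrable[OF fin_leb(1)[OF assms] \<Omega>(2) \<Omega>_meas(1) *])
qed

lemma fin_G_le:
 assumes "fin B v g" shows "AE x in lebesgue. Gfun a \<delta> (v x) \<le> \<bar>Fp \<delta> a\<bar> * indicator \<Omega> x"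
 using fin_AE[OF assms]
proof eventually_elim
 case (elim x)
 show ?case
 proof (cases "x \<in> \<Omega>")
  case True
  then show ?thesis using elim Gfun_le[OF a, of "v x" \<delta>] by simp
 qed (use elim in \<open>simp add: Gfun_nonpos\<close>)
qed

lemma fin_lower:
 assumes "fin B v g"
 shows "- lam * \<bar>Fp \<delta> a\<bar> * measure lebesgue \<Omega> - lam * \<kappa> / q * (\<bar>B\<bar> powr q * measure lebesgue \<Omega>) \<le> J v g"
proof -
 have "(LINT x. Gfun a \<delta> (v x)) \<le> (LINT x. \<bar>Fp \<delta> a\<bar> * indicator \<Omega> x)"
  using assms fin_G_le[OF assms] \<Omega> by (intro integral_mono_AE integrable_mult_right indicator_integrable \<Omega>_meas) (auto simp: fin_def)
 then have 1: "(LINT x. Gfun a \<delta> (v x)) \<le> \<bar>Fp \<delta> a\<bar> * measure lebesgue \<Omega>" using \<Omega>_meas by simp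
 have "(LINT x. \<bar>v x\<bar> powr q) \<le> (LINT x. \<bar>B\<bar> powr q * indicator \<Omega> x)"
  using fin_powr[OF assms] \<Omega> by (intro integral_mono_AE integrable_mult_right indicator_integrable \<Omega>_meas)
 then have 2: "(LINT x. \<bar>v x\<bar> powr q) \<le> \<bar>B\<bar> powr q * measure lebesgue \<Omega>" using \<Omega>_meas by simp
 have c: "0 \<le> lam * \<kappa> / q" using lam \<kappa> q by simp
 have "0 \<le> 1/2 * (LINT x. (norm (g x))\<^sup>2)" by simp
 moreover have "lam * (LINT x. Gfun a \<delta> (v x)) \<le> lam * (\<bar>Fp \<delta> a\<bar> * measure lebesgue \<Omega>)" using 1 lam by (intro mult_left_mono) auto
 ultimately have "- (lam * (\<bar>Fp \<delta> a\<bar> * measure lebesgue \<Omega>)) - lam * \<kappa> / q * (\<bar>B\<bar> powr q * measure lebesgue \<Omega>) \<le> J v g"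
  unfolding J_def using mult_left_mono[OF 2 c] by linarith
 then show ?thesis by (simp add: mult.assoc)
qed

text \<open>The gradient of w + (v - w)^+. On {v = w} both this and \<open>mng\<close> give the mean
  of the two gradients, since \<open>hs\<close> is 1/2 at 0.\<close>

definition mxg :: "(real^'n => real) => (real^'n => real^'n) => (real^'n => real) => (real^'n => real^'n) => real^'n => real^'n" where
 "mxg v g w h x = h x + hs (v x - w x) *\<^sub>R (g x - h x)"

definition mng :: "(real^'n => real) => (real^'n => real^'n) => (real^'n => real) => (real^'n => real^'n) => real^'n => real^'n" where
 "mng v g w h x = g x - hs (v x - w x) *\<^sub>R (g x - h x)"

lemma H01_max_min:
 assumes "H01 A v g" "H01 A w h"
 shows "H01 A (\<lambda>x. max (v x) (w x)) (mxg v g w h)" "H01 A (\<lambda>x. min (v x) (w x)) (mng v g w h)"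
proof -
 have p: "H01 A (\<lambda>x. max 0 (v x - w x)) (\<lambda>x. hs (v x - w x) *\<^sub>R (g x - h x))" by (rule H01_pos[OF H01_diff[OF assms]])
 have "(\<lambda>x. w x + max 0 (v x - w x)) = (\<lambda>x. max (v x) (w x))" by (auto simp: fun_eq_iff max_def)
 then show "H01 A (\<lambda>x. max (v x) (w x)) (mxg v g w h)" using H01_add[OF assms(2) p] unfolding mxg_def[abs_def] by simp
 have "(\<lambda>x. v x - max 0 (v x - w x)) = (\<lambda>x. min (v x) (w x))" by (auto simp: fun_eq_iff max_def min_def)
 then show "H01 A (\<lambda>x. min (v x) (w x)) (mng v g w h)" using H01_diff[OF assms(1) p] unfolding mng_def[abs_def] by simp
qed

lemma max_min_G_integrable:
 assumes "H01 \<Omega> v g" "H01 \<Omega> w h" "integrable lebesgue (\<lambda>x. Gfun a \<delta> (v x))" "integrable lebesgue (\<lambda>x. Gfun a \<delta> (w x))"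
 shows "integrable lebesgue (\<lambda>x. Gfun a \<delta> (max (v x) (w x)))" "integrable lebesgue (\<lambda>x. Gfun a \<delta> (min (v x) (w x)))"
proof -
 have m: "v \<in> borel_measurable lebesgue" "w \<in> borel_measurable lebesgue" using assms gcl_leb by blast+
 have i: "integrable lebesgue (\<lambda>x. \<bar>Gfun a \<delta> (v x)\<bar> + \<bar>Gfun a \<delta> (w x)\<bar>)" using assms by (intro Bochner_Integration.integrable_add integrable_abs)
 show "integrable lebesgue (\<lambda>x. Gfun a \<delta> (max (v x) (w x)))"
  by (rule Bochner_Integration.integrable_bound[OF i])
    (use m in \<open>auto simp: max_def intro!: comp_leb[OF Gfun_borel[OF a]] AE_I2\<close>)
 show "integrable lebesgue (\<lambda>x. Gfun a \<delta> (min (v x) (w x)))"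
  by (rule Bochner_Integration.integrable_bound[OF i])
    (use m in \<open>auto simp: min_def intro!: comp_leb[OF Gfun_borel[OF a]] AE_I2\<close>)
qed

lemma adm_max: "adm l b v g ==> adm l b w h ==> adm l b (\<lambda>x. max (v x) (w x)) (mxg v g w h)"
 and adm_min: "adm l b v g ==> adm l b w h ==> adm l b (\<lambda>x. min (v x) (w x)) (mng v g w h)"
proof -
 assume A: "adm l b v g" "adm l b w h"
 have bd: "AE x in lebesgue. x \<in> \<Omega> --> (l x \<le> v x \<and> v x \<le> b x) \<and> l x \<le> w x \<and> w x \<le> b x"
 proof -
  have "AE x in lebesgue. x \<in> \<Omega> --> l x \<le> v x \<and> v x \<le> b x" "AE x in lebesgue. x \<in> \<Omega> --> l x \<le> w x \<and> w x \<le> b x"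
   using A by (auto simp: adm_def)
  then show ?thesis by eventually_elim auto
 qed
 have H: "H01 \<Omega> v g" "H01 \<Omega> w h" "integrable lebesgue (\<lambda>x. Gfun a \<delta> (v x))" "integrable lebesgue (\<lambda>x. Gfun a \<delta> (w x))"
  using A by (auto simp: adm_def)
 show "adm l b (\<lambda>x. max (v x) (w x)) (mxg v g w h)"
  unfolding adm_def by (intro conjI H01_max_min H max_min_G_integrable[OF H]) (use bd in eventually_elim, auto)
 show "adm l b (\<lambda>x. min (v x) (w x)) (mng v g w h)"
  unfolding adm_def by (intro conjI H01_max_min H max_min_G_integrable[OF H]) (use bd in eventually_elim, auto)
qed

text \<open>At each point maximum and minimum merely exchange the two values, so the terms without
  gradients balance exactly. The gradient term can only decrease, by 2 t (1 - t) times the squared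
  difference of the gradients, with t the value of \<open>hs\<close>.\<close>

lemma J_lattice:
 assumes v: "fin B v g" and w: "fin B w h"
 shows "J (\<lambda>x. max (v x) (w x)) (mxg v g w h) + J (\<lambda>x. min (v x) (w x)) (mng v g w h) \<le> J v g + J w h"
proof -
 have H: "H01 \<Omega> v g" "H01 \<Omega> w h" and GI: "integrable lebesgue (\<lambda>x. Gfun a \<delta> (v x))" "integrable lebesgue (\<lambda>x. Gfun a \<delta> (w x))"
  using v w by (auto simp: fin_def)
 note Hm = H01_max_min[OF H] and GI' = max_min_G_integrable[OF H GI]
 note sg = gcl_sq(2)[OF H(1)] gcl_sq(2)[OF H(2)] gcl_sq(2)[OF Hm(1)] gcl_sq(2)[OF Hm(2)]
 have G: "(LINT x. Gfun a \<delta> (max (v x) (w x))) + (LINT x. Gfun a \<delta> (min (v x) (w x)))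
   = (LINT x. Gfun a \<delta> (v x)) + (LINT x. Gfun a \<delta> (w x))"
  unfolding Bochner_Integration.integral_add[OF GI, symmetric] Bochner_Integration.integral_add[OF GI', symmetric]
  by (intro Bochner_Integration.integral_cong refl) (auto simp: max_def min_def)
 have pI: "integrable lebesgue (\<lambda>x. \<bar>max (v x) (w x)\<bar> powr q)" "integrable lebesgue (\<lambda>x. \<bar>min (v x) (w x)\<bar> powr q)"
 proof -
  have i: "integrable lebesgue (\<lambda>x. \<bar>v x\<bar> powr q + \<bar>w x\<bar> powr q)" using fin_powr(2)[OF v] fin_powr(2)[OF w] by simp
  have m: "(\<lambda>s::real. \<bar>s\<bar> powr q) \<in> borel_measurable borel" by measurable
  show "integrable lebesgue (\<lambda>x. \<bar>max (v x) (w x)\<bar> powr q)"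
   by (rule Bochner_Integration.integrable_bound[OF i])
     (use gcl_leb(1)[OF Hm(1)] in \<open>auto simp: max_def intro!: comp_leb[OF m] AE_I2\<close>)
  show "integrable lebesgue (\<lambda>x. \<bar>min (v x) (w x)\<bar> powr q)"
   by (rule Bochner_Integration.integrable_bound[OF i])
     (use gcl_leb(1)[OF Hm(2)] in \<open>auto simp: min_def intro!: comp_leb[OF m] AE_I2\<close>)
 qed
 have P: "(LINT x. \<bar>max (v x) (w x)\<bar> powr q) + (LINT x. \<bar>min (v x) (w x)\<bar> powr q)
   = (LINT x. \<bar>v x\<bar> powr q) + (LINT x. \<bar>w x\<bar> powr q)"
  unfolding Bochner_Integration.integral_add[OF pI, symmetric] Bochner_Integration.integral_add[OF fin_powr(2)[OF v] fin_powr(2)[OF w], symmetric]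
  by (intro Bochner_Integration.integral_cong refl) (auto simp: max_def min_def)
 have D: "(LINT x. (norm (mxg v g w h x))\<^sup>2) + (LINT x. (norm (mng v g w h x))\<^sup>2)
   \<le> (LINT x. (norm (g x))\<^sup>2) + (LINT x. (norm (h x))\<^sup>2)"
  unfolding Bochner_Integration.integral_add[OF sq_integrable[OF sg(1)] sq_integrable[OF sg(2)], symmetric]
   Bochner_Integration.integral_add[OF sq_integrable[OF sg(3)] sq_integrable[OF sg(4)], symmetric]
 proof (rule integral_mono)
  fix x
  define t where "t = hs (v x - w x)"
  have t: "0 \<le> t" "t \<le> 1" by (auto simp: t_def hs_range)
  define A B where "A = g x" and "B = h x"
  have "(norm (B + t *\<^sub>R (A - B)))\<^sup>2 + (norm (A - t *\<^sub>R (A - B)))\<^sup>2 = (norm A)\<^sup>2 + (norm B)\<^sup>2 - 2 * (t * (1 - t)) * (norm (A - B))\<^sup>2"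
   unfolding power2_norm_eq_inner by (simp add: inner_diff_left inner_diff_right inner_add_left inner_add_right inner_commute algebra_simps)
  moreover have "0 \<le> 2 * (t * (1 - t)) * (norm (A - B))\<^sup>2" using t by simp
  ultimately show "(norm (mxg v g w h x))\<^sup>2 + (norm (mng v g w h x))\<^sup>2 \<le> (norm (g x))\<^sup>2 + (norm (h x))\<^sup>2"
   by (simp add: mxg_def mng_def t_def A_def B_def)
 qed (use sg in \<open>auto intro!: Bochner_Integration.integrable_add sq_integrable\<close>)
 have "J (\<lambda>x. max (v x) (w x)) (mxg v g w h) + J (\<lambda>x. min (v x) (w x)) (mng v g w h) =
   1/2 * ((LINT x. (norm (mxg v g w h x))\<^sup>2) + (LINT x. (norm (mng v g w h x))\<^sup>2))
   - lam * ((LINT x. Gfun a \<delta> (max (v x) (w x))) + (LINT x. Gfun a \<delta> (min (v x) (w x))))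
   - lam * \<kappa> / q * ((LINT x. \<bar>max (v x) (w x)\<bar> powr q) + (LINT x. \<bar>min (v x) (w x)\<bar> powr q))"
  unfolding J_def distrib_left by simp
 also have "\<dots> \<le> 1/2 * ((LINT x. (norm (g x))\<^sup>2) + (LINT x. (norm (h x))\<^sup>2))
   - lam * ((LINT x. Gfun a \<delta> (v x)) + (LINT x. Gfun a \<delta> (w x)))
   - lam * \<kappa> / q * ((LINT x. \<bar>v x\<bar> powr q) + (LINT x. \<bar>w x\<bar> powr q))"
  unfolding G P using D by simp
 also have "\<dots> = J v g + J w h" unfolding J_def distrib_left by simp
 finally show ?thesis .
qed

lemma adm_mid:
 assumes v: "adm l b v g" and w: "adm l b w h" and l: "AE x in lebesgue. x \<in> \<Omega> --> 0 < l x"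
 shows "adm l b (\<lambda>x. (v x + w x) / 2) (\<lambda>x. (1/2) *\<^sub>R (g x + h x))"
  "(LINT x. Gfun a \<delta> (v x)) / 2 + (LINT x. Gfun a \<delta> (w x)) / 2 \<le> (LINT x. Gfun a \<delta> ((v x + w x) / 2))"
proof -
 have H: "H01 \<Omega> v g" "H01 \<Omega> w h" and GI: "integrable lebesgue (\<lambda>x. Gfun a \<delta> (v x))" "integrable lebesgue (\<lambda>x. Gfun a \<delta> (w x))"
  using v w by (auto simp: adm_def)
 have Hm: "H01 \<Omega> (\<lambda>x. (v x + w x) / 2) (\<lambda>x. (1/2) *\<^sub>R (g x + h x))"
  using H01_cmult[OF H01_add[OF H], of "1/2"] by simp
 have bd: "AE x in lebesgue. x \<in> \<Omega> --> 0 < l x \<and> (l x \<le> v x \<and> v x \<le> b x) \<and> l x \<le> w x \<and> w x \<le> b x"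
 proof -
  have "AE x in lebesgue. x \<in> \<Omega> --> l x \<le> v x \<and> v x \<le> b x" "AE x in lebesgue. x \<in> \<Omega> --> l x \<le> w x \<and> w x \<le> b x"
   using v w by (auto simp: adm_def)
  then show ?thesis using l by eventually_elim auto
 qed
 have off: "AE x in lebesgue. x \<notin> \<Omega> --> v x = 0 \<and> w x = 0"
 proof -
  have "AE x in lebesgue. x \<notin> \<Omega> --> v x = 0 \<and> g x = 0" "AE x in lebesgue. x \<notin> \<Omega> --> w x = 0 \<and> h x = 0"
   by (rule H01_off[OF H(1)]) (rule H01_off[OF H(2)])
  then show ?thesis by eventually_elim auto
 qed
 have low: "AE x in lebesgue. Gfun a \<delta> (v x) / 2 + Gfun a \<delta> (w x) / 2 \<le> Gfun a \<delta> ((v x + w x) / 2) \<and>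
   \<bar>Gfun a \<delta> ((v x + w x) / 2)\<bar> \<le> \<bar>Gfun a \<delta> (v x)\<bar> + \<bar>Gfun a \<delta> (w x)\<bar> + \<bar>Fp \<delta> a\<bar> * indicator \<Omega> x"
  using bd off
 proof eventually_elim
  case (elim x)
  show ?case
  proof (cases "x \<in> \<Omega>")
   case True
   then have p: "0 < v x" "0 < w x" using elim by auto
   have 1: "Gfun a \<delta> (v x) / 2 + Gfun a \<delta> (w x) / 2 \<le> Gfun a \<delta> ((v x + w x) / 2)" by (rule Gfun_mid[OF a \<delta> p])
   have 2: "Gfun a \<delta> ((v x + w x) / 2) \<le> Fp \<delta> a" using p by (intro Gfun_le a) auto
   show ?thesis using 1 2 True by (auto simp: abs_if)
  next
   case False
   then show ?thesis using elim by (simp add: Gfun_nonpos)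
  qed
 qed
 have GM: "integrable lebesgue (\<lambda>x. Gfun a \<delta> ((v x + w x) / 2))"
 proof (rule Bochner_Integration.integrable_bound)
  show "integrable lebesgue (\<lambda>x. \<bar>Gfun a \<delta> (v x)\<bar> + \<bar>Gfun a \<delta> (w x)\<bar> + \<bar>Fp \<delta> a\<bar> * indicator \<Omega> x)"
   by (intro Bochner_Integration.integrable_add integrable_abs GI integrable_mult_right indicator_integrable \<Omega>_meas(1) \<Omega>(2))
  show "(\<lambda>x. Gfun a \<delta> ((v x + w x) / 2)) \<in> borel_measurable lebesgue" by (rule comp_leb[OF Gfun_borel[OF a] gcl_leb(1)[OF Hm]])
  show "AE x in lebesgue. norm (Gfun a \<delta> ((v x + w x) / 2)) \<le> norm (\<bar>Gfun a \<delta> (v x)\<bar> + \<bar>Gfun a \<delta> (w x)\<bar> + \<bar>Fp \<delta> a\<bar> * indicator \<Omega> x)"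
   using low by eventually_elim auto
 qed
 have "AE x in lebesgue. x \<in> \<Omega> --> l x \<le> (v x + w x) / 2 \<and> (v x + w x) / 2 \<le> b x" using bd by eventually_elim auto
 then show "adm l b (\<lambda>x. (v x + w x) / 2) (\<lambda>x. (1/2) *\<^sub>R (g x + h x))" using Hm GM by (simp add: adm_def)
 have "(LINT x. Gfun a \<delta> (v x) / 2 + Gfun a \<delta> (w x) / 2) \<le> (LINT x. Gfun a \<delta> ((v x + w x) / 2))"
  using low GI GM by (intro integral_mono_AE) auto
 then show "(LINT x. Gfun a \<delta> (v x)) / 2 + (LINT x. Gfun a \<delta> (w x)) / 2 \<le> (LINT x. Gfun a \<delta> ((v x + w x) / 2))"
  using GI by simp
qed

text \<open>The parallelogram identity produces the difference of the gradients, and concavity of G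
  favours the midpoint. Only the power has the wrong sign; its Lipschitz bound costs an L1 term, in
  whose constant the factor q cancels the 1/q of the energy.\<close>

lemma mid_gradient_bound:
 assumes v: "adm l b v g" and w: "adm l b w h" and l: "AE x in lebesgue. x \<in> \<Omega> --> 0 < l x"
  and b: "AE x in lebesgue. x \<in> \<Omega> --> b x \<le> B"
  and m: "m \<le> J (\<lambda>x. (v x + w x) / 2) (\<lambda>x. (1/2) *\<^sub>R (g x + h x))"
 shows "(nrm lebesgue (\<lambda>x. g x - h x))\<^sup>2 / 8 \<le> (J v g - m) / 2 + (J w h - m) / 2 + lam * \<kappa> * \<bar>B\<bar> powr (q - 1) * (LINT x. \<bar>v x - w x\<bar>)"
proof -
 note fv = adm_fin[OF v l b] and fw = adm_fin[OF w l b] and fm = adm_fin[OF adm_mid(1)[OF v w l] l b]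
 note sg = gcl_sq(2)[of "tests \<Omega>" v g] gcl_sq(2)[of "tests \<Omega>" w h]
 have H: "sq lebesgue g" "sq lebesgue h" using sg v w by (auto simp: adm_def)
 have par: "(LINT x. (norm ((1/2) *\<^sub>R (g x + h x)))\<^sup>2) = (LINT x. (norm (g x))\<^sup>2) / 2 + (LINT x. (norm (h x))\<^sup>2) / 2
   - (nrm lebesgue (\<lambda>x. g x - h x))\<^sup>2 / 4"
 proof -
  have "(norm ((1/2) *\<^sub>R (g x + h x)))\<^sup>2 = (norm (g x))\<^sup>2 / 2 + (norm (h x))\<^sup>2 / 2 - (norm (g x - h x))\<^sup>2 / 4" for x
   unfolding power2_norm_eq_inner by (simp add: inner_diff_left inner_diff_right inner_add_left inner_add_right inner_commute field_simps)
  then show ?thesis using sq_integrable[OF H(1)] sq_integrable[OF H(2)] sq_integrable[OF sq_diff[OF H]] by (simp add: nrm_power2)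
 qed
 define L where "L = q * \<bar>B\<bar> powr (q - 1)"
 have L0: "0 \<le> L" using q by (simp add: L_def)
 have pw: "(LINT x. \<bar>v x\<bar> powr q) / 2 + (LINT x. \<bar>w x\<bar> powr q) / 2 - (LINT x. \<bar>(v x + w x) / 2\<bar> powr q)
   \<le> L * (LINT x. \<bar>v x - w x\<bar>)"
 proof -
  have i: "integrable lebesgue (\<lambda>x. \<bar>v x - w x\<bar>)" using fin_abs_integrable(1)[OF fv] fin_abs_integrable(1)[OF fw] by simp
  have "(LINT x. \<bar>v x\<bar> powr q / 2 + \<bar>w x\<bar> powr q / 2 - \<bar>(v x + w x) / 2\<bar> powr q) \<le> (LINT x. L * \<bar>v x - w x\<bar>)"
  proof (rule integral_mono_AE)
   show "AE x in lebesgue. \<bar>v x\<bar> powr q / 2 + \<bar>w x\<bar> powr q / 2 - \<bar>(v x + w x) / 2\<bar> powr q \<le> L * \<bar>v x - w x\<bar>"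
    using fin_AE[OF fv] fin_AE[OF fw]
   proof eventually_elim
    case (elim x)
    show ?case
    proof (cases "x \<in> \<Omega>")
     case True
     then have p: "0 < v x" "v x \<le> \<bar>B\<bar>" "0 < w x" "w x \<le> \<bar>B\<bar>" using elim by auto
     define M where "M = (v x + w x) / 2"
     have 1: "\<bar>v x powr q - M powr q\<bar> \<le> L * \<bar>v x - M\<bar>" unfolding L_def by (rule powr_lipschitz) (use q p in \<open>auto simp: M_def\<close>)
     have 2: "\<bar>w x powr q - M powr q\<bar> \<le> L * \<bar>w x - M\<bar>" unfolding L_def by (rule powr_lipschitz) (use q p in \<open>auto simp: M_def\<close>)
     have 3: "\<bar>v x - M\<bar> \<le> \<bar>v x - w x\<bar>" "\<bar>w x - M\<bar> \<le> \<bar>v x - w x\<bar>" by (auto simp: M_def abs_if field_simps)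
     have "\<bar>v x powr q - M powr q\<bar> \<le> L * \<bar>v x - w x\<bar>" "\<bar>w x powr q - M powr q\<bar> \<le> L * \<bar>v x - w x\<bar>"
      using 1 2 mult_left_mono[OF 3(1) L0] mult_left_mono[OF 3(2) L0] by linarith+
     moreover have "\<bar>M\<bar> = M" using p by (simp add: M_def)
     ultimately show ?thesis using p unfolding M_def[symmetric] by simp
    next
     case False
     then show ?thesis using elim by simp
    qed
   qed
  qed (use i fin_powr(2)[OF fv] fin_powr(2)[OF fw] fin_powr(2)[OF fm] in auto)
  then show ?thesis using fin_powr(2)[OF fv] fin_powr(2)[OF fw] fin_powr(2)[OF fm] by simp
 qed
 have c: "0 \<le> lam * \<kappa> / q" using lam \<kappa> q by simp
 have Gm: "lam * ((LINT x. Gfun a \<delta> (v x)) / 2 + (LINT x. Gfun a \<delta> (w x)) / 2) \<le> lam * (LINT x. Gfun a \<delta> ((v x + w x) / 2))"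
  using adm_mid(2)[OF v w l] lam by (intro mult_left_mono) auto
 have pm: "lam * \<kappa> / q * ((LINT x. \<bar>v x\<bar> powr q) / 2 + (LINT x. \<bar>w x\<bar> powr q) / 2 - (LINT x. \<bar>(v x + w x) / 2\<bar> powr q))
   \<le> lam * \<kappa> / q * (L * (LINT x. \<bar>v x - w x\<bar>))" by (rule mult_left_mono[OF pw c])
 have Lq: "lam * \<kappa> / q * (L * (LINT x. \<bar>v x - w x\<bar>)) = lam * \<kappa> * \<bar>B\<bar> powr (q - 1) * (LINT x. \<bar>v x - w x\<bar>)"
  using q by (simp add: L_def)
 have "m \<le> 1/2 * ((LINT x. (norm (g x))\<^sup>2) / 2 + (LINT x. (norm (h x))\<^sup>2) / 2 - (nrm lebesgue (\<lambda>x. g x - h x))\<^sup>2 / 4)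
   - lam * (LINT x. Gfun a \<delta> ((v x + w x) / 2)) - lam * \<kappa> / q * (LINT x. \<bar>(v x + w x) / 2\<bar> powr q)"
  using m unfolding J_def par .
 moreover have "N / 8 \<le> (1/2 * A - gv - pv - m) / 2 + (1/2 * C - gw - pw - m) / 2 + R"
  if "m \<le> 1/2 * (A / 2 + C / 2 - N / 4) - gm - pm" "gv / 2 + gw / 2 \<le> gm" "pv / 2 + pw / 2 - pm \<le> R"
  for A C N gv gw gm pv pw pm R m :: real
  using that by (simp add: field_simps)
 ultimately show ?thesis using Gm pm unfolding Lq J_def right_diff_distrib[of "lam * \<kappa> / q"] distrib_left[of "lam * \<kappa> / q"] distrib_left[of lam]
   times_divide_eq_right[of _ _ 2] by blast
qed

end

context energy_pb begin

text \<open>Running maxima of \<open>P n\<close>, ..., \<open>P (n + k)\<close> as pairs of a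
  function and its gradient.\<close>

primrec mxseq :: "(nat => (real^'n => real) \<times> (real^'n => real^'n)) => nat => nat => (real^'n => real) \<times> (real^'n => real^'n)" where
 "mxseq P n 0 = P n"
| "mxseq P n (Suc k) = (\<lambda>x. max (fst (mxseq P n k) x) (fst (P (n + Suc k)) x),
   mxg (fst (mxseq P n k)) (snd (mxseq P n k)) (fst (P (n + Suc k))) (snd (P (n + Suc k))))"

lemma mxseq_Max: "fst (mxseq P n k) x = Max ((\<lambda>j. fst (P j) x) ` {n..n+k})"
proof (induction k)
 case (Suc k)
 have "{n..n + Suc k} = insert (n + Suc k) {n..n+k}" by auto
 then show ?case using Suc by (simp add: max.commute)
qed simp

lemma mxseq_mono:
 assumes "n \<le> m" "m + k \<le> n + k'" shows "fst (mxseq P m k) x \<le> fst (mxseq P n k') x"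
 unfolding mxseq_Max by (rule Max_mono) (use assms in auto)

text \<open>A minimising sequence \<open>(v\<^sub>n)\<close> is replaced by \<open>w\<^sub>n = max(v\<^sub>n, \<dots>, v\<^sub>m)\<close> with \<open>m = m(n)\<close> large.  By
 submodularity of the energy \<open>(w\<^sub>n)\<close> is still minimising; it is almost decreasing, hence converges
 in \<open>L\<^sup>1\<close>, and the parallelogram identity turns this into convergence of the gradients.\<close>

lemma minimizer:
 assumes l: "AE x in lebesgue. x \<in> \<Omega> --> 0 < l x" and b: "AE x in lebesgue. x \<in> \<Omega> --> b x \<le> B"
  and ne: "adm l b v0 g0"
 obtains u g where "adm l b u g" "\<forall>v h. adm l b v h --> J u g \<le> J v h"
proof -
 note fin = adm_fin[OF _ l b]
 define S where "S = {J v g |v g. adm l b v g}"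
 define m where "m = Inf S"
 have bS: "bdd_below S" unfolding S_def bdd_below_def using fin_lower[OF fin] by blast
 have Sne: "S \<noteq> {}" using ne by (auto simp: S_def)
 have mle: "m \<le> J v g" if "adm l b v g" for v g unfolding m_def by (rule cInf_lower) (use that bS in \<open>auto simp: S_def\<close>)
 have "\<forall>n. \<exists>p. adm l b (fst p) (snd p) \<and> J (fst p) (snd p) < m + (1/2)^n"
 proof
  fix n :: nat
  have "\<exists>s\<in>S. s < m + (1/2)^n" using cInf_lessD[OF Sne, of "m + (1/2)^n"] by (auto simp: m_def)
  then show "\<exists>p. adm l b (fst p) (snd p) \<and> J (fst p) (snd p) < m + (1/2)^n" by (auto simp: S_def)
 qed
 from choice[OF this] obtain P where P0: "\<forall>n. adm l b (fst (P n)) (snd (P n)) \<and> J (fst (P n)) (snd (P n)) < m + (1/2)^n"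
  by (elim exE) (rule that)
 then have P: "\<And>n. adm l b (fst (P n)) (snd (P n))" "\<And>n. J (fst (P n)) (snd (P n)) < m + (1/2)^n" by auto
 let ?W = "mxseq P"
 \<comment> \<open>Submodularity and the admissibility of the minimum show that joining
   \<open>P j\<close> raises the excess over \<open>m\<close> by at most 2^-j. The sum of these,
   starting at \<open>n\<close>, stays below twice 2^-n.\<close>
 have W: "adm l b (fst (?W n k)) (snd (?W n k)) \<and> J (fst (?W n k)) (snd (?W n k)) \<le> m + (2 - (1/2)^k) * (1/2)^n" for n k
 proof (induction k)
  case 0
  then show ?case using P(1)[of n] less_imp_le[OF P(2)[of n]] by simp
 next
  case (Suc k)
  let ?v = "fst (?W n k)" and ?g = "snd (?W n k)" and ?w = "fst (P (n + Suc k))" and ?h = "snd (P (n + Suc k))"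
  have A: "adm l b ?v ?g" "adm l b ?w ?h" using Suc P(1) by auto
  have "J (\<lambda>x. max (?v x) (?w x)) (mxg ?v ?g ?w ?h) + J (\<lambda>x. min (?v x) (?w x)) (mng ?v ?g ?w ?h) \<le> J ?v ?g + J ?w ?h"
   by (rule J_lattice[OF fin[OF A(1)] fin[OF A(2)]])
  moreover have "m \<le> J (\<lambda>x. min (?v x) (?w x)) (mng ?v ?g ?w ?h)" by (rule mle[OF adm_min[OF A]])
  moreover have "J ?w ?h \<le> m + (1/2)^(n + Suc k)" by (rule less_imp_le[OF P(2)])
  moreover have "J ?v ?g \<le> m + (2 - (1/2)^k) * (1/2)^n" using Suc by simp
  ultimately have "J (\<lambda>x. max (?v x) (?w x)) (mxg ?v ?g ?w ?h) \<le> m + ((2 - (1/2)^k) * (1/2)^n + (1/2)^(n + Suc k))" by linarith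
  also have "(2 - (1/2)^k) * (1/2)^n + (1/2)^(n + Suc k) = (2 - (1/2)^Suc k) * (1/2::real)^n" by (simp add: power_add algebra_simps)
  finally show ?case using adm_max[OF A] by simp
 qed
 have Wfin: "fin B (fst (?W n k)) (snd (?W n k))" for n k using W by (intro fin) auto
 define I where "I n k = (LINT x. fst (?W n k) x)" for n k
 have Wint: "integrable lebesgue (fst (?W n k))" for n k by (rule fin_abs_integrable(1)[OF Wfin])
 define V where "V = \<bar>B\<bar> * measure lebesgue \<Omega>"
 have Ibd: "\<bar>I n k\<bar> \<le> V" for n k
 proof -
  have "\<bar>I n k\<bar> \<le> (LINT x. \<bar>fst (?W n k) x\<bar>)" unfolding I_def by (rule integral_abs_bound)
  also have "\<dots> \<le> (LINT x. \<bar>B\<bar> * indicator \<Omega> x)"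
   by (intro integral_mono_AE integrable_abs Wint integrable_mult_right indicator_integrable \<Omega>_meas(1) \<Omega>(2) fin_abs_integrable(2)[OF Wfin])
  also have "\<dots> = V" using \<Omega>_meas by (simp add: V_def)
  finally show ?thesis .
 qed
 have Imono: "I n k \<le> I n' k'" if "n' \<le> n" "n + k \<le> n' + k'" for n k n' k'
  unfolding I_def by (intro integral_mono Wint mxseq_mono that)
 \<comment> \<open>The integrals of the running maxima increase and are bounded, so from some index
   on they gain at most 2^-n; this index fixes the length of the nth maximum.\<close>
 have "\<forall>n. \<exists>k. \<forall>k'\<ge>k. I n k' - I n k \<le> (1/2)^n"
 proof
  fix n
  have "incseq (I n)" by (intro incseq_SucI Imono) auto
  moreover have "\<forall>i. I n i \<le> V" using Ibd[of n] by (auto simp: abs_le_iff)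
  ultimately obtain L where L: "I n \<longlonglongrightarrow> L" "\<forall>i. I n i \<le> L" by (rule incseq_convergent)
  have "\<forall>\<^sub>F k in sequentially. L - (1/2)^n < I n k" using L(1) by (intro order_tendstoD) auto
  then obtain k where "L - (1/2)^n < I n k" using eventually_happens' by force
  then have "I n k' - I n k \<le> (1/2)^n" for k' using L(2)[rule_format, of k'] by linarith
  then show "\<exists>k. \<forall>k'\<ge>k. I n k' - I n k \<le> (1/2)^n" by blast
 qed
 from choice[OF this] obtain K where K0: "\<forall>n. \<forall>k'\<ge>K n. I n k' - I n (K n) \<le> (1/2)^n" by (elim exE) (rule that)
 define w where "w n = fst (?W n (K n))" for n
 define G where "G n = snd (?W n (K n))" for n
 have wadm: "adm l b (w n) (G n)" for n using W unfolding w_def G_def by blast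
 have wJ: "J (w n) (G n) \<le> m + 2 * (1/2)^n" for n
 proof -
  have "(2 - (1/2)^K n) * (1/2)^n \<le> 2 * (1/2::real)^n" by (intro mult_right_mono) auto
  then show ?thesis using W[of n "K n"] unfolding w_def G_def by linarith
 qed
 have wfin: "fin B (w n) (G n)" for n by (rule fin[OF wadm])
 have wH: "H01 \<Omega> (w n) (G n)" for n using wadm by (simp add: adm_def)
 have wi: "integrable lebesgue (w n)" for n unfolding w_def by (rule Wint)
 define c where "c n = (LINT x. w n x)" for n
 have cI: "c n = I n (K n)" for n by (simp add: c_def I_def w_def)
 \<comment> \<open>\<open>w n\<close> and \<open>w k\<close> both lie below a longer maximum started
   at \<open>n\<close>, whose integral exceeds that of \<open>w n\<close> by at most 2^-n.\<close>
 have pos: "(LINT x. max 0 (w k x - w n x)) \<le> (1/2)^n" if "n \<le> k" for n k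
 proof -
  define M where "M = max (K n) (k - n + K k)"
  have "(LINT x. max 0 (w k x - w n x)) \<le> (LINT x. fst (?W n M) x - w n x)"
  proof (rule integral_mono)
   show "integrable lebesgue (\<lambda>x. max 0 (w k x - w n x))" using wi by simp
   show "integrable lebesgue (\<lambda>x. fst (?W n M) x - w n x)" using wi Wint by simp
   fix x
   have "w n x \<le> fst (?W n M) x" unfolding w_def by (rule mxseq_mono) (auto simp: M_def)
   moreover have "w k x \<le> fst (?W n M) x" unfolding w_def by (rule mxseq_mono) (use that in \<open>auto simp: M_def\<close>)
   ultimately show "max 0 (w k x - w n x) \<le> fst (?W n M) x - w n x" by simp
  qed
  also have "\<dots> = I n M - I n (K n)" using wi Wint by (simp add: I_def w_def)
  also have "\<dots> \<le> (1/2)^n" using K0 by (auto simp: M_def)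
  finally show ?thesis .
 qed
 define D where "D k n = (LINT x. \<bar>w k x - w n x\<bar>)" for k n
 have Dsym: "D k n = D n k" for k n by (simp add: D_def abs_minus_commute)
 have Dle: "D k n \<le> 2 * (1/2)^n + \<bar>c n - c k\<bar>" if "n \<le> k" for n k
 proof -
  have "D k n = (LINT x. 2 * max 0 (w k x - w n x) - (w k x - w n x))"
   unfolding D_def by (intro Bochner_Integration.integral_cong refl) (auto simp: max_def)
  also have "\<dots> = 2 * (LINT x. max 0 (w k x - w n x)) - (c k - c n)"
   unfolding c_def using wi by simp
  finally show ?thesis using pos[OF that] by linarith
 qed
 have half0: "(\<lambda>n. (1/2::real)^n) \<longlonglongrightarrow> 0" by (intro LIMSEQ_power_zero) simp
 have cC: "Cauchy c"
 proof -
  \<comment> \<open>\<open>c\<close> may grow by 2^-n in the nth step; the added term decreases by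
    exactly as much, which makes \<open>e\<close> decreasing.\<close>
  define e where "e n = c n + 2 * (1/2)^n" for n
  have "decseq e"
  proof (rule decseq_SucI)
   fix n
   have "c (Suc n) - c n = (LINT x. w (Suc n) x - w n x)" using wi by (simp add: c_def)
   also have "\<dots> \<le> (LINT x. max 0 (w (Suc n) x - w n x))" using wi by (intro integral_mono) auto
   also have "\<dots> \<le> (1/2)^n" by (rule pos) simp
   finally show "e (Suc n) \<le> e n" by (simp add: e_def)
  qed
  moreover have "\<forall>i. - V \<le> e i"
  proof
   fix i
   have "(0::real) \<le> 2 * (1/2)^i" by simp
   then show "- V \<le> e i" using Ibd[of i "K i"] unfolding e_def cI by linarith
  qed
  ultimately obtain L where "e \<longlonglongrightarrow> L" by (rule decseq_convergent)
  then have "(\<lambda>n. e n - 2 * (1/2)^n) \<longlonglongrightarrow> L - 2 * 0" by (intro tendsto_intros half0)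
  then have "c \<longlonglongrightarrow> L" by (simp add: e_def)
  then show ?thesis by (intro convergent_Cauchy convergentI)
 qed
 have DC: "\<exists>N. \<forall>k\<ge>N. \<forall>n\<ge>N. D k n < e" if e: "e > 0" for e
 proof -
  obtain N1 where N1: "\<And>k n. k \<ge> N1 ==> n \<ge> N1 ==> \<bar>c k - c n\<bar> < e / 2"
   using CauchyD[OF cC, of "e/2"] e by auto
  have "\<forall>\<^sub>F n in sequentially. (1/2::real)^n < e / 4" using half0 e by (intro order_tendstoD(2)[of _ 0]) auto
  then obtain N2 where N2: "\<And>n. n \<ge> N2 ==> (1/2::real)^n < e / 4" by (auto simp: eventually_sequentially)
  have *: "D k n < e" if "n \<le> k" "n \<ge> max N1 N2" for k n
   using Dle[OF that(1)] N1[of n k] N2[of n] that by auto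
  show ?thesis
  proof (intro exI allI impI)
   fix k n assume "max N1 N2 \<le> k" "max N1 N2 \<le> n"
   then show "D k n < e" using *[of n k] *[of k n] Dsym[of k n] by (cases "n \<le> k") auto
  qed
 qed
 have wsq: "sq lebesgue (w n)" and Gsq: "sq lebesgue (G n)" for n using gcl_sq[OF wH] by auto
 \<comment> \<open>In a bounded order interval the L1 distance controls the L2 distance.\<close>
 have w2: "(nrm lebesgue (\<lambda>x. w k x - w n x))\<^sup>2 \<le> 2 * \<bar>B\<bar> * D k n" for k n
 proof -
  have "(LINT x. (norm (w k x - w n x))\<^sup>2) \<le> (LINT x. 2 * \<bar>B\<bar> * \<bar>w k x - w n x\<bar>)"
  proof (rule integral_mono_AE)
   show "AE x in lebesgue. (norm (w k x - w n x))\<^sup>2 \<le> 2 * \<bar>B\<bar> * \<bar>w k x - w n x\<bar>"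
    using fin_abs_integrable(2)[OF wfin[of k]] fin_abs_integrable(2)[OF wfin[of n]]
   proof eventually_elim
    case (elim x)
    have "\<bar>B\<bar> * indicator \<Omega> x \<le> \<bar>B\<bar>" by (simp add: indicator_def)
    then have "\<bar>w k x - w n x\<bar> \<le> 2 * \<bar>B\<bar>" using elim by linarith
    then show ?case unfolding real_norm_def power2_eq_square by (intro mult_right_mono) auto
   qed
  qed (use wi in \<open>auto intro!: sq_integrable[of _ "\<lambda>x. w k x - w n x", simplified] sq_diff wsq\<close>)
  also have "\<dots> = 2 * \<bar>B\<bar> * D k n" by (simp add: D_def)
  finally show ?thesis by (simp add: nrm_power2)
 qed
 have sqless: "x < e" if "x\<^sup>2 < e\<^sup>2" "0 < e" for x e :: real using that by (simp add: power_less_imp_less_base)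
 obtain U where U: "L2lim lebesgue w U"
 proof (rule L2_complete[of lebesgue w])
  fix e :: real assume e: "e > 0"
  define e' where "e' = e\<^sup>2 / (2 * \<bar>B\<bar> + 1)"
  have e': "e' > 0" "2 * \<bar>B\<bar> * e' < e\<^sup>2 \<or> B = 0" using e by (auto simp: e'_def field_simps intro!: divide_pos_pos add_nonneg_pos)
  obtain N where N: "\<forall>k\<ge>N. \<forall>n\<ge>N. D k n < e'" using DC[OF e'(1)] by blast
  have "nrm lebesgue (\<lambda>x. w k x - w n x) < e" if "k \<ge> N" "n \<ge> N" for k n
  proof (rule sqless[OF _ e])
   have "D k n \<le> e'" using N that by (simp add: less_imp_le)
   then have "2 * \<bar>B\<bar> * D k n \<le> 2 * \<bar>B\<bar> * e'" by (intro mult_left_mono) auto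
   then show "(nrm lebesgue (\<lambda>x. w k x - w n x))\<^sup>2 < e\<^sup>2" using w2[of k n] e'(2) e zero_less_power[OF e, of 2]
    by (elim disjE) (linarith, simp)
  qed
  then show "\<exists>N. \<forall>m\<ge>N. \<forall>n\<ge>N. nrm lebesgue (\<lambda>x. w m x - w n x) < e" by blast
 qed (use wsq in auto)
 obtain \<Gamma> where \<Gamma>: "L2lim lebesgue G \<Gamma>"
 proof (rule L2_complete[of lebesgue G])
  fix e :: real assume e: "e > 0"
  \<comment> \<open>The constant of \<open>mid_gradient_bound\<close> after clearing its factor
    1/8.\<close>
  define C where "C = 8 * lam * \<kappa> * \<bar>B\<bar> powr (q - 1)"
  have C0: "0 \<le> C" using lam \<kappa> by (simp add: C_def)
  define e' where "e' = e\<^sup>2 / (2 * (C + 1))"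
  have e': "e' > 0" "C * e' < e\<^sup>2 / 2"
  proof -
   show "e' > 0" using e C0 by (auto simp: e'_def intro!: divide_pos_pos)
   have "C * e' < (C + 1) * e'" using \<open>e' > 0\<close> by simp
   also have "\<dots> = e\<^sup>2 / 2" using C0 by (simp add: e'_def field_simps)
   finally show "C * e' < e\<^sup>2 / 2" .
  qed
  obtain N where N: "\<forall>k\<ge>N. \<forall>n\<ge>N. D k n < e'" using DC[OF e'(1)] by blast
  have "\<forall>\<^sub>F n in sequentially. (1/2::real)^n < e\<^sup>2 / 32" using half0 e by (intro order_tendstoD(2)[of _ 0]) auto
  then obtain N2 where N2: "\<And>n. n \<ge> N2 ==> (1/2::real)^n < e\<^sup>2 / 32" by (auto simp: eventually_sequentially)
  have "nrm lebesgue (\<lambda>x. G k x - G n x) < e" if kn: "k \<ge> max N N2" "n \<ge> max N N2" for k n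
  proof (rule sqless[OF _ e])
   have "(nrm lebesgue (\<lambda>x. G k x - G n x))\<^sup>2 / 8 \<le> (J (w k) (G k) - m) / 2 + (J (w n) (G n) - m) / 2 + lam * \<kappa> * \<bar>B\<bar> powr (q - 1) * D k n"
    unfolding D_def by (rule mid_gradient_bound[OF wadm wadm l b mle[OF adm_mid(1)[OF wadm wadm l]]])
   then have "(nrm lebesgue (\<lambda>x. G k x - G n x))\<^sup>2 \<le> 4 * (J (w k) (G k) - m) + 4 * (J (w n) (G n) - m) + C * D k n"
   proof -
    have "C * D k n = 8 * (lam * \<kappa> * \<bar>B\<bar> powr (q - 1) * D k n)" by (simp add: C_def)
    moreover assume "(nrm lebesgue (\<lambda>x. G k x - G n x))\<^sup>2 / 8 \<le> (J (w k) (G k) - m) / 2 + (J (w n) (G n) - m) / 2 + lam * \<kappa> * \<bar>B\<bar> powr (q - 1) * D k n"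
    ultimately show ?thesis by linarith
   qed
   also have "\<dots> \<le> 8 * (1/2)^k + 8 * (1/2)^n + C * e'"
   proof -
    have "D k n \<le> e'" using N kn by (simp add: less_imp_le)
    then have "C * D k n \<le> C * e'" using C0 by (rule mult_left_mono)
    moreover have "4 * (x - m) + 4 * (y - m) + s \<le> 8 * t1 + 8 * t2 + s'"
     if "s \<le> s'" "x \<le> m + 2 * t1" "y \<le> m + 2 * t2" for x y s s' t1 t2 :: real
     using that unfolding right_diff_distrib by linarith
    ultimately show ?thesis using wJ[of k] wJ[of n] by blast
   qed
   also have "\<dots> < e\<^sup>2"
   proof -
    have "8 * t1 + 8 * t2 + s < z" if "s < z / 2" "t1 < z / 32" "t2 < z / 32" for s z t1 t2 :: real using that by linarith
    then show ?thesis using e'(2) N2[of k] N2[of n] kn by (meson max.boundedE)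
   qed
   finally show "(nrm lebesgue (\<lambda>x. G k x - G n x))\<^sup>2 < e\<^sup>2" .
  qed
  then show "\<exists>N. \<forall>m\<ge>N. \<forall>n\<ge>N. nrm lebesgue (\<lambda>x. G m x - G n x) < e" by blast
 qed (use Gsq in auto)
 have UH: "H01 \<Omega> U \<Gamma>" by (rule gcl_closed[OF wH U \<Gamma> tests_UNIV(1)])
 obtain r where r: "strict_mono r" "AE x in lebesgue. (\<lambda>n. w (r n) x) \<longlonglongrightarrow> U x" by (rule L2lim_AE_subseq[OF U])
 have wb: "AE x in lebesgue. \<forall>n. x \<in> \<Omega> --> l x \<le> w (r n) x \<and> w (r n) x \<le> b x"
  unfolding AE_all_countable using wadm by (simp add: adm_def)
 have Ub: "AE x in lebesgue. x \<in> \<Omega> --> l x \<le> U x \<and> U x \<le> b x"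
  using wb r(2)
 proof eventually_elim
  case (elim x)
  then show ?case by (auto intro: LIMSEQ_le_const LIMSEQ_le_const2)
 qed
 have woff: "AE x in lebesgue. \<forall>n. (x \<in> \<Omega> --> 0 < w (r n) x \<and> w (r n) x \<le> B) \<and> (x \<notin> \<Omega> --> w (r n) x = 0 \<and> G (r n) x = 0)"
  unfolding AE_all_countable using fin_AE[OF wfin] by blast
 have Uoff: "AE x in lebesgue. (x \<in> \<Omega> --> 0 < U x) \<and> (x \<notin> \<Omega> --> U x = 0)"
  using Ub l H01_off[OF UH] by eventually_elim force
 let ?CG = "\<lambda>x. \<bar>Fp \<delta> a\<bar> * indicator \<Omega> x :: real"
 have iCG: "integrable lebesgue ?CG" by (intro integrable_mult_right indicator_integrable \<Omega>_meas(1) \<Omega>(2))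
 have pwlim: "(\<lambda>n. LINT x. \<bar>w (r n) x\<bar> powr q) \<longlonglongrightarrow> (LINT x. \<bar>U x\<bar> powr q)"
 proof (rule integral_dominated_convergence[where w="\<lambda>x. \<bar>B\<bar> powr q * indicator \<Omega> x"])
  have "(\<lambda>s::real. \<bar>s\<bar> powr q) \<in> borel_measurable borel" by measurable
  then show "(\<lambda>x. \<bar>U x\<bar> powr q) \<in> borel_measurable lebesgue" by (rule comp_leb[OF _ gcl_leb(1)[OF UH]])
  show "(\<lambda>x. \<bar>w (r n) x\<bar> powr q) \<in> borel_measurable lebesgue" for n by (rule fin_leb(4)[OF wfin])
  show "integrable lebesgue (\<lambda>x. \<bar>B\<bar> powr q * indicator \<Omega> x)" by (intro integrable_mult_right indicator_integrable \<Omega>_meas(1) \<Omega>(2))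
  show "AE x in lebesgue. (\<lambda>n. \<bar>w (r n) x\<bar> powr q) \<longlonglongrightarrow> \<bar>U x\<bar> powr q"
   using r(2)
  proof eventually_elim
   case (elim x)
   show ?case by (rule tendsto_powr') (use elim q in \<open>auto intro!: tendsto_intros\<close>)
  qed
  show "AE x in lebesgue. norm (\<bar>w (r n) x\<bar> powr q) \<le> \<bar>B\<bar> powr q * indicator \<Omega> x" for n
   using fin_powr(1)[OF wfin[of "r n"]] by simp
 qed
 have Glim: "(\<lambda>n. LINT x. (norm (G (r n) x))\<^sup>2) \<longlonglongrightarrow> (LINT x. (norm (\<Gamma> x))\<^sup>2)"
  using tendsto_power[OF L2lim_nrm[OF L2lim_subseq[OF \<Gamma> r(1)]], of 2] by (simp add: nrm_power2)
 \<comment> \<open>The energy bound solved for the integral of the nonnegative function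
   \<open>\<bar>Fp \<delta> a\<bar> * indicator \<Omega> x\<close> minus G. Fatou then gives
   integrability of G of the limit and semicontinuity in one stroke.\<close>
 define cn where "cn n = \<bar>Fp \<delta> a\<bar> * measure lebesgue \<Omega> + (m + 2 * (1/2)^(r n) - 1/2 * (LINT x. (norm (G (r n) x))\<^sup>2)
   + lam * \<kappa> / q * (LINT x. \<bar>w (r n) x\<bar> powr q)) / lam" for n
 define cl where "cl = \<bar>Fp \<delta> a\<bar> * measure lebesgue \<Omega> + (m + 2 * 0 - 1/2 * (LINT x. (norm (\<Gamma> x))\<^sup>2)
   + lam * \<kappa> / q * (LINT x. \<bar>U x\<bar> powr q)) / lam"
 have cnl: "cn \<longlonglongrightarrow> cl" unfolding cn_def[abs_def] cl_def
  using LIMSEQ_subseq_LIMSEQ[OF half0 r(1)] lam by (intro tendsto_intros pwlim Glim) (auto simp: o_def)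
 have GI: "integrable lebesgue (\<lambda>x. Gfun a \<delta> (w n x))" for n using wadm by (simp add: adm_def)
 have fint: "integrable lebesgue (\<lambda>x. ?CG x - Gfun a \<delta> (w (r n) x))" for n using iCG GI by simp
 have fle: "(LINT x. ?CG x - Gfun a \<delta> (w (r n) x)) \<le> cn n" for n
 proof -
  have "- lam * (LINT x. Gfun a \<delta> (w (r n) x)) \<le> m + 2 * (1/2)^(r n) - 1/2 * (LINT x. (norm (G (r n) x))\<^sup>2)
   + lam * \<kappa> / q * (LINT x. \<bar>w (r n) x\<bar> powr q)" using wJ[of "r n"] unfolding J_def by linarith
  then have "- (LINT x. Gfun a \<delta> (w (r n) x)) \<le> (m + 2 * (1/2)^(r n) - 1/2 * (LINT x. (norm (G (r n) x))\<^sup>2)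
   + lam * \<kappa> / q * (LINT x. \<bar>w (r n) x\<bar> powr q)) / lam" using lam by (subst pos_le_divide_eq) (auto simp: mult.commute)
  moreover have "(LINT x. ?CG x - Gfun a \<delta> (w (r n) x)) = \<bar>Fp \<delta> a\<bar> * measure lebesgue \<Omega> - (LINT x. Gfun a \<delta> (w (r n) x))"
   using iCG GI \<Omega>_meas by simp
  ultimately show ?thesis unfolding cn_def by linarith
 qed
 have fpos: "AE x in lebesgue. 0 \<le> ?CG x - Gfun a \<delta> (w (r n) x)" for n
  using fin_G_le[OF wfin[of "r n"]] by eventually_elim simp
 have fm: "(\<lambda>x. ?CG x - Gfun a \<delta> (U x)) \<in> borel_measurable lebesgue"
  by (rule borel_measurable_diff[OF borel_measurable_integrable[OF iCG] comp_leb[OF Gfun_borel[OF a] gcl_leb(1)[OF UH]]])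
 have flim: "AE x in lebesgue. (\<lambda>n. ?CG x - Gfun a \<delta> (w (r n) x)) \<longlonglongrightarrow> ?CG x - Gfun a \<delta> (U x)"
  using r(2) Uoff woff
 proof eventually_elim
  case (elim x)
  show ?case
  proof (cases "x \<in> \<Omega>")
   case True
   then show ?thesis using elim by (intro tendsto_diff tendsto_const Gfun_tendsto a) auto
  next
   case False
   then show ?thesis using elim by simp
  qed
 qed
 have int1: "integrable lebesgue (\<lambda>x. ?CG x - Gfun a \<delta> (U x))" by (rule fatou_real(1)[OF fint fpos fm flim fle cnl])
 have le1: "(LINT x. ?CG x - Gfun a \<delta> (U x)) \<le> cl" by (rule fatou_real(2)[OF fint fpos fm flim fle cnl])
 have GU: "integrable lebesgue (\<lambda>x. Gfun a \<delta> (U x))" using Bochner_Integration.integrable_diff[OF iCG int1] by simp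
 have Uadm: "adm l b U \<Gamma>" using UH Ub GU by (simp add: adm_def)
 have "(LINT x. ?CG x - Gfun a \<delta> (U x)) = \<bar>Fp \<delta> a\<bar> * measure lebesgue \<Omega> - (LINT x. Gfun a \<delta> (U x))"
  using iCG GU \<Omega>_meas by simp
 then have "- (LINT x. Gfun a \<delta> (U x)) \<le> (m - 1/2 * (LINT x. (norm (\<Gamma> x))\<^sup>2) + lam * \<kappa> / q * (LINT x. \<bar>U x\<bar> powr q)) / lam"
  using le1 unfolding cl_def by simp
 then have "- (LINT x. Gfun a \<delta> (U x)) * lam \<le> m - 1/2 * (LINT x. (norm (\<Gamma> x))\<^sup>2) + lam * \<kappa> / q * (LINT x. \<bar>U x\<bar> powr q)"
  using lam by (simp only: pos_le_divide_eq)
 then have "J U \<Gamma> \<le> m" unfolding J_def by (simp only: mult_minus_left mult.commute[of _ lam])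
 then have "\<forall>v h. adm l b v h --> J U \<Gamma> \<le> J v h" using mle order_trans by blast
 then show ?thesis using that Uadm by blast
qed

end

subsection \<open>Clamping and the Euler-Lagrange equation\<close>

lemma powr_tangent:
 fixes x y q :: real
 assumes "0 < x" "0 < y" "1 \<le> q" shows "q * x powr (q - 1) * (y - x) \<le> y powr q - x powr q"
proof (cases x y rule: linorder_cases)
 case less
 obtain z where z: "x < z" "z < y" "y powr q - x powr q = (y - x) * (q * z powr (q - 1))"
  using MVT2[OF less, of "\<lambda>x. x powr q" "\<lambda>z. q * z powr (q - 1)"] has_real_derivative_powr assms by force
 have "x powr (q - 1) \<le> z powr (q - 1)" using z assms by (intro powr_mono2) auto
 then have "(y - x) * (q * x powr (q - 1)) \<le> (y - x) * (q * z powr (q - 1))" using less assms by (intro mult_left_mono) auto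
 then show ?thesis using z(3) by (simp add: mult_ac)
next
 case greater
 obtain z where z: "y < z" "z < x" "x powr q - y powr q = (x - y) * (q * z powr (q - 1))"
  using MVT2[OF greater, of "\<lambda>x. x powr q" "\<lambda>z. q * z powr (q - 1)"] has_real_derivative_powr assms by force
 have "z powr (q - 1) \<le> x powr (q - 1)" using z assms by (intro powr_mono2) auto
 then have "(x - y) * (q * z powr (q - 1)) \<le> (x - y) * (q * x powr (q - 1))" using greater assms by (intro mult_left_mono) auto
 then show ?thesis using z(3) by (simp add: algebra_simps)
qed simp

context energy_pb begin

definition ff :: "real => real" where
 "ff s = lam * (\<kappa> * s powr (q - 1) + rhs_S a \<delta> s)"

lemma ff_nonneg: "0 \<le> ff s"
 using lam \<kappa> by (simp add: ff_def rhs_S_nonneg)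

lemma ff_borel: "ff \<in> borel_measurable borel"
proof -
 have [measurable]: "rhs_S a \<delta> \<in> borel_measurable borel" by (rule rhs_S_borel)
 show ?thesis unfolding ff_def[abs_def] by measurable
qed

text \<open>Cutting down to \<open>u\<close> changes the gradient energy by at most minus the
  pairing of \<open>gu\<close> with the gradient of (v - u)^+, which the supersolution inequality
  controls. G is concave and leaves no error; linearising the convex power at \<open>u\<close>
  leaves the quadratic one.\<close>

lemma upper_clamp:
 assumes v: "fin B v g" and u: "fin B u gu" and sup: "supersol \<Omega> ff u gu"
 shows "J (\<lambda>x. min (v x) (u x)) (mng v g u gu)
  \<le> J v g + lam * \<kappa> * (q - 1) * \<bar>B\<bar> powr (q - 2) * (LINT x. (max 0 (v x - u x))\<^sup>2)"
proof -
 define \<zeta> where "\<zeta> x = max 0 (v x - u x)" for x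
 define k where "k x = hs (v x - u x) *\<^sub>R (g x - gu x)" for x
 have H: "H01 \<Omega> v g" "H01 \<Omega> u gu" and GI: "integrable lebesgue (\<lambda>x. Gfun a \<delta> (v x))" "integrable lebesgue (\<lambda>x. Gfun a \<delta> (u x))"
  using v u by (auto simp: fin_def)
 have \<zeta>H: "H01 \<Omega> \<zeta> k" unfolding \<zeta>_def[abs_def] k_def[abs_def] by (rule H01_pos[OF H01_diff[OF H]])
 have \<zeta>nn: "AE x in lebesgue. 0 \<le> \<zeta> x" by (simp add: \<zeta>_def)
 note st = supersol_test[OF sup ff_borel ff_nonneg \<zeta>H \<zeta>nn]
 note Hm = H01_max_min(2)[OF H] and GM = max_min_G_integrable(2)[OF H GI]
 define C where "C = lam * \<kappa> * (q - 1) * \<bar>B\<bar> powr (q - 2)"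
 have i2: "integrable lebesgue (\<lambda>x. (\<zeta> x)\<^sup>2)" using sq_integrable[OF gcl_sq(1)[OF \<zeta>H]] by simp
 have minfin: "fin B (\<lambda>x. min (v x) (u x)) (mng v g u gu)"
  unfolding fin_def
 proof (intro conjI Hm GM)
  show "AE x in lebesgue. x \<in> \<Omega> --> 0 < min (v x) (u x) \<and> min (v x) (u x) \<le> B"
   using fin_AE[OF v] fin_AE[OF u] by eventually_elim auto
 qed
 have grad: "1/2 * (LINT x. (norm (mng v g u gu x))\<^sup>2) - 1/2 * (LINT x. (norm (g x))\<^sup>2) \<le> - (LINT x. gu x \<bullet> k x)"
 proof -
  note s1 = sq_integrable[OF gcl_sq(2)[OF Hm]] and s2 = sq_integrable[OF gcl_sq(2)[OF H(1)]] and s3 = sq_inner[OF gcl_sq(2)[OF H(2)] gcl_sq(2)[OF \<zeta>H]]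
  have "(norm (mng v g u gu x))\<^sup>2 - (norm (g x))\<^sup>2 \<le> - 2 * (gu x \<bullet> k x)" for x
  proof -
   define t A D where "t = hs (v x - u x)" and "A = gu x" and "D = g x - gu x"
   have t: "0 \<le> t" "t \<le> 1" by (auto simp: t_def hs_range)
   have g: "g x = A + D" by (simp add: A_def D_def)
   have "(norm (mng v g u gu x))\<^sup>2 - (norm (g x))\<^sup>2 = (norm (A + D - t *\<^sub>R D))\<^sup>2 - (norm (A + D))\<^sup>2"
   proof -
    have "mng v g u gu x = A + D - t *\<^sub>R D" by (simp add: mng_def t_def A_def D_def)
    then show ?thesis by (simp only: g)
   qed
   also have "\<dots> = - 2 * (A \<bullet> (t *\<^sub>R D)) - t * (2 - t) * (D \<bullet> D)"
    unfolding power2_norm_eq_inner by (simp add: inner_diff_left inner_diff_right inner_add_left inner_add_right inner_commute algebra_simps)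
   also have "\<dots> \<le> - 2 * (A \<bullet> (t *\<^sub>R D))" using t by simp
   finally show ?thesis by (simp add: k_def t_def A_def D_def)
  qed
  then have "(LINT x. (norm (mng v g u gu x))\<^sup>2 - (norm (g x))\<^sup>2) \<le> (LINT x. - 2 * (gu x \<bullet> k x))"
   using s1 s2 s3 by (intro integral_mono) auto
  then show ?thesis using s1 s2 s3 by simp
 qed
 have low: "(LINT x. lam * (Gfun a \<delta> (v x) - Gfun a \<delta> (min (v x) (u x))) + lam * \<kappa> / q * (\<bar>v x\<bar> powr q - \<bar>min (v x) (u x)\<bar> powr q))
   \<le> (LINT x. ff (u x) * \<zeta> x + C * (\<zeta> x)\<^sup>2)"
 proof (rule integral_mono_AE)
  show "AE x in lebesgue. lam * (Gfun a \<delta> (v x) - Gfun a \<delta> (min (v x) (u x))) + lam * \<kappa> / q * (\<bar>v x\<bar> powr q - \<bar>min (v x) (u x)\<bar> powr q)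
   \<le> ff (u x) * \<zeta> x + C * (\<zeta> x)\<^sup>2"
   using fin_AE[OF v] fin_AE[OF u]
  proof eventually_elim
   case (elim x)
   show ?case
   proof (cases "x \<in> \<Omega> \<and> u x < v x")
    case True
    then have p: "0 < u x" "u x < v x" "v x \<le> \<bar>B\<bar>" using elim by auto
    have z: "\<zeta> x = v x - u x" using p by (simp add: \<zeta>_def)
    have 1: "lam * (Gfun a \<delta> (v x) - Gfun a \<delta> (u x)) \<le> lam * (rhs_S a \<delta> (u x) * \<zeta> x)"
     unfolding z using p lam a \<delta> by (intro mult_left_mono Gfun_concave) auto
    have "v x powr q - u x powr q \<le> q * v x powr (q - 1) * \<zeta> x"
     using powr_tangent[of "v x" "u x" q] p q by (simp add: z algebra_simps)
    moreover have "v x powr (q - 1) - u x powr (q - 1) \<le> (q - 1) * \<bar>B\<bar> powr (q - 2) * \<zeta> x"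
     using powr_lipschitz[of "q - 1" "v x" "\<bar>B\<bar>" "u x"] p q by (simp add: z)
    then have "(v x powr (q - 1) - u x powr (q - 1)) * \<zeta> x \<le> (q - 1) * \<bar>B\<bar> powr (q - 2) * \<zeta> x * \<zeta> x"
     by (intro mult_right_mono) (simp_all add: \<zeta>_def)
    then have "q * (v x powr (q - 1) * \<zeta> x) \<le> q * (u x powr (q - 1) * \<zeta> x + (q - 1) * \<bar>B\<bar> powr (q - 2) * (\<zeta> x)\<^sup>2)"
     using q by (intro mult_left_mono) (auto simp: algebra_simps power2_eq_square)
    ultimately have "v x powr q - u x powr q \<le> q * (u x powr (q - 1) * \<zeta> x + (q - 1) * \<bar>B\<bar> powr (q - 2) * (\<zeta> x)\<^sup>2)"
     by (simp add: mult.assoc)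
    then have "lam * \<kappa> / q * (v x powr q - u x powr q) \<le> lam * \<kappa> / q * (q * (u x powr (q - 1) * \<zeta> x + (q - 1) * \<bar>B\<bar> powr (q - 2) * (\<zeta> x)\<^sup>2))"
     using lam \<kappa> q by (intro mult_left_mono) auto
    then have 2: "lam * \<kappa> / q * (v x powr q - u x powr q) \<le> lam * \<kappa> * (u x powr (q - 1) * \<zeta> x) + C * (\<zeta> x)\<^sup>2"
     using q by (simp add: C_def algebra_simps)
    have "lam * (Gfun a \<delta> (v x) - Gfun a \<delta> (u x)) + lam * \<kappa> / q * (v x powr q - u x powr q)
      \<le> lam * (rhs_S a \<delta> (u x) * \<zeta> x) + (lam * \<kappa> * (u x powr (q - 1) * \<zeta> x) + C * (\<zeta> x)\<^sup>2)"
     by (rule add_mono[OF 1 2])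
    also have "\<dots> = ff (u x) * \<zeta> x + C * (\<zeta> x)\<^sup>2" by (simp add: ff_def algebra_simps)
    finally show ?thesis using p by (simp add: min_def)
   next
    case False
    then have "min (v x) (u x) = v x" "\<zeta> x = 0" using elim by (auto simp: \<zeta>_def min_def)
    then show ?thesis by simp
   qed
  qed
 qed (use st(1) i2 GI GM fin_powr(2)[OF v] fin_powr(2)[OF minfin] in \<open>auto intro!: integrable_mult_right\<close>)
 have e1: "(LINT x. lam * (Gfun a \<delta> (v x) - Gfun a \<delta> (min (v x) (u x))) + lam * \<kappa> / q * (\<bar>v x\<bar> powr q - \<bar>min (v x) (u x)\<bar> powr q))
   = lam * ((LINT x. Gfun a \<delta> (v x)) - (LINT x. Gfun a \<delta> (min (v x) (u x))))
    + lam * \<kappa> / q * ((LINT x. \<bar>v x\<bar> powr q) - (LINT x. \<bar>min (v x) (u x)\<bar> powr q))"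
 proof -
  have i: "integrable lebesgue (\<lambda>x. Gfun a \<delta> (v x) - Gfun a \<delta> (min (v x) (u x)))" "integrable lebesgue (\<lambda>x. \<bar>v x\<bar> powr q - \<bar>min (v x) (u x)\<bar> powr q)"
   using GI GM fin_powr(2)[OF v] fin_powr(2)[OF minfin] by auto
  show ?thesis
   unfolding Bochner_Integration.integral_add[OF integrable_mult_right[OF i(1)] integrable_mult_right[OF i(2)]]
   using GI GM fin_powr(2)[OF v] fin_powr(2)[OF minfin] by simp
 qed
 have e2: "(LINT x. ff (u x) * \<zeta> x + C * (\<zeta> x)\<^sup>2) = (LINT x. ff (u x) * \<zeta> x) + C * (LINT x. (\<zeta> x)\<^sup>2)"
  using st(1) i2 by simp
 have "J (\<lambda>x. min (v x) (u x)) (mng v g u gu) \<le> J v g + C * (LINT x. (\<zeta> x)\<^sup>2)"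
  using low[unfolded e1 e2, unfolded right_diff_distrib] grad st(2) unfolding J_def by linarith
 then show ?thesis by (simp add: C_def \<zeta>_def)
qed

text \<open>No quadratic cost here: raising the function lowers the power term of the energy, and G
  is concave. The inequality for \<open>w\<close> is assumed only for (w - v)^+, because the
  singular equation will be available only for compactly supported test functions.\<close>

lemma lower_clamp:
 assumes v: "fin B v g" and w: "fin B w gw"
  and sub: "integrable lebesgue (\<lambda>x. lam * rhs_S a \<delta> (w x) * max 0 (w x - v x))"
   "(LINT x. gw x \<bullet> (hs (w x - v x) *\<^sub>R (gw x - g x))) \<le> (LINT x. lam * rhs_S a \<delta> (w x) * max 0 (w x - v x))"
 shows "J (\<lambda>x. max (w x) (v x)) (mxg w gw v g) \<le> J v g"
proof -
 define \<zeta> where "\<zeta> x = max 0 (w x - v x)" for x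
 define k where "k x = hs (w x - v x) *\<^sub>R (gw x - g x)" for x
 have H: "H01 \<Omega> w gw" "H01 \<Omega> v g" and GI: "integrable lebesgue (\<lambda>x. Gfun a \<delta> (w x))" "integrable lebesgue (\<lambda>x. Gfun a \<delta> (v x))"
  using v w by (auto simp: fin_def)
 have \<zeta>H: "H01 \<Omega> \<zeta> k" unfolding \<zeta>_def[abs_def] k_def[abs_def] by (rule H01_pos[OF H01_diff[OF H]])
 note Hm = H01_max_min(1)[OF H] and GM = max_min_G_integrable(1)[OF H GI]
 have maxfin: "fin B (\<lambda>x. max (w x) (v x)) (mxg w gw v g)"
  unfolding fin_def
 proof (intro conjI Hm GM)
  show "AE x in lebesgue. x \<in> \<Omega> --> 0 < max (w x) (v x) \<and> max (w x) (v x) \<le> B"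
   using fin_AE[OF v] fin_AE[OF w] by eventually_elim auto
 qed
 have grad: "1/2 * (LINT x. (norm (mxg w gw v g x))\<^sup>2) - 1/2 * (LINT x. (norm (g x))\<^sup>2) \<le> (LINT x. gw x \<bullet> k x)"
 proof -
  note s1 = sq_integrable[OF gcl_sq(2)[OF Hm]] and s2 = sq_integrable[OF gcl_sq(2)[OF H(2)]] and s3 = sq_inner[OF gcl_sq(2)[OF H(1)] gcl_sq(2)[OF \<zeta>H]]
  have "(norm (mxg w gw v g x))\<^sup>2 - (norm (g x))\<^sup>2 \<le> 2 * (gw x \<bullet> k x)" for x
  proof -
   define t A D where "t = hs (w x - v x)" and "A = g x" and "D = gw x - g x"
   have t: "0 \<le> t" "t \<le> 1" by (auto simp: t_def hs_range)
   have gw: "gw x = A + D" by (simp add: A_def D_def)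
   have "(norm (mxg w gw v g x))\<^sup>2 - (norm (g x))\<^sup>2 = (norm (A + t *\<^sub>R D))\<^sup>2 - (norm A)\<^sup>2"
   proof -
    have "mxg w gw v g x = A + t *\<^sub>R D" by (simp add: mxg_def t_def A_def D_def)
    then show ?thesis by (simp only: A_def)
   qed
   also have "\<dots> = 2 * ((A + D) \<bullet> (t *\<^sub>R D)) - t * (2 - t) * (D \<bullet> D)"
    unfolding power2_norm_eq_inner by (simp add: inner_diff_left inner_diff_right inner_add_left inner_add_right inner_commute algebra_simps)
   also have "\<dots> \<le> 2 * ((A + D) \<bullet> (t *\<^sub>R D))" using t by simp
   also have "t *\<^sub>R D = k x" by (simp add: k_def t_def D_def)
   finally show ?thesis by (simp only: gw)
  qed
  then have "(LINT x. (norm (mxg w gw v g x))\<^sup>2 - (norm (g x))\<^sup>2) \<le> (LINT x. 2 * (gw x \<bullet> k x))"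
   using s1 s2 s3 by (intro integral_mono) auto
  then show ?thesis using s1 s2 s3 by simp
 qed
 have low: "(LINT x. lam * rhs_S a \<delta> (w x) * \<zeta> x) \<le> (LINT x. lam * (Gfun a \<delta> (max (w x) (v x)) - Gfun a \<delta> (v x)))"
 proof (rule integral_mono_AE)
  show "AE x in lebesgue. lam * rhs_S a \<delta> (w x) * \<zeta> x \<le> lam * (Gfun a \<delta> (max (w x) (v x)) - Gfun a \<delta> (v x))"
   using fin_AE[OF v] fin_AE[OF w]
  proof eventually_elim
   case (elim x)
   show ?case
   proof (cases "x \<in> \<Omega> \<and> v x < w x")
    case True
    then have "rhs_S a \<delta> (w x) * \<zeta> x \<le> Gfun a \<delta> (w x) - Gfun a \<delta> (v x)"
     using Gfun_concave[OF a \<delta>, of "w x" "v x"] elim by (simp add: \<zeta>_def algebra_simps)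
    then have "lam * (rhs_S a \<delta> (w x) * \<zeta> x) \<le> lam * (Gfun a \<delta> (w x) - Gfun a \<delta> (v x))"
     using lam by (intro mult_left_mono) auto
    then show ?thesis using True by (simp add: max_def mult.assoc)
   next
    case False
    then have "max (w x) (v x) = v x" "\<zeta> x = 0" using elim by (auto simp: \<zeta>_def max_def)
    then show ?thesis by simp
   qed
  qed
 qed (use sub(1) GI GM in \<open>auto simp: \<zeta>_def\<close>)
 have pw: "(LINT x. \<bar>v x\<bar> powr q) \<le> (LINT x. \<bar>max (w x) (v x)\<bar> powr q)"
 proof (rule integral_mono_AE[OF fin_powr(2)[OF v] fin_powr(2)[OF maxfin]])
  show "AE x in lebesgue. \<bar>v x\<bar> powr q \<le> \<bar>max (w x) (v x)\<bar> powr q"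
   using fin_AE[OF v] fin_AE[OF w]
  proof eventually_elim
   case (elim x)
   then show ?case using q by (intro powr_mono2) (auto simp: max_def)
  qed
 qed
 have c: "0 \<le> lam * \<kappa> / q" using lam \<kappa> q by simp
 have e1: "(LINT x. lam * (Gfun a \<delta> (max (w x) (v x)) - Gfun a \<delta> (v x)))
   = lam * (LINT x. Gfun a \<delta> (max (w x) (v x))) - lam * (LINT x. Gfun a \<delta> (v x))"
  using GI GM by (simp add: right_diff_distrib)
 show ?thesis
  using low grad sub(2) mult_left_mono[OF pw c] unfolding e1 J_def k_def \<zeta>_def by linarith
qed

definition locpos :: "(real^'n => real) => bool" where
 "locpos u \<longleftrightarrow> (\<forall>K. compact K --> K \<subseteq> \<Omega> --> (\<exists>c>0. AE x in lebesgue. x \<in> K --> c \<le> u x))"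

lemma rhs_S_le: "0 < c ==> c \<le> s ==> rhs_S a \<delta> s \<le> c powr (-\<delta>)"
 using \<delta> by (auto simp: rhs_S_def intro: powr_mono2')

lemma ff_local_bound:
 assumes u: "fin B u g" and c: "0 < c" "AE x in lebesgue. x \<in> K --> c \<le> u x" and K: "K \<subseteq> \<Omega>"
 shows "AE x in lebesgue. x \<in> K --> \<bar>ff (u x)\<bar> \<le> lam * (\<kappa> * \<bar>B\<bar> powr (q - 1) + c powr (-\<delta>))"
 using fin_AE[OF u] c(2)
proof eventually_elim
 case (elim x)
 show ?case
 proof
  assume x: "x \<in> K"
  then have p: "0 < u x" "u x \<le> \<bar>B\<bar>" "c \<le> u x" using elim K by auto
  have "u x powr (q - 1) \<le> \<bar>B\<bar> powr (q - 1)" using p q by (intro powr_mono2) auto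
  then have "\<kappa> * u x powr (q - 1) + rhs_S a \<delta> (u x) \<le> \<kappa> * \<bar>B\<bar> powr (q - 1) + c powr (-\<delta>)"
   using \<kappa> rhs_S_le[OF c(1) p(3)] by (intro add_mono mult_left_mono)
  then show "\<bar>ff (u x)\<bar> \<le> lam * (\<kappa> * \<bar>B\<bar> powr (q - 1) + c powr (-\<delta>))"
   using ff_nonneg[of "u x"] lam by (simp add: ff_def)
 qed
qed

lemma ff_test_integrable:
 assumes u: "fin B u g" "locpos u" and \<phi>: "test_fun \<Omega> \<phi>"
 shows "integrable lebesgue (\<lambda>x. ff (u x) * \<phi> x)"
proof -
 obtain K where K: "compact K" "K \<subseteq> \<Omega>" "\<And>x. x \<notin> K ==> \<phi> x = 0" using \<phi> unfolding test_fun_def by blast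
 obtain c where c: "c > 0" "AE x in lebesgue. x \<in> K --> c \<le> u x" using u(2) K(1,2) unfolding locpos_def by blast
 define C where "C = lam * (\<kappa> * \<bar>B\<bar> powr (q - 1) + c powr (-\<delta>))"
 have b: "AE x in lebesgue. x \<in> K --> \<bar>ff (u x)\<bar> \<le> C" unfolding C_def by (rule ff_local_bound[OF u(1) c K(2)])
 show ?thesis
 proof (rule Bochner_Integration.integrable_bound)
  show "integrable lebesgue (\<lambda>x. C * \<phi> x)" using test_integrable[OF \<phi>] by simp
  show "(\<lambda>x. ff (u x) * \<phi> x) \<in> borel_measurable lebesgue"
   by (intro borel_measurable_times comp_leb[OF ff_borel fin_leb(1)[OF u(1)]] test_leb[OF \<phi>])
  show "AE x in lebesgue. norm (ff (u x) * \<phi> x) \<le> norm (C * \<phi> x)"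
   using b
  proof eventually_elim
   case (elim x)
   show ?case
   proof (cases "x \<in> K")
    case True
    then have "\<bar>ff (u x)\<bar> * \<bar>\<phi> x\<bar> \<le> \<bar>C\<bar> * \<bar>\<phi> x\<bar>" using elim by (intro mult_right_mono) auto
    then show ?thesis by (simp add: abs_mult)
   qed (use K(3) in simp)
  qed
 qed
qed

lemma H01_pert: "H01 \<Omega> u g ==> test_fun \<Omega> \<phi> ==> H01 \<Omega> (\<lambda>x. u x + t * \<phi> x) (\<lambda>x. g x + t *\<^sub>R grad \<phi> x)"
 by (intro H01_add H01_cmult H01_test)

text \<open>On the support of \<open>\<phi>\<close> the function \<open>u\<close> is bounded away
  from 0, so a small perturbation stays positive and G remains bounded there; elsewhere nothing
  changes.\<close>

lemma pert_fin:
 assumes u: "fin B u g" "locpos u" and \<phi>: "test_fun \<Omega> \<phi>"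
 obtains t0 c K where "t0 > 0" "c > 0" "compact K" "K \<subseteq> \<Omega>" "\<forall>x. x \<notin> K --> \<phi> x = 0"
  "AE x in lebesgue. x \<in> K --> c \<le> u x"
  "\<forall>t. \<bar>t\<bar> \<le> t0 --> fin (\<bar>B\<bar> + 1) (\<lambda>x. u x + t * \<phi> x) (\<lambda>x. g x + t *\<^sub>R grad \<phi> x)"
  "\<forall>t x. \<bar>t\<bar> \<le> t0 --> \<bar>t * \<phi> x\<bar> \<le> c / 2"
proof -
 obtain K where K: "compact K" "K \<subseteq> \<Omega>" "\<And>x. x \<notin> K ==> \<phi> x = 0" using \<phi> unfolding test_fun_def by blast
 obtain c where c: "c > 0" "AE x in lebesgue. x \<in> K --> c \<le> u x" using u(2) K(1,2) unfolding locpos_def by blast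
 obtain M where M: "M \<ge> 0" "\<And>x. \<bar>\<phi> x\<bar> \<le> M" using test_bound1[OF \<phi>] by metis
 \<comment> \<open>\<open>c/2\<close> preserves half of the lower bound, 1 limits the growth of the
   upper bound, and \<open>M + 1\<close> avoids a zero denominator.\<close>
 define t0 where "t0 = min (c/2) 1 / (M + 1)"
 have t0: "t0 > 0" using c M by (auto simp: t0_def intro!: divide_pos_pos)
 have tb: "\<bar>t * \<phi> x\<bar> \<le> min (c/2) 1" if "\<bar>t\<bar> \<le> t0" for t x
 proof -
  have "\<bar>t * \<phi> x\<bar> \<le> t0 * (M + 1)" unfolding abs_mult using that M(1) M(2)[of x] t0 by (intro mult_mono) auto
  then show ?thesis using M(1) by (simp add: t0_def)
 qed
 have fin: "fin (\<bar>B\<bar> + 1) (\<lambda>x. u x + t * \<phi> x) (\<lambda>x. g x + t *\<^sub>R grad \<phi> x)" if t: "\<bar>t\<bar> \<le> t0" for t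
 proof -
  have uH: "H01 \<Omega> u g" and GI: "integrable lebesgue (\<lambda>x. Gfun a \<delta> (u x))" using u(1) by (auto simp: fin_def)
  note pH = H01_pert[OF uH \<phi>, of t]
  define N where "N = \<bar>Fp \<delta> (min (c/2) a)\<bar> + \<bar>Fp \<delta> a\<bar>"
  have pos: "AE x in lebesgue. (x \<in> \<Omega> --> 0 < u x + t * \<phi> x \<and> u x + t * \<phi> x \<le> \<bar>B\<bar> + 1) \<and>
    \<bar>Gfun a \<delta> (u x + t * \<phi> x)\<bar> \<le> \<bar>Gfun a \<delta> (u x)\<bar> + N * indicator \<Omega> x"
   using fin_AE[OF u(1)] c(2)
  proof eventually_elim
   case (elim x)
   show ?case
   proof (cases "x \<in> K")
    case True
    then have p: "c/2 \<le> u x + t * \<phi> x" "u x + t * \<phi> x \<le> \<bar>B\<bar> + 1" "x \<in> \<Omega>" using tb[OF t, of x] elim K(2) by auto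
    have "Fp \<delta> (min (c/2) a) \<le> Gfun a \<delta> (u x + t * \<phi> x)" using p c a Gfun_mono[of a "c/2" "u x + t * \<phi> x" \<delta>] by (simp add: Gfun_eq)
    moreover have "Gfun a \<delta> (u x + t * \<phi> x) \<le> Fp \<delta> a" using p c by (intro Gfun_le a) auto
    ultimately have "\<bar>Gfun a \<delta> (u x + t * \<phi> x)\<bar> \<le> N" by (auto simp: N_def abs_if)
    then show ?thesis using p c by auto
   next
    case False
    have "0 \<le> N * indicator \<Omega> x" by (simp add: N_def)
    then show ?thesis using K(3)[OF False] elim by auto
   qed
  qed
  have "integrable lebesgue (\<lambda>x. Gfun a \<delta> (u x + t * \<phi> x))"
  proof (rule Bochner_Integration.integrable_bound)
   show "integrable lebesgue (\<lambda>x. \<bar>Gfun a \<delta> (u x)\<bar> + N * indicator \<Omega> x)"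
    by (intro Bochner_Integration.integrable_add integrable_abs GI integrable_mult_right indicator_integrable \<Omega>_meas(1) \<Omega>(2))
   show "(\<lambda>x. Gfun a \<delta> (u x + t * \<phi> x)) \<in> borel_measurable lebesgue"
    by (rule comp_leb[OF Gfun_borel[OF a] gcl_leb(1)[OF pH]])
   show "AE x in lebesgue. norm (Gfun a \<delta> (u x + t * \<phi> x)) \<le> norm (\<bar>Gfun a \<delta> (u x)\<bar> + N * indicator \<Omega> x)"
    using pos by eventually_elim (auto simp: N_def)
  qed
  moreover have "AE x in lebesgue. x \<in> \<Omega> --> 0 < u x + t * \<phi> x \<and> u x + t * \<phi> x \<le> \<bar>B\<bar> + 1" using pos by eventually_elim auto
  ultimately show ?thesis using pH by (simp add: fin_def)
 qed
 show ?thesis using that[OF t0 c(1) K(1,2) _ c(2)] K(3) fin tb by fastforce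
qed

text \<open>The kink of \<open>G\<close> at \<open>a\<close> shows up in the one-sided derivative of the energy, only on the plateau
 \<open>{u = a}\<close> and only in decreasing directions.\<close>

lemma one_sided_euler:
 assumes u: "fin B u g" "locpos u" and \<phi>: "test_fun \<Omega> \<phi>" and t1: "0 < t1"
  and qm: "\<And>t. 0 < t ==> t \<le> t1 ==> J u g - C * t\<^sup>2 \<le> J (\<lambda>x. u x + t * \<phi> x) (\<lambda>x. g x + t *\<^sub>R grad \<phi> x)"
 shows "(LINT x. ff (u x) * \<phi> x) - lam * a powr (-\<delta>) * (LINT x. indicator {x\<in>\<Omega>. u x = a} x * max 0 (- \<phi> x))
   \<le> (LINT x. g x \<bullet> grad \<phi> x)"
proof -
 obtain t0 c K where t0: "t0 > 0" "c > 0" "compact K" "K \<subseteq> \<Omega>" "\<forall>x. x \<notin> K --> \<phi> x = 0"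
  "AE x in lebesgue. x \<in> K --> c \<le> u x"
  "\<forall>t. \<bar>t\<bar> \<le> t0 --> fin (\<bar>B\<bar> + 1) (\<lambda>x. u x + t * \<phi> x) (\<lambda>x. g x + t *\<^sub>R grad \<phi> x)"
  "\<forall>t x. \<bar>t\<bar> \<le> t0 --> \<bar>t * \<phi> x\<bar> \<le> c / 2"
  by (rule pert_fin[OF u \<phi>])
 have uH: "H01 \<Omega> u g" and GI: "integrable lebesgue (\<lambda>x. Gfun a \<delta> (u x))" using u(1) by (auto simp: fin_def)
 define N where "N = (LINT x. (norm (grad \<phi> x))\<^sup>2)"
 define E where "E = {x\<in>\<Omega>. u x = a}"
 define s where "s n = min t0 t1 * (1 / real (Suc n))" for n
 have s: "0 < s n" "s n \<le> t0" "s n \<le> t1" for n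
 proof -
  have "s n \<le> min t0 t1" unfolding s_def using t0 t1 by (intro mult_left_le) auto
  then show "0 < s n" "s n \<le> t0" "s n \<le> t1" using t0 t1 by (auto simp: s_def)
 qed
 have slim: "s \<longlonglongrightarrow> 0" unfolding s_def[abs_def] by (intro tendsto_mult_right_zero inv_Suc_lim)
 \<comment> \<open>The power is taken at \<open>u\<close>, the singular term at the perturbed point:
   convexity of the power and concavity of G then both bound the increments from below.\<close>
 define H where "H n x = lam * (\<kappa> * u x powr (q - 1) + rhs_S a \<delta> (u x + s n * \<phi> x)) * \<phi> x" for n x
 define Cb where "Cb = lam * (\<kappa> * \<bar>B\<bar> powr (q - 1) + (c/2) powr (-\<delta>))"
 have ptpos: "AE x in lebesgue. x \<in> K --> 0 < u x \<and> u x \<le> \<bar>B\<bar> \<and> (\<forall>n. c/2 \<le> u x + s n * \<phi> x)"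
  using fin_AE[OF u(1)] t0(6)
 proof eventually_elim
  case (elim x)
  show ?case
  proof
   assume x: "x \<in> K"
   have "c/2 \<le> u x + s n * \<phi> x" for n
    using t0(8)[rule_format, of "s n" x] s[of n] elim x by (auto simp: abs_le_iff)
   then show "0 < u x \<and> u x \<le> \<bar>B\<bar> \<and> (\<forall>n. c/2 \<le> u x + s n * \<phi> x)" using elim x t0(4) by auto
  qed
 qed
 have mu: "u \<in> borel_measurable lebesgue" by (rule fin_leb(1)[OF u(1)])
 have mH: "H n \<in> borel_measurable lebesgue" for n
 proof -
  have "(\<lambda>x. rhs_S a \<delta> (u x + s n * \<phi> x)) \<in> borel_measurable lebesgue"
   using mu test_leb[OF \<phi>] by (intro comp_leb[OF rhs_S_borel]) simp
  moreover have "(\<lambda>x. u x powr (q - 1)) \<in> borel_measurable lebesgue"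
  proof -
   have "(\<lambda>s::real. s powr (q - 1)) \<in> borel_measurable borel" by measurable
   from comp_leb[OF this mu] show ?thesis .
  qed
  ultimately show ?thesis unfolding H_def[abs_def] using test_leb[OF \<phi>] by simp
 qed
 have Hb: "AE x in lebesgue. norm (H n x) \<le> Cb * \<bar>\<phi> x\<bar>" for n
  using ptpos
 proof eventually_elim
  case (elim x)
  show ?case
  proof (cases "x \<in> K")
   case True
   then have p: "0 < u x" "u x \<le> \<bar>B\<bar>" "c/2 \<le> u x + s n * \<phi> x" using elim by auto
   have 1: "u x powr (q - 1) \<le> \<bar>B\<bar> powr (q - 1)" using p q by (intro powr_mono2) auto
   have 2: "rhs_S a \<delta> (u x + s n * \<phi> x) \<le> (c/2) powr (-\<delta>)" using p t0(2) by (intro rhs_S_le) auto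
   have 3: "lam * (\<kappa> * u x powr (q - 1) + rhs_S a \<delta> (u x + s n * \<phi> x)) \<le> Cb"
    unfolding Cb_def using 1 2 \<kappa> lam by (intro mult_left_mono add_mono) auto
   have 4: "0 \<le> lam * (\<kappa> * u x powr (q - 1) + rhs_S a \<delta> (u x + s n * \<phi> x))" using lam \<kappa> by (simp add: rhs_S_nonneg)
   show ?thesis unfolding H_def real_norm_def abs_mult[of _ "\<phi> x"] using 3 4 by (intro mult_right_mono) auto
  next
   case False
   then show ?thesis using t0(5) by (simp add: H_def)
  qed
 qed
 have iH: "integrable lebesgue (H n)" for n
  by (rule Bochner_Integration.integrable_bound[of _ "\<lambda>x. Cb * \<bar>\<phi> x\<bar>"])
    (use mH test_integrable[OF \<phi>] eventually_mono[OF Hb[of n]] in auto)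
 have main: "(LINT x. H n x) \<le> (LINT x. g x \<bullet> grad \<phi> x) + s n * (C + N / 2)" for n
 proof -
  let ?t = "s n"
  let ?v = "\<lambda>x. u x + ?t * \<phi> x" and ?h = "\<lambda>x. g x + ?t *\<^sub>R grad \<phi> x"
  have vf: "fin (\<bar>B\<bar> + 1) ?v ?h" using t0(7) s[of n] by auto
  have vH: "H01 \<Omega> ?v ?h" and GV: "integrable lebesgue (\<lambda>x. Gfun a \<delta> (?v x))" using vf by (auto simp: fin_def)
  note P = fin_powr(2)[OF u(1)] fin_powr(2)[OF vf]
  have low: "(LINT x. ?t * H n x) \<le> (LINT x. lam * (Gfun a \<delta> (?v x) - Gfun a \<delta> (u x)) + lam * \<kappa> / q * (\<bar>?v x\<bar> powr q - \<bar>u x\<bar> powr q))"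
  proof (rule integral_mono_AE)
   show "AE x in lebesgue. ?t * H n x \<le> lam * (Gfun a \<delta> (?v x) - Gfun a \<delta> (u x)) + lam * \<kappa> / q * (\<bar>?v x\<bar> powr q - \<bar>u x\<bar> powr q)"
    using ptpos
   proof eventually_elim
    case (elim x)
    show ?case
    proof (cases "x \<in> K")
     case True
     then have "0 < u x" "c/2 \<le> ?v x" using elim by auto
     then have p: "0 < u x" "0 < ?v x" using t0(2) by auto
     have "rhs_S a \<delta> (?v x) * (?t * \<phi> x) \<le> Gfun a \<delta> (?v x) - Gfun a \<delta> (u x)"
      using Gfun_concave[OF a \<delta> p(2,1)] by (simp add: algebra_simps)
     then have 1: "lam * (rhs_S a \<delta> (?v x) * (?t * \<phi> x)) \<le> lam * (Gfun a \<delta> (?v x) - Gfun a \<delta> (u x))"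
      using lam by (intro mult_left_mono) auto
     have "q * u x powr (q - 1) * (?t * \<phi> x) \<le> ?v x powr q - u x powr q"
      using powr_tangent[OF p, of q] q by simp
     then have "lam * \<kappa> / q * (q * u x powr (q - 1) * (?t * \<phi> x)) \<le> lam * \<kappa> / q * (?v x powr q - u x powr q)"
      using lam \<kappa> q by (intro mult_left_mono) auto
     then have 2: "lam * \<kappa> * (u x powr (q - 1) * (?t * \<phi> x)) \<le> lam * \<kappa> / q * (?v x powr q - u x powr q)"
      using q by (simp add: mult.assoc)
     have "?t * H n x = lam * (rhs_S a \<delta> (?v x) * (?t * \<phi> x)) + lam * \<kappa> * (u x powr (q - 1) * (?t * \<phi> x))"
      by (simp add: H_def algebra_simps)
     then show ?thesis using add_mono[OF 1 2] p by simp
    next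
     case False
     then show ?thesis using t0(5) by (simp add: H_def)
    qed
   qed
  qed (use iH GI GV P in auto)
  have e1: "(LINT x. lam * (Gfun a \<delta> (?v x) - Gfun a \<delta> (u x)) + lam * \<kappa> / q * (\<bar>?v x\<bar> powr q - \<bar>u x\<bar> powr q))
    = lam * ((LINT x. Gfun a \<delta> (?v x)) - (LINT x. Gfun a \<delta> (u x)))
     + lam * \<kappa> / q * ((LINT x. \<bar>?v x\<bar> powr q) - (LINT x. \<bar>u x\<bar> powr q))"
   using Bochner_Integration.integral_add[OF integrable_mult_right[OF Bochner_Integration.integrable_diff[OF GV GI], of lam]
     integrable_mult_right[OF Bochner_Integration.integrable_diff[OF P(2,1)], of "lam * \<kappa> / q"]]
    GI GV P by simp
  have quad: "(LINT x. (norm (?h x))\<^sup>2) = (LINT x. (norm (g x))\<^sup>2) + 2 * ?t * (LINT x. g x \<bullet> grad \<phi> x) + ?t\<^sup>2 * N"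
  proof -
   note i = sq_integrable[OF gcl_sq(2)[OF uH]] sq_inner[OF gcl_sq(2)[OF uH] test_grad_sq[OF \<phi>]] sq_integrable[OF test_grad_sq[OF \<phi>]]
   have "(norm (?h x))\<^sup>2 = (norm (g x))\<^sup>2 + 2 * ?t * (g x \<bullet> grad \<phi> x) + ?t\<^sup>2 * (norm (grad \<phi> x))\<^sup>2" for x
    unfolding power2_norm_eq_inner by (simp add: inner_add_left inner_add_right inner_commute power2_eq_square algebra_simps)
   then show ?thesis using i by (simp add: N_def)
  qed
  have "J u g - C * ?t\<^sup>2 \<le> J ?v ?h" using qm s[of n] by auto
  then have "(LINT x. ?t * H n x) \<le> ?t * (LINT x. g x \<bullet> grad \<phi> x) + ?t\<^sup>2 * (C + N / 2)"
   using low unfolding e1 J_def quad by (simp add: algebra_simps)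
  then have "?t * (LINT x. H n x) \<le> ?t * ((LINT x. g x \<bullet> grad \<phi> x) + ?t * (C + N / 2))"
   by (simp add: power2_eq_square algebra_simps)
  then show ?thesis using s(1)[of n] by simp
 qed
 \<comment> \<open>The pointwise limit of \<open>H n\<close>. At height \<open>a\<close> the
   perturbed singular term is 0 for upward and tends to \<open>a powr (-\<delta>)\<close> for
   downward perturbations, whereas \<open>ff\<close> always uses the value 0; the last term makes up
   the difference.\<close>
 define H0 where "H0 x = ff (u x) * \<phi> x - lam * a powr (-\<delta>) * (indicator E x * max 0 (- \<phi> x))" for x
 have "(\<lambda>n. LINT x. H n x) \<longlonglongrightarrow> (LINT x. H0 x)"
 proof (rule integral_dominated_convergence[where w="\<lambda>x. Cb * \<bar>\<phi> x\<bar>"])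
  have mE: "E \<in> sets lebesgue"
  proof -
   have [measurable]: "u \<in> borel_measurable lebesgue" by (rule mu)
   have "{x \<in> space lebesgue. u x = a} \<in> sets lebesgue" by measurable
   then show ?thesis using \<Omega>_meas(1) sets.Int[of "\<Omega>" lebesgue "{x. u x = a}"] unfolding E_def by (simp add: Int_def)
  qed
  have "(\<lambda>x. ff (u x)) \<in> borel_measurable lebesgue" by (rule comp_leb[OF ff_borel mu])
  then show "H0 \<in> borel_measurable lebesgue" unfolding H0_def[abs_def] using test_leb[OF \<phi>] mE
   by (intro borel_measurable_diff borel_measurable_times borel_measurable_const borel_measurable_indicator borel_measurable_max borel_measurable_uminus)
  show "integrable lebesgue (\<lambda>x. Cb * \<bar>\<phi> x\<bar>)" using test_integrable[OF \<phi>] by simp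
  show "AE x in lebesgue. (\<lambda>n. H n x) \<longlonglongrightarrow> H0 x"
   using ptpos
  proof eventually_elim
   case (elim x)
   show ?case
   proof (cases "x \<in> K \<and> \<phi> x \<noteq> 0")
    case False
    then have "\<phi> x = 0" using t0(5) by auto
    then show ?thesis by (simp add: H_def H0_def)
   next
    case True
    then have p: "0 < u x" "x \<in> \<Omega>" using elim t0(4) by auto
    have vl: "(\<lambda>n. u x + s n * \<phi> x) \<longlonglongrightarrow> u x + 0 * \<phi> x" by (intro tendsto_intros slim)
    have "(\<lambda>n. rhs_S a \<delta> (u x + s n * \<phi> x) * \<phi> x) \<longlonglongrightarrow> rhs_S a \<delta> (u x) * \<phi> x - a powr (-\<delta>) * (indicator E x * max 0 (- \<phi> x))"
    proof (cases "u x = a")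
     case eq: True
     show ?thesis
     proof (cases "\<phi> x > 0")
      case True
      then have "rhs_S a \<delta> (u x + s n * \<phi> x) = 0" for n using eq mult_pos_pos[OF s(1)[of n] True] by (simp add: rhs_S_def)
      then show ?thesis using True eq by (simp add: rhs_S_def)
     next
      case False
      then have neg: "\<phi> x < 0" using True by simp
      have "rhs_S a \<delta> (u x + s n * \<phi> x) = (u x + s n * \<phi> x) powr (-\<delta>)" for n
       using eq mult_pos_neg[OF s(1)[of n] neg] by (simp add: rhs_S_def)
      moreover have "(\<lambda>n. (u x + s n * \<phi> x) powr (-\<delta>) * \<phi> x) \<longlonglongrightarrow> (u x + 0 * \<phi> x) powr (-\<delta>) * \<phi> x"
       using p by (intro tendsto_mult tendsto_const tendsto_powr vl) auto
      ultimately show ?thesis using eq neg p by (simp add: rhs_S_def E_def)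
     qed
    next
     case ne: False
     have E0: "indicator E x = (0::real)" using ne by (simp add: E_def)
     show ?thesis
     proof (cases "u x < a")
      case True
      have "\<forall>\<^sub>F n in sequentially. u x + s n * \<phi> x < a" using vl True by (intro order_tendstoD(2)[of _ "u x"]) auto
      then have "\<forall>\<^sub>F n in sequentially. (u x + s n * \<phi> x) powr (-\<delta>) * \<phi> x = rhs_S a \<delta> (u x + s n * \<phi> x) * \<phi> x"
       by eventually_elim (simp add: rhs_S_def)
      moreover have "(\<lambda>n. (u x + s n * \<phi> x) powr (-\<delta>) * \<phi> x) \<longlonglongrightarrow> (u x + 0 * \<phi> x) powr (-\<delta>) * \<phi> x"
       using p by (intro tendsto_mult tendsto_const tendsto_powr vl) auto
      ultimately have "(\<lambda>n. rhs_S a \<delta> (u x + s n * \<phi> x) * \<phi> x) \<longlonglongrightarrow> (u x + 0 * \<phi> x) powr (-\<delta>) * \<phi> x"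
       by (rule Lim_transform_eventually[rotated])
      then show ?thesis using True E0 by (simp add: rhs_S_def)
     next
      case False
      then have "a < u x" using ne by simp
      then have "\<forall>\<^sub>F n in sequentially. a < u x + s n * \<phi> x" using vl by (intro order_tendstoD(1)[of _ "u x"]) auto
      then have "\<forall>\<^sub>F n in sequentially. 0 = rhs_S a \<delta> (u x + s n * \<phi> x) * \<phi> x"
       by eventually_elim (simp add: rhs_S_def)
      then have "(\<lambda>n. rhs_S a \<delta> (u x + s n * \<phi> x) * \<phi> x) \<longlonglongrightarrow> 0" by (rule Lim_transform_eventually[OF tendsto_const])
      then show ?thesis using False E0 by (simp add: rhs_S_def)
     qed
    qed
    then have "(\<lambda>n. lam * (\<kappa> * u x powr (q - 1) * \<phi> x + rhs_S a \<delta> (u x + s n * \<phi> x) * \<phi> x))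
      \<longlonglongrightarrow> lam * (\<kappa> * u x powr (q - 1) * \<phi> x + (rhs_S a \<delta> (u x) * \<phi> x - a powr (-\<delta>) * (indicator E x * max 0 (- \<phi> x))))"
     by (intro tendsto_mult tendsto_add tendsto_const)
    then show ?thesis by (simp add: H_def H0_def ff_def algebra_simps)
   qed
  qed
 qed (use Hb mH in auto)
 moreover have "(\<lambda>n. (LINT x. g x \<bullet> grad \<phi> x) + s n * (C + N / 2)) \<longlonglongrightarrow> (LINT x. g x \<bullet> grad \<phi> x) + 0 * (C + N / 2)"
  by (intro tendsto_intros slim)
 ultimately have le: "(LINT x. H0 x) \<le> (LINT x. g x \<bullet> grad \<phi> x) + 0 * (C + N / 2)"
  by (rule LIMSEQ_le) (use main in auto)
 have iE: "integrable lebesgue (\<lambda>x. indicator E x * max 0 (- \<phi> x))"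
 proof (rule Bochner_Integration.integrable_bound[OF test_integrable[OF \<phi>]])
  have [measurable]: "u \<in> borel_measurable lebesgue" by (rule mu)
  have "{x \<in> space lebesgue. u x = a} \<in> sets lebesgue" by measurable
  then have mE: "E \<in> sets lebesgue" using \<Omega>_meas(1) sets.Int[of "\<Omega>" lebesgue "{x. u x = a}"] unfolding E_def by (simp add: Int_def)
  show "(\<lambda>x. indicator E x * max 0 (- \<phi> x)) \<in> borel_measurable lebesgue" using test_leb[OF \<phi>] mE
   by (intro borel_measurable_times borel_measurable_const borel_measurable_indicator borel_measurable_max borel_measurable_uminus)
 qed (auto simp: indicator_def intro!: AE_I2)
 have "(LINT x. H0 x) = (LINT x. ff (u x) * \<phi> x) - lam * a powr (-\<delta>) * (LINT x. indicator E x * max 0 (- \<phi> x))"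
  unfolding H0_def using ff_test_integrable[OF u \<phi>] iE by simp
 then show ?thesis using le by (simp add: E_def)
qed

end

subsection \<open>The singular problem\<close>

lemma infdist_compl_pos:
 fixes \<Omega> :: "(real^'n::finite) set"
 assumes \<Omega>: "open \<Omega>" "bounded \<Omega>"
 shows "x \<in> \<Omega> ==> 0 < infdist x (- \<Omega>)"
  and "compact K ==> K \<subseteq> \<Omega> ==> \<exists>d>0. \<forall>x\<in>K. d \<le> infdist x (- \<Omega>)"
proof -
 have ne: "- \<Omega> \<noteq> {}" using \<Omega>(2) not_bounded_UNIV by (metis Compl_empty_eq double_complement)
 have clo: "closed (- \<Omega>)" using \<Omega>(1) by auto
 show *: "0 < infdist x (- \<Omega>)" if "x \<in> \<Omega>" for x
  using in_closed_iff_infdist_zero[OF clo ne, of x] infdist_nonneg[of x "- \<Omega>"] that by force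
 show "\<exists>d>0. \<forall>x\<in>K. d \<le> infdist x (- \<Omega>)" if K: "compact K" "K \<subseteq> \<Omega>"
 proof (cases "K = {}")
  case True then show ?thesis by (intro exI[of _ 1]) simp
 next
  case False
  have "continuous_on K (\<lambda>x. infdist x (- \<Omega>))" by (intro continuous_intros)
  then obtain z where z: "z \<in> K" "\<forall>x\<in>K. infdist z (- \<Omega>) \<le> infdist x (- \<Omega>)"
   using continuous_attains_inf[OF K(1) False] by blast
  then show ?thesis using * K(2) by (intro exI[of _ "infdist z (- \<Omega>)"]) auto
 qed
qed

lemma distance_barrier_ex:
 fixes \<Omega> :: "(real^'n::finite) set"
 assumes \<Omega>: "open \<Omega>" "bounded \<Omega>" and a: "0 < a" "0 < \<delta>" and lam: "0 < lam"
 shows "\<exists>c>0. \<forall>u g. supersol \<Omega> (\<lambda>s. lam * rhs_S a \<delta> s) u g -->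
   (AE x in lebesgue. x \<in> \<Omega> --> c * (infdist x (- \<Omega>))\<^sup>2 \<le> u x)"
proof (rule distance_barrier[OF assms])
 fix c :: real
 assume "c > 0" and c: "\<And>u g. supersol \<Omega> (\<lambda>s. lam * rhs_S a \<delta> s) u g ==>
   AE x in lebesgue. x \<in> \<Omega> --> c * (infdist x (- \<Omega>))\<^sup>2 \<le> u x"
 then show ?thesis by (intro exI[of _ c] conjI allI impI)
qed

lemma Gfun_supersol_integrable:
 fixes \<Omega> :: "(real^'n::finite) set"
 assumes \<Omega>: "bounded_smooth_domain \<Omega>" and a: "0 < a" "0 < \<delta>" and lam: "0 < lam"
  and u: "supersol \<Omega> (\<lambda>s. lam * rhs_S a \<delta> s) u g"
 shows "integrable lebesgue (\<lambda>x. Gfun a \<delta> (u x))"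
proof -
 have O: "open \<Omega>" "bounded \<Omega>" using \<Omega> by (auto simp: bounded_smooth_domain_def)
 have mO: "\<Omega> \<in> sets lebesgue" using O by auto
 have uH: "H01 \<Omega> u g" and up: "AE x in lebesgue. x \<in> \<Omega> --> 0 < u x" using u by (auto simp: supersol_def)
 have off: "AE x in lebesgue. x \<notin> \<Omega> --> u x = 0"
  using H01_off[OF uH] by eventually_elim auto
 have m: "(\<lambda>x. Gfun a \<delta> (u x)) \<in> borel_measurable lebesgue" by (rule comp_leb[OF Gfun_borel[OF a(1)] gcl_leb(1)[OF uH]])
 have iO: "integrable lebesgue (\<lambda>x. C * indicator \<Omega> x :: real)" for C by (intro integrable_mult_right indicator_integrable mO O)
 consider "\<delta> < 1" | "\<delta> = 1" | "1 < \<delta>" by linarith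
 then show ?thesis
 proof cases
  case 1
  \<comment> \<open>For \<open>\<delta> < 1\<close> the primitive is nonnegative and bounded by its
    value at \<open>a\<close>.\<close>
  have "AE x in lebesgue. \<bar>Gfun a \<delta> (u x)\<bar> \<le> \<bar>Fp \<delta> a\<bar> * indicator \<Omega> x"
   using up off
  proof eventually_elim
   case (elim x)
   show ?case
   proof (cases "x \<in> \<Omega>")
    case True
    then have p: "0 < u x" using elim by auto
    have "0 \<le> Gfun a \<delta> (u x)" using p a 1 by (simp add: Gfun_eq Fp_def)
    then show ?thesis using Gfun_le[OF a(1) p, of \<delta>] True by simp
   next
    case False
    then show ?thesis using elim by (simp add: Gfun_nonpos)
   qed
  qed
  then show ?thesis by (rule bounded_integrable[OF m O(2) mO])
 next
  case 2
  obtain c where c: "c > 0" "\<And>u g. supersol \<Omega> (\<lambda>s. lam * rhs_S a \<delta> s) u g ==> AE x in lebesgue. x \<in> \<Omega> --> c * (infdist x (- \<Omega>))\<^sup>2 \<le> u x"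
   using distance_barrier_ex[OF O a lam] by blast
  define M where "M = \<bar>ln c\<bar> + \<bar>ln a\<bar>"
  show ?thesis
  proof (rule Bochner_Integration.integrable_bound[OF _ m])
   show "integrable lebesgue (\<lambda>x. M * indicator \<Omega> x + 2 * (indicator \<Omega> x * max 0 (- ln (infdist x (- \<Omega>)))))"
    by (intro Bochner_Integration.integrable_add iO integrable_mult_right ln_dist_integrable[OF \<Omega>])
   show "AE x in lebesgue. norm (Gfun a \<delta> (u x)) \<le> norm (M * indicator \<Omega> x + 2 * (indicator \<Omega> x * max 0 (- ln (infdist x (- \<Omega>)))))"
    using up off c(2)[OF u]
   proof eventually_elim
    case (elim x)
    show ?case
    proof (cases "x \<in> \<Omega>")
     case True
     define d where "d = infdist x (- \<Omega>)"
     have d: "d > 0" unfolding d_def by (rule infdist_compl_pos(1)[OF O True])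
     have p: "0 < u x" "c * d\<^sup>2 \<le> u x" using elim True by (auto simp: d_def)
     have G: "Gfun a \<delta> (u x) = ln (min (u x) a)" using p a 2 by (simp add: Gfun_eq Fp_def)
     have up: "ln (min (u x) a) \<le> \<bar>ln a\<bar>"
     proof -
      have "ln (min (u x) a) \<le> ln a" using p a by simp
      then show ?thesis by simp
     qed
     have "ln (min (c * d\<^sup>2) a) \<le> ln (min (u x) a)" using p a c(1) d by (intro ln_mono) auto
     moreover have "- (\<bar>ln c\<bar> + 2 * max 0 (- ln d) + \<bar>ln a\<bar>) \<le> ln (min (c * d\<^sup>2) a)"
     proof (cases "c * d\<^sup>2 \<le> a")
      case True
      have "ln (c * d\<^sup>2) = ln c + 2 * ln d" using c(1) d by (simp add: ln_mult ln_realpow)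
      then show ?thesis using True by (auto simp: min_def max_def)
     next
      case False
      then show ?thesis by (auto simp: min_def max_def)
     qed
     ultimately have "\<bar>ln (min (u x) a)\<bar> \<le> M + 2 * max 0 (- ln d)"
      using up abs_ge_zero[of "ln c"] max.cobounded1[of 0 "- ln d"] unfolding M_def by linarith
     then show ?thesis using True G by (simp add: d_def)
    next
     case False
     then show ?thesis using elim by (simp add: Gfun_nonpos)
    qed
   qed
  qed
 next
  case 3
  have F: "(\<lambda>s. lam * rhs_S a \<delta> s) \<in> borel_measurable borel" "\<And>s. 0 \<le> lam * rhs_S a \<delta> s"
   using lam rhs_S_borel[of a \<delta>] by (auto simp: rhs_S_nonneg)
  \<comment> \<open>Testing with \<open>u\<close> itself: below height \<open>a\<close> the power
    \<open>u powr (1 - \<delta>)\<close>, to which G is proportional, is the singular term times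
    \<open>u\<close>.\<close>
  have i: "integrable lebesgue (\<lambda>x. lam * rhs_S a \<delta> (u x) * u x)"
   by (rule supersol_test(1)[OF u F uH supersol_nonneg[OF u]])
  define C where "C = 1 / (\<delta> - 1)"
  have C: "0 < C" using 3 by (simp add: C_def)
  show ?thesis
  proof (rule Bochner_Integration.integrable_bound[OF _ m])
   show "integrable lebesgue (\<lambda>x. C / lam * (lam * rhs_S a \<delta> (u x) * u x) + C * a powr (1 - \<delta>) * indicator \<Omega> x)"
    by (intro Bochner_Integration.integrable_add iO integrable_mult_right i)
   show "AE x in lebesgue. norm (Gfun a \<delta> (u x)) \<le> norm (C / lam * (lam * rhs_S a \<delta> (u x) * u x) + C * a powr (1 - \<delta>) * indicator \<Omega> x)"
    using up off
   proof eventually_elim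
    case (elim x)
    show ?case
    proof (cases "x \<in> \<Omega>")
     case True
     then have p: "0 < u x" using elim by auto
     have "Gfun a \<delta> (u x) = - (C * (min (u x) a) powr (1 - \<delta>))" using p a 3 by (simp add: Gfun_eq Fp_def C_def field_simps)
     then have G: "\<bar>Gfun a \<delta> (u x)\<bar> = C * (min (u x) a) powr (1 - \<delta>)" using C by simp
     have pw: "C / lam * (lam * rhs_S a \<delta> (u x) * u x) = C * (rhs_S a \<delta> (u x) * u x)" using lam by simp
     show ?thesis
     proof (cases "u x < a")
      case lt: True
      have "rhs_S a \<delta> (u x) * u x = u x powr (1 - \<delta>)" using lt p by (simp add: rhs_S_def powr_diff powr_minus field_simps)
      then show ?thesis using G C True lt unfolding pw by (simp add: abs_of_nonneg)
     next
      case ge: False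
      have "0 \<le> C * (rhs_S a \<delta> (u x) * u x)" using C p by (simp add: rhs_S_nonneg)
      then show ?thesis using G C True ge a(1) unfolding pw by (simp add: min_def abs_of_nonneg rhs_S_nonneg)
     qed
    next
     case False
     then show ?thesis using elim by (simp add: Gfun_nonpos)
    qed
   qed
  qed
 qed
qed

text \<open>\<open>F\<close> is only locally bounded, so the approximants of \<open>\<zeta>\<close>
  are multiplied by a cutoff that is 1 near \<open>K\<close>. Then \<open>F\<close> times the cutoff
  is in L2, and uniqueness of the gradient shows that the cutoff does not change
  \<open>\<zeta>\<close> or \<open>k\<close>.\<close>

lemma solution_compact_test:
 fixes \<Omega> :: "(real^'n::finite) set"
 assumes \<Omega>: "open \<Omega>" and w: "H01 \<Omega> w g" and F: "F \<in> borel_measurable lebesgue"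
  and loc: "\<And>K. compact K ==> K \<subseteq> \<Omega> ==> \<exists>C. AE x in lebesgue. x \<in> K --> \<bar>F x\<bar> \<le> C"
  and eq: "\<And>\<phi>. test_fun \<Omega> \<phi> ==> (LINT x. g x \<bullet> grad \<phi> x) = (LINT x. F x * \<phi> x)"
  and \<zeta>: "H01 \<Omega> \<zeta> k" and K: "compact K" "K \<subseteq> \<Omega>" "AE x in lebesgue. x \<notin> K --> \<zeta> x = 0"
 shows "integrable lebesgue (\<lambda>x. F x * \<zeta> x)" "(LINT x. g x \<bullet> k x) = (LINT x. F x * \<zeta> x)"
proof -
 obtain \<eta> V where \<eta>: "test_fun \<Omega> \<eta>" "\<forall>x. 0 \<le> \<eta> x \<and> \<eta> x \<le> 1" "open V" "K \<subseteq> V" "\<forall>x\<in>V. \<eta> x = 1"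
  by (rule cutoff[OF K(1) \<Omega> K(2)])
 obtain L where L: "compact L" "L \<subseteq> \<Omega>" "\<And>x. x \<notin> L ==> \<eta> x = 0" using \<eta>(1) unfolding test_fun_def by blast
 obtain C where C: "AE x in lebesgue. x \<in> L --> \<bar>F x\<bar> \<le> C" using loc[OF L(1,2)] by blast
 have sF: "sq lebesgue (\<lambda>x. F x * \<eta> x)"
 proof (rule sq_bound[OF sq_cmult[OF test_sq[OF \<eta>(1)], of C]])
  show "(\<lambda>x. F x * \<eta> x) \<in> borel_measurable lebesgue" using F test_leb[OF \<eta>(1)] by simp
  show "AE x in lebesgue. norm (F x * \<eta> x) \<le> norm (C * \<eta> x)"
   using C
  proof eventually_elim
   case (elim x)
   show ?case
   proof (cases "x \<in> L")
    case True
    then have "\<bar>F x\<bar> * \<bar>\<eta> x\<bar> \<le> \<bar>C\<bar> * \<bar>\<eta> x\<bar>" using elim by (intro mult_right_mono) auto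
    then show ?thesis by (simp add: abs_mult)
   qed (use L(3) in simp)
  qed
 qed
 have AE\<eta>: "AE x in lebesgue. \<eta> x * \<zeta> x = \<zeta> x"
  using K(3) by eventually_elim (use \<eta>(4,5) in auto)
 have \<eta>\<zeta>: "H01 \<Omega> (\<lambda>x. \<eta> x * \<zeta> x) (\<lambda>x. \<eta> x *\<^sub>R k x + \<zeta> x *\<^sub>R grad \<eta> x)"
  by (rule H01_mult_test[OF H01_UNIV[OF \<zeta>] \<eta>(1)])
 have mk: "k \<in> borel_measurable lebesgue" "\<zeta> \<in> borel_measurable lebesgue" using gcl_leb[OF \<zeta>] by auto
 have "H01 UNIV \<zeta> (\<lambda>x. \<eta> x *\<^sub>R k x + \<zeta> x *\<^sub>R grad \<eta> x)"
  by (rule gcl_cong_AE[OF H01_UNIV[OF \<eta>\<zeta>] mk(2) gcl_leb(2)[OF \<eta>\<zeta>] AE\<eta>]) auto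
 then have AEk: "AE x in lebesgue. \<eta> x *\<^sub>R k x + \<zeta> x *\<^sub>R grad \<eta> x = k x" by (rule H01_grad_unique[OF _ H01_UNIV[OF \<zeta>]])
 obtain B where B: "\<And>x. \<bar>\<eta> x\<bar> \<le> B" "\<And>x. norm (grad \<eta> x) \<le> B" using test_bound1[OF \<eta>(1)] by metis
 note sg = gcl_sq(2)[OF w]
 from gcl_seq_ex[OF \<zeta>, of \<Omega>] obtain \<phi> where \<phi>: "\<forall>n. \<phi> n \<in> tests \<Omega>" "L2lim lebesgue \<phi> \<zeta>" "L2lim lebesgue (\<lambda>n. grad (\<phi> n)) k"
  by auto
 have t: "test_fun \<Omega> (\<phi> n)" for n using \<phi>(1) by simp
 have 1: "L2lim lebesgue (\<lambda>n x. \<eta> x *\<^sub>R grad (\<phi> n) x + \<phi> n x *\<^sub>R grad \<eta> x) (\<lambda>x. \<eta> x *\<^sub>R k x + \<zeta> x *\<^sub>R grad \<eta> x)"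
  by (intro L2lim_add L2lim_bounded_scale[OF \<phi>(3), of "\<lambda>_. \<eta>" \<eta> B] L2lim_scaleR_vec[OF \<phi>(2) test_grad_leb[OF \<eta>(1)] B(2)])
    (use test_leb[OF \<eta>(1)] B in auto)
 have gr: "grad (\<lambda>x. \<eta> x * \<phi> n x) = (\<lambda>x. \<eta> x *\<^sub>R grad (\<phi> n) x + \<phi> n x *\<^sub>R grad \<eta> x)" for n
  by (auto simp: fun_eq_iff grad_mult[OF test_smooth[OF \<eta>(1)] test_smooth[OF t]])
 have "(\<lambda>n. LINT x. g x \<bullet> (\<eta> x *\<^sub>R grad (\<phi> n) x + \<phi> n x *\<^sub>R grad \<eta> x)) \<longlonglongrightarrow> (LINT x. g x \<bullet> (\<eta> x *\<^sub>R k x + \<zeta> x *\<^sub>R grad \<eta> x))"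
  by (rule L2lim_inner[OF L2lim_const[OF sg] 1])
 moreover have "(LINT x. g x \<bullet> (\<eta> x *\<^sub>R grad (\<phi> n) x + \<phi> n x *\<^sub>R grad \<eta> x)) = (LINT x. (F x * \<eta> x) \<bullet> \<phi> n x)" for n
  using eq[OF test_mult[OF \<eta>(1) test_smooth[OF t]], of n] unfolding gr by (simp add: mult.assoc)
 moreover have "(\<lambda>n. LINT x. (F x * \<eta> x) \<bullet> \<phi> n x) \<longlonglongrightarrow> (LINT x. (F x * \<eta> x) \<bullet> \<zeta> x)"
  by (rule L2lim_inner[OF L2lim_const[OF sF] \<phi>(2)])
 ultimately have lim: "(LINT x. g x \<bullet> (\<eta> x *\<^sub>R k x + \<zeta> x *\<^sub>R grad \<eta> x)) = (LINT x. (F x * \<eta> x) \<bullet> \<zeta> x)"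
  using LIMSEQ_unique by (metis (no_types, lifting) ext)
 have "(LINT x. g x \<bullet> (\<eta> x *\<^sub>R k x + \<zeta> x *\<^sub>R grad \<eta> x)) = (LINT x. g x \<bullet> k x)"
 proof (rule integral_cong_AE)
  show "AE x in lebesgue. g x \<bullet> (\<eta> x *\<^sub>R k x + \<zeta> x *\<^sub>R grad \<eta> x) = g x \<bullet> k x" using AEk by eventually_elim simp
 qed (use sg mk gcl_leb(2)[OF \<eta>\<zeta>] in \<open>auto simp: sq_def intro!: borel_measurable_inner\<close>)
 moreover have AEF: "AE x in lebesgue. (F x * \<eta> x) \<bullet> \<zeta> x = F x * \<zeta> x"
  using AE\<eta> by eventually_elim (simp add: mult.assoc)
 have iF: "integrable lebesgue (\<lambda>x. (F x * \<eta> x) \<bullet> \<zeta> x)" by (rule sq_inner[OF sF gcl_sq(1)[OF \<zeta>]])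
 have mF: "(\<lambda>x. F x * \<zeta> x) \<in> borel_measurable lebesgue" using F mk by simp
 show "integrable lebesgue (\<lambda>x. F x * \<zeta> x)"
  by (rule integrable_cong_AE_imp[OF iF mF]) (use AEF in auto)
 have "(LINT x. (F x * \<eta> x) \<bullet> \<zeta> x) = (LINT x. F x * \<zeta> x)"
  by (rule integral_cong_AE[OF borel_measurable_integrable[OF iF] mF AEF])
 ultimately show "(LINT x. g x \<bullet> k x) = (LINT x. F x * \<zeta> x)" using lim by simp
qed

context energy_pb begin

text \<open>The plateau contributes to the one-sided derivative only in decreasing directions, hence
  not at all for nonnegative test functions.\<close>

lemma euler_supersol:
 assumes u: "fin B u g" "locpos u"
  and qm: "\<And>\<phi>. test_fun \<Omega> \<phi> ==> \<forall>x. 0 \<le> \<phi> x ==> \<exists>t1>0. \<exists>C. \<forall>t. 0 < t --> t \<le> t1 -->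
    J u g - C * t\<^sup>2 \<le> J (\<lambda>x. u x + t * \<phi> x) (\<lambda>x. g x + t *\<^sub>R grad \<phi> x)"
 shows "supersol \<Omega> ff u g"
 unfolding supersol_def
proof (intro conjI allI impI)
 show "H01 \<Omega> u g" using u by (simp add: fin_def)
 show "AE x in lebesgue. x \<in> \<Omega> --> 0 < u x" using fin_AE[OF u(1)] by eventually_elim auto
 fix \<phi> assume \<phi>: "test_fun \<Omega> \<phi>" "\<forall>x. 0 \<le> \<phi> x"
 show "integrable lebesgue (\<lambda>x. ff (u x) * \<phi> x)" by (rule ff_test_integrable[OF u \<phi>(1)])
 obtain t1 C where t1: "t1 > 0" "\<And>t. 0 < t ==> t \<le> t1 ==> J u g - C * t\<^sup>2 \<le> J (\<lambda>x. u x + t * \<phi> x) (\<lambda>x. g x + t *\<^sub>R grad \<phi> x)"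
  using qm[OF \<phi>] by blast
 have "max 0 (- \<phi> x) = 0" for x using \<phi>(2)[rule_format, of x] by (simp add: max_def)
 then show "(LINT x. ff (u x) * \<phi> x) \<le> (LINT x. g x \<bullet> grad \<phi> x)"
  using one_sided_euler[OF u \<phi>(1) t1] by simp
qed

text \<open>The one-sided inequality for \<open>\<phi>\<close> and its negative bounds the defect by
  an integral over the plateau, and \<open>plateau\<close> then says that the right-hand side counts
  as 0 there. It remains to show that \<open>ff\<close> has no mass on the plateau.\<close>

lemma euler_solution:
 assumes u: "fin B u g" "locpos u"
  and qm: "\<And>\<phi>. test_fun \<Omega> \<phi> ==> \<exists>t1>0. \<exists>C. \<forall>t. 0 < t --> t \<le> t1 -->
    J u g - C * t\<^sup>2 \<le> J (\<lambda>x. u x + t * \<phi> x) (\<lambda>x. g x + t *\<^sub>R grad \<phi> x)"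
  and \<phi>: "test_fun \<Omega> \<phi>"
 shows "(LINT x. g x \<bullet> grad \<phi> x) = (LINT x. ff (u x) * \<phi> x)"
proof -
 define E where "E = {x\<in>\<Omega>. u x = a}"
 define D where "D = lam * a powr (-\<delta>)"
 have D0: "0 \<le> D" using lam by (simp add: D_def)
 have uH: "H01 \<Omega> u g" using u by (simp add: fin_def)
 have mu: "u \<in> borel_measurable lebesgue" by (rule fin_leb(1)[OF u(1)])
 have mE: "E \<in> sets lebesgue"
 proof -
  have [measurable]: "u \<in> borel_measurable lebesgue" by (rule mu)
  have "{x \<in> space lebesgue. u x = a} \<in> sets lebesgue" by measurable
  then show ?thesis using \<Omega>_meas(1) sets.Int[of "\<Omega>" lebesgue "{x. u x = a}"] unfolding E_def by (simp add: Int_def)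
 qed
 have sup: "supersol \<Omega> ff u g" using euler_supersol[OF u] qm by blast
 have iE: "integrable lebesgue (\<lambda>x. indicator E x * f x)" if "integrable lebesgue f" for f :: "_ => real"
  using integrable_mult_indicator[OF mE that] by simp
 have one: "(LINT x. ff (u x) * \<phi> x) - D * (LINT x. indicator E x * \<bar>\<phi> x\<bar>) \<le> (LINT x. g x \<bullet> grad \<phi> x)"
  if \<phi>: "test_fun \<Omega> \<phi>" for \<phi>
 proof -
  obtain t1 C where t1: "t1 > 0" "\<And>t. 0 < t ==> t \<le> t1 ==> J u g - C * t\<^sup>2 \<le> J (\<lambda>x. u x + t * \<phi> x) (\<lambda>x. g x + t *\<^sub>R grad \<phi> x)"
   using qm[OF \<phi>] by blast
  have "(LINT x. indicator E x * max 0 (- \<phi> x)) \<le> (LINT x. indicator E x * \<bar>\<phi> x\<bar>)"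
   using test_integrable[OF \<phi>] by (intro integral_mono iE) (auto simp: indicator_def)
  then have "D * (LINT x. indicator E x * max 0 (- \<phi> x)) \<le> D * (LINT x. indicator E x * \<bar>\<phi> x\<bar>)"
   using D0 by (rule mult_left_mono)
  then show ?thesis using one_sided_euler[OF u \<phi> t1] unfolding E_def[symmetric] D_def[symmetric] by linarith
 qed
 have key: "\<bar>(LINT x. g x \<bullet> grad \<phi> x) - (LINT x. ff (u x) * \<phi> x)\<bar> \<le> D * (LINT x. indicator E x * \<bar>\<phi> x\<bar>)"
  if \<phi>: "test_fun \<Omega> \<phi>" for \<phi>
 proof -
  have t: "test_fun \<Omega> (\<lambda>x. (-1) * \<phi> x)" by (rule test_cmult[OF \<phi>])
  have "grad (\<lambda>x. (-1) * \<phi> x) x = - grad \<phi> x" for x using grad_cmult[OF test_smooth[OF \<phi>], of "-1" x] by simp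
  then show ?thesis using one[OF \<phi>] one[OF t] by simp
 qed
 have loc: "\<exists>C. AE x in lebesgue. x \<in> K --> \<bar>ff (u x)\<bar> \<le> C" if K: "compact K" "K \<subseteq> \<Omega>" for K
 proof -
  obtain c where "c > 0" "AE x in lebesgue. x \<in> K --> c \<le> u x" using u(2) K unfolding locpos_def by blast
  then show ?thesis using ff_local_bound[OF u(1) _ _ K(2)] by blast
 qed
 have pl: "(LINT x. g x \<bullet> grad \<phi> x) = (LINT x. ff (u x) * \<phi> x) - (LINT x. indicator E x * (ff (u x) * \<phi> x))"
  if "test_fun \<Omega> \<phi>" for \<phi>
  by (rule plateau[where f="\<lambda>x. ff (u x)" and D=D, OF \<Omega> uH comp_leb[OF ff_borel mu] loc E_def D0 key that])
 \<comment> \<open>At height \<open>a\<close> the singular term has the value 0, so on the plateau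
   \<open>ff\<close> is the constant critical term.\<close>
 define \<gamma> where "\<gamma> = lam * \<kappa> * a powr (q - 1)"
 have \<gamma>: "0 \<le> \<gamma>" using lam \<kappa> by (simp add: \<gamma>_def)
 have ffE: "indicator E x * (ff (u x) * y) = indicator E x * (\<gamma> * y)" for x y
  by (auto simp: indicator_def E_def ff_def rhs_S_def \<gamma>_def)
 obtain K where K: "compact K" "K \<subseteq> \<Omega>" "\<And>x. x \<notin> K ==> \<phi> x = 0" using \<phi> unfolding test_fun_def by blast
 obtain \<eta> V where \<eta>: "test_fun \<Omega> \<eta>" "\<forall>x. 0 \<le> \<eta> x \<and> \<eta> x \<le> 1" "open V" "K \<subseteq> V" "\<forall>x\<in>V. \<eta> x = 1"
  by (rule cutoff[OF K(1) \<Omega>(1) K(2)])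
 obtain M where M: "M \<ge> 0" "\<And>x. \<bar>\<phi> x\<bar> \<le> M" using test_bound1[OF \<phi>] by metis
 \<comment> \<open>The supersolution inequality and \<open>pl\<close>, applied to the same cutoff,
   show that dropping the plateau cannot lose mass; \<open>ff\<close> being nonnegative, its plateau
   integral is zero.\<close>
 have "(LINT x. indicator E x * (ff (u x) * \<eta> x)) \<le> 0"
 proof -
  have "\<forall>x. 0 \<le> \<eta> x" using \<eta>(2) by blast
  then have "(LINT x. ff (u x) * \<eta> x) \<le> (LINT x. g x \<bullet> grad \<eta> x)" using sup \<eta>(1) unfolding supersol_def by blast
  then show ?thesis using pl[OF \<eta>(1)] by linarith
 qed
 then have \<eta>0: "\<gamma> * (LINT x. indicator E x * \<eta> x) \<le> 0" unfolding ffE by (simp add: mult.left_commute)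
 have "\<bar>LINT x. indicator E x * (ff (u x) * \<phi> x)\<bar> = \<gamma> * \<bar>LINT x. indicator E x * \<phi> x\<bar>"
  unfolding ffE using \<gamma> by (simp add: mult.left_commute abs_mult)
 also have "\<dots> \<le> \<gamma> * (LINT x. M * (indicator E x * \<eta> x))"
 proof (intro mult_left_mono \<gamma>)
  have "\<bar>LINT x. indicator E x * \<phi> x\<bar> \<le> (LINT x. \<bar>indicator E x * \<phi> x\<bar>)" by (rule integral_abs_bound)
  also have "\<dots> \<le> (LINT x. M * (indicator E x * \<eta> x))"
  proof (rule integral_mono)
   fix x
   show "\<bar>indicator E x * \<phi> x\<bar> \<le> M * (indicator E x * \<eta> x)"
   proof (cases "x \<in> K")
    case True
    then have "\<eta> x = 1" using \<eta>(4,5) by auto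
    then show ?thesis using M(2)[of x] by (simp add: indicator_def)
   next
    case False
    then show ?thesis using K(3) M(1) \<eta>(2) by simp
   qed
  qed (use iE[OF test_integrable[OF \<phi>]] iE[OF test_integrable[OF \<eta>(1)]] in auto)
  finally show "\<bar>LINT x. indicator E x * \<phi> x\<bar> \<le> (LINT x. M * (indicator E x * \<eta> x))" .
 qed
 also have "\<dots> = M * (\<gamma> * (LINT x. indicator E x * \<eta> x))" by simp
 also have "\<dots> \<le> 0" using \<eta>0 M(1) by (simp add: mult_nonneg_nonpos)
 finally have "(LINT x. indicator E x * (ff (u x) * \<phi> x)) = 0" by simp
 then show ?thesis using pl[OF \<phi>] by simp
qed

text \<open>Since \<open>u\<close> lies below \<open>b\<close>, the part cut off from the perturbed
  function is at most the perturbation itself, and the quadratic cost of clamping becomes a multiple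
  of the squared step.\<close>

lemma upper_quasi_min:
 assumes u: "adm l b u g" and mn: "\<forall>v h. adm l b v h --> J u g \<le> J v h"
  and b: "fin B b gb" "supersol \<Omega> ff b gb" and \<phi>: "test_fun \<Omega> \<phi>"
  and v: "fin B (\<lambda>x. u x + t * \<phi> x) (\<lambda>x. g x + t *\<^sub>R grad \<phi> x)"
 shows "J (\<lambda>x. min (u x + t * \<phi> x) (b x)) (mng (\<lambda>x. u x + t * \<phi> x) (\<lambda>x. g x + t *\<^sub>R grad \<phi> x) b gb)
   - lam * \<kappa> * (q - 1) * \<bar>B\<bar> powr (q - 2) * (LINT x. (\<phi> x)\<^sup>2) * t\<^sup>2 \<le> J (\<lambda>x. u x + t * \<phi> x) (\<lambda>x. g x + t *\<^sub>R grad \<phi> x)"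
proof -
 let ?v = "\<lambda>x. u x + t * \<phi> x" and ?h = "\<lambda>x. g x + t *\<^sub>R grad \<phi> x"
 have ub: "AE x in lebesgue. x \<in> \<Omega> --> u x \<le> b x" using u unfolding adm_def by (auto elim: eventually_mono)
 have off: "AE x in lebesgue. x \<notin> \<Omega> --> u x = 0 \<and> b x = 0"
 proof -
  have "H01 \<Omega> u g" "H01 \<Omega> b gb" using u b by (auto simp: adm_def fin_def)
  from this[THEN H01_off] show ?thesis by eventually_elim auto
 qed
 have i: "integrable lebesgue (\<lambda>x. (\<phi> x)\<^sup>2)" using sq_integrable[OF test_sq[OF \<phi>]] by simp
 have vH: "H01 \<Omega> ?v ?h" "H01 \<Omega> b gb" using v b by (auto simp: fin_def)
 have i2: "integrable lebesgue (\<lambda>x. (max 0 (?v x - b x))\<^sup>2)"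
  using sq_integrable[OF gcl_sq(1)[OF H01_pos[OF H01_diff[OF vH]]]] by simp
 have "(LINT x. (max 0 (?v x - b x))\<^sup>2) \<le> (LINT x. (t * \<phi> x)\<^sup>2)"
 proof (rule integral_mono_AE[OF i2])
  show "AE x in lebesgue. (max 0 (?v x - b x))\<^sup>2 \<le> (t * \<phi> x)\<^sup>2"
   using ub off
  proof eventually_elim
   case (elim x)
   then have "u x \<le> b x" by (cases "x \<in> \<Omega>") auto
   then have "\<bar>max 0 (?v x - b x)\<bar> \<le> \<bar>t * \<phi> x\<bar>" by (auto simp: max_def abs_if)
   then show ?case by (simp only: abs_le_square_iff)
  qed
 qed (use i in \<open>simp add: power_mult_distrib\<close>)
 also have "\<dots> = (LINT x. (\<phi> x)\<^sup>2) * t\<^sup>2" by (simp add: power_mult_distrib mult.commute)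
 finally have le: "(LINT x. (max 0 (?v x - b x))\<^sup>2) \<le> (LINT x. (\<phi> x)\<^sup>2) * t\<^sup>2" .
 have c: "0 \<le> lam * \<kappa> * (q - 1) * \<bar>B\<bar> powr (q - 2)" using lam \<kappa> q by simp
 show ?thesis using upper_clamp[OF v b(1) b(2)] mult_left_mono[OF le c] by (simp add: mult.assoc)
qed

lemma fin_mono: "fin B u g ==> B \<le> B' ==> fin B' u g"
 unfolding fin_def by (auto elim!: eventually_mono)

lemma adm_clamp_upper:
 assumes v: "fin B v h" and b: "fin B b gb" and l: "AE x in lebesgue. x \<in> \<Omega> --> l x \<le> v x \<and> l x \<le> b x"
 shows "adm l b (\<lambda>x. min (v x) (b x)) (mng v h b gb)"
proof -
 have H: "H01 \<Omega> v h" "H01 \<Omega> b gb" "integrable lebesgue (\<lambda>x. Gfun a \<delta> (v x))" "integrable lebesgue (\<lambda>x. Gfun a \<delta> (b x))"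
  using v b by (auto simp: fin_def)
 show ?thesis unfolding adm_def
  using H01_max_min(2)[OF H(1,2)] max_min_G_integrable(2)[OF H] l by (auto elim!: eventually_mono)
qed

end

text \<open>The lower obstacle is a device: half of the barrier is imposed, the whole barrier is
  recovered for the minimiser, and the obstacle is then inactive on every compact set.\<close>

lemma singular_solution:
 fixes \<Omega> :: "(real^'n::finite) set"
 assumes \<Omega>: "bounded_smooth_domain \<Omega>" and a: "0 < a" "0 < \<delta>" and lam: "0 < lam"
  and b: "supersol \<Omega> (\<lambda>s. lam * rhs_S a \<delta> s) b gb" "AE x in lebesgue. x \<in> \<Omega> --> b x \<le> B"
 obtains w g where "H01 \<Omega> w g" "AE x in lebesgue. x \<in> \<Omega> --> 0 < w x \<and> w x \<le> b x" "integrable lebesgue (\<lambda>x. Gfun a \<delta> (w x))"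
  "\<forall>K. compact K --> K \<subseteq> \<Omega> --> (\<exists>c>0. AE x in lebesgue. x \<in> K --> c \<le> w x)"
  "\<forall>\<phi>. test_fun \<Omega> \<phi> --> integrable lebesgue (\<lambda>x. lam * rhs_S a \<delta> (w x) * \<phi> x) \<and>
    (LINT x. g x \<bullet> grad \<phi> x) = (LINT x. lam * rhs_S a \<delta> (w x) * \<phi> x)"
proof -
 have O: "open \<Omega>" "bounded \<Omega>" using \<Omega> by (auto simp: bounded_smooth_domain_def)
 \<comment> \<open>With \<open>\<kappa> = 0\<close> the power drops out of the energy; 3 is merely
   an exponent above 2.\<close>
 interpret E: energy_pb \<Omega> a \<delta> lam 0 3 by unfold_locales (use O a lam in auto)
 have ffe: "E.ff = (\<lambda>s. lam * rhs_S a \<delta> s)" by (simp add: E.ff_def fun_eq_iff)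
 obtain c where c: "c > 0" "\<And>u g. supersol \<Omega> (\<lambda>s. lam * rhs_S a \<delta> s) u g ==> AE x in lebesgue. x \<in> \<Omega> --> c * (infdist x (- \<Omega>))\<^sup>2 \<le> u x"
  using distance_barrier_ex[OF O a lam] by blast
 define l where "l x = c / 2 * (infdist x (- \<Omega>))\<^sup>2" for x
 have lpos: "0 < l x" if "x \<in> \<Omega>" for x using infdist_compl_pos(1)[OF O that] c(1) by (simp add: l_def)
 have lc: "l x \<le> c * (infdist x (- \<Omega>))\<^sup>2" for x using c(1) by (simp add: l_def)
 have lb: "AE x in lebesgue. x \<in> \<Omega> --> l x \<le> b x"
  using c(2)[OF b(1)] by eventually_elim (use lc order_trans in blast)
 have bH: "H01 \<Omega> b gb" using b by (simp add: supersol_def)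
 have GB: "integrable lebesgue (\<lambda>x. Gfun a \<delta> (b x))" by (rule Gfun_supersol_integrable[OF \<Omega> a lam b(1)])
 have badm: "E.adm l b b gb" unfolding E.adm_def using bH GB lb by (auto elim!: eventually_mono)
 have lpos': "AE x in lebesgue. x \<in> \<Omega> --> 0 < l x" using lpos by simp
 obtain w g where w: "E.adm l b w g" "\<forall>v h. E.adm l b v h --> E.J w g \<le> E.J v h"
  by (rule E.minimizer[OF lpos' b(2) badm])
 have wf: "E.fin B w g" by (rule E.adm_fin[OF w(1) lpos' b(2)])
 have bf: "E.fin B b gb" by (rule E.adm_fin[OF badm lpos' b(2)])
 have wl: "AE x in lebesgue. x \<in> \<Omega> --> l x \<le> w x \<and> w x \<le> b x" using w(1) by (simp add: E.adm_def)
 have lK: "\<exists>e>0. \<forall>x\<in>K. e \<le> l x" if K: "compact K" "K \<subseteq> \<Omega>" for K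
 proof -
  obtain d where d: "d > 0" "\<forall>x\<in>K. d \<le> infdist x (- \<Omega>)" using infdist_compl_pos(2)[OF O K] by blast
  have "c / 2 * d\<^sup>2 \<le> l x" if "x \<in> K" for x
   unfolding l_def using d that c(1) by (intro mult_left_mono power_mono) auto
  moreover have "0 < c / 2 * d\<^sup>2" using c(1) d(1) by simp
  ultimately show ?thesis by blast
 qed
 have wp: "E.locpos w"
  unfolding E.locpos_def
 proof (intro allI impI)
  fix K assume K: "compact K" "K \<subseteq> \<Omega>"
  obtain e where e: "e > 0" "\<forall>x\<in>K. e \<le> l x" using lK[OF K] by blast
  have "AE x in lebesgue. x \<in> K --> e \<le> w x" using wl by eventually_elim (use e(2) K(2) in force)
  then show "\<exists>c>0. AE x in lebesgue. x \<in> K --> c \<le> w x" using e(1) by blast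
 qed
 have supb: "supersol \<Omega> E.ff b gb" unfolding ffe by (rule b(1))
 \<comment> \<open>Only perturbations that respect the lower obstacle are considered. The clamp from
   above costs nothing since \<open>\<kappa> = 0\<close>, hence the constant 0.\<close>
 have qm0: "\<exists>t1>0. \<exists>C. \<forall>t. 0 < t --> t \<le> t1 --> E.J w g - C * t\<^sup>2 \<le> E.J (\<lambda>x. w x + t * \<phi> x) (\<lambda>x. g x + t *\<^sub>R grad \<phi> x)"
  if \<phi>: "test_fun \<Omega> \<phi>" and t2: "t2 > 0" "\<And>t. 0 < t ==> t \<le> t2 ==> AE x in lebesgue. x \<in> \<Omega> --> l x \<le> w x + t * \<phi> x" for \<phi> t2
 proof -
  obtain t0 c0 K0 where t0: "t0 > 0" "c0 > 0" "compact K0" "K0 \<subseteq> \<Omega>" "\<forall>x. x \<notin> K0 --> \<phi> x = 0"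
   "AE x in lebesgue. x \<in> K0 --> c0 \<le> w x"
   "\<forall>t. \<bar>t\<bar> \<le> t0 --> E.fin (\<bar>B\<bar> + 1) (\<lambda>x. w x + t * \<phi> x) (\<lambda>x. g x + t *\<^sub>R grad \<phi> x)"
   "\<forall>t x. \<bar>t\<bar> \<le> t0 --> \<bar>t * \<phi> x\<bar> \<le> c0 / 2"
   by (rule E.pert_fin[OF wf wp \<phi>])
  have bf': "E.fin (\<bar>B\<bar> + 1) b gb" by (rule E.fin_mono[OF bf]) simp
  have "E.J w g - 0 * t\<^sup>2 \<le> E.J (\<lambda>x. w x + t * \<phi> x) (\<lambda>x. g x + t *\<^sub>R grad \<phi> x)" if t: "0 < t" "t \<le> min t0 t2" for t
  proof -
   have vf: "E.fin (\<bar>B\<bar> + 1) (\<lambda>x. w x + t * \<phi> x) (\<lambda>x. g x + t *\<^sub>R grad \<phi> x)" using t0(7) t by auto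
   have "AE x in lebesgue. x \<in> \<Omega> --> l x \<le> w x + t * \<phi> x" using t2(2) t by auto
   then have "AE x in lebesgue. x \<in> \<Omega> --> l x \<le> w x + t * \<phi> x \<and> l x \<le> b x" using lb by eventually_elim auto
   then have "E.adm l b (\<lambda>x. min (w x + t * \<phi> x) (b x)) (E.mng (\<lambda>x. w x + t * \<phi> x) (\<lambda>x. g x + t *\<^sub>R grad \<phi> x) b gb)"
    by (rule E.adm_clamp_upper[OF vf bf'])
   then have "E.J w g \<le> E.J (\<lambda>x. min (w x + t * \<phi> x) (b x)) (E.mng (\<lambda>x. w x + t * \<phi> x) (\<lambda>x. g x + t *\<^sub>R grad \<phi> x) b gb)"
    using w(2) by blast
   then show ?thesis using E.upper_quasi_min[OF w bf' supb \<phi> vf] by simp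
  qed
  then show ?thesis using t0(1) t2(1) by (intro exI[of _ "min t0 t2"] conjI exI[of _ 0]) auto
 qed
 have supw: "supersol \<Omega> E.ff w g"
 proof (rule E.euler_supersol[OF wf wp])
  fix \<phi> assume \<phi>: "test_fun \<Omega> \<phi>" "\<forall>x. 0 \<le> \<phi> x"
  show "\<exists>t1>0. \<exists>C. \<forall>t. 0 < t --> t \<le> t1 --> E.J w g - C * t\<^sup>2 \<le> E.J (\<lambda>x. w x + t * \<phi> x) (\<lambda>x. g x + t *\<^sub>R grad \<phi> x)"
  proof (rule qm0[OF \<phi>(1), of 1])
   fix t :: real assume "0 < t"
   then have "0 \<le> t * \<phi> x" for x using \<phi>(2) by simp
   then show "AE x in lebesgue. x \<in> \<Omega> --> l x \<le> w x + t * \<phi> x" using wl by (auto elim!: eventually_mono simp: add_increasing2)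
  qed simp
 qed
 \<comment> \<open>Upward perturbations never violate the obstacle, so the minimiser is already
   known to be a supersolution. It thus lies above the full barrier, twice the obstacle, which
   leaves room for perturbations of either sign.\<close>
 have wc: "AE x in lebesgue. x \<in> \<Omega> --> c * (infdist x (- \<Omega>))\<^sup>2 \<le> w x" by (rule c(2)) (use supw in \<open>simp add: ffe\<close>)
 have qm: "\<exists>t1>0. \<exists>C. \<forall>t. 0 < t --> t \<le> t1 --> E.J w g - C * t\<^sup>2 \<le> E.J (\<lambda>x. w x + t * \<phi> x) (\<lambda>x. g x + t *\<^sub>R grad \<phi> x)"
  if \<phi>: "test_fun \<Omega> \<phi>" for \<phi>
 proof -
  obtain K where K: "compact K" "K \<subseteq> \<Omega>" "\<And>x. x \<notin> K ==> \<phi> x = 0" using \<phi> unfolding test_fun_def by blast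
  obtain e where e: "e > 0" "\<forall>x\<in>K. e \<le> l x" using lK[OF K(1,2)] by blast
  obtain M where M: "M \<ge> 0" "\<And>x. \<bar>\<phi> x\<bar> \<le> M" using test_bound1[OF \<phi>] by metis
  show ?thesis
  proof (rule qm0[OF \<phi>, of "e / (M + 1)"])
   show "0 < e / (M + 1)" using e M by (intro divide_pos_pos) auto
   fix t assume t: "0 < t" "t \<le> e / (M + 1)"
   have tb: "\<bar>t * \<phi> x\<bar> \<le> e" for x
   proof -
    have "\<bar>t * \<phi> x\<bar> \<le> e / (M + 1) * (M + 1)" unfolding abs_mult using t M(1) M(2)[of x] by (intro mult_mono) auto
    then show ?thesis using M(1) by simp
   qed
   show "AE x in lebesgue. x \<in> \<Omega> --> l x \<le> w x + t * \<phi> x"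
    using wc
   proof eventually_elim
    case (elim x)
    show ?case
    proof
     assume x: "x \<in> \<Omega>"
     show "l x \<le> w x + t * \<phi> x"
     proof (cases "x \<in> K")
      case True
      have "2 * l x \<le> w x" using elim x by (simp add: l_def)
      moreover have "e \<le> l x" using e(2) True by blast
      ultimately show ?thesis using tb[of x] by (simp add: abs_le_iff)
     next
      case False
      have "l x \<le> w x" using elim x lc[of x] by auto
      then show ?thesis using K(3)[OF False] by simp
     qed
    qed
   qed
  qed
 qed
 show ?thesis
 proof (rule that)
  show "H01 \<Omega> w g" "integrable lebesgue (\<lambda>x. Gfun a \<delta> (w x))" using w(1) by (auto simp: E.adm_def)
  show "AE x in lebesgue. x \<in> \<Omega> --> 0 < w x \<and> w x \<le> b x" using wl by eventually_elim (use lpos in force)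
  show "\<forall>K. compact K --> K \<subseteq> \<Omega> --> (\<exists>c>0. AE x in lebesgue. x \<in> K --> c \<le> w x)" using wp by (simp add: E.locpos_def)
  show "\<forall>\<phi>. test_fun \<Omega> \<phi> --> integrable lebesgue (\<lambda>x. lam * rhs_S a \<delta> (w x) * \<phi> x) \<and>
    (LINT x. g x \<bullet> grad \<phi> x) = (LINT x. lam * rhs_S a \<delta> (w x) * \<phi> x)"
   using E.ff_test_integrable[OF wf wp] E.euler_solution[OF wf wp qm] unfolding ffe by blast
 qed
qed

subsection \<open>Bounded supersolutions\<close>

text \<open>For \<open>e = 0\<close> this is theta + c |s|^m; a positive \<open>e\<close> smooths
  the absolute value, as composition with test functions requires.\<close>

definition reg :: "real => real => real => real => real => real" where
 "reg \<theta> c m e s = \<theta> + c * (s\<^sup>2 + e\<^sup>2) powr (m/2)"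

context
 fixes \<theta> c m :: real
 assumes \<theta>: "0 < \<theta>" "\<theta> < 1" and c: "0 < c" and m: "0 < m"
begin

lemma reg_ge: "\<theta> \<le> reg \<theta> c m e s"
 using c by (simp add: reg_def)

lemma reg_pos: "0 < reg \<theta> c m e s"
 using reg_ge[of e s] \<theta> by linarith

lemma reg_powr_le: "r \<le> 0 ==> reg \<theta> c m e s powr r \<le> \<theta> powr r"
 using powr_mono2'[OF _ \<theta>(1) reg_ge] by simp

lemma smooth_reg: "smooth_fun f ==> 0 < e ==> smooth_fun (\<lambda>x. reg \<theta> c m e (f x))"
 unfolding reg_def power2_eq_square
 by (intro smooth_powr smooth_add smooth_mult smooth_const) (auto intro: add_nonneg_pos)

lemma reg_deriv:
 assumes "0 < e"
 shows "(reg \<theta> c m e has_real_derivative c * m * s * (s\<^sup>2 + e\<^sup>2) powr (m/2 - 1)) (at s)"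
proof -
 have p: "0 < s\<^sup>2 + e\<^sup>2" using assms by (intro add_nonneg_pos) auto
 have "((\<lambda>s. s\<^sup>2 + e\<^sup>2) has_real_derivative 2 * s) (at s)" by (auto intro!: derivative_eq_intros)
 from DERIV_fun_powr[OF this p, of "m/2"]
 have "((\<lambda>s. (s\<^sup>2 + e\<^sup>2) powr (m/2)) has_real_derivative m / 2 * (s\<^sup>2 + e\<^sup>2) powr (m/2 - 1) * (2 * s)) (at s)" by simp
 from DERIV_add[OF DERIV_const[of \<theta>] DERIV_cmult[OF this, of c]]
 show ?thesis unfolding reg_def[abs_def] by (simp add: ac_simps)
qed

lemma reg_powr_deriv:
 assumes "0 < e"
 shows "((\<lambda>s. reg \<theta> c m e s powr r) has_real_derivative
  r * reg \<theta> c m e s powr (r - 1) * (c * m * s * (s\<^sup>2 + e\<^sup>2) powr (m/2 - 1))) (at s)"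
 using DERIV_fun_powr[OF reg_deriv[OF assms] reg_pos, of r] by simp

text \<open>The bound degenerates as \<open>e\<close> tends to 0. It serves the chain rule at fixed
  \<open>e\<close>; the passage to the limit relies on the sign of this derivative instead.\<close>

lemma reg_powr_deriv_bound:
 assumes e: "0 < e" and r: "r < 0"
 shows "\<bar>r * reg \<theta> c m e s powr (r - 1) * (c * m * s * (s\<^sup>2 + e\<^sup>2) powr (m/2 - 1))\<bar> \<le> \<bar>r\<bar> * m * \<theta> powr r / e"
proof -
 define w where "w = s\<^sup>2 + e\<^sup>2"
 define R where "R = reg \<theta> c m e s"
 have w: "0 < w" using e unfolding w_def by (intro add_nonneg_pos) auto
 have R: "0 < R" "R powr r \<le> \<theta> powr r" unfolding R_def using reg_pos reg_powr_le r by auto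
 have s: "\<bar>s\<bar> \<le> sqrt w" "e \<le> sqrt w" using e unfolding w_def by (auto intro!: real_le_rsqrt)
 have "e * \<bar>s\<bar> \<le> sqrt w * sqrt w" using s e w by (intro mult_mono) auto
 then have es: "e * \<bar>s\<bar> \<le> w" using w by simp
 have "e * (c * (\<bar>s\<bar> * w powr (m/2 - 1))) = c * ((e * \<bar>s\<bar>) * w powr (m/2 - 1))" by simp
 also have "\<dots> \<le> c * (w * w powr (m/2 - 1))" using es c by (intro mult_left_mono mult_right_mono) auto
 also have "w * w powr (m/2 - 1) = w powr (m/2)" using w by (simp add: powr_diff)
 also have "c * w powr (m/2) \<le> R" using \<theta> by (simp add: R_def reg_def w_def)
 finally have k: "e * (c * (\<bar>s\<bar> * w powr (m/2 - 1))) \<le> R" .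
 have "e * \<bar>r * R powr (r - 1) * (c * m * s * w powr (m/2 - 1))\<bar> = \<bar>r\<bar> * m * R powr (r - 1) * (e * (c * (\<bar>s\<bar> * w powr (m/2 - 1))))"
  using c m e by (simp add: abs_mult)
 also have "\<dots> \<le> \<bar>r\<bar> * m * R powr (r - 1) * R" using k m by (intro mult_left_mono) auto
 also have "\<dots> = \<bar>r\<bar> * m * R powr r" using R by (simp add: powr_diff)
 also have "\<dots> \<le> \<bar>r\<bar> * m * \<theta> powr r" using R m by (intro mult_left_mono) auto
 finally show ?thesis unfolding w_def[symmetric] R_def[symmetric] using e by (simp add: pos_le_divide_eq mult.commute)
qed

lemma reg_tendsto:
 assumes "e \<longlonglongrightarrow> 0" shows "(\<lambda>n. reg \<theta> c m (e n) s powr r) \<longlonglongrightarrow> reg \<theta> c m 0 s powr r"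
proof -
 have "(\<lambda>n. s\<^sup>2 + (e n)\<^sup>2) \<longlonglongrightarrow> s\<^sup>2 + 0\<^sup>2" by (intro tendsto_intros assms)
 then have "(\<lambda>n. (s\<^sup>2 + (e n)\<^sup>2) powr (m/2)) \<longlonglongrightarrow> (s\<^sup>2 + 0\<^sup>2) powr (m/2)"
  by (rule tendsto_powr'[OF _ tendsto_const]) (use m in auto)
 then have "(\<lambda>n. reg \<theta> c m (e n) s) \<longlonglongrightarrow> reg \<theta> c m 0 s" unfolding reg_def by (intro tendsto_add tendsto_const tendsto_mult_left)
 then show ?thesis by (rule tendsto_powr[OF _ tendsto_const]) (use reg_pos[of 0 s] in simp)
qed

text \<open>For \<open>e = 0\<close> and \<open>s > 0\<close> the solution of S' = theta * (S /
  s)^(m+1): here S / s is \<open>reg\<close> to the power -1/m. As \<open>reg\<close> is at least c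
  s^m, it saturates at \<open>c powr (-1/m)\<close>.\<close>

definition sat :: "real => real => real" where "sat e s = s * reg \<theta> c m e s powr (-1/m)"

lemma sat_deriv:
 assumes e: "0 < e"
 shows "(sat e has_real_derivative reg \<theta> c m e s powr (-1/m - 1) * (\<theta> + c * (e\<^sup>2 * (s\<^sup>2 + e\<^sup>2) powr (m/2 - 1)))) (at s)"
proof -
 define w where "w = s\<^sup>2 + e\<^sup>2"
 define R where "R = reg \<theta> c m e s"
 have w: "0 < w" using e unfolding w_def by (intro add_nonneg_pos) auto
 have R: "0 < R" unfolding R_def using reg_pos by auto
 have Req: "R = \<theta> + c * (w * w powr (m/2 - 1))" using w by (simp add: R_def reg_def w_def[symmetric] powr_diff)
 have "(sat e has_real_derivative 1 * R powr (-1/m) + (-1/m * R powr (-1/m - 1) * (c * m * s * w powr (m/2 - 1))) * s) (at s)"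
  unfolding sat_def[abs_def] R_def w_def by (rule DERIV_mult[OF DERIV_ident reg_powr_deriv[OF e]])
 moreover have "R powr (-1/m) = R powr (-1/m - 1) * R" using R by (simp add: powr_diff)
 ultimately have "(sat e has_real_derivative R powr (-1/m - 1) * (R - c * (s\<^sup>2 * w powr (m/2 - 1)))) (at s)"
  using m by (simp add: algebra_simps power2_eq_square)
 moreover have "R - c * (s\<^sup>2 * w powr (m/2 - 1)) = \<theta> + c * (e\<^sup>2 * w powr (m/2 - 1))"
  unfolding Req by (simp add: w_def algebra_simps)
 ultimately show ?thesis by (simp add: w_def R_def)
qed

lemma sat_deriv_bound:
 assumes e: "0 < e"
 shows "\<bar>reg \<theta> c m e s powr (-1/m - 1) * (\<theta> + c * (e\<^sup>2 * (s\<^sup>2 + e\<^sup>2) powr (m/2 - 1)))\<bar> \<le> \<theta> powr (-1/m)"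
proof -
 define w where "w = s\<^sup>2 + e\<^sup>2"
 define R where "R = reg \<theta> c m e s"
 have w: "0 < w" "e\<^sup>2 \<le> w" using e unfolding w_def by (auto intro: add_nonneg_pos)
 have R: "0 < R" "R powr (-1/m) \<le> \<theta> powr (-1/m)" unfolding R_def using reg_pos reg_powr_le m by auto
 have "c * (e\<^sup>2 * w powr (m/2 - 1)) \<le> c * (w * w powr (m/2 - 1))" using w c by (intro mult_left_mono mult_right_mono) auto
 also have "w * w powr (m/2 - 1) = w powr (m/2)" using w by (simp add: powr_diff)
 finally have "R powr (-1/m - 1) * (\<theta> + c * (e\<^sup>2 * w powr (m/2 - 1))) \<le> R powr (-1/m - 1) * R"
  by (intro mult_left_mono) (auto simp: R_def reg_def w_def)
 also have "\<dots> = R powr (-1/m)" using R by (simp add: powr_diff)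
 finally show ?thesis using R c \<theta> by (simp add: R_def w_def abs_of_nonneg)
qed

lemma sat_bound: "\<bar>sat e s\<bar> \<le> \<theta> powr (-1/m) * \<bar>s\<bar>"
 using mult_left_mono[OF reg_powr_le[of "-1/m" e s] abs_ge_zero[of s]] m by (simp add: sat_def abs_mult mult.commute)

lemma H01_sat:
 assumes u: "H01 \<Omega> u g"
 shows "H01 \<Omega> (\<lambda>x. sat 0 (u x)) (\<lambda>x. (\<theta> * reg \<theta> c m 0 (u x) powr (-1/m - 1)) *\<^sub>R g x)"
proof -
 define e where "e n = 1 / real (Suc n)" for n
 have e: "0 < e n" for n by (simp add: e_def)
 have e0: "e \<longlonglongrightarrow> 0" unfolding e_def[abs_def] by (rule inv_Suc_lim)
 define D where "D n s = reg \<theta> c m (e n) s powr (-1/m - 1) * (\<theta> + c * ((e n)\<^sup>2 * (s\<^sup>2 + (e n)\<^sup>2) powr (m/2 - 1)))" for n s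
 have w: "0 < s\<^sup>2 + (e n)\<^sup>2" for s n using e[of n] by (intro add_nonneg_pos) auto
 have contR: "continuous_on UNIV (reg \<theta> c m (e n))" for n using reg_deriv[OF e] by (rule DERIV_continuous_on)
 have contD: "continuous_on UNIV (D n)" for n
  unfolding D_def using w[of _ n] reg_pos
  by (intro continuous_intros continuous_on_subset[OF contR]) (auto simp: less_imp_neq[THEN not_sym])
 have gc: "H01 \<Omega> (\<lambda>x. sat (e n) (u x)) (\<lambda>x. D n (u x) *\<^sub>R g x)" for n
 proof (rule gcl_chain[OF u, where L="\<theta> powr (-1/m)"])
  show "sat (e n) 0 = 0" by (simp add: sat_def)
  show "(sat (e n) has_real_derivative D n t) (at t)" for t unfolding D_def by (rule sat_deriv[OF e])
  show "\<bar>D n t\<bar> \<le> \<theta> powr (-1/m)" for t unfolding D_def by (rule sat_deriv_bound[OF e])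
  show "(\<lambda>x. sat (e n) (\<phi> x)) \<in> tests \<Omega>" if "\<phi> \<in> tests \<Omega>" for \<phi>
  proof -
   have s: "smooth_fun \<phi>" using that test_smooth by blast
   have "test_fun \<Omega> (\<lambda>x. sat (e n) (\<phi> x))"
    by (rule test_comp) (use that s in \<open>auto simp: sat_def intro!: smooth_mult smooth_powr smooth_reg[OF s e] reg_pos\<close>)
   then show ?thesis by simp
  qed
  show "tests \<Omega> \<subseteq> tests UNIV" by (auto intro: test_mono)
 qed (use contD in \<open>auto intro: test_mono\<close>)
 show ?thesis
 proof (rule gcl_chain_lim[where S="\<lambda>n. sat (e n)" and S'=D and L="\<theta> powr (-1/m)", OF gc gcl_sq[OF u]])
  show "\<bar>D n t\<bar> \<le> \<theta> powr (-1/m)" for t n unfolding D_def by (rule sat_deriv_bound[OF e])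
  show "(\<lambda>n. sat (e n) t) \<longlonglongrightarrow> sat 0 t" for t unfolding sat_def by (intro tendsto_intros reg_tendsto e0)
  show "D n \<in> borel_measurable borel" for n using contD by (rule borel_measurable_continuous_onI)
  show "sat (e n) \<in> borel_measurable borel" for n
   using sat_deriv[OF e] by (intro borel_measurable_continuous_onI DERIV_continuous_on)
  fix t
  \<comment> \<open>The error term of the smoothed derivative. Away from 0 the factor
    \<open>(e n)\<^sup>2\<close> suffices; at 0 the exponent \<open>m/2 - 1\<close> may be negative,
    but the product is \<open>((e n)\<^sup>2) powr (m/2)\<close>.\<close>
  have "(\<lambda>n. (e n)\<^sup>2 * (t\<^sup>2 + (e n)\<^sup>2) powr (m/2 - 1)) \<longlonglongrightarrow> 0"
  proof (cases "t = 0")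
   case True
   have "(\<lambda>n. (e n)\<^sup>2 * (t\<^sup>2 + (e n)\<^sup>2) powr (m/2 - 1)) = (\<lambda>n. ((e n)\<^sup>2) powr (m/2))"
   proof
    fix n
    have "0 < (e n)\<^sup>2" using e[of n] by simp
    then show "(e n)\<^sup>2 * (t\<^sup>2 + (e n)\<^sup>2) powr (m/2 - 1) = ((e n)\<^sup>2) powr (m/2)" using True by (simp add: powr_diff)
   qed
   moreover have "(\<lambda>n. ((e n)\<^sup>2) powr (m/2)) \<longlonglongrightarrow> (0\<^sup>2) powr (m/2)"
    by (rule tendsto_powr'[OF tendsto_power[OF e0] tendsto_const]) (use m in auto)
   ultimately show ?thesis by simp
  next
   case False
   then have "(\<lambda>n. (e n)\<^sup>2 * (t\<^sup>2 + (e n)\<^sup>2) powr (m/2 - 1)) \<longlonglongrightarrow> 0\<^sup>2 * (t\<^sup>2 + 0\<^sup>2) powr (m/2 - 1)"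
    by (intro tendsto_intros e0) auto
   then show ?thesis by simp
  qed
  then have "(\<lambda>n. D n t) \<longlonglongrightarrow> reg \<theta> c m 0 t powr (-1/m - 1) * (\<theta> + c * 0)"
   unfolding D_def by (intro tendsto_intros reg_tendsto e0)
  then show "(\<lambda>n. D n t) \<longlonglongrightarrow> \<theta> * reg \<theta> c m 0 t powr (-1/m - 1)" by (simp add: mult.commute)
  show "\<bar>sat (e n) t\<bar> \<le> \<theta> powr (-1/m) * \<bar>t\<bar>" for n t by (rule sat_bound)
 qed (auto intro: test_mono)
qed

text \<open>Testing the supersolution inequality with the decreasing function \<open>reg(u) powr r\<close> times a test
 function costs only a term of favourable sign.\<close>

lemma supersol_test_weight:
 assumes u: "supersol \<Omega> F u g" and F: "F \<in> borel_measurable borel" "\<And>s. 0 \<le> F s" and \<phi>: "test_fun \<Omega> \<phi>" "\<forall>x. 0 \<le> \<phi> x" and r: "r < 0"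
 shows "integrable lebesgue (\<lambda>x. F (u x) * (reg \<theta> c m 0 (u x) powr r * \<phi> x))"
  "(LINT x. F (u x) * (reg \<theta> c m 0 (u x) powr r * \<phi> x)) \<le> (LINT x. (reg \<theta> c m 0 (u x) powr r *\<^sub>R g x) \<bullet> grad \<phi> x)"
proof -
 define e where "e n = 1 / real (Suc n)" for n
 have e: "0 < e n" for n by (simp add: e_def)
 have e0: "e \<longlonglongrightarrow> 0" unfolding e_def[abs_def] by (rule inv_Suc_lim)
 define W where "W n s = reg \<theta> c m (e n) s powr r" for n s
 define D where "D n s = r * reg \<theta> c m (e n) s powr (r - 1) * (c * m * s * (s\<^sup>2 + (e n)\<^sup>2) powr (m/2 - 1))" for n s
 have uH: "H01 \<Omega> u g" using u by (simp add: supersol_def)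
 have un: "AE x in lebesgue. 0 \<le> u x" by (rule supersol_nonneg[OF u])
 have w: "0 < s\<^sup>2 + (e n)\<^sup>2" for s n using e[of n] by (intro add_nonneg_pos) auto
 have contR: "continuous_on UNIV (reg \<theta> c m (e n))" for n using reg_deriv[OF e] by (rule DERIV_continuous_on)
 have contD: "continuous_on UNIV (D n)" for n
  unfolding D_def using w[of _ n] reg_pos
  by (intro continuous_intros continuous_on_subset[OF contR]) (auto simp: less_imp_neq[THEN not_sym])
 have WD: "(W n has_real_derivative D n t) (at t)" for n t unfolding W_def D_def by (rule reg_powr_deriv[OF e])
 have W: "0 \<le> W n t" "W n t \<le> \<theta> powr r" for n t unfolding W_def using reg_powr_le r by auto
 have W0: "(\<lambda>n. W n t) \<longlonglongrightarrow> reg \<theta> c m 0 t powr r" for t unfolding W_def by (rule reg_tendsto[OF e0])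
 have mW: "W n \<in> borel_measurable borel" for n using WD by (intro borel_measurable_continuous_onI DERIV_continuous_on)
 have mR: "(\<lambda>t. reg \<theta> c m 0 t powr r) \<in> borel_measurable borel" by (rule borel_measurable_LIMSEQ_real[OF W0 mW])
 have lW: "(\<lambda>x. W n (u x)) \<in> borel_measurable lebesgue" for n by (rule comp_leb[OF mW gcl_leb(1)[OF uH]])
 have lR: "(\<lambda>x. reg \<theta> c m 0 (u x) powr r) \<in> borel_measurable lebesgue" by (rule comp_leb[OF mR gcl_leb(1)[OF uH]])
 have lF: "(\<lambda>x. F (u x)) \<in> borel_measurable lebesgue" by (rule comp_leb[OF F(1) gcl_leb(1)[OF uH]])
 have l\<phi>: "\<phi> \<in> borel_measurable lebesgue" "grad \<phi> \<in> borel_measurable lebesgue" using test_leb[OF \<phi>(1)] test_grad_leb[OF \<phi>(1)] by auto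
 have lg: "g \<in> borel_measurable lebesgue" by (rule gcl_leb[OF uH])
 have iF: "integrable lebesgue (\<lambda>x. F (u x) * \<phi> x)" using u \<phi> by (simp add: supersol_def)
 have ig: "integrable lebesgue (\<lambda>x. g x \<bullet> grad \<phi> x)" by (rule sq_inner[OF gcl_sq(2)[OF uH] test_grad_sq[OF \<phi>(1)]])
 have step: "(LINT x. F (u x) * (W n (u x) * \<phi> x)) \<le> (LINT x. (W n (u x) *\<^sub>R g x) \<bullet> grad \<phi> x)" for n
 proof -
  \<comment> \<open>The weight does not vanish at 0, so its value there is subtracted to stay in the
    closure of test functions, and added back as a multiple of \<open>\<phi>\<close>.\<close>
  have 1: "H01 \<Omega> (\<lambda>x. W n (u x) - W n 0) (\<lambda>x. D n (u x) *\<^sub>R g x)"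
  proof (rule gcl_chain[OF uH, where S="\<lambda>t. W n t - W n 0" and L="\<bar>r\<bar> * m * \<theta> powr r / e n"])
   show "((\<lambda>t. W n t - W n 0) has_real_derivative D n t) (at t)" for t
    using DERIV_diff[OF WD DERIV_const] by simp
   show "\<bar>D n t\<bar> \<le> \<bar>r\<bar> * m * \<theta> powr r / e n" for t unfolding D_def by (rule reg_powr_deriv_bound[OF e r])
   show "(\<lambda>x. W n (\<psi> x) - W n 0) \<in> tests \<Omega>" if "\<psi> \<in> tests \<Omega>" for \<psi>
   proof -
    have s: "smooth_fun \<psi>" using that test_smooth by blast
    have "test_fun \<Omega> (\<lambda>x. W n (\<psi> x) - W n 0)"
     by (rule test_comp[where S="\<lambda>t. W n t - W n 0"]) (use that s in \<open>auto simp: W_def intro!: smooth_diff smooth_const smooth_powr smooth_reg[OF s e] reg_pos\<close>)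
    then show ?thesis by simp
   qed
   show "tests \<Omega> \<subseteq> tests UNIV" by (auto intro: test_mono)
  qed (use contD in \<open>auto intro: test_mono\<close>)
  have 2: "H01 \<Omega> (\<lambda>x. W n 0 * \<phi> x) (\<lambda>x. W n 0 *\<^sub>R grad \<phi> x)" by (rule H01_cmult[OF H01_test[OF \<phi>(1)]])
  have \<zeta>: "H01 \<Omega> (\<lambda>x. \<phi> x * (W n (u x) - W n 0) + W n 0 * \<phi> x)
    (\<lambda>x. (\<phi> x *\<^sub>R (D n (u x) *\<^sub>R g x) + (W n (u x) - W n 0) *\<^sub>R grad \<phi> x) + W n 0 *\<^sub>R grad \<phi> x)"
   by (rule H01_add[OF H01_mult_test[OF H01_UNIV[OF 1] \<phi>(1)] 2])
  have z: "\<phi> x * (W n (u x) - W n 0) + W n 0 * \<phi> x = W n (u x) * \<phi> x" for x by (simp add: algebra_simps)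
  have k: "(\<phi> x *\<^sub>R (D n (u x) *\<^sub>R g x) + (W n (u x) - W n 0) *\<^sub>R grad \<phi> x) + W n 0 *\<^sub>R grad \<phi> x
    = (\<phi> x * D n (u x)) *\<^sub>R g x + W n (u x) *\<^sub>R grad \<phi> x" for x by (simp add: algebra_simps)
  note \<zeta> = \<zeta>[unfolded z k]
  have "(LINT x. F (u x) * (W n (u x) * \<phi> x)) \<le> (LINT x. g x \<bullet> ((\<phi> x * D n (u x)) *\<^sub>R g x + W n (u x) *\<^sub>R grad \<phi> x))"
   by (rule supersol_test(2)[OF u F \<zeta>]) (use \<phi>(2) W in auto)
  also have "\<dots> \<le> (LINT x. (W n (u x) *\<^sub>R g x) \<bullet> grad \<phi> x)"
  proof (rule integral_mono_AE)
   show "integrable lebesgue (\<lambda>x. g x \<bullet> ((\<phi> x * D n (u x)) *\<^sub>R g x + W n (u x) *\<^sub>R grad \<phi> x))"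
    by (rule sq_inner[OF gcl_sq(2)[OF uH] gcl_sq(2)[OF \<zeta>]])
   show "integrable lebesgue (\<lambda>x. (W n (u x) *\<^sub>R g x) \<bullet> grad \<phi> x)"
   proof (rule Bochner_Integration.integrable_bound[OF integrable_mult_right[OF ig, of "\<theta> powr r"]])
    show "AE x in lebesgue. norm ((W n (u x) *\<^sub>R g x) \<bullet> grad \<phi> x) \<le> norm (\<theta> powr r * (g x \<bullet> grad \<phi> x))"
     using W by (auto simp: abs_mult intro!: AE_I2 mult_right_mono)
   qed (use lW lg l\<phi> in \<open>auto intro!: borel_measurable_inner\<close>)
   show "AE x in lebesgue. g x \<bullet> ((\<phi> x * D n (u x)) *\<^sub>R g x + W n (u x) *\<^sub>R grad \<phi> x) \<le> (W n (u x) *\<^sub>R g x) \<bullet> grad \<phi> x"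
    using un
   proof eventually_elim
    case (elim x)
    \<comment> \<open>The weight decreases along nonnegative values, so the term with the squared
      gradient of \<open>u\<close> is nonpositive and may be dropped.\<close>
    have "D n (u x) \<le> 0" unfolding D_def
     by (intro mult_nonpos_nonneg) (use r c m elim in auto)
    then have "\<phi> x * D n (u x) * (g x \<bullet> g x) \<le> 0" using \<phi>(2) by (intro mult_nonpos_nonneg mult_nonneg_nonpos) auto
    then show ?case by (simp add: inner_add_right)
   qed
  qed
  finally show ?thesis .
 qed
 have dl: "integrable lebesgue (\<lambda>x. F (u x) * (reg \<theta> c m 0 (u x) powr r * \<phi> x))"
   "(\<lambda>n. LINT x. F (u x) * (W n (u x) * \<phi> x)) \<longlonglongrightarrow> (LINT x. F (u x) * (reg \<theta> c m 0 (u x) powr r * \<phi> x))"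
 proof -
  have 1: "AE x in lebesgue. (\<lambda>n. F (u x) * (W n (u x) * \<phi> x)) \<longlonglongrightarrow> F (u x) * (reg \<theta> c m 0 (u x) powr r * \<phi> x)"
   by (intro AE_I2 tendsto_intros W0)
  have 2: "AE x in lebesgue. norm (F (u x) * (W n (u x) * \<phi> x)) \<le> \<theta> powr r * (F (u x) * \<phi> x)" for n
  proof (intro AE_I2)
   fix x
   have "W n (u x) * (F (u x) * \<phi> x) \<le> \<theta> powr r * (F (u x) * \<phi> x)" using F(2) \<phi>(2) W by (intro mult_right_mono) auto
   then show "norm (F (u x) * (W n (u x) * \<phi> x)) \<le> \<theta> powr r * (F (u x) * \<phi> x)"
    using F(2)[of "u x"] \<phi>(2) W by (simp add: abs_mult mult.left_commute)
  qed
  have 3: "(\<lambda>x. F (u x) * (reg \<theta> c m 0 (u x) powr r * \<phi> x)) \<in> borel_measurable lebesgue"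
   "(\<lambda>x. F (u x) * (W n (u x) * \<phi> x)) \<in> borel_measurable lebesgue" for n using lF lR lW l\<phi> by auto
  show "integrable lebesgue (\<lambda>x. F (u x) * (reg \<theta> c m 0 (u x) powr r * \<phi> x))" by (rule integrable_dominated_convergence[OF 3 integrable_mult_right[OF iF, of "\<theta> powr r"] 1 2])
  show "(\<lambda>n. LINT x. F (u x) * (W n (u x) * \<phi> x)) \<longlonglongrightarrow> (LINT x. F (u x) * (reg \<theta> c m 0 (u x) powr r * \<phi> x))"
   by (rule integral_dominated_convergence[OF 3 integrable_mult_right[OF iF, of "\<theta> powr r"] 1 2])
 qed
 have dr: "(\<lambda>n. LINT x. (W n (u x) *\<^sub>R g x) \<bullet> grad \<phi> x) \<longlonglongrightarrow> (LINT x. (reg \<theta> c m 0 (u x) powr r *\<^sub>R g x) \<bullet> grad \<phi> x)"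
 proof (rule integral_dominated_convergence[OF _ _ integrable_mult_right[OF integrable_norm[OF ig], of "\<theta> powr r"]])
  show "AE x in lebesgue. norm ((W n (u x) *\<^sub>R g x) \<bullet> grad \<phi> x) \<le> \<theta> powr r * norm (g x \<bullet> grad \<phi> x)" for n
   using W by (auto simp: abs_mult intro!: AE_I2 mult_right_mono)
  show "AE x in lebesgue. (\<lambda>n. (W n (u x) *\<^sub>R g x) \<bullet> grad \<phi> x) \<longlonglongrightarrow> (reg \<theta> c m 0 (u x) powr r *\<^sub>R g x) \<bullet> grad \<phi> x"
   by (intro AE_I2 tendsto_intros W0)
 qed (use lW lR lg l\<phi> in \<open>auto intro!: borel_measurable_inner\<close>)
 show "integrable lebesgue (\<lambda>x. F (u x) * (reg \<theta> c m 0 (u x) powr r * \<phi> x))" by (rule dl(1))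
 show "(LINT x. F (u x) * (reg \<theta> c m 0 (u x) powr r * \<phi> x)) \<le> (LINT x. (reg \<theta> c m 0 (u x) powr r *\<^sub>R g x) \<bullet> grad \<phi> x)"
  by (rule LIMSEQ_le[OF dl(2) dr]) (use step in auto)
qed

end

text \<open>Composition with a concave increasing S multiplies the right-hand side by S'(u) and adds
  a term of favourable sign. So it is enough that lam F(S(s)) is at most lam' F(s) S'(s), with S'
  equal to theta times \<open>reg\<close> to the power -1/m - 1.\<close>

lemma bounded_supersolution:
 fixes \<Omega> :: "(real^'n::finite) set"
 assumes \<Omega>: "open \<Omega>" and a: "0 < a" "0 < \<delta>" and lam: "0 < lam" "lam < lam'" and q: "2 < q"
  and F: "F = (\<lambda>s. s powr (q - 1) + rhs_S a \<delta> s)" and u: "supersol \<Omega> (\<lambda>s. lam' * F s) u g"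
 obtains ub gb B where "supersol \<Omega> (\<lambda>s. lam * F s) ub gb" "\<forall>x. ub x \<le> B"
proof -
 define \<theta> where "\<theta> = lam / lam'"
 define m where "m = q - 2"
 \<comment> \<open>Chosen so that \<open>reg\<close> equals 1 at height \<open>a\<close>, that is, S
   fixes \<open>a\<close>.\<close>
 define c where "c = (1 - \<theta>) / a powr m"
 have l': "lam' > 0" "lam' * \<theta> = lam" using lam by (auto simp: \<theta>_def)
 have \<theta>: "0 < \<theta>" "\<theta> < 1" using lam by (auto simp: \<theta>_def)
 have m: "0 < m" using q by (simp add: m_def)
 have c: "0 < c" using \<theta> a by (simp add: c_def)
 note P = \<theta> c m
 let ?S = "sat \<theta> c m 0" and ?R = "reg \<theta> c m 0"
 have Rs: "?R s = \<theta> + c * s powr m" if "0 < s" for s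
 proof -
  have "s\<^sup>2 powr (m/2) = s powr m" using that powr_powr[of s 2 "m/2"] by simp
  then show ?thesis by (simp add: reg_def)
 qed
 have Rp: "0 < ?R s" for s by (rule reg_pos[OF P])
 have Sp: "0 < ?S s" if "0 < s" for s using that Rp[of s] by (simp add: sat_def[OF P])
 have SB: "?S s \<le> c powr (-1/m)" for s
 proof (cases "0 < s")
  case True
  have "c * s powr m \<le> ?R s" using Rs[OF True] \<theta> by simp
  moreover have "0 < c * s powr m" using c True by simp
  ultimately have "?R s powr (-1/m) \<le> (c * s powr m) powr (-1/m)" using m by (intro powr_mono2') auto
  also have "\<dots> = c powr (-1/m) / s" using c True m by (simp add: powr_mult powr_powr powr_minus divide_inverse)
  finally show ?thesis using True by (simp add: sat_def[OF P] field_simps)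
 next
  case False
  have "?S s \<le> 0" using False by (auto simp: sat_def[OF P] intro!: mult_nonpos_nonneg)
  also have "0 \<le> c powr (-1/m)" by simp
  finally show ?thesis .
 qed
 have Fnn: "0 \<le> F s" for s unfolding F by (simp add: rhs_S_nonneg)
 have Fb: "F \<in> borel_measurable borel" unfolding F using rhs_S_borel[of a \<delta>] by simp
 have pt: "lam * F (?S s) \<le> lam' * F s * (\<theta> * ?R s powr (-1/m - 1))" if s: "0 < s" for s
 proof -
  define R where "R = ?R s"
  have R: "0 < R" "R = \<theta> + c * s powr m" unfolding R_def by (rule Rp, rule Rs[OF s])
  have Ss: "?S s = s * R powr (-1/m)" by (simp add: sat_def[OF P] R_def)
  have e: "(-1/m) * (m + 1) = -1/m - 1" using m by (simp add: field_simps)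
  \<comment> \<open>For the critical power the inequality is an equality; this fixes
    \<open>m = q - 2\<close> and \<open>\<theta> = lam / lam'\<close>.\<close>
  have "(?S s) powr (m + 1) = s powr (m + 1) * R powr (-1/m - 1)" unfolding Ss e[symmetric] using s R by (simp add: powr_mult powr_powr)
  then have 1: "lam * (?S s) powr (q - 1) = lam' * (s powr (q - 1)) * (\<theta> * R powr (-1/m - 1))"
   using l'(2)[symmetric] by (simp add: m_def)
  have 2: "lam * rhs_S a \<delta> (?S s) \<le> lam' * rhs_S a \<delta> s * (\<theta> * R powr (-1/m - 1))"
  proof (cases "s < a")
   case True
   \<comment> \<open>Below \<open>a\<close> the regulariser is at most 1, hence S(s) >= s and S'(s)
     >= theta: the singular term does not increase, and lam' theta = lam.\<close>
   have "s powr m \<le> a powr m" using True s m by (intro powr_mono2) auto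
   then have "c * s powr m \<le> c * a powr m" using c by (intro mult_left_mono) auto
   also have "\<dots> = 1 - \<theta>" using a by (simp add: c_def)
   finally have R1: "R \<le> 1" using R(2) by simp
   have p1: "1 \<le> R powr t" if "t \<le> 0" for t using powr_mono2'[OF that R(1) R1] by simp
   have rr: "-1/m - 1 \<le> 0" using m by (simp add: field_simps)
   have "s \<le> ?S s" unfolding Ss using mult_left_mono[OF p1[of "-1/m"], of s] s m by simp
   then have "rhs_S a \<delta> (?S s) \<le> s powr (-\<delta>)" using a s powr_mono2'[of "-\<delta>" s "?S s"] by (simp add: rhs_S_def)
   then have "lam * rhs_S a \<delta> (?S s) \<le> lam * s powr (-\<delta>)" using lam by (intro mult_left_mono) auto
   also have "\<dots> = lam' * rhs_S a \<delta> s * (\<theta> * 1)" using True l'(2) by (simp add: rhs_S_def mult.left_commute mult.commute)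
   also have "\<dots> \<le> lam' * rhs_S a \<delta> s * (\<theta> * R powr (-1/m - 1))"
    using p1[OF rr] l' \<theta> by (intro mult_left_mono) (auto simp: rhs_S_nonneg)
   finally show ?thesis .
  next
   case False
   \<comment> \<open>From \<open>a\<close> on S stays at least \<open>a\<close>, so the singular
     term of S(s) is switched off.\<close>
   have "a powr m \<le> s powr m" using False a m by (intro powr_mono2) auto
   then have "R \<le> s powr m / a powr m" using \<theta> a unfolding R(2) c_def by (simp add: field_simps)
   then have "(s powr m / a powr m) powr (-1/m) \<le> R powr (-1/m)" using R m by (intro powr_mono2') auto
   moreover have "(s powr m / a powr m) powr (-1/m) = a / s" using s a m by (simp add: powr_divide powr_powr powr_minus field_simps)
   ultimately have "s * (a / s) \<le> s * R powr (-1/m)" using s by (intro mult_left_mono) auto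
   then have "a \<le> ?S s" unfolding Ss using s by simp
   then show ?thesis using lam l' \<theta> by (simp add: rhs_S_def)
  qed
  show ?thesis using 1 2 unfolding F R_def[symmetric] by (simp add: algebra_simps)
 qed
 have uH: "H01 \<Omega> u g" and up: "AE x in lebesgue. x \<in> \<Omega> --> 0 < u x" using u by (auto simp: supersol_def)
 have off: "AE x in lebesgue. x \<notin> \<Omega> --> u x = 0 \<and> g x = 0" by (rule H01_off[OF uH])
 have SH: "H01 \<Omega> (\<lambda>x. ?S (u x)) (\<lambda>x. (\<theta> * ?R (u x) powr (-1/m - 1)) *\<^sub>R g x)" by (rule H01_sat[OF P uH])
 have r: "-1/m - 1 < 0" using m by (simp add: field_simps)
 have F': "(\<lambda>s. lam' * F s) \<in> borel_measurable borel" "\<And>s. 0 \<le> lam' * F s" using Fb Fnn l' by auto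
 have "supersol \<Omega> (\<lambda>s. lam * F s) (\<lambda>x. ?S (u x)) (\<lambda>x. (\<theta> * ?R (u x) powr (-1/m - 1)) *\<^sub>R g x)"
  unfolding supersol_def
 proof (intro conjI allI impI SH)
  show "AE x in lebesgue. x \<in> \<Omega> --> 0 < ?S (u x)" using up by eventually_elim (use Sp in auto)
  fix \<phi> assume \<phi>: "test_fun \<Omega> \<phi>" "\<forall>x. 0 \<le> \<phi> x"
  note T = supersol_test_weight[OF P u F' \<phi> r]
  have le: "AE x in lebesgue. lam * F (?S (u x)) * \<phi> x \<le> \<theta> * (lam' * F (u x) * (?R (u x) powr (-1/m - 1) * \<phi> x))"
   using up off
  proof eventually_elim
   case (elim x)
   show ?case
   proof (cases "x \<in> \<Omega>")
    case True
    have "lam * F (?S (u x)) * \<phi> x \<le> lam' * F (u x) * (\<theta> * ?R (u x) powr (-1/m - 1)) * \<phi> x"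
     using elim True \<phi>(2) by (intro mult_right_mono pt) auto
    then show ?thesis by (simp add: algebra_simps)
   next
    case False
    then show ?thesis using test_off[OF \<phi>(1)] by simp
   qed
  qed
  have mS: "(\<lambda>x. lam * F (?S (u x)) * \<phi> x) \<in> borel_measurable lebesgue"
   using comp_leb[OF Fb gcl_leb(1)[OF SH]] test_leb[OF \<phi>(1)] by simp
  show i: "integrable lebesgue (\<lambda>x. lam * F (?S (u x)) * \<phi> x)"
  proof (rule Bochner_Integration.integrable_bound[OF integrable_mult_right[OF T(1), of \<theta>] mS])
   show "AE x in lebesgue. norm (lam * F (?S (u x)) * \<phi> x) \<le> norm (\<theta> * (lam' * F (u x) * (?R (u x) powr (-1/m - 1) * \<phi> x)))"
    using le
   proof eventually_elim
    case (elim x)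
    have "0 \<le> lam * F (?S (u x)) * \<phi> x" using lam Fnn \<phi>(2) by simp
    then show ?case using elim by (simp only: real_norm_def abs_of_nonneg[OF order_trans[OF _ elim]] abs_of_nonneg)
   qed
  qed
  have "(LINT x. lam * F (?S (u x)) * \<phi> x) \<le> (LINT x. \<theta> * (lam' * F (u x) * (?R (u x) powr (-1/m - 1) * \<phi> x)))"
   by (rule integral_mono_AE[OF i integrable_mult_right[OF T(1)] le])
  also have "\<dots> = \<theta> * (LINT x. lam' * F (u x) * (?R (u x) powr (-1/m - 1) * \<phi> x))" by simp
  also have "\<dots> \<le> \<theta> * (LINT x. (?R (u x) powr (-1/m - 1) *\<^sub>R g x) \<bullet> grad \<phi> x)" using T(2) \<theta> by (intro mult_left_mono) auto
  also have "\<dots> = (LINT x. ((\<theta> * ?R (u x) powr (-1/m - 1)) *\<^sub>R g x) \<bullet> grad \<phi> x)"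
   by (subst integral_mult_right_zero[symmetric]) (simp add: mult.assoc)
  finally show "(LINT x. lam * F (?S (u x)) * \<phi> x) \<le> (LINT x. ((\<theta> * ?R (u x) powr (-1/m - 1)) *\<^sub>R g x) \<bullet> grad \<phi> x)" .
 qed
 then show ?thesis by (rule that) (use SB in auto)
qed

subsection \<open>The critical problem\<close>

lemma H10_grad_H01:
 fixes \<Omega> :: "(real^'n::finite) set"
 assumes \<Omega>: "open \<Omega>" and u: "H10_grad \<Omega> u g"
 shows "H01 \<Omega> (\<lambda>x. indicator \<Omega> x * u x) (\<lambda>x. indicator \<Omega> x *\<^sub>R g x)"
proof -
 have m: "u \<in> borel_measurable lebesgue" "g \<in> borel_measurable lebesgue" and mO [measurable]: "\<Omega> \<in> sets lebesgue"
  using u \<Omega> by (auto simp: H10_grad_def)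
 have e1: "(norm (indicator \<Omega> x * u x))\<^sup>2 = indicator \<Omega> x *\<^sub>R (u x)\<^sup>2"
  and e2: "(norm (indicator \<Omega> x *\<^sub>R g x))\<^sup>2 = indicator \<Omega> x *\<^sub>R (norm (g x))\<^sup>2" for x
  by (auto simp: indicator_def)
 obtain \<phi> where \<phi>: "\<forall>k. test_fun \<Omega> (\<phi> k)"
  "(\<lambda>k. LINT x:\<Omega>|lebesgue. (\<phi> k x - u x)\<^sup>2) \<longlonglongrightarrow> 0" "(\<lambda>k. LINT x:\<Omega>|lebesgue. (norm (grad (\<phi> k) x - g x))\<^sup>2) \<longlonglongrightarrow> 0"
  using u unfolding H10_grad_def by blast
 have n1: "(nrm lebesgue (\<lambda>x. \<phi> k x - indicator \<Omega> x * u x))\<^sup>2 = (LINT x:\<Omega>|lebesgue. (\<phi> k x - u x)\<^sup>2)" for k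
  unfolding nrm_power2 set_lebesgue_integral_def
  by (intro Bochner_Integration.integral_cong) (use test_off[OF \<phi>(1)[rule_format]] in \<open>auto simp: indicator_def\<close>)
 have n2: "(nrm lebesgue (\<lambda>x. grad (\<phi> k) x - indicator \<Omega> x *\<^sub>R g x))\<^sup>2 = (LINT x:\<Omega>|lebesgue. (norm (grad (\<phi> k) x - g x))\<^sup>2)" for k
  unfolding nrm_power2 set_lebesgue_integral_def
  by (intro Bochner_Integration.integral_cong) (use test_grad_off[OF \<phi>(1)[rule_format]] in \<open>auto simp: indicator_def\<close>)
 show ?thesis
  unfolding gcl_def
 proof (intro conjI allI impI)
  show "sq lebesgue (\<lambda>x. indicator \<Omega> x * u x)" "sq lebesgue (\<lambda>x. indicator \<Omega> x *\<^sub>R g x)"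
   using u m unfolding sq_def e1 e2 by (auto simp: H10_grad_def set_integrable_def)
  fix e :: real assume e: "e > 0"
  have "\<forall>\<^sub>F k in sequentially. (nrm lebesgue (\<lambda>x. \<phi> k x - indicator \<Omega> x * u x))\<^sup>2 < e\<^sup>2"
   "\<forall>\<^sub>F k in sequentially. (nrm lebesgue (\<lambda>x. grad (\<phi> k) x - indicator \<Omega> x *\<^sub>R g x))\<^sup>2 < e\<^sup>2"
   unfolding n1 n2 using e by (auto intro!: order_tendstoD(2)[OF \<phi>(2)] order_tendstoD(2)[OF \<phi>(3)])
  then have "\<forall>\<^sub>F k in sequentially. nrm lebesgue (\<lambda>x. \<phi> k x - indicator \<Omega> x * u x) < e \<and>
    nrm lebesgue (\<lambda>x. grad (\<phi> k) x - indicator \<Omega> x *\<^sub>R g x) < e"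
   by eventually_elim (use e in \<open>auto intro: power2_less_imp_less\<close>)
  then obtain k where "nrm lebesgue (\<lambda>x. \<phi> k x - indicator \<Omega> x * u x) < e \<and>
    nrm lebesgue (\<lambda>x. grad (\<phi> k) x - indicator \<Omega> x *\<^sub>R g x) < e"
   using eventually_happens by force
  then show "\<exists>\<phi>\<in>tests \<Omega>. nrm lebesgue (\<lambda>x. \<phi> x - indicator \<Omega> x * u x) < e \<and>
    nrm lebesgue (\<lambda>x. grad \<phi> x - indicator \<Omega> x *\<^sub>R g x) < e" using \<phi>(1) by blast
 qed
qed

lemma H01_H10_grad:
 fixes \<Omega> :: "(real^'n::finite) set"
 assumes \<Omega>: "open \<Omega>" and u: "H01 \<Omega> u g"
 shows "H10_grad \<Omega> u g"
proof -
 have mO: "\<Omega> \<in> sets lebesgue" using \<Omega> by auto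
 note s = gcl_sq[OF u]
 from gcl_seq_ex[OF u, of \<Omega>] obtain \<phi> where \<phi>: "\<forall>n. \<phi> n \<in> tests \<Omega>" "L2lim lebesgue \<phi> u" "L2lim lebesgue (\<lambda>n. grad (\<phi> n)) g"
  by auto
 have bd: "(\<lambda>n. LINT x:\<Omega>|lebesgue. (norm (fs n x - f x))\<^sup>2) \<longlonglongrightarrow> 0" if L: "L2lim lebesgue fs f"
  for fs :: "nat => real^'n => 'b::euclidean_space" and f
 proof (rule tendsto_sandwich[OF _ _ tendsto_const])
  have i: "integrable lebesgue (\<lambda>x. (norm (fs n x - f x))\<^sup>2)" for n
   by (rule sq_integrable[OF sq_diff]) (use L in \<open>auto simp: L2lim_def\<close>)
  show "(\<lambda>n. (nrm lebesgue (\<lambda>x. fs n x - f x))\<^sup>2) \<longlonglongrightarrow> 0"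
   using tendsto_power[of _ 0 _ 2] L unfolding L2lim_def by fastforce
  show "\<forall>\<^sub>F n in sequentially. (LINT x:\<Omega>|lebesgue. (norm (fs n x - f x))\<^sup>2) \<le> (nrm lebesgue (\<lambda>x. fs n x - f x))\<^sup>2"
   unfolding nrm_power2 set_lebesgue_integral_def
   by (intro always_eventually allI integral_mono integrable_mult_indicator[OF mO] i) (auto simp: indicator_def)
  show "\<forall>\<^sub>F n in sequentially. 0 \<le> (LINT x:\<Omega>|lebesgue. (norm (fs n x - f x))\<^sup>2)"
   unfolding set_lebesgue_integral_def by (intro always_eventually allI Bochner_Integration.integral_nonneg) auto
 qed
 have "set_integrable lebesgue \<Omega> (\<lambda>x. (u x)\<^sup>2)" "set_integrable lebesgue \<Omega> (\<lambda>x. (norm (g x))\<^sup>2)"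
  unfolding set_integrable_def by (rule integrable_mult_indicator[OF mO], use s in \<open>simp add: sq_def\<close>)+
 moreover have "\<forall>k. test_fun \<Omega> (\<phi> k)" using \<phi>(1) by simp
 ultimately show ?thesis using bd[OF \<phi>(2), unfolded real_norm_def power2_abs] bd[OF \<phi>(3)] gcl_leb[OF u]
  unfolding H10_grad_def by (intro conjI exI[of _ \<phi>])
qed

lemma H10_wgrad: "H10 \<Omega> v ==> H10_grad \<Omega> v (wgrad \<Omega> v)"
 unfolding H10_def wgrad_def using someI_ex[of "H10_grad \<Omega> v"] by simp

text \<open>\<open>wgrad\<close> is an arbitrary choice, unconstrained off \<Omega>; uniqueness of
  the gradient of the zero extension identifies it almost everywhere.\<close>

lemma wgrad_AE:
 assumes \<Omega>: "open \<Omega>" and u: "H01 \<Omega> u g"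
 shows "AE x in lebesgue. indicator \<Omega> x *\<^sub>R wgrad \<Omega> u x = g x"
proof -
 have h: "H10_grad \<Omega> u g" by (rule H01_H10_grad[OF assms])
 then have "H10 \<Omega> u" by (auto simp: H10_def)
 from H01_grad_unique[OF H01_UNIV[OF H10_grad_H01[OF \<Omega> H10_wgrad[OF this]]] H01_UNIV[OF H10_grad_H01[OF \<Omega> h]]]
 show ?thesis using H01_off[OF u] by eventually_elim (auto simp: indicator_def split: if_splits)
qed

lemma set_integral_test:
 assumes "test_fun \<Omega> \<phi>"
 shows "set_integrable lebesgue \<Omega> (\<lambda>x. f x * \<phi> x) \<longleftrightarrow> integrable lebesgue (\<lambda>x. f x * \<phi> x)"
  "(LINT x:\<Omega>|lebesgue. f x * \<phi> x) = (LINT x. f x * \<phi> x)"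
  "(LINT x:\<Omega>|lebesgue. h x \<bullet> grad \<phi> x) = (LINT x. (indicator \<Omega> x *\<^sub>R h x) \<bullet> grad \<phi> x)"
proof -
 have "(\<lambda>x. indicator \<Omega> x *\<^sub>R (f x * \<phi> x)) = (\<lambda>x. f x * \<phi> x)"
  using test_off[OF assms] by (auto simp: fun_eq_iff indicator_def)
 then show "set_integrable lebesgue \<Omega> (\<lambda>x. f x * \<phi> x) \<longleftrightarrow> integrable lebesgue (\<lambda>x. f x * \<phi> x)"
  "(LINT x:\<Omega>|lebesgue. f x * \<phi> x) = (LINT x. f x * \<phi> x)"
  by (simp_all add: set_integrable_def set_lebesgue_integral_def)
 show "(LINT x:\<Omega>|lebesgue. h x \<bullet> grad \<phi> x) = (LINT x. (indicator \<Omega> x *\<^sub>R h x) \<bullet> grad \<phi> x)"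
  by (simp add: set_lebesgue_integral_def)
qed

lemma wgrad_test:
 assumes \<Omega>: "open \<Omega>" and u: "H01 \<Omega> u g" and \<phi>: "test_fun \<Omega> \<phi>"
 shows "(LINT x:\<Omega>|lebesgue. wgrad \<Omega> u x \<bullet> grad \<phi> x) = (LINT x. g x \<bullet> grad \<phi> x)"
proof -
 have h: "H10 \<Omega> u" using H01_H10_grad[OF \<Omega> u] by (auto simp: H10_def)
 note m = gcl_leb(2)[OF H10_grad_H01[OF \<Omega> H10_wgrad[OF h]]] gcl_leb(2)[OF u] test_grad_leb[OF \<phi>]
 show ?thesis unfolding set_integral_test[OF \<phi>]
 proof (rule integral_cong_AE)
  show "AE x in lebesgue. (indicator \<Omega> x *\<^sub>R wgrad \<Omega> u x) \<bullet> grad \<phi> x = g x \<bullet> grad \<phi> x"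
   using wgrad_AE[OF \<Omega> u] by eventually_elim simp
 qed (rule borel_measurable_inner[OF m(1,3)], rule borel_measurable_inner[OF m(2,3)])
qed

text \<open>The points at distance at least 1/(n+1) from the complement form compact sets that
  exhaust \<Omega>, so countably many null sets are discarded.\<close>

lemma locally_pos_AE:
 fixes \<Omega> :: "(real^'n::finite) set"
 assumes \<Omega>: "open \<Omega>" "bounded \<Omega>" and u: "locally_pos \<Omega> u"
 shows "AE x in lebesgue. x \<in> \<Omega> --> 0 < u x"
proof -
 define K where "K n = {x. 1 / real (Suc n) \<le> infdist x (- \<Omega>)}" for n
 have KO: "K n \<subseteq> \<Omega>" for n
 proof
  fix x assume x: "x \<in> K n"
  have "0 < 1 / real (Suc n)" by simp
  then have "0 < infdist x (- \<Omega>)" using x unfolding K_def mem_Collect_eq by linarith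
  then show "x \<in> \<Omega>" by (metis ComplI infdist_zero less_irrefl)
 qed
 have cK: "compact (K n)" for n
 proof -
  have "closed (K n)" unfolding K_def by (intro closed_Collect_le continuous_intros)
  then show ?thesis using bounded_subset[OF \<Omega>(2) KO] by (simp add: compact_eq_bounded_closed)
 qed
 have "AE x in lebesgue. \<forall>n. x \<in> K n --> 0 < u x"
  unfolding AE_all_countable
 proof
  fix n
  obtain c where c: "c > 0" "AE x in lebesgue. x \<in> K n --> c \<le> u x" using u cK KO unfolding locally_pos_def by blast
  show "AE x in lebesgue. x \<in> K n --> 0 < u x" using c(2) by eventually_elim (use c(1) in auto)
 qed
 then show ?thesis
 proof eventually_elim
  case (elim x)
  show ?case
  proof
   assume "x \<in> \<Omega>"
   then obtain n where "1 / real (Suc n) < infdist x (- \<Omega>)"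
    using infdist_compl_pos(1)[OF \<Omega>] nat_approx_posE by metis
   then have "x \<in> K n" by (simp add: K_def)
   then show "0 < u x" using elim by blast
  qed
 qed
qed

lemma weak_solI:
 assumes \<Omega>: "open \<Omega>" and u: "H01 \<Omega> u g" "locally_pos \<Omega> u"
  and eq: "\<And>\<phi>. test_fun \<Omega> \<phi> ==> integrable lebesgue (\<lambda>x. f (u x) * \<phi> x)"
   "\<And>\<phi>. test_fun \<Omega> \<phi> ==> (LINT x. g x \<bullet> grad \<phi> x) = lam * (LINT x. f (u x) * \<phi> x)"
 shows "weak_sol \<Omega> f lam u"
 unfolding weak_sol_def
proof (intro conjI allI impI)
 show "H10 \<Omega> u" using H01_H10_grad[OF \<Omega> u(1)] by (auto simp: H10_def)
 fix \<phi> assume \<phi>: "test_fun \<Omega> \<phi>"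
 show "set_integrable lebesgue \<Omega> (\<lambda>x. f (u x) * \<phi> x)" using eq(1)[OF \<phi>] by (simp add: set_integral_test(1)[OF \<phi>])
 show "(LINT x:\<Omega>|lebesgue. wgrad \<Omega> u x \<bullet> grad \<phi> x) = lam * (LINT x:\<Omega>|lebesgue. f (u x) * \<phi> x)"
  using eq(2)[OF \<phi>] by (simp add: set_integral_test(2)[OF \<phi>] wgrad_test[OF \<Omega> u(1) \<phi>])
qed (rule u(2))

lemma weak_supersolI:
 assumes \<Omega>: "open \<Omega>" and u: "supersol \<Omega> (\<lambda>s. lam * f s) u g" "locally_pos \<Omega> u" and lam: "lam \<noteq> 0"
 shows "weak_supersol \<Omega> f lam u"
 unfolding weak_supersol_def
proof (intro conjI allI impI)
 have uH: "H01 \<Omega> u g" using u by (simp add: supersol_def)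
 show "H10 \<Omega> u" using H01_H10_grad[OF \<Omega> uH] by (auto simp: H10_def)
 fix \<phi> assume \<phi>: "test_fun \<Omega> \<phi> \<and> (\<forall>x. 0 \<le> \<phi> x)"
 then have t: "test_fun \<Omega> \<phi>" by blast
 have e: "integrable lebesgue (\<lambda>x. lam * (f (u x) * \<phi> x))" "(LINT x. lam * (f (u x) * \<phi> x)) \<le> (LINT x. g x \<bullet> grad \<phi> x)"
  using u \<phi> by (auto simp: supersol_def mult.assoc)
 show "set_integrable lebesgue \<Omega> (\<lambda>x. f (u x) * \<phi> x)" using e(1) lam by (simp add: set_integral_test(1)[OF t])
 show "lam * (LINT x:\<Omega>|lebesgue. f (u x) * \<phi> x) \<le> (LINT x:\<Omega>|lebesgue. wgrad \<Omega> u x \<bullet> grad \<phi> x)"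
  using e(2) by (simp add: set_integral_test(2)[OF t] wgrad_test[OF \<Omega> uH t])
qed (rule u(2))

lemma weak_sol_supersol:
 fixes \<Omega> :: "(real^'n::finite) set"
 assumes \<Omega>: "open \<Omega>" "bounded \<Omega>" and u: "weak_sol \<Omega> f lam u"
 shows "supersol \<Omega> (\<lambda>s. lam * f s) (\<lambda>x. indicator \<Omega> x * u x) (\<lambda>x. indicator \<Omega> x *\<^sub>R wgrad \<Omega> u x)"
 unfolding supersol_def
proof (intro conjI allI impI)
 have h: "H10 \<Omega> u" "locally_pos \<Omega> u" using u by (auto simp: weak_sol_def)
 show "H01 \<Omega> (\<lambda>x. indicator \<Omega> x * u x) (\<lambda>x. indicator \<Omega> x *\<^sub>R wgrad \<Omega> u x)" by (rule H10_grad_H01[OF \<Omega>(1) H10_wgrad[OF h(1)]])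
 show "AE x in lebesgue. x \<in> \<Omega> --> 0 < indicator \<Omega> x * u x"
  using locally_pos_AE[OF \<Omega> h(2)] by eventually_elim auto
 fix \<phi> assume \<phi>: "test_fun \<Omega> \<phi>"
 have c: "lam * f (indicator \<Omega> x * u x) * \<phi> x = lam * (f (u x) * \<phi> x)" for x
  using test_off[OF \<phi>, of x] by (cases "x \<in> \<Omega>") auto
 have e: "integrable lebesgue (\<lambda>x. f (u x) * \<phi> x)"
  "(LINT x. (indicator \<Omega> x *\<^sub>R wgrad \<Omega> u x) \<bullet> grad \<phi> x) = lam * (LINT x. f (u x) * \<phi> x)"
  using u \<phi> unfolding weak_sol_def set_integral_test(3)[OF \<phi>, symmetric] set_integral_test(1,2)[OF \<phi>, symmetric] by auto
 show "integrable lebesgue (\<lambda>x. lam * f (indicator \<Omega> x * u x) * \<phi> x)" unfolding c using e(1) by simp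
 show "(LINT x. lam * f (indicator \<Omega> x * u x) * \<phi> x) \<le> (LINT x. (indicator \<Omega> x *\<^sub>R wgrad \<Omega> u x) \<bullet> grad \<phi> x)"
  unfolding c using e(2) by simp
qed

section \<open>The energy and its minimiser between two obstacles\<close>

lemma (in energy_pb) J_cong_AE:
 assumes "H01 \<Omega> u g" "H01 \<Omega> u' g'" "AE x in lebesgue. u x = u' x" "AE x in lebesgue. g x = g' x"
 shows "J u g = J u' g'"
proof -
 have [measurable]: "u \<in> borel_measurable lebesgue" "g \<in> borel_measurable lebesgue" "u' \<in> borel_measurable lebesgue" "g' \<in> borel_measurable lebesgue"
  using gcl_leb[OF assms(1)] gcl_leb[OF assms(2)] by auto
 have "(LINT x. (norm (g x))\<^sup>2) = (LINT x. (norm (g' x))\<^sup>2)"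
  by (rule integral_cong_AE) (use assms(4) in \<open>auto elim: eventually_mono\<close>)
 moreover have "(LINT x. \<bar>u x\<bar> powr q) = (LINT x. \<bar>u' x\<bar> powr q)"
  by (rule integral_cong_AE) (use assms(3) in \<open>auto elim: eventually_mono\<close>)
 moreover have "(LINT x. Gfun a \<delta> (u x)) = (LINT x. Gfun a \<delta> (u' x))"
 proof (rule integral_cong_AE)
  show "AE x in lebesgue. Gfun a \<delta> (u x) = Gfun a \<delta> (u' x)" using assms(3) by eventually_elim simp
 qed (auto intro!: comp_leb[OF Gfun_borel[OF a]])
 ultimately show ?thesis by (simp add: J_def)
qed

lemma (in energy_pb) energy_J:
 assumes "\<kappa> = 1" "q = crit_exp TYPE('n)"
 shows "energy \<Omega> a \<delta> lam v = J (\<lambda>x. indicator \<Omega> x * v x) (\<lambda>x. indicator \<Omega> x *\<^sub>R wgrad \<Omega> v x)"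
proof -
 have "(\<lambda>x. indicator \<Omega> x *\<^sub>R (norm (wgrad \<Omega> v x))\<^sup>2) = (\<lambda>x. (norm (indicator \<Omega> x *\<^sub>R wgrad \<Omega> v x))\<^sup>2)"
  "(\<lambda>x. indicator \<Omega> x *\<^sub>R Gfun a \<delta> (v x)) = (\<lambda>x. Gfun a \<delta> (indicator \<Omega> x * v x))"
  "(\<lambda>x. indicator \<Omega> x *\<^sub>R (\<bar>v x\<bar> powr q)) = (\<lambda>x. \<bar>indicator \<Omega> x * v x\<bar> powr q)"
  by (auto simp: fun_eq_iff indicator_def Gfun_nonpos)
 then show ?thesis unfolding energy_def J_def set_lebesgue_integral_def assms(2)[symmetric] by (simp add: assms(1))
qed

lemma (in energy_pb) singular_test:
 assumes w: "H01 \<Omega> w gw" "locpos w" and eq: "\<forall>\<phi>. test_fun \<Omega> \<phi> --> integrable lebesgue (\<lambda>x. lam * rhs_S a \<delta> (w x) * \<phi> x) \<and>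
    (LINT x. gw x \<bullet> grad \<phi> x) = (LINT x. lam * rhs_S a \<delta> (w x) * \<phi> x)"
  and \<zeta>: "H01 \<Omega> \<zeta> k" and K: "compact K" "K \<subseteq> \<Omega>" "AE x in lebesgue. x \<notin> K --> \<zeta> x = 0"
 shows "integrable lebesgue (\<lambda>x. lam * rhs_S a \<delta> (w x) * \<zeta> x)"
  "(LINT x. gw x \<bullet> k x) = (LINT x. lam * rhs_S a \<delta> (w x) * \<zeta> x)"
proof -
 have m: "(\<lambda>x. lam * rhs_S a \<delta> (w x)) \<in> borel_measurable lebesgue"
  using comp_leb[OF rhs_S_borel gcl_leb(1)[OF w(1)]] by simp
 have loc: "\<exists>C. AE x in lebesgue. x \<in> L --> \<bar>lam * rhs_S a \<delta> (w x)\<bar> \<le> C" if L: "compact L" "L \<subseteq> \<Omega>" for L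
 proof -
  obtain c where c: "c > 0" "AE x in lebesgue. x \<in> L --> c \<le> w x" using w(2) L unfolding locpos_def by blast
  have "AE x in lebesgue. x \<in> L --> \<bar>lam * rhs_S a \<delta> (w x)\<bar> \<le> lam * c powr (-\<delta>)"
   using c(2)
  proof eventually_elim
   case (elim x)
   show ?case
   proof
    assume "x \<in> L"
    then have "rhs_S a \<delta> (w x) \<le> c powr (-\<delta>)" using elim rhs_S_le[OF c(1)] by blast
    then show "\<bar>lam * rhs_S a \<delta> (w x)\<bar> \<le> lam * c powr (-\<delta>)" using lam rhs_S_nonneg[of a \<delta> "w x"] by (simp add: abs_mult)
   qed
  qed
  then show ?thesis by blast
 qed
 have eq': "(LINT x. gw x \<bullet> grad \<phi> x) = (LINT x. lam * rhs_S a \<delta> (w x) * \<phi> x)" if "test_fun \<Omega> \<phi>" for \<phi>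
  using eq that by blast
 show "integrable lebesgue (\<lambda>x. lam * rhs_S a \<delta> (w x) * \<zeta> x)"
  by (rule solution_compact_test(1)[OF \<Omega>(1) w(1) m loc eq' \<zeta> K])
 show "(LINT x. gw x \<bullet> k x) = (LINT x. lam * rhs_S a \<delta> (w x) * \<zeta> x)"
  by (rule solution_compact_test(2)[OF \<Omega>(1) w(1) m loc eq' \<zeta> K])
qed

text \<open>A perturbed minimiser is cut from above by \<open>b\<close> at quadratic cost and then
  raised to \<open>w\<close> at no cost. The result is an admissible competitor, so the minimiser
  loses at most a multiple of the squared step in any direction, which is all that the
  Euler-Lagrange argument needs.\<close>

lemma (in energy_pb) two_sided_minimizer_solution:
 assumes w: "H01 \<Omega> w gw" "integrable lebesgue (\<lambda>x. Gfun a \<delta> (w x))" "locpos w"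
   "\<forall>\<phi>. test_fun \<Omega> \<phi> --> integrable lebesgue (\<lambda>x. lam * rhs_S a \<delta> (w x) * \<phi> x) \<and>
    (LINT x. gw x \<bullet> grad \<phi> x) = (LINT x. lam * rhs_S a \<delta> (w x) * \<phi> x)"
  and wb: "AE x in lebesgue. x \<in> \<Omega> --> 0 < w x \<and> w x \<le> b x"
  and b: "supersol \<Omega> ff b gb" "fin B b gb"
  and u: "adm w b u g" and mn: "\<forall>v h. adm w b v h --> J u g \<le> J v h" and \<psi>: "test_fun \<Omega> \<psi>"
 shows "(LINT x. g x \<bullet> grad \<psi> x) = (LINT x. ff (u x) * \<psi> x)"
proof -
 have wl: "AE x in lebesgue. x \<in> \<Omega> --> w x \<le> u x \<and> u x \<le> b x" using u by (simp add: adm_def)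
 have bB: "AE x in lebesgue. x \<in> \<Omega> --> 0 < b x \<and> b x \<le> B" using b(2) by (simp add: fin_def)
 have uf: "fin B u g"
  by (rule adm_fin[OF u]) (use wb bB in \<open>auto elim: eventually_mono\<close>)
 have bH: "H01 \<Omega> b gb" using b by (simp add: supersol_def)
 have uH: "H01 \<Omega> u g" using u by (simp add: adm_def)
 have ul: "locpos u"
  unfolding locpos_def
 proof (intro allI impI)
  fix K assume K: "compact K" "K \<subseteq> \<Omega>"
  obtain c where c: "c > 0" "AE x in lebesgue. x \<in> K --> c \<le> w x" using w(3) K unfolding locpos_def by blast
  have "AE x in lebesgue. x \<in> K --> c \<le> u x" using c(2) wl by eventually_elim (use K(2) in force)
  then show "\<exists>c>0. AE x in lebesgue. x \<in> K --> c \<le> u x" using c(1) by blast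
 qed
 have off: "AE x in lebesgue. x \<notin> \<Omega> --> w x = 0 \<and> u x = 0 \<and> b x = 0"
  using H01_off[OF w(1)] H01_off[OF bH] H01_off[OF uH] by eventually_elim auto
 have qm: "\<exists>t1>0. \<exists>C. \<forall>t. 0 < t --> t \<le> t1 --> J u g - C * t\<^sup>2 \<le> J (\<lambda>x. u x + t * \<phi> x) (\<lambda>x. g x + t *\<^sub>R grad \<phi> x)"
  if \<phi>: "test_fun \<Omega> \<phi>" for \<phi>
 proof -
  obtain t0 c0 K where t0: "t0 > 0" "c0 > 0" "compact K" "K \<subseteq> \<Omega>" "\<forall>x. x \<notin> K --> \<phi> x = 0"
   "AE x in lebesgue. x \<in> K --> c0 \<le> u x"
   "\<forall>t. \<bar>t\<bar> \<le> t0 --> fin (\<bar>B\<bar> + 1) (\<lambda>x. u x + t * \<phi> x) (\<lambda>x. g x + t *\<^sub>R grad \<phi> x)"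
   "\<forall>t x. \<bar>t\<bar> \<le> t0 --> \<bar>t * \<phi> x\<bar> \<le> c0 / 2"
   by (rule pert_fin[OF uf ul \<phi>])
  have bf': "fin (\<bar>B\<bar> + 1) b gb" by (rule fin_mono[OF b(2)]) simp
  define C where "C = lam * \<kappa> * (q - 1) * \<bar>\<bar>B\<bar> + 1\<bar> powr (q - 2) * (LINT x. (\<phi> x)\<^sup>2)"
  have "J u g - C * t\<^sup>2 \<le> J (\<lambda>x. u x + t * \<phi> x) (\<lambda>x. g x + t *\<^sub>R grad \<phi> x)" if t: "0 < t" "t \<le> t0" for t
  proof -
   define v where "v x = u x + t * \<phi> x" for x
   define h where "h x = g x + t *\<^sub>R grad \<phi> x" for x
   define m where "m x = min (v x) (b x)" for x
   define k where "k = mng v h b gb"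
   have vf: "fin (\<bar>B\<bar> + 1) v h" using t0(7) t unfolding v_def[abs_def] h_def[abs_def] by auto
   then have vH: "H01 \<Omega> v h" "integrable lebesgue (\<lambda>x. Gfun a \<delta> (v x))" "AE x in lebesgue. x \<in> \<Omega> --> 0 < v x \<and> v x \<le> \<bar>B\<bar> + 1"
    by (auto simp: fin_def)
   have GB: "integrable lebesgue (\<lambda>x. Gfun a \<delta> (b x))" using b(2) by (simp add: fin_def)
   have mH: "H01 \<Omega> m k" unfolding m_def[abs_def] k_def by (rule H01_max_min(2)[OF vH(1) bH])
   have mG: "integrable lebesgue (\<lambda>x. Gfun a \<delta> (m x))" unfolding m_def by (rule max_min_G_integrable(2)[OF vH(1) bH vH(2) GB])
   have mp: "AE x in lebesgue. x \<in> \<Omega> --> 0 < m x \<and> m x \<le> \<bar>B\<bar> + 1" using vH(3) bB by eventually_elim (auto simp: m_def)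
   have mf: "fin (\<bar>B\<bar> + 1) m k" unfolding fin_def using mH mG mp by blast
   have "AE x in lebesgue. x \<in> \<Omega> --> 0 < w x \<and> w x \<le> \<bar>B\<bar> + 1" using wb bB by eventually_elim auto
   then have wf: "fin (\<bar>B\<bar> + 1) w gw" unfolding fin_def using w(1,2) by blast
   have 1: "J m k - C * t\<^sup>2 \<le> J v h"
    using upper_quasi_min[OF u mn bf' b(1) \<phi> vf[unfolded v_def[abs_def] h_def[abs_def]]]
    unfolding m_def[abs_def] k_def v_def[abs_def] h_def[abs_def] C_def .
   \<comment> \<open>Off the support nothing was perturbed and \<open>w\<close> lies below both
     \<open>u\<close> and \<open>b\<close>. The lower clamp thus acts on a compact set only, where
     the singular equation may be tested.\<close>
   have "AE x in lebesgue. x \<notin> K --> max 0 (w x - m x) = 0"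
    using wl off wb
   proof eventually_elim
    case (elim x)
    show ?case
    proof
     assume x: "x \<notin> K"
     have "v x = u x" using t0(5) x by (simp add: v_def)
     then show "max 0 (w x - m x) = 0" using elim by (cases "x \<in> \<Omega>") (auto simp: m_def)
    qed
   qed
   note st = singular_test[OF w(1,3,4) H01_pos[OF H01_diff[OF w(1) mH]] t0(3,4) this]
   have 2: "J (\<lambda>x. max (w x) (m x)) (mxg w gw m k) \<le> J m k"
    by (rule lower_clamp[OF mf wf st(1)]) (use st(2) in simp)
   have "AE x in lebesgue. x \<in> \<Omega> --> w x \<le> max (w x) (m x) \<and> max (w x) (m x) \<le> b x"
    using wb by eventually_elim (auto simp: m_def)
   then have "adm w b (\<lambda>x. max (w x) (m x)) (mxg w gw m k)"
    unfolding adm_def using H01_max_min(1)[OF w(1) mH] max_min_G_integrable(1)[OF w(1) mH w(2) mG] by blast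
   then have "J u g \<le> J (\<lambda>x. max (w x) (m x)) (mxg w gw m k)" using mn by blast
   then have "J u g - C * t\<^sup>2 \<le> J v h" using 1 2 by linarith
   then show ?thesis unfolding v_def[abs_def] h_def[abs_def] .
  qed
  then show ?thesis using t0(1) by (intro exI[of _ t0] conjI exI[of _ C]) auto
 qed
 show ?thesis by (rule euler_solution[OF uf ul qm \<psi>])
qed

theorem theorem2p1:
 fixes \<Omega> :: "(real^'n::finite) set" and a \<delta> :: real
 assumes "CARD('n) \<ge> 3"
  and "bounded_smooth_domain \<Omega>"
  and "0 < \<delta>" and "\<delta> < 3" and "0 < a"
 shows "\<forall>lam. 0 < lam \<and> ereal lam < Lambda_a \<Omega> a \<delta> -->
  (\<exists>u. solP \<Omega> a \<delta> lam u \<and>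
   (\<exists>w ub. solS \<Omega> a \<delta> lam w \<and> supersolP \<Omega> a \<delta> lam ub \<and>
     (AE x in lebesgue. x \<in> \<Omega> --> w x \<le> ub x) \<and>
     (let M = {v. H10 \<Omega> v \<and> (AE x in lebesgue. x \<in> \<Omega> --> w x \<le> v x \<and> v x \<le> ub x)}
     in u \<in> M \<and> (\<forall>v\<in>M. energy \<Omega> a \<delta> lam u \<le> energy \<Omega> a \<delta> lam v))))"
proof (intro allI impI)
 fix lam assume L: "0 < lam \<and> ereal lam < Lambda_a \<Omega> a \<delta>"
 have O: "open \<Omega>" "bounded \<Omega>" using assms(2) by (auto simp: bounded_smooth_domain_def)
 have mO: "\<Omega> \<in> sets lebesgue" using O by auto
 define q where "q = crit_exp TYPE('n)"
 define F where "F = rhs_P TYPE('n) a \<delta>"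
 have q: "2 < q"
 proof -
  have "3 \<le> real CARD('n)" using assms(1) by simp
  then show ?thesis unfolding q_def crit_exp_def by (simp add: field_simps)
 qed
 have Fe: "F = (\<lambda>s. s powr (q - 1) + rhs_S a \<delta> s)" by (simp add: F_def q_def fun_eq_iff rhs_P_eq)
 \<comment> \<open>Strictly below the supremum there is a solvable parameter strictly above
   \<open>lam\<close>; this gap is what the change of variable consumes.\<close>
 have "\<exists>lam'>lam. \<exists>u. solP \<Omega> a \<delta> lam' u"
  using L unfolding Lambda_a_def less_Sup_iff by auto
 then obtain lam' u0 where l': "lam < lam'" and u0: "solP \<Omega> a \<delta> lam' u0" by blast
 have lam: "0 < lam" using L by blast
 interpret E: energy_pb \<Omega> a \<delta> lam 1 q by unfold_locales (use O assms lam q in auto)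
 have ffe: "E.ff = (\<lambda>s. lam * F s)" by (simp add: E.ff_def fun_eq_iff Fe)
 have "supersol \<Omega> (\<lambda>s. lam' * F s) (\<lambda>x. indicator \<Omega> x * u0 x) (\<lambda>x. indicator \<Omega> x *\<^sub>R wgrad \<Omega> u0 x)"
  using weak_sol_supersol[OF O u0[unfolded solP_def]] by (simp add: F_def)
 then obtain b gb B where b: "supersol \<Omega> (\<lambda>s. lam * F s) b gb" "\<forall>x. b x \<le> B"
  by (rule bounded_supersolution[OF O(1) assms(5,3) lam l' q Fe])
 have bH: "H01 \<Omega> b gb" and bp: "AE x in lebesgue. x \<in> \<Omega> --> 0 < b x" using b(1) by (auto simp: supersol_def)
 \<comment> \<open>Dropping the nonnegative power leaves a supersolution of the singular problem,
   which provides both the integrability of G and the upper obstacle for \<open>w\<close>.\<close>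
 have bS: "supersol \<Omega> (\<lambda>s. lam * rhs_S a \<delta> s) b gb"
  unfolding supersol_def
 proof (intro conjI allI impI bH bp)
  fix \<phi> assume \<phi>: "test_fun \<Omega> \<phi>" "\<forall>x. 0 \<le> \<phi> x"
  have f: "integrable lebesgue (\<lambda>x. lam * F (b x) * \<phi> x)" "(LINT x. lam * F (b x) * \<phi> x) \<le> (LINT x. gb x \<bullet> grad \<phi> x)"
   using b(1) \<phi> by (auto simp: supersol_def)
  have le: "0 \<le> lam * rhs_S a \<delta> (b x) * \<phi> x" "lam * rhs_S a \<delta> (b x) * \<phi> x \<le> lam * F (b x) * \<phi> x" for x
   using lam \<phi>(2) rhs_S_nonneg[of a \<delta> "b x"] by (auto simp: Fe intro!: mult_right_mono)
  have m: "(\<lambda>x. lam * rhs_S a \<delta> (b x) * \<phi> x) \<in> borel_measurable lebesgue"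
   using comp_leb[OF rhs_S_borel gcl_leb(1)[OF bH]] test_leb[OF \<phi>(1)] by simp
  show i: "integrable lebesgue (\<lambda>x. lam * rhs_S a \<delta> (b x) * \<phi> x)"
   by (rule Bochner_Integration.integrable_bound[OF f(1) m]) (use le order_trans[OF le] in \<open>auto simp del: mult_le_cancel_right intro!: AE_I2\<close>)
  show "(LINT x. lam * rhs_S a \<delta> (b x) * \<phi> x) \<le> (LINT x. gb x \<bullet> grad \<phi> x)"
   using integral_mono[OF i f(1) le(2)] f(2) by linarith
 qed
 have bB: "AE x in lebesgue. x \<in> \<Omega> --> b x \<le> B" using b(2) by simp
 have GB: "integrable lebesgue (\<lambda>x. Gfun a \<delta> (b x))" by (rule Gfun_supersol_integrable[OF assms(2,5,3) lam bS])
 obtain w gw where w: "H01 \<Omega> w gw" "AE x in lebesgue. x \<in> \<Omega> --> 0 < w x \<and> w x \<le> b x" "integrable lebesgue (\<lambda>x. Gfun a \<delta> (w x))"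
  "\<forall>K. compact K --> K \<subseteq> \<Omega> --> (\<exists>c>0. AE x in lebesgue. x \<in> K --> c \<le> w x)"
  "\<forall>\<phi>. test_fun \<Omega> \<phi> --> integrable lebesgue (\<lambda>x. lam * rhs_S a \<delta> (w x) * \<phi> x) \<and>
    (LINT x. gw x \<bullet> grad \<phi> x) = (LINT x. lam * rhs_S a \<delta> (w x) * \<phi> x)"
  by (rule singular_solution[OF assms(2,5,3) lam bS bB])
 have wp: "AE x in lebesgue. x \<in> \<Omega> --> 0 < w x" using w(2) by eventually_elim auto
 have wb: "AE x in lebesgue. x \<in> \<Omega> --> w x \<le> b x" using w(2) by eventually_elim auto
 have wlp: "locally_pos \<Omega> w" using w(4) by (simp add: locally_pos_def)
 have lp: "locally_pos \<Omega> v" if "AE x in lebesgue. x \<in> \<Omega> --> w x \<le> v x" for v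
  unfolding locally_pos_def
 proof (intro allI impI)
  fix K assume K: "compact K \<and> K \<subseteq> \<Omega>"
  then obtain c where c: "c > 0" "AE x in lebesgue. x \<in> K --> c \<le> w x" using w(4) by blast
  have "AE x in lebesgue. x \<in> K --> c \<le> v x" using c(2) that by eventually_elim (use K in force)
  then show "\<exists>c>0. AE x in lebesgue. x \<in> K --> c \<le> v x" using c(1) by blast
 qed
 have bf: "E.fin B b gb"
  unfolding E.fin_def using bH GB bp b(2) by (auto elim: eventually_mono)
 have badm: "E.adm w b b gb" unfolding E.adm_def using bH GB wb by auto
 obtain u g where u: "E.adm w b u g" "\<forall>v h. E.adm w b v h --> E.J u g \<le> E.J v h"
  by (rule E.minimizer[OF wp bB badm])
 have uH: "H01 \<Omega> u g" and ub: "AE x in lebesgue. x \<in> \<Omega> --> w x \<le> u x \<and> u x \<le> b x" using u(1) by (auto simp: E.adm_def)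
 have uw: "AE x in lebesgue. x \<in> \<Omega> --> w x \<le> u x" using ub by eventually_elim auto
 have uf: "E.fin B u g" by (rule E.adm_fin[OF u(1) wp bB])
 have ul: "E.locpos u" using lp[OF uw] by (simp add: E.locpos_def locally_pos_def)
 have wl: "E.locpos w" using w(4) by (simp add: E.locpos_def)
 have eq: "(LINT x. g x \<bullet> grad \<phi> x) = (LINT x. E.ff (u x) * \<phi> x)" if "test_fun \<Omega> \<phi>" for \<phi>
  by (rule E.two_sided_minimizer_solution[OF w(1,3) wl w(5,2) _ bf u that]) (use b(1) in \<open>simp add: ffe\<close>)
 have solP: "solP \<Omega> a \<delta> lam u"
  unfolding solP_def F_def[symmetric]
 proof (rule weak_solI[OF O(1) uH lp[OF uw]])
  fix \<phi> assume \<phi>: "test_fun \<Omega> \<phi>"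
  show "integrable lebesgue (\<lambda>x. F (u x) * \<phi> x)"
   using E.ff_test_integrable[OF uf ul \<phi>] lam by (simp add: ffe mult.assoc)
  show "(LINT x. g x \<bullet> grad \<phi> x) = lam * (LINT x. F (u x) * \<phi> x)"
   using eq[OF \<phi>] by (simp add: ffe mult.assoc)
 qed
 have solS: "solS \<Omega> a \<delta> lam w"
  unfolding solS_def
 proof (rule weak_solI[OF O(1) w(1) wlp])
  fix \<phi> assume \<phi>: "test_fun \<Omega> \<phi>"
  show "integrable lebesgue (\<lambda>x. rhs_S a \<delta> (w x) * \<phi> x)"
   using w(5)[rule_format, OF \<phi>] lam by (simp add: mult.assoc)
  show "(LINT x. gw x \<bullet> grad \<phi> x) = lam * (LINT x. rhs_S a \<delta> (w x) * \<phi> x)"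
   using w(5)[rule_format, OF \<phi>] by (simp add: mult.assoc)
 qed
 have supP: "supersolP \<Omega> a \<delta> lam b"
  unfolding supersolP_def by (rule weak_supersolI[OF O(1) _ lp[OF wb]]) (use b(1) lam in \<open>auto simp: F_def\<close>)
 have uM: "H10 \<Omega> u" using H01_H10_grad[OF O(1) uH] by (auto simp: H10_def)
 have eJ: "energy \<Omega> a \<delta> lam v = E.J (\<lambda>x. indicator \<Omega> x * v x) (\<lambda>x. indicator \<Omega> x *\<^sub>R wgrad \<Omega> v x)" for v
  by (rule E.energy_J) (simp_all add: q_def)
 have eu: "energy \<Omega> a \<delta> lam u = E.J u g"
  unfolding eJ
 proof (rule E.J_cong_AE[OF H10_grad_H01[OF O(1) H10_wgrad[OF uM]] uH _ wgrad_AE[OF O(1) uH]])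
  show "AE x in lebesgue. indicator \<Omega> x * u x = u x" using H01_off[OF uH] by eventually_elim (auto simp: indicator_def)
 qed
 have mn: "energy \<Omega> a \<delta> lam u \<le> energy \<Omega> a \<delta> lam v"
  if v: "H10 \<Omega> v" "AE x in lebesgue. x \<in> \<Omega> --> w x \<le> v x \<and> v x \<le> b x" for v
 proof -
  note vH = H10_grad_H01[OF O(1) H10_wgrad[OF v(1)]]
  have bd: "AE x in lebesgue. x \<in> \<Omega> --> w x \<le> indicator \<Omega> x * v x \<and> indicator \<Omega> x * v x \<le> b x"
   using v(2) by eventually_elim auto
  \<comment> \<open>G is increasing, so it is squeezed between its values at \<open>w\<close> and
    the constant \<open>Fp \<delta> a\<close>. Hence every member of the order interval is an
    admissible competitor.\<close>
  have "integrable lebesgue (\<lambda>x. Gfun a \<delta> (indicator \<Omega> x * v x))"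
  proof (rule Bochner_Integration.integrable_bound)
   show "integrable lebesgue (\<lambda>x. \<bar>Gfun a \<delta> (w x)\<bar> + \<bar>Fp \<delta> a\<bar> * indicator \<Omega> x)"
    by (intro Bochner_Integration.integrable_add integrable_abs w(3) integrable_mult_right indicator_integrable mO O)
   show "AE x in lebesgue. norm (Gfun a \<delta> (indicator \<Omega> x * v x)) \<le> norm (\<bar>Gfun a \<delta> (w x)\<bar> + \<bar>Fp \<delta> a\<bar> * indicator \<Omega> x)"
    using v(2) wp
   proof eventually_elim
    case (elim x)
    show ?case
    proof (cases "x \<in> \<Omega>")
     case True
     then have p: "0 < w x" "w x \<le> v x" using elim by auto
     have "Gfun a \<delta> (w x) \<le> Gfun a \<delta> (v x)" "Gfun a \<delta> (v x) \<le> Fp \<delta> a"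
      using p by (auto intro: Gfun_mono Gfun_le assms(5))
     then show ?thesis using True by auto
    next
     case False
     then show ?thesis by (simp add: Gfun_nonpos)
    qed
   qed
  qed (rule comp_leb[OF Gfun_borel[OF assms(5)] gcl_leb(1)[OF vH]])
  then have "E.adm w b (\<lambda>x. indicator \<Omega> x * v x) (\<lambda>x. indicator \<Omega> x *\<^sub>R wgrad \<Omega> v x)"
   unfolding E.adm_def using vH bd by blast
  then show ?thesis unfolding eu eJ[of v] using u(2) by blast
 qed
 show "\<exists>u. solP \<Omega> a \<delta> lam u \<and>
   (\<exists>w ub. solS \<Omega> a \<delta> lam w \<and> supersolP \<Omega> a \<delta> lam ub \<and>
     (AE x in lebesgue. x \<in> \<Omega> --> w x \<le> ub x) \<and>
     (let M = {v. H10 \<Omega> v \<and> (AE x in lebesgue. x \<in> \<Omega> --> w x \<le> v x \<and> v x \<le> ub x)}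
     in u \<in> M \<and> (\<forall>v\<in>M. energy \<Omega> a \<delta> lam u \<le> energy \<Omega> a \<delta> lam v)))"
  unfolding Let_def mem_Collect_eq Ball_def
  using solP solS supP wb uM ub mn by blast
qed

end
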